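(* Let $b_1, b_2 \in C(\partial D, \mathbb{R})$, $c_1, c_2 \in \mathbb{R}$, and $f \in L^1(D, \mathbb{B})$. The nonhomogeneous bicomplex Schwarz boundary value problem for $w = p^+ w^+ + p^- w^- : D \to \mathbb{B}$, \[ \begin{cases} \bar\partial w = f \ \text{ in } D,\\ \operatorname{Re}\{w^+\}|_{\partial D} = b_1, \\ \operatorname{Re}\{w^-\}|_{\partial D} = b_2,\\ \operatorname{Im}\{ w^+(0)\} = c_1, \\ \operatorname{Im}\{ w^-(0) \} = c_2, \end{cases} \] is uniquely solved by \[ w(z) = p^+ \left(\frac{1}{2\pi i }\int_{|\zeta|=1} b_1(\zeta)\, \frac{\overline{\zeta + z}}{\overline{\zeta - z}}\, \frac{d\zeta}{\zeta} + ic_1 \right) + p^- \left(\frac{1}{2\pi i }\int_{|\zeta|=1} b_2(\zeta)\, \frac{\zeta + z}{\zeta - z}\, \frac{d\zeta}{\zeta} +ic_2 \right) +T_{\mathbb{B}}(f)(z). \]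
   Context: $D$ is the open unit disk in $\mathbb{C}$ and $\partial D$ is the unit circle; $C(\partial D,\mathbb{R})$ is the set of continuous real-valued functions on $\partial D$. The bicomplex numbers $\mathbb{B}$ are $\mathbb{C}^2$ with the usual addition and scalar multiplication and with the commutative product $(z_1,z_2)(w_1,w_2) = (z_1w_1 - z_2w_2,\, z_1w_2+z_2w_1)$; one writes $(z_1,z_2) = z_1 + j z_2$, so $j^2=-1$ and $j$ commutes with $i$. Put $p^\pm := \frac12(1 \pm ji)\in\mathbb{B}$. Every $z\in\mathbb{B}$ has a unique representation $z = p^+ z^+ + p^- z^-$ with $z^\pm\in\mathbb{C}$; for a $\mathbb{B}$-valued function $w$, the complex-valued functions $w^\pm$ are the components in this representation. The norm on $\mathbb{B}$ is $\|z\|_{\mathbb{B}} := \sqrt{(|z^+|^2+|z^-|^2)/2}$, and $L^1(D,\mathbb{B})$ is the set of $f:D\to\mathbb{B}$ with $\iint_D \|f(z)\|_{\mathbb{B}}\,dx\,dy<\infty$. The bicomplex operator $\bar\partial$ is $\bar\partial := p^+\frac{\partial}{\partial z} + p^-\frac{\partial}{\partial \bar z}$, where $\frac{\partial}{\partial z},\frac{\partial}{\partial\bar z}$ are the complex Wirtinger derivatives; thus $\bar\partial w = p^+ \frac{\partial w^+}{\partial z} + p^- \frac{\partial w^-}{\partial \bar z}$. Overlines on numbers or complex-valued functions denote ordinary complex conjugation. The integral operator $T_{\mathbb{B}}$ is defined for $f = p^+f^+ + p^-f^-\in L^1(D,\mathbb{B})$ by $T_{\mathbb{B}}(f)(z)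 := p^+ T_*(f^+)(z) + p^- T(f^-)(z)$, where, with $\zeta = \xi + i\eta$, \[ T(f^-)(z) := -\frac{1}{2 \pi} \iint_D \left(\frac{f^-(\zeta)}{\zeta} \frac{\zeta+z}{\zeta - z} + \frac{\overline{f^-(\zeta)}}{\overline{\zeta}} \frac{1+z\overline{\zeta}}{1-z\overline{\zeta}} \right)d\xi\,d\eta, \] \[ T_*(f^+)(z) := -\frac{1}{2 \pi} \iint_D \left(\frac{f^+(\zeta)}{\overline{\zeta}} \frac{\overline{\zeta+z}}{\overline{\zeta - z}} + \frac{\overline{f^+(\zeta)}}{\zeta} \frac{1+\bar z\zeta}{1-\bar z\zeta} \right) d\xi\,d\eta. \]
   Formalization: T_B(f) can diverge for f in L^1 (f^- = iζ/|ζ|^2), so that the formula solves is stated when its integrals converge for a.e. z; uniqueness (a.e.) for all f. Derivatives are weak, boundary values distributional, and Im w^±(0) must be the limit of means over small disks. *)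

theory Defs
  imports "HOL-Complex_Analysis.Complex_Analysis"
begin

section \<open>Bicomplex numbers\<close>

datatype bicomplex = Bicomplex (bc1: complex) (bc2: complex)

lemma bicomplex_eq_iff: "z = w \<longleftrightarrow> bc1 z = bc1 w \<and> bc2 z = bc2 w"
  by (cases z; cases w) auto

instantiation bicomplex :: comm_ring_1
begin

definition "0 = Bicomplex 0 0"
definition "1 = Bicomplex 1 0"
definition "z + w = Bicomplex (bc1 z + bc1 w) (bc2 z + bc2 w)"
definition "z - w = Bicomplex (bc1 z - bc1 w) (bc2 z - bc2 w)"
definition "- z = Bicomplex (- bc1 z) (- bc2 z)"
definition "z * w = Bicomplex (bc1 z * bc1 w - bc2 z * bc2 w) (bc1 z * bc2 w + bc2 z * bc1 w)"

lemmas bicomplex_arith_defs = zero_bicomplex_def one_bicomplex_def plus_bicomplex_def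
  minus_bicomplex_def uminus_bicomplex_def times_bicomplex_def

instance
  by standard (auto simp: bicomplex_arith_defs bicomplex_eq_iff algebra_simps)

end

text \<open>The embedding of the complex numbers; multiplication by \<open>bc_of a\<close> is the scalar
  multiplication of \<open>\<complex>\<^sup>2\<close>.\<close>

definition bc_of :: "complex \<Rightarrow> bicomplex" where
  "bc_of a = Bicomplex a 0"

definition bc_j :: bicomplex where
  "bc_j = Bicomplex 0 1"

lemma bicomplex_z1_j_z2: "Bicomplex a b = bc_of a + bc_j * bc_of b"
  by (simp add: bc_of_def bc_j_def bicomplex_arith_defs)

lemma bc_j_squared: "bc_j * bc_j = - 1"
  by (simp add: bc_j_def bicomplex_arith_defs)

definition p_plus :: bicomplex where
  "p_plus = bc_of (1/2) * (1 + bc_j * bc_of \<i>)"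

definition p_minus :: bicomplex where
  "p_minus = bc_of (1/2) * (1 - bc_j * bc_of \<i>)"

text \<open>The components \<open>z\<^sup>+\<close> and \<open>z\<^sup>-\<close>; the lemma below is the defining property.\<close>

definition bc_plus :: "bicomplex \<Rightarrow> complex" where
  "bc_plus z = bc1 z - \<i> * bc2 z"

definition bc_minus :: "bicomplex \<Rightarrow> complex" where
  "bc_minus z = bc1 z + \<i> * bc2 z"

lemma bc_decomposition:
  "z = p_plus * bc_of a + p_minus * bc_of b \<longleftrightarrow> a = bc_plus z \<and> b = bc_minus z"
proof -
  have eq: "p_plus * bc_of a + p_minus * bc_of b = Bicomplex ((a + b) / 2) (\<i> * (a - b) / 2)" for a b
    by (simp add: p_plus_def p_minus_def bc_of_def bc_j_def bicomplex_arith_defs field_simps)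
  show ?thesis
    unfolding eq bc_plus_def bc_minus_def bicomplex_eq_iff
    by (auto simp: complex_eq_iff field_simps)
qed

definition bc_norm :: "bicomplex \<Rightarrow> real" where
  "bc_norm z = sqrt (((cmod (bc_plus z))\<^sup>2 + (cmod (bc_minus z))\<^sup>2) / 2)"


section \<open>The disk and function spaces\<close>

abbreviation disk :: "complex set" where
  "disk \<equiv> ball 0 1"

definition L1_disk_bc :: "(complex \<Rightarrow> bicomplex) \<Rightarrow> bool" where
  "L1_disk_bc f \<longleftrightarrow>
     (\<lambda>z. bc_plus (f z)) \<in> borel_measurable (lebesgue_on disk) \<and>
     (\<lambda>z. bc_minus (f z)) \<in> borel_measurable (lebesgue_on disk) \<and>
     integrable (lebesgue_on disk) (\<lambda>z. bc_norm (f z))"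

definition L1_loc_disk :: "(complex \<Rightarrow> complex) \<Rightarrow> bool" where
  "L1_loc_disk u \<longleftrightarrow> (\<forall>K. compact K \<and> K \<subseteq> disk \<longrightarrow> integrable (lebesgue_on K) u)"


section \<open>Wirtinger derivatives and the bicomplex operator\<close>

definition wirtinger_z :: "(complex \<Rightarrow> complex) \<Rightarrow> complex \<Rightarrow> complex" where
  "wirtinger_z \<phi> z =
     (frechet_derivative \<phi> (at z) 1 - \<i> * frechet_derivative \<phi> (at z) \<i>) / 2"

definition wirtinger_zbar :: "(complex \<Rightarrow> complex) \<Rightarrow> complex \<Rightarrow> complex" where
  "wirtinger_zbar \<phi> z =
     (frechet_derivative \<phi> (at z) 1 + \<i> * frechet_derivative \<phi> (at z) \<i>) / 2"

text \<open>Continuously (real) differentiable functions with compact support in the disk,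
  extended by zero to the plane.\<close>

definition C1_compact_disk :: "(complex \<Rightarrow> complex) \<Rightarrow> bool" where
  "C1_compact_disk \<phi> \<longleftrightarrow>
     (\<forall>z. \<phi> differentiable (at z)) \<and>
     continuous_on UNIV (\<lambda>z. frechet_derivative \<phi> (at z) 1) \<and>
     continuous_on UNIV (\<lambda>z. frechet_derivative \<phi> (at z) \<i>) \<and>
     (\<exists>K. compact K \<and> K \<subseteq> disk \<and> (\<forall>z. z \<notin> K \<longrightarrow> \<phi> z = 0))"

text \<open>Since the right-hand side \<open>f\<close> of the equation is merely integrable, derivatives are weak
  (generalized) derivatives, as in the theory of Vekua.\<close>

definition has_weak_dz :: "(complex \<Rightarrow> complex) \<Rightarrow> (complex \<Rightarrow> complex) \<Rightarrow> bool" where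
  "has_weak_dz u g \<longleftrightarrow> L1_loc_disk u \<and> L1_loc_disk g \<and>
     (\<forall>\<phi>. C1_compact_disk \<phi> \<longrightarrow>
        (LINT z|lebesgue_on disk. u z * wirtinger_z \<phi> z) = - (LINT z|lebesgue_on disk. g z * \<phi> z))"

definition has_weak_dzbar :: "(complex \<Rightarrow> complex) \<Rightarrow> (complex \<Rightarrow> complex) \<Rightarrow> bool" where
  "has_weak_dzbar u g \<longleftrightarrow> L1_loc_disk u \<and> L1_loc_disk g \<and>
     (\<forall>\<phi>. C1_compact_disk \<phi> \<longrightarrow>
        (LINT z|lebesgue_on disk. u z * wirtinger_zbar \<phi> z) = - (LINT z|lebesgue_on disk. g z * \<phi> z))"

definition has_bc_dbar :: "(complex \<Rightarrow> bicomplex) \<Rightarrow> (complex \<Rightarrow> bicomplex) \<Rightarrow> bool" where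
  "has_bc_dbar w f \<longleftrightarrow>
     (\<exists>g h. has_weak_dz (\<lambda>z. bc_plus (w z)) g \<and> has_weak_dzbar (\<lambda>z. bc_minus (w z)) h \<and>
            (\<forall>z\<in>disk. f z = p_plus * bc_of (g z) + p_minus * bc_of (h z)))"


section \<open>Boundary values and the value at the origin\<close>

text \<open>Smooth functions on the unit circle, as functions of the angle.\<close>

definition smooth_circle :: "(real \<Rightarrow> real) \<Rightarrow> bool" where
  "smooth_circle \<phi> \<longleftrightarrow> (\<forall>t. \<phi> (t + 2 * pi) = \<phi> t) \<and>
     (\<forall>k t. ((deriv ^^ k) \<phi>) differentiable (at t))"

text \<open>Boundary values in the sense of distributions. A solution with integrable right-hand side
  need not extend continuously to the closed disk, and it is determined only almost everywhere.
  Its integral over the circle of radius \<open>r\<close> is then available for almost every \<open>r\<close>, so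
  the limit for \<open>r\<close> tending to 1 is an essential limit: the filter below ignores null sets
  of radii.\<close>

definition has_boundary_value :: "(complex \<Rightarrow> real) \<Rightarrow> (complex \<Rightarrow> real) \<Rightarrow> bool" where
  "has_boundary_value u b \<longleftrightarrow>
     (\<forall>\<phi>. smooth_circle \<phi> \<longrightarrow>
        ((\<lambda>r. LINT t|lebesgue_on {0..2*pi}. u (rcis r t) * \<phi> t)
           \<longlongrightarrow> (LINT t|lebesgue_on {0..2*pi}. b (cis t) * \<phi> t))
        (inf (at_left 1) (ae_filter lebesgue)))"

text \<open>The value at the origin of a function determined only almost everywhere is meaningful if it
  is the limit of the mean values over small disks.\<close>

definition mean_value_at_0 :: "(complex \<Rightarrow> real) \<Rightarrow> bool" where
  "mean_value_at_0 u \<longleftrightarrow>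
     ((\<lambda>r. (LINT z|lebesgue_on (ball 0 r). u z) / (pi * r\<^sup>2)) \<longlongrightarrow> u 0) (at_right 0)"


section \<open>The Schwarz boundary value problem\<close>

definition schwarz_solution ::
  "(complex \<Rightarrow> real) \<Rightarrow> (complex \<Rightarrow> real) \<Rightarrow> real \<Rightarrow> real \<Rightarrow> (complex \<Rightarrow> bicomplex)
     \<Rightarrow> (complex \<Rightarrow> bicomplex) \<Rightarrow> bool" where
  "schwarz_solution b1 b2 c1 c2 f w \<longleftrightarrow>
     has_bc_dbar w f \<and>
     has_boundary_value (\<lambda>z. Re (bc_plus (w z))) b1 \<and>
     has_boundary_value (\<lambda>z. Re (bc_minus (w z))) b2 \<and>
     mean_value_at_0 (\<lambda>z. Im (bc_plus (w z))) \<and> Im (bc_plus (w 0)) = c1 \<and>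
     mean_value_at_0 (\<lambda>z. Im (bc_minus (w z))) \<and> Im (bc_minus (w 0)) = c2"


section \<open>The integral operator\<close>

definition T_kernel :: "(complex \<Rightarrow> complex) \<Rightarrow> complex \<Rightarrow> complex \<Rightarrow> complex" where
  "T_kernel g z \<zeta> =
     g \<zeta> / \<zeta> * ((\<zeta> + z) / (\<zeta> - z)) + cnj (g \<zeta>) / cnj \<zeta> * ((1 + z * cnj \<zeta>) / (1 - z * cnj \<zeta>))"

definition T_star_kernel :: "(complex \<Rightarrow> complex) \<Rightarrow> complex \<Rightarrow> complex \<Rightarrow> complex" where
  "T_star_kernel g z \<zeta> =
     g \<zeta> / cnj \<zeta> * (cnj (\<zeta> + z) / cnj (\<zeta> - z)) + cnj (g \<zeta>) / \<zeta> * ((1 + cnj z * \<zeta>) / (1 - cnj z * \<zeta>))"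

definition T_op :: "(complex \<Rightarrow> complex) \<Rightarrow> complex \<Rightarrow> complex" where
  "T_op g z = - 1 / (2 * pi) * (LINT \<zeta>|lebesgue_on disk. T_kernel g z \<zeta>)"

definition T_star_op :: "(complex \<Rightarrow> complex) \<Rightarrow> complex \<Rightarrow> complex" where
  "T_star_op g z = - 1 / (2 * pi) * (LINT \<zeta>|lebesgue_on disk. T_star_kernel g z \<zeta>)"

definition T_bc :: "(complex \<Rightarrow> bicomplex) \<Rightarrow> complex \<Rightarrow> bicomplex" where
  "T_bc f z = p_plus * bc_of (T_star_op (\<lambda>\<zeta>. bc_plus (f \<zeta>)) z)
            + p_minus * bc_of (T_op (\<lambda>\<zeta>. bc_minus (f \<zeta>)) z)"

text \<open>The integrals defining \<open>T_bc f z\<close> converge for almost every \<open>z\<close>. This does not follow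
  from integrability of \<open>f\<close>, because of the factor \<open>1 / \<zeta>\<close> in the kernels: if
  \<open>bc_minus (f \<zeta>) = \<i> * \<zeta> / (cmod \<zeta>)\<^sup>2\<close>, the integral defining \<open>T_op\<close> diverges
  for every \<open>z \<noteq> 0\<close>.\<close>

definition T_bc_defined :: "(complex \<Rightarrow> bicomplex) \<Rightarrow> bool" where
  "T_bc_defined f \<longleftrightarrow>
     (AE z in lebesgue_on disk.
        integrable (lebesgue_on disk) (T_star_kernel (\<lambda>\<zeta>. bc_plus (f \<zeta>)) z) \<and>
        integrable (lebesgue_on disk) (T_kernel (\<lambda>\<zeta>. bc_minus (f \<zeta>)) z))"

end

theory Submission
  imports Defs
begin

text \<open>
  Conjugation exchanges the two idempotent components, so everything reduces to a scalar Schwarz problem for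
  the generalized Cauchy--Riemann equation.

  For existence, the kernel of the integral operator is, up to the term \<open>Im (g w / w)\<close> that does not depend on
  \<open>z\<close>, the Cauchy kernel plus the kernel obtained from it by reflection in the circle. The Cauchy--Pompeiu
  formula shows that the former solves the equation, the latter is holomorphic in \<open>z\<close>, and on the unit circle
  the real parts of the two cancel. The Schwarz integral adds the boundary values.

  For uniqueness, Weyl's lemma is not needed. Testing a solution \<open>d\<close> of the homogeneous equation with
  \<open>q (\<bar>z\<bar>\<^sup>2) * z powi k\<close> shows that each integral of \<open>d z * \<theta> (\<bar>z\<bar>\<^sup>2) * z powi j\<close> is a constant multiple of the
  integral of \<open>\<theta>\<close>, and the constant is 0 for \<open>j > 0\<close>. Letting \<open>\<theta>\<close> concentrate near 1, the boundary values force the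
  remaining constants to vanish, except for an imaginary one at \<open>j = 0\<close>, which the value at the origin
  removes. By the Stone--Weierstrass theorem, \<open>d = 0\<close> almost everywhere.
\<close>

section \<open>Completeness of Lebesgue measure\<close>

text \<open>As \<open>f\<close> is only integrable, little is available pointwise: potentials
  converge at almost every point, circles are usable for almost every radius, and limits need
  estimates uniform in the pole \<open>w\<close>, so that dominated convergence against
  \<open>g\<close> applies. Much of this rests on one fact: both kernels are at most
  \<open>1 / cmod (w - z)\<close>, whose integral over the disk in \<open>z\<close> is bounded. The
  term \<open>Im (g w / w)\<close> is what convergence of the operator adds to integrability of
  \<open>f\<close>. Almost everywhere it contributes an imaginary constant, whereas at the origin
  itself the operator is real, its kernel there being \<open>2 * Re (g w / w)\<close>. The two agree
  in the mean over small disks: the Cauchy potential has means whose imaginary part tends to exactly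
  that integral, which cancels the constant. Uniqueness works with Laurent coefficients without
  knowing that \<open>d\<close> is holomorphic: for a Laurent series with coefficients
  \<open>a n\<close>, the integral with exponent \<open>j\<close> is \<open>pi * a (- j)\<close>
  times the integral of \<open>\<theta>\<close>. Conjugation links the exponents \<open>n\<close>
  and \<open>- n\<close>, and so a condition on real parts alone controls the coefficients that the
  equation leaves free.\<close>

lemma complete_measure_lebesgue_on:
  assumes "S \<in> sets lebesgue"
  shows "complete_measure (lebesgue_on S)"
proof
  fix A B
  assume "B \<subseteq> A" "A \<in> null_sets (lebesgue_on S)"
  then have "A \<in> null_sets lebesgue" "A \<subseteq> S"
    using assms by (auto simp: null_sets_restrict_space)
  then have "B \<in> null_sets lebesgue" "B \<subseteq> S"
    using \<open>B \<subseteq> A\<close> by (auto intro: completion.complete2)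
  then show "B \<in> sets (lebesgue_on S)"
    using assms by (auto simp: sets_restrict_space)
qed

lemma (in complete_measure) measurable_cong_AE:
  assumes eq: "AE x in M. f x = g x" and g: "g \<in> measurable M N" and "\<And>x. f x \<in> space N"
  shows "f \<in> measurable M N"
proof (rule measurableI)
  fix A assume A: "A \<in> sets N"
  show "f -` A \<inter> space M \<in> sets M"
  proof (rule in_sets_AE)
    show "AE x in M. (x \<in> g -` A \<inter> space M) = (x \<in> f -` A \<inter> space M)"
      using eq by eventually_elim auto
  qed (use measurable_sets[OF g A] in auto)
qed (use assms in auto)

text \<open>Completeness carries measurability across an almost everywhere equality, so neither side
  has to be assumed measurable; if neither is, both integrals have the default value 0.\<close>

lemma (in complete_measure)
  fixes f g :: "'a \<Rightarrow> 'b::{banach, second_countable_topology}"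
  assumes eq: "AE x in M. f x = g x"
  shows integral_cong_AE_complete: "integral\<^sup>L M f = integral\<^sup>L M g"
    and integrable_cong_AE_complete: "integrable M f \<longleftrightarrow> integrable M g"
proof -
  have eq': "AE x in M. g x = f x" using eq by eventually_elim auto
  have meas: "f \<in> borel_measurable M \<longleftrightarrow> g \<in> borel_measurable M"
    by (intro iffI; rule measurable_cong_AE[OF eq'] measurable_cong_AE[OF eq]; simp)
  show "integrable M f \<longleftrightarrow> integrable M g"
    using meas eq by (metis borel_measurable_integrable integrable_cong_AE)
  show "integral\<^sup>L M f = integral\<^sup>L M g"
  proof (cases "f \<in> borel_measurable M")
    case True
    then show ?thesis using meas eq by (intro integral_cong_AE) auto
  next
    case False
    then show ?thesis using meas
      by (metis borel_measurable_integrable not_integrable_integral_eq)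
  qed
qed

text \<open>Bridge from \<open>lebesgue_on\<close>, in which the problem is posed, to
  \<open>lborel\<close>, in which Fubini, push-forwards and substitutions are applied. No
  integrability is assumed: the two integrals also share the default value 0.\<close>

lemma
  fixes f :: "'a::euclidean_space \<Rightarrow> 'b::{banach, second_countable_topology}"
  assumes S: "S \<in> sets borel" and eq: "AE x in lborel. x \<in> S \<longrightarrow> f x = F x"
    and F: "F \<in> borel_measurable borel"
  shows lebesgue_on_integral_eq: "(LINT x|lebesgue_on S. f x) = (LINT x:S|lborel. F x)"
    and lebesgue_on_integrable_iff: "integrable (lebesgue_on S) f \<longleftrightarrow> set_integrable lborel S F"
proof -
  interpret complete_measure "lebesgue_on S"
    using S by (intro complete_measure_lebesgue_on) auto
  have eq': "AE x in lebesgue_on S. f x = F x"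
    using S eq by (subst AE_restrict_space_iff) (auto intro: AE_completion)
  have m: "(\<lambda>x. indicator S x *\<^sub>R F x) \<in> borel_measurable lborel"
    using S F by auto
  show "(LINT x|lebesgue_on S. f x) = (LINT x:S|lborel. F x)"
    using S m integral_cong_AE_complete[OF eq']
    by (simp add: integral_restrict_space integral_completion set_lebesgue_integral_def)
  show "integrable (lebesgue_on S) f \<longleftrightarrow> set_integrable lborel S F"
    using S m integrable_cong_AE_complete[OF eq']
    by (simp add: integrable_restrict_space integrable_completion set_integrable_def)
qed

text \<open>The cut-off by \<open>indicator S\<close> makes \<open>F\<close> vanish off
  \<open>S\<close>; this later lets integrals over the disk be written as integrals over the
  plane.\<close>

lemma lebesgue_on_borel_representative:
  fixes f :: "'a::euclidean_space \<Rightarrow> complex"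
  assumes f: "f \<in> borel_measurable (lebesgue_on S)" and S: "S \<in> sets borel"
  obtains F where "F \<in> borel_measurable borel" "AE x in lborel. x \<in> S \<longrightarrow> f x = F x" "\<And>x. x \<notin> S \<Longrightarrow> F x = 0"
proof -
  have "(\<lambda>x. indicator S x *\<^sub>R f x) \<in> borel_measurable lebesgue"
    using f S by (subst (asm) borel_measurable_restrict_space_iff) auto
  then have "(\<lambda>x. Re (indicator S x *\<^sub>R f x)) \<in> borel_measurable lebesgue"
     "(\<lambda>x. Im (indicator S x *\<^sub>R f x)) \<in> borel_measurable lebesgue"
    by measurable
  then obtain p q where [measurable]: "p \<in> borel_measurable borel" "q \<in> borel_measurable borel"
    and pq: "AE x in lborel. Re (indicator S x *\<^sub>R f x) = p x"
      "AE x in lborel. Im (indicator S x *\<^sub>R f x) = q x"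
    by (auto dest!: completion_ex_borel_measurable_real)
  have [measurable]: "S \<in> sets borel" by fact
  show ?thesis
  proof
    show "(\<lambda>x. indicator S x *\<^sub>R (of_real (p x) + \<i> * of_real (q x))) \<in> borel_measurable borel"
      by measurable
    show "AE x in lborel. x \<in> S \<longrightarrow> f x = indicator S x *\<^sub>R (of_real (p x) + \<i> * of_real (q x))"
      using pq by eventually_elim (auto simp: complex_eq_iff)
  qed auto
qed

section \<open>Polar coordinates\<close>

text \<open>Lebesgue measure is determined by its values on boxes, and a box in the complex plane is
  the image of a product of two intervals.\<close>

lemma lborel_complex_eq_distr:
  "(lborel :: complex measure) = distr (lborel \<Otimes>\<^sub>M lborel) borel (\<lambda>(x, y). Complex x y)"
proof (rule lborel_eqI)
  have [measurable]: "(\<lambda>(x, y). Complex x y) \<in> borel \<Otimes>\<^sub>M borel \<rightarrow>\<^sub>M borel"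
    unfolding Complex_eq by measurable
  fix l u :: complex
  assume le: "\<And>b. b \<in> Basis \<Longrightarrow> l \<bullet> b \<le> u \<bullet> b"
  then have le': "Re l \<le> Re u" "Im l \<le> Im u"
    using le[of 1] le[of \<i>] by (auto simp: Basis_complex_def inner_complex_def)
  have "(\<lambda>(x, y). Complex x y) -` box l u \<inter> space (lborel \<Otimes>\<^sub>M lborel) =
      box (Re l) (Re u) \<times> box (Im l) (Im u)"
    by (auto simp: box_def Basis_complex_def inner_complex_def space_pair_measure)
  then have "emeasure (distr (lborel \<Otimes>\<^sub>M lborel) borel (\<lambda>(x, y). Complex x y)) (box l u)
      = emeasure (lborel \<Otimes>\<^sub>M lborel) (box (Re l) (Re u) \<times> box (Im l) (Im u))"
    by (subst emeasure_distr) (auto simp del: lborel_prod)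
  also have "\<dots> = (\<Prod>b\<in>Basis. (u - l) \<bullet> b)"
    using le' by (simp add: lborel.emeasure_pair_measure_Times Basis_complex_def inner_complex_def
        ennreal_mult[symmetric] del: lborel_prod)
  finally show "emeasure (distr (lborel \<Otimes>\<^sub>M lborel) borel (\<lambda>(x, y). Complex x y)) (box l u)
      = (\<Prod>b\<in>Basis. (u - l) \<bullet> b)" .
qed simp

lemma nn_integral_lborel_complex:
  fixes h :: "complex \<Rightarrow> ennreal"
  assumes [measurable]: "h \<in> borel_measurable borel"
  shows "(\<integral>\<^sup>+z. h z \<partial>lborel) = (\<integral>\<^sup>+x. \<integral>\<^sup>+y. h (Complex x y) \<partial>lborel \<partial>lborel)"
proof -
  have [measurable]: "(\<lambda>(x, y). Complex x y) \<in> borel \<Otimes>\<^sub>M borel \<rightarrow>\<^sub>M borel"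
    unfolding Complex_eq by measurable
  show ?thesis
    by (subst lborel_complex_eq_distr, subst nn_integral_distr)
      (auto simp: lborel.nn_integral_fst[symmetric] simp del: lborel_prod)
qed

lemma nn_integral_tan:
  fixes G :: "real \<Rightarrow> ennreal"
  assumes G [measurable]: "G \<in> borel_measurable borel"
  shows "(\<integral>\<^sup>+c. ennreal (1 / (1 + c\<^sup>2)) * G c \<partial>lborel)
    = (\<integral>\<^sup>+t. G (tan t) * indicator {-(pi/2)<..<pi/2} t \<partial>lborel)"
proof -
  define H where "H = (\<lambda>c. ennreal (1 / (1 + c\<^sup>2)) * G c)"
  have [measurable]: "H \<in> borel_measurable borel"
    unfolding H_def by measurable
  have [measurable]: "(tan :: real \<Rightarrow> real) \<in> borel_measurable borel"
    unfolding tan_def[abs_def] by measurable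
  \<comment> \<open>\<open>Suc n\<close> keeps the interval of angles nondegenerate. On it
    \<open>cos\<close> has no zero, so \<open>tan\<close> is continuously differentiable and the
    substitution applies; monotone convergence then exhausts the open interval.\<close>
  have step: "(\<integral>\<^sup>+c. H c * indicator {- real (Suc n)..real (Suc n)} c \<partial>lborel)
     = (\<integral>\<^sup>+t. G (tan t) * indicator {-arctan (Suc n)..arctan (Suc n)} t \<partial>lborel)" for n
  proof -
    let ?a = "arctan (real (Suc n))"
    have a: "0 < ?a" "?a < pi/2"
      using arctan_ubound[of "real (Suc n)"] by auto
    have cos: "cos t \<noteq> 0" if "t \<in> {-?a..?a}" for t
      using that a cos_gt_zero_pi[of t] by (auto simp: field_simps)
    have "(\<integral>\<^sup>+c. H c * indicator {tan (-?a)..tan ?a} c \<partial>lborel)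
       = (\<integral>\<^sup>+t. H (tan t) * ennreal (inverse ((cos t)\<^sup>2)) * indicator {-?a..?a} t \<partial>lborel)"
    proof (rule nn_integral_substitution_aux)
      show "(tan has_real_derivative inverse ((cos x)\<^sup>2)) (at x)" if "x \<in> {-?a..?a}" for x
        using cos[OF that] by (rule DERIV_tan)
      show "continuous_on {-?a..?a} (\<lambda>x. inverse ((cos x)\<^sup>2))"
        using cos by (intro continuous_intros) auto
    qed (use a in auto)
    also have "\<dots> = (\<integral>\<^sup>+t. G (tan t) * indicator {-?a..?a} t \<partial>lborel)"
    proof (intro nn_integral_cong)
      fix t
      show "H (tan t) * ennreal (inverse ((cos t)\<^sup>2)) * indicator {-?a..?a} t
          = G (tan t) * indicator {-?a..?a} t"
      proof (cases "t \<in> {-?a..?a}")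
        case True
        have "ennreal (1 / (1 + (tan t)\<^sup>2)) * ennreal (inverse ((cos t)\<^sup>2)) = 1"
          using cos[OF True] by (simp add: ennreal_mult[symmetric] tan_sec power_inverse)
        then show ?thesis
          by (simp add: H_def mult_ac)
      qed auto
    qed
    finally show ?thesis by (simp add: tan_arctan arctan_minus[symmetric] del: of_nat_Suc)
  qed
  have ind_mono: "indicator {- arctan (real (Suc m))..arctan (real (Suc m))} x
      \<le> (indicator {- arctan (real (Suc n))..arctan (real (Suc n))} x :: ennreal)" if "m \<le> n" for m n x
  proof -
    have "arctan (real (Suc m)) \<le> arctan (real (Suc n))"
      using that by (intro arctan_monotone') simp
    then show ?thesis by (auto simp: indicator_def simp del: of_nat_Suc)
  qed
  have "(\<integral>\<^sup>+c. H c \<partial>lborel)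
     = (\<integral>\<^sup>+c. (SUP n. H c * indicator {- real (Suc n)..real (Suc n)} c) \<partial>lborel)"
  proof (intro nn_integral_cong)
    fix c
    obtain n where n: "\<bar>c\<bar> \<le> real n" using real_arch_simple by blast
    show "H c = (SUP n. H c * indicator {- real (Suc n)..real (Suc n)} c)"
    proof (intro antisym)
      show "H c \<le> (SUP n. H c * indicator {- real (Suc n)..real (Suc n)} c)"
        using n by (intro SUP_upper2[of n]) (auto simp: indicator_def)
    qed (auto intro!: SUP_least simp: indicator_def)
  qed
  also have "\<dots> = (SUP n. \<integral>\<^sup>+c. H c * indicator {- real (Suc n)..real (Suc n)} c \<partial>lborel)"
    by (intro nn_integral_monotone_convergence_SUP)
       (auto simp: incseq_def le_fun_def indicator_def)
  also have "\<dots> = (SUP n. \<integral>\<^sup>+t. G (tan t) * indicator {-arctan (Suc n)..arctan (Suc n)} t \<partial>lborel)"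
    using step by simp
  also have "\<dots> = (\<integral>\<^sup>+t. (SUP n. G (tan t) * indicator {-arctan (Suc n)..arctan (Suc n)} t) \<partial>lborel)"
    by (intro nn_integral_monotone_convergence_SUP[symmetric])
       (auto simp: incseq_def le_fun_def simp del: of_nat_Suc intro!: mult_left_mono ind_mono)
  also have "\<dots> = (\<integral>\<^sup>+t. G (tan t) * indicator {-(pi/2)<..<pi/2} t \<partial>lborel)"
  proof (intro nn_integral_cong antisym)
    fix t :: real
    show "(SUP n. G (tan t) * indicator {-arctan (Suc n)..arctan (Suc n)} t)
        \<le> G (tan t) * indicator {-(pi/2)<..<pi/2} t"
    proof (intro SUP_least)
      fix n
      show "G (tan t) * indicator {-arctan (Suc n)..arctan (Suc n)} t
        \<le> G (tan t) * indicator {-(pi/2)<..<pi/2} t"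
        using arctan_ubound[of "real (Suc n)"] by (auto simp: indicator_def simp del: of_nat_Suc)
    qed
    show "G (tan t) * indicator {-(pi/2)<..<pi/2} t
      \<le> (SUP n. G (tan t) * indicator {-arctan (Suc n)..arctan (Suc n)} t)"
    proof (cases "t \<in> {-(pi/2)<..<pi/2}")
      case True
      obtain n where n: "\<bar>tan t\<bar> \<le> real n" using real_arch_simple by blast
      have "\<bar>t\<bar> \<le> arctan (Suc n)"
      proof -
        have "arctan (tan t) = t" using True by (intro arctan_tan) auto
        moreover have "arctan (tan t) \<le> arctan (Suc n)" "arctan (- tan t) \<le> arctan (Suc n)"
          using n by (auto intro!: arctan_monotone')
        ultimately show ?thesis by (auto simp: arctan_minus)
      qed
      then show ?thesis
        using True by (intro SUP_upper2[of n]) (auto simp: indicator_def)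
    qed auto
  qed
  finally show ?thesis by (simp add: H_def)
qed

lemma rcis_measurable [measurable]:
  assumes [measurable]: "f \<in> borel_measurable M" "g \<in> borel_measurable M"
  shows "(\<lambda>x. rcis (f x) (g x)) \<in> borel_measurable M"
proof -
  have [measurable]: "cis \<in> borel_measurable borel"
    by (intro borel_measurable_continuous_onI continuous_intros)
  show ?thesis unfolding rcis_def by measurable
qed

lemma nn_integral_shift:
  fixes K :: "real \<Rightarrow> ennreal"
  assumes [measurable]: "K \<in> borel_measurable borel" "S \<in> sets borel"
    and "\<And>t. K (t + c) = L t" "\<And>t. t + c \<in> S \<longleftrightarrow> t \<in> S'"
  shows "(\<integral>\<^sup>+t. K t * indicator S t \<partial>lborel) = (\<integral>\<^sup>+t. L t * indicator S' t \<partial>lborel)"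
proof -
  have "(\<integral>\<^sup>+t. K t * indicator S t \<partial>lborel) = (\<integral>\<^sup>+t. K (c + 1 * t) * indicator S (c + 1 * t) \<partial>lborel)"
    by (subst nn_integral_real_affine[where c = 1 and t = c]) auto
  also have "\<dots> = (\<integral>\<^sup>+t. L t * indicator S' t \<partial>lborel)"
    using assms(3,4) by (intro nn_integral_cong) (auto simp: indicator_def add.commute)
  finally show ?thesis .
qed

text \<open>Cartesian coordinates turn into polar ones by the one-dimensional substitutions \<open>y = x * c\<close>,
  \<open>x = r / sqrt (1 + c\<^sup>2)\<close> and \<open>c = tan t\<close>.\<close>

theorem nn_integral_polar:
  fixes h :: "complex \<Rightarrow> ennreal"
  assumes [measurable]: "h \<in> borel_measurable borel"
  shows "(\<integral>\<^sup>+z. h z \<partial>lborel) =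
    (\<integral>\<^sup>+t. (\<integral>\<^sup>+r. ennreal r * h (rcis r t) * indicator {0<..} r \<partial>lborel) * indicator {0..2*pi} t \<partial>lborel)"
proof -
  \<comment> \<open>\<open>K t\<close> is the integral along the open ray at angle
    \<open>t\<close>.\<close>
  define K where "K t = (\<integral>\<^sup>+r. ennreal r * h (rcis r t) * indicator {0<..} r \<partial>lborel)" for t
  have [measurable]: "K \<in> borel_measurable borel"
    unfolding K_def[abs_def] by measurable
  have per: "K (t + 2 * pi) = K t" for t
    unfolding K_def by (simp add: rcis_def cis.code)
  have [measurable]: "(\<lambda>p. Complex (fst p) (fst p * snd p)) \<in> borel_measurable (borel \<Otimes>\<^sub>M borel)"
     "(\<lambda>p. Complex (snd p) (snd p * fst p)) \<in> borel_measurable (borel \<Otimes>\<^sub>M borel)"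
     "\<And>x. (\<lambda>p. Complex x p) \<in> borel_measurable borel" "\<And>c. (\<lambda>x. Complex x (x * c)) \<in> borel_measurable borel"
    unfolding Complex_eq by measurable
  have "(\<integral>\<^sup>+z. h z \<partial>lborel) = (\<integral>\<^sup>+x. \<integral>\<^sup>+y. h (Complex x y) \<partial>lborel \<partial>lborel)"
    by (rule nn_integral_lborel_complex) measurable
  also have "\<dots> = (\<integral>\<^sup>+x. \<integral>\<^sup>+c. ennreal \<bar>x\<bar> * h (Complex x (x * c)) \<partial>lborel \<partial>lborel)"
  proof (rule nn_integral_cong_AE)
    \<comment> \<open>The substitution \<open>y = x * c\<close> degenerates on the line
      \<open>x = 0\<close>, which is discarded as a null set.\<close>
    show "AE x in lborel. (\<integral>\<^sup>+y. h (Complex x y) \<partial>lborel) = (\<integral>\<^sup>+c. ennreal \<bar>x\<bar> * h (Complex x (x * c)) \<partial>lborel)"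
      using AE_lborel_singleton[of 0]
    proof eventually_elim
      case (elim x)
      then show ?case
        by (subst nn_integral_real_affine[where c = x and t = 0]) (auto simp: nn_integral_cmult)
    qed
  qed
  also have "\<dots> = (\<integral>\<^sup>+c. \<integral>\<^sup>+x. ennreal \<bar>x\<bar> * h (Complex x (x * c)) \<partial>lborel \<partial>lborel)"
    by (intro lborel_pair.Fubini') (simp add: case_prod_beta' del: lborel_prod, measurable)
  \<comment> \<open>The substitution in \<open>x\<close> contributes
    \<open>1 / sqrt (1 + c^2)\<close> twice, from \<open>dx\<close> and from the factor
    \<open>x\<close>. The product \<open>1 / (1 + c^2)\<close> is the derivative of
    \<open>arctan\<close>, ready for \<open>c = tan t\<close>.\<close>
  also have "\<dots> = (\<integral>\<^sup>+c. ennreal (1 / (1 + c\<^sup>2)) *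
      (\<integral>\<^sup>+r. ennreal \<bar>r\<bar> * h (rcis r (arctan c)) \<partial>lborel) \<partial>lborel)"
  proof (rule nn_integral_cong)
    fix c :: real
    let ?s = "sqrt (1 + c\<^sup>2)"
    have s: "?s > 0" by (simp add: add_pos_nonneg)
    have "(\<integral>\<^sup>+x. ennreal \<bar>x\<bar> * h (Complex x (x * c)) \<partial>lborel)
       = ennreal (1 / ?s) * (\<integral>\<^sup>+r. ennreal \<bar>r / ?s\<bar> * h (Complex (r / ?s) (r / ?s * c)) \<partial>lborel)"
      using s by (subst nn_integral_real_affine[where c = "1 / ?s" and t = 0]) auto
    also have "\<dots> = (\<integral>\<^sup>+r. ennreal (1 / (1 + c\<^sup>2)) * (ennreal \<bar>r\<bar> * h (rcis r (arctan c))) \<partial>lborel)"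
    proof (subst nn_integral_cmult[symmetric], measurable, intro nn_integral_cong)
      fix r
      have "Complex (r / ?s) (r / ?s * c) = rcis r (arctan c)"
        by (simp add: complex_eq_iff cos_arctan sin_arctan)
      moreover have "ennreal (1 / ?s) * ennreal \<bar>r / ?s\<bar> = ennreal (1 / (1 + c\<^sup>2)) * ennreal \<bar>r\<bar>"
        using s by (simp add: ennreal_mult[symmetric] abs_divide)
      ultimately show "ennreal (1 / ?s) * (ennreal \<bar>r / ?s\<bar> * h (Complex (r / ?s) (r / ?s * c)))
          = ennreal (1 / (1 + c\<^sup>2)) * (ennreal \<bar>r\<bar> * h (rcis r (arctan c)))"
        by (simp add: mult.assoc[symmetric])
    qed
    also have "\<dots> = ennreal (1 / (1 + c\<^sup>2)) * (\<integral>\<^sup>+r. ennreal \<bar>r\<bar> * h (rcis r (arctan c)) \<partial>lborel)"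
      by (rule nn_integral_cmult) measurable
    finally show "(\<integral>\<^sup>+x. ennreal \<bar>x\<bar> * h (Complex x (x * c)) \<partial>lborel) = \<dots>" .
  qed
  also have "\<dots> = (\<integral>\<^sup>+t. (\<integral>\<^sup>+r. ennreal \<bar>r\<bar> * h (rcis r (arctan (tan t))) \<partial>lborel)
      * indicator {-(pi/2)<..<pi/2} t \<partial>lborel)"
    by (rule nn_integral_tan) measurable
  \<comment> \<open>The line through the origin with slope \<open>tan t\<close> consists of two
    opposite rays: negative \<open>r\<close> belongs to the ray at angle
    \<open>t + pi\<close>.\<close>
  also have "\<dots> = (\<integral>\<^sup>+t. (K t + K (t + pi)) * indicator {-(pi/2)<..<pi/2} t \<partial>lborel)"
  proof (rule nn_integral_cong)
    fix t :: real
    have "(\<integral>\<^sup>+r. ennreal \<bar>r\<bar> * h (rcis r t) \<partial>lborel) =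
      (\<integral>\<^sup>+r. (ennreal \<bar>r\<bar> * h (rcis r t)) * indicator {0<..} r + (ennreal \<bar>r\<bar> * h (rcis r t)) * indicator {..<0} r \<partial>lborel)"
      by (intro nn_integral_cong) (auto simp: indicator_def)
    also have "\<dots> = K t + (\<integral>\<^sup>+r. (ennreal \<bar>r\<bar> * h (rcis r t)) * indicator {..<0} r \<partial>lborel)"
      by (subst nn_integral_add) (auto simp: K_def indicator_def intro!: arg_cong2[where f = "(+)"] nn_integral_cong)
    also have "(\<integral>\<^sup>+r. (ennreal \<bar>r\<bar> * h (rcis r t)) * indicator {..<0} r \<partial>lborel) = K (t + pi)"
      unfolding K_def
      by (subst nn_integral_real_affine[where c = "-1" and t = 0])
         (auto simp: indicator_def rcis_def cis.code Complex_eq algebra_simps intro!: nn_integral_cong)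
    finally show "(\<integral>\<^sup>+r. ennreal \<bar>r\<bar> * h (rcis r (arctan (tan t))) \<partial>lborel) * indicator {-(pi/2)<..<pi/2} t
      = (K t + K (t + pi)) * indicator {-(pi/2)<..<pi/2} t"
      by (auto simp: indicator_def arctan_tan)
  qed
  also have "\<dots> = (\<integral>\<^sup>+t. K t * indicator {-(pi/2)<..<0} t \<partial>lborel) + (\<integral>\<^sup>+t. K t * indicator {0..<pi/2} t \<partial>lborel)
      + (\<integral>\<^sup>+t. K (t + pi) * indicator {-(pi/2)<..<pi/2} t \<partial>lborel)"
    by (subst nn_integral_add[symmetric], measurable, subst nn_integral_add[symmetric], measurable)
       (intro nn_integral_cong, auto simp: indicator_def)
  \<comment> \<open>Angles between \<open>- pi/2\<close> and 0 move to the interval from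
    \<open>3*pi/2\<close> to \<open>2*pi\<close> by periodicity, and the opposite rays occupy the
    angles from \<open>pi/2\<close> to \<open>3*pi/2\<close>. Together with the first quadrant they
    cover \<open>{0..2*pi}\<close> up to three points.\<close>
  also have "(\<integral>\<^sup>+t. K t * indicator {-(pi/2)<..<0} t \<partial>lborel) = (\<integral>\<^sup>+t. K t * indicator {3*pi/2<..<2*pi} t \<partial>lborel)"
    by (rule nn_integral_shift[symmetric, where c = "2*pi"]) (auto simp: per)
  also have "(\<integral>\<^sup>+t. K (t + pi) * indicator {-(pi/2)<..<pi/2} t \<partial>lborel) = (\<integral>\<^sup>+t. K t * indicator {pi/2<..<3*pi/2} t \<partial>lborel)"
    by (rule nn_integral_shift[symmetric, where c = pi]) auto
  also have "(\<integral>\<^sup>+t. K t * indicator {3*pi/2<..<2*pi} t \<partial>lborel) + (\<integral>\<^sup>+t. K t * indicator {0..<pi/2} t \<partial>lborel)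
      + (\<integral>\<^sup>+t. K t * indicator {pi/2<..<3*pi/2} t \<partial>lborel)
    = (\<integral>\<^sup>+t. K t * indicator {3*pi/2<..<2*pi} t + K t * indicator {0..<pi/2} t + K t * indicator {pi/2<..<3*pi/2} t \<partial>lborel)"
    by (subst nn_integral_add[symmetric], measurable, subst nn_integral_add[symmetric]) auto
  also have "\<dots> = (\<integral>\<^sup>+t. K t * indicator {0..2*pi} t \<partial>lborel)"
  proof (rule nn_integral_cong_AE)
    show "AE t in lborel. K t * indicator {3*pi/2<..<2*pi} t + K t * indicator {0..<pi/2} t + K t * indicator {pi/2<..<3*pi/2} t
       = K t * indicator {0..2*pi} t"
      using AE_lborel_singleton[of "pi/2"] AE_lborel_singleton[of "3*pi/2"] AE_lborel_singleton[of "2*pi"]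
      by eventually_elim (auto simp: indicator_def)
  qed
  finally show ?thesis unfolding K_def .
qed

text \<open>With polar coordinates stated as an equality of measures, the rules for densities and
  push-forwards yield integrability and Bochner integrals. The closed interval of angles covers the
  positive axis twice, which is a null set.\<close>

definition polar_measure :: "(real \<times> real) measure" where
  "polar_measure = density (lborel \<Otimes>\<^sub>M lborel) (\<lambda>(r, t). ennreal r * indicator ({0<..} \<times> {0..2*pi}) (r, t))"

lemma sets_polar_measure [measurable_cong]: "sets polar_measure = sets (borel \<Otimes>\<^sub>M borel)"
  unfolding polar_measure_def sets_density by (intro sets_pair_measure_cong sets_lborel)

lemma lborel_eq_distr_polar: "(lborel :: complex measure) = distr polar_measure borel (\<lambda>(r, t). rcis r t)"
proof (rule measure_eqI)
  fix A :: "complex set" assume "A \<in> sets lborel"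
  then have [measurable]: "A \<in> sets borel" by simp
  have "emeasure lborel A = (\<integral>\<^sup>+z. indicator A z \<partial>lborel)"
    by simp
  also have "\<dots> = (\<integral>\<^sup>+t. (\<integral>\<^sup>+r. ennreal r * indicator A (rcis r t) * indicator {0<..} r \<partial>lborel) * indicator {0..2*pi} t \<partial>lborel)"
    by (rule nn_integral_polar) measurable
  also have "\<dots> = (\<integral>\<^sup>+t. (\<integral>\<^sup>+r. ennreal r * indicator A (rcis r t) * indicator {0<..} r * indicator {0..2*pi} t \<partial>lborel) \<partial>lborel)"
    by (intro nn_integral_cong nn_integral_multc[symmetric]) measurable
  also have "\<dots> = (\<integral>\<^sup>+r. (\<integral>\<^sup>+t. ennreal r * indicator A (rcis r t) * indicator {0<..} r * indicator {0..2*pi} t \<partial>lborel) \<partial>lborel)"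
    by (rule lborel_pair.Fubini') (simp add: case_prod_beta' del: lborel_prod)
  also have "\<dots> = (\<integral>\<^sup>+p. ennreal (fst p) * indicator A (rcis (fst p) (snd p)) * indicator {0<..} (fst p) * indicator {0..2*pi} (snd p) \<partial>(lborel \<Otimes>\<^sub>M lborel))"
    by (subst lborel.nn_integral_fst[symmetric]) (auto simp del: lborel_prod)
  also have "\<dots> = (\<integral>\<^sup>+p. indicator A (case p of (r, t) \<Rightarrow> rcis r t) \<partial>polar_measure)"
    unfolding polar_measure_def
    by (subst nn_integral_density)
       (auto simp: case_prod_beta' indicator_def simp del: lborel_prod intro!: nn_integral_cong)
  also have "\<dots> = (\<integral>\<^sup>+z. indicator A z \<partial>distr polar_measure borel (\<lambda>(r, t). rcis r t))"
    by (subst nn_integral_distr) auto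
  also have "\<dots> = emeasure (distr polar_measure borel (\<lambda>(r, t). rcis r t)) A"
    by simp
  finally show "emeasure lborel A = emeasure (distr polar_measure borel (\<lambda>(r, t). rcis r t)) A" .
qed simp

text \<open>Transfer to \<open>polar_measure\<close> and Fubini with the radius outside. Only almost
  every circle is guaranteed an integrable restriction, which explains the exceptional null sets of
  radii in what follows.\<close>

lemma
  fixes h :: "complex \<Rightarrow> 'b::{banach, second_countable_topology}"
  assumes h: "integrable lborel h"
  shows integrable_polar: "AE r in lborel. 0 < r \<longrightarrow> set_integrable lborel {0..2*pi} (\<lambda>t. h (rcis r t))"
    and integrable_polar_outer: "set_integrable lborel {0<..} (\<lambda>r. r *\<^sub>R (LINT t:{0..2*pi}|lborel. h (rcis r t)))"
    and integral_polar: "(LINT z|lborel. h z) = (LINT r:{0<..}|lborel. r *\<^sub>R (LINT t:{0..2*pi}|lborel. h (rcis r t)))"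
proof -
  have [measurable]: "h \<in> borel_measurable borel" using h by auto
  let ?w = "\<lambda>(r, t). r * indicator ({0<..} \<times> {0..2*pi}) (r, t) :: real"
  let ?h = "\<lambda>(r, t). indicator {0<..} r *\<^sub>R r *\<^sub>R indicator {0..2*pi} t *\<^sub>R h (rcis r t)"
  have eq: "(\<lambda>p. ?w p *\<^sub>R h (case p of (r, t) \<Rightarrow> rcis r t)) = ?h"
    by (auto simp: indicator_def fun_eq_iff)
  have dens: "polar_measure = density (lborel \<Otimes>\<^sub>M lborel) (\<lambda>p. ennreal (?w p))"
    unfolding polar_measure_def by (intro density_cong) (auto simp: indicator_def simp del: lborel_prod)
  have nn: "AE p in (lborel \<Otimes>\<^sub>M lborel). 0 \<le> ?w p"
    by (auto simp: indicator_def)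
  have int: "integrable (lborel \<Otimes>\<^sub>M lborel) ?h"
    using h nn
    by (subst (asm) lborel_eq_distr_polar)
       (simp add: integrable_distr_eq dens integrable_density eq del: lborel_prod)
  have "AE r in lborel. integrable lborel (\<lambda>t. ?h (r, t))"
    by (rule lborel_pair.AE_integrable_fst'[OF int])
  then show "AE r in lborel. 0 < r \<longrightarrow> set_integrable lborel {0..2*pi} (\<lambda>t. h (rcis r t))"
  proof eventually_elim
    case (elim r)
    then have "integrable lborel (\<lambda>t. (1 / r) *\<^sub>R ?h (r, t))"
      by (rule integrable_scaleR_right)
    then show ?case by (auto simp: set_integrable_def)
  qed
  have inner: "(LINT t|lborel. ?h (r, t)) = indicator {0<..} r *\<^sub>R r *\<^sub>R (LINT t:{0..2*pi}|lborel. h (rcis r t))" for r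
    by (simp add: set_lebesgue_integral_def del: scaleR_scaleR)
  show "set_integrable lborel {0<..} (\<lambda>r. r *\<^sub>R (LINT t:{0..2*pi}|lborel. h (rcis r t)))"
    using lborel_pair.integrable_fst'[OF int] unfolding inner set_integrable_def .
  have "(LINT z|lborel. h z) = (LINT p|(lborel \<Otimes>\<^sub>M lborel). ?h p)"
    using nn by (subst lborel_eq_distr_polar) (simp add: integral_distr dens integral_density eq del: lborel_prod)
  also have "\<dots> = (LINT r|lborel. LINT t|lborel. ?h (r, t))"
    by (rule lborel_pair.integral_fst'[OF int, symmetric])
  finally show "(LINT z|lborel. h z) = (LINT r:{0<..}|lborel. r *\<^sub>R (LINT t:{0..2*pi}|lborel. h (rcis r t)))"
    unfolding inner set_lebesgue_integral_def .
qed

text \<open>With the radius as the outer variable, finiteness or vanishing of the integral says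
  something about almost every circle.\<close>

lemma nn_integral_polar':
  fixes h :: "complex \<Rightarrow> ennreal"
  assumes [measurable]: "h \<in> borel_measurable borel"
  shows "(\<integral>\<^sup>+z. h z \<partial>lborel) =
    (\<integral>\<^sup>+r. ennreal r * indicator {0<..} r * (\<integral>\<^sup>+t. h (rcis r t) * indicator {0..2*pi} t \<partial>lborel) \<partial>lborel)"
proof -
  have "(\<integral>\<^sup>+z. h z \<partial>lborel) = (\<integral>\<^sup>+p. h (case p of (r, t) \<Rightarrow> rcis r t) \<partial>polar_measure)"
    by (subst lborel_eq_distr_polar, subst nn_integral_distr) auto
  also have "\<dots> = (\<integral>\<^sup>+p. ennreal (fst p) * indicator {0<..} (fst p) * (h (rcis (fst p) (snd p)) * indicator {0..2*pi} (snd p)) \<partial>(lborel \<Otimes>\<^sub>M lborel))"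
    unfolding polar_measure_def
    by (subst nn_integral_density)
       (auto simp: case_prod_beta' indicator_def simp del: lborel_prod intro!: nn_integral_cong)
  also have "\<dots> = (\<integral>\<^sup>+r. ennreal r * indicator {0<..} r * (\<integral>\<^sup>+t. h (rcis r t) * indicator {0..2*pi} t \<partial>lborel) \<partial>lborel)"
    by (subst lborel.nn_integral_fst[symmetric]) (auto simp: nn_integral_cmult simp del: lborel_prod)
  finally show ?thesis .
qed

text \<open>A Borel null set containing the exceptions has integral 0, so by
  \<open>nn_integral_polar'\<close> almost every circle meets it in a null set of angles.\<close>

lemma AE_polar:
  assumes "AE z in lborel. P (z::complex)"
  shows "AE r in lborel. 0 < r \<longrightarrow> (AE t in lborel. t \<in> {0..2*pi} \<longrightarrow> P (rcis r t))"
proof -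
  obtain N where N: "{z. \<not> P z} \<subseteq> N" "N \<in> null_sets lborel"
    using assms by (auto simp: eventually_ae_filter)
  then have [measurable]: "N \<in> sets borel" by auto
  have "(\<integral>\<^sup>+z. indicator N z \<partial>lborel) = 0" using N by (simp add: null_setsD1)
  then have "AE r in lborel. ennreal r * indicator {0<..} r * (\<integral>\<^sup>+t. indicator N (rcis r t) * indicator {0..2*pi} t \<partial>lborel) = 0"
    by (subst (asm) nn_integral_polar', measurable, subst (asm) nn_integral_0_iff_AE) auto
  then show ?thesis
  proof eventually_elim
    case (elim r)
    show ?case
    proof
      assume "0 < r"
      with elim have "(\<integral>\<^sup>+t. indicator N (rcis r t) * indicator {0..2*pi} t \<partial>lborel) = 0"
        by auto
      then have "AE t in lborel. (indicator N (rcis r t) :: ennreal) * indicator {0..2*pi} t = 0"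
        by (subst (asm) nn_integral_0_iff_AE) auto
      then show "AE t in lborel. t \<in> {0..2*pi} \<longrightarrow> P (rcis r t)"
        by eventually_elim (use N in \<open>auto simp: indicator_def\<close>)
    qed
  qed
qed

section \<open>Circle means and the Cauchy--Pompeiu formula\<close>

lemma set_integrable_circle:
  fixes f :: "real \<Rightarrow> 'a::{banach, second_countable_topology}"
  assumes "continuous_on UNIV f"
  shows "set_integrable lborel {a..b} f"
  using assms by (intro borel_integrable_atLeastAtMost' continuous_on_subset[OF assms]) auto

lemma circlepath_integral_eq:
  assumes "continuous_on (sphere 0 r) f" and "r > 0"
  shows "(f has_contour_integral (LINT t:{0..2*pi}|lborel. f (rcis r t) * \<i> * rcis r t)) (circlepath 0 r)"
proof -
  have cont: "continuous_on {0..2*pi} (\<lambda>t. f (rcis r t) * \<i> * rcis r t)"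
    using assms unfolding rcis_def
    by (intro continuous_intros continuous_on_compose2[OF assms(1)]) (auto simp: norm_mult)
  have "((\<lambda>t. f (rcis r t) * \<i> * rcis r t) has_integral (LINT t:{0..2*pi}|lborel. f (rcis r t) * \<i> * rcis r t)) {0..2*pi}"
    using set_borel_integral_eq_integral[OF borel_integrable_atLeastAtMost'[OF cont]]
    by (simp add: has_integral_iff)
  then show ?thesis
    unfolding circlepath_def
    by (subst has_contour_integral_part_circlepath_iff) (auto simp: rcis_def mult_ac)
qed

text \<open>On the circle \<open>dz / z\<close> is \<open>\<i> * dt\<close>, so Cauchy's integral
  formula at the centre is the mean value property.\<close>

lemma integral_circle_mean:
  fixes f :: "complex \<Rightarrow> complex"
  assumes contf: "continuous_on (cball 0 r) f" and holf: "f holomorphic_on ball 0 r" and r: "r > 0"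
  shows "(LINT t:{0..2*pi}|lborel. f (rcis r t)) = 2 * pi * f 0"
proof -
  have C: "((\<lambda>u. f u / (u - 0)) has_contour_integral (2 * of_real pi * \<i> * f 0)) (circlepath 0 r)"
    using r by (intro Cauchy_integral_circlepath[OF contf holf]) auto
  have contS: "continuous_on (sphere 0 r) f"
    by (rule continuous_on_subset[OF contf sphere_cball])
  have "continuous_on (sphere 0 r) (\<lambda>u. f u / (u - 0))"
    using r by (intro continuous_intros contS) auto
  from circlepath_integral_eq[OF this r]
  have "((\<lambda>u. f u / (u - 0)) has_contour_integral
      (LINT t:{0..2*pi}|lborel. f (rcis r t) / (rcis r t - 0) * \<i> * rcis r t)) (circlepath 0 r)" .
  from has_contour_integral_unique[OF this C]
  have "(LINT t:{0..2*pi}|lborel. f (rcis r t) / (rcis r t - 0) * \<i> * rcis r t) = 2 * of_real pi * \<i> * f 0" .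
  moreover have "(\<lambda>t. f (rcis r t) / (rcis r t - 0) * \<i> * rcis r t) = (\<lambda>t. \<i> * f (rcis r t))"
    using r by (auto simp: fun_eq_iff)
  ultimately show ?thesis by simp
qed

lemma ball_in_sets_borel [measurable]: "ball (c::'a::metric_space) r \<in> sets borel"
  by simp

text \<open>The Jacobian \<open>r\<close> cancels the singularity \<open>1 / r\<close>. Finiteness
  of the value makes the Cauchy kernel locally integrable.\<close>

lemma nn_integral_inverse_norm:
  assumes "R \<ge> 0"
  shows "(\<integral>\<^sup>+z. inverse (ennreal (cmod z)) * indicator (ball 0 R) z \<partial>lborel) = ennreal (2 * pi * R)"
proof -
  have "(\<integral>\<^sup>+z. inverse (ennreal (cmod z)) * indicator (ball 0 R) z \<partial>lborel)
    = (\<integral>\<^sup>+r. ennreal r * indicator {0<..} r * (\<integral>\<^sup>+t. inverse (ennreal (cmod (rcis r t))) * indicator (ball 0 R) (rcis r t) * indicator {0..2*pi} t \<partial>lborel) \<partial>lborel)"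
    by (rule nn_integral_polar') measurable
  also have "\<dots> = (\<integral>\<^sup>+r. ennreal (2 * pi) * indicator {0<..<R} r \<partial>lborel)"
  proof (rule nn_integral_cong)
    fix r :: real
    show "ennreal r * indicator {0<..} r * (\<integral>\<^sup>+t. inverse (ennreal (cmod (rcis r t))) * indicator (ball 0 R) (rcis r t) * indicator {0..2*pi} t \<partial>lborel)
      = ennreal (2 * pi) * indicator {0<..<R} r"
    proof (cases "r > 0")
      case True
      have "(\<lambda>t. inverse (ennreal (cmod (rcis r t))) * indicator (ball 0 R) (rcis r t) * indicator {0..2*pi} t)
         = (\<lambda>t. inverse (ennreal r) * indicator {0<..<R} r * indicator {0..2*pi} t)"
        using True by (auto simp: indicator_def fun_eq_iff)
      then show ?thesis
        using True
        by (cases "r < R") (simp_all add: nn_integral_cmult_indicator inverse_ennreal ennreal_mult[symmetric])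
    qed auto
  qed
  also have "\<dots> = ennreal (2 * pi * R)"
    using assms by (simp add: nn_integral_cmult_indicator ennreal_mult)
  finally show ?thesis .
qed

lemma nn_integral_translate:
  fixes h :: "'a::euclidean_space \<Rightarrow> ennreal"
  assumes [measurable]: "h \<in> borel_measurable borel"
  shows "(\<integral>\<^sup>+z. h z \<partial>lborel) = (\<integral>\<^sup>+z. h (c + z) \<partial>lborel)"
  by (subst lborel_distr_plus[of c, symmetric], subst nn_integral_distr) auto

lemma
  fixes h :: "'a::euclidean_space \<Rightarrow> 'b::{banach, second_countable_topology}"
  assumes [measurable]: "h \<in> borel_measurable borel"
  shows integral_translate: "(LINT z|lborel. h z) = (LINT z|lborel. h (c + z))"
    and integrable_translate: "integrable lborel h \<longleftrightarrow> integrable lborel (\<lambda>z. h (c + z))"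
   by (subst lborel_distr_plus[of c, symmetric], subst integral_distr, auto)
      (subst (asm) lborel_distr_plus[of c, symmetric], subst (asm) integrable_distr_eq, auto,
       subst lborel_distr_plus[of c, symmetric], subst integrable_distr_eq, auto)

section \<open>Wirtinger derivatives of compactly supported functions and the Cauchy--Pompeiu
  formula\<close>

lemma frechet_derivative_complex:
  assumes "\<phi> differentiable (at z)"
  shows "frechet_derivative \<phi> (at z) h =
    of_real (Re h) * frechet_derivative \<phi> (at z) 1 + of_real (Im h) * frechet_derivative \<phi> (at z) \<i>"
proof -
  interpret linear "frechet_derivative \<phi> (at z)"
    using assms frechet_derivative_works has_derivative_linear by blast
  have "h = Re h *\<^sub>R 1 + Im h *\<^sub>R \<i>" by (simp add: complex_eq_iff)
  then have "frechet_derivative \<phi> (at z) h = frechet_derivative \<phi> (at z) (Re h *\<^sub>R 1 + Im h *\<^sub>R \<i>)"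
    by simp
  then show ?thesis by (simp only: add scaleR) (simp only: scaleR_conv_of_real)
qed

lemma wirtinger_zbar_continuous:
  assumes "C1_compact_disk \<phi>" shows "continuous_on UNIV (wirtinger_zbar \<phi>)"
  using assms unfolding C1_compact_disk_def wirtinger_zbar_def[abs_def] by (intro continuous_intros) auto

lemma frechet_derivative_eq_0_outside:
  assumes K: "closed K" "\<And>z. z \<notin> K \<Longrightarrow> \<phi> z = 0" and z: "z \<notin> K"
  shows "frechet_derivative \<phi> (at z) = (\<lambda>h. 0 :: 'b::real_normed_vector)"
proof -
  have "(\<phi> has_derivative (\<lambda>h. 0)) (at z)"
    by (rule has_derivative_transform_within_open[where f = "\<lambda>_. 0" and s = "- K"])
       (use K z in auto)
  then show ?thesis using frechet_derivative_at by metis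
qed

lemma wirtinger_zbar_eq_0_outside:
  assumes K: "closed K" "\<And>z. z \<notin> K \<Longrightarrow> \<phi> z = 0" and z: "z \<notin> K"
  shows "wirtinger_zbar \<phi> z = 0"
  using frechet_derivative_eq_0_outside[OF assms] by (simp add: wirtinger_zbar_def)

lemma C1_compact_diskE:
  assumes "C1_compact_disk \<phi>"
  obtains K where "compact K" "K \<subseteq> disk" "\<And>z. z \<notin> K \<Longrightarrow> \<phi> z = 0" "\<And>z. z \<notin> K \<Longrightarrow> wirtinger_zbar \<phi> z = 0"
proof -
  obtain K where K: "compact K" "K \<subseteq> disk" "\<And>z. z \<notin> K \<Longrightarrow> \<phi> z = 0"
    using assms unfolding C1_compact_disk_def by auto
  then show ?thesis
    using wirtinger_zbar_eq_0_outside[of K \<phi>] by (intro that[of K]) (auto intro: compact_imp_closed)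
qed

lemma C1_compact_disk_bounded:
  assumes "C1_compact_disk \<phi>"
  obtains M where "M \<ge> 0" "\<And>z. cmod (wirtinger_zbar \<phi> z) \<le> M * indicator disk z"
proof -
  obtain K where K: "compact K" "K \<subseteq> disk" "\<And>z. z \<notin> K \<Longrightarrow> \<phi> z = 0" "\<And>z. z \<notin> K \<Longrightarrow> wirtinger_zbar \<phi> z = 0"
    using assms by (rule C1_compact_diskE) blast
  have "compact (wirtinger_zbar \<phi> ` K)"
    using wirtinger_zbar_continuous[OF assms] K(1)
    by (intro compact_continuous_image) (auto intro: continuous_on_subset)
  then obtain M where M: "M > 0" "\<forall>x\<in>wirtinger_zbar \<phi> ` K. cmod x \<le> M"
    using compact_imp_bounded bounded_pos by blast
  show ?thesis
  proof
    show "cmod (wirtinger_zbar \<phi> z) \<le> M * indicator disk z" for z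
      using M K by (cases "z \<in> K") (auto simp: indicator_def)
  qed (use M in simp)
qed

text \<open>In polar coordinates around \<open>w\<close> the Jacobian cancels the denominator and
  leaves half the radial derivative of \<open>\<phi>\<close> plus a tangential term. In each
  direction the radial derivative integrates to \<open>- \<phi> w\<close>, because
  \<open>\<phi>\<close> vanishes far out; half of \<open>2 * pi\<close> directions gives the
  constant \<open>- pi\<close>.\<close>

theorem
  fixes \<phi> :: "complex \<Rightarrow> complex"
  assumes \<phi>: "C1_compact_disk \<phi>"
  shows Cauchy_Pompeiu_integrable: "integrable lborel (\<lambda>z. wirtinger_zbar \<phi> z / (z - w))"
    and Cauchy_Pompeiu: "(LINT z|lborel. wirtinger_zbar \<phi> z / (z - w)) = - pi * \<phi> w"
proof -
  obtain K where K: "compact K" "K \<subseteq> disk" "\<And>z. z \<notin> K \<Longrightarrow> \<phi> z = 0" "\<And>z. z \<notin> K \<Longrightarrow> wirtinger_zbar \<phi> z = 0"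
    using \<phi> by (rule C1_compact_diskE) blast
  obtain M where M: "M \<ge> 0" "\<And>z. cmod (wirtinger_zbar \<phi> z) \<le> M * indicator disk z"
    using \<phi> by (rule C1_compact_disk_bounded) blast
  have diff: "(\<phi> has_derivative frechet_derivative \<phi> (at z)) (at z)" for z
    using \<phi> by (auto simp: C1_compact_disk_def frechet_derivative_works)
  have frech: "frechet_derivative \<phi> (at z) h =
    of_real (Re h) * frechet_derivative \<phi> (at z) 1 + of_real (Im h) * frechet_derivative \<phi> (at z) \<i>" for z h
    using \<phi> by (intro frechet_derivative_complex) (auto simp: C1_compact_disk_def)
  have chain: "((\<lambda>t. \<phi> (a t)) has_vector_derivative frechet_derivative \<phi> (at (a t)) a') (at t within S)"
    if "(a has_vector_derivative a') (at t within S)" for a a' t S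
    using diff_chain_within[OF that[unfolded has_vector_derivative_def] has_derivative_at_withinI[OF diff]]
    by (simp add: has_vector_derivative_def o_def linear_cmul[OF has_derivative_linear[OF diff]])
  define p where "p z = frechet_derivative \<phi> (at z) 1" for z
  define q where "q z = frechet_derivative \<phi> (at z) \<i>" for z
  have contp: "continuous_on UNIV p" and contq: "continuous_on UNIV q"
    using \<phi> by (auto simp: C1_compact_disk_def p_def[abs_def] q_def[abs_def])
  have wz: "wirtinger_zbar \<phi> z = (p z + \<i> * q z) / 2" for z
    by (simp add: wirtinger_zbar_def p_def q_def)
  have contw: "continuous_on UNIV (wirtinger_zbar \<phi>)" by (rule wirtinger_zbar_continuous[OF \<phi>])
  then have [measurable]: "wirtinger_zbar \<phi> \<in> borel_measurable borel"
    by (rule borel_measurable_continuous_onI)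
  \<comment> \<open>The support lies in the unit disk, so every ray from \<open>w\<close> has left
    it at distance \<open>cmod w + 1\<close>.\<close>
  define R where "R = cmod w + 1"
  have R: "R > 0" by (simp add: R_def add_nonneg_pos)
  have out: "w + z \<notin> K" if "cmod z \<ge> R" for z
  proof
    assume "w + z \<in> K"
    then have "cmod (w + z) < 1" using K(2) by auto
    then have "cmod z < 1 + cmod w" using norm_triangle_ineq2[of z "- w"] by (simp add: add.commute)
    then show False using that by (simp add: R_def)
  qed
  define h where "h z = wirtinger_zbar \<phi> (w + z) / z" for z
  have [measurable]: "h \<in> borel_measurable borel" unfolding h_def[abs_def] by measurable
  have inth: "integrable lborel h"
  proof (rule integrableI_bounded)
    have "(\<integral>\<^sup>+z. ennreal (norm (h z)) \<partial>lborel) \<le> (\<integral>\<^sup>+z. ennreal M * (inverse (ennreal (cmod z)) * indicator (ball 0 R) z) \<partial>lborel)"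
    proof (rule nn_integral_mono)
      fix z
      show "ennreal (norm (h z)) \<le> ennreal M * (inverse (ennreal (cmod z)) * indicator (ball 0 R) z)"
      proof (cases "z = 0 \<or> cmod z \<ge> R")
        case True
        then show ?thesis using out[of z] K(4) by (auto simp: h_def)
      next
        case False
        have "cmod (wirtinger_zbar \<phi> (w + z)) \<le> M"
          using M(1) M(2)[of "w + z"] by (cases "w + z \<in> disk") auto
        then show ?thesis using False M(1)
          by (auto simp: h_def norm_divide inverse_ennreal ennreal_mult[symmetric] field_simps
              intro!: ennreal_leI)
      qed
    qed
    also have "\<dots> = ennreal M * ennreal (2 * pi * R)"
      using R by (subst nn_integral_cmult, measurable, simp add: nn_integral_inverse_norm)
    also have "\<dots> < \<infinity>" by (simp add: ennreal_mult_less_top)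
    finally show "(\<integral>\<^sup>+z. ennreal (norm (h z)) \<partial>lborel) < \<infinity>" .
  qed measurable
  then show "integrable lborel (\<lambda>z. wirtinger_zbar \<phi> z / (z - w))"
    by (subst integrable_translate[where c = w]) (auto simp: h_def[abs_def])
  \<comment> \<open>\<open>Q r t\<close> is the derivative of \<open>\<phi>\<close> at
    \<open>w + rcis r t\<close> in the radial direction \<open>cis t\<close>.\<close>
  define Q where "Q r t = of_real (cos t) * p (w + rcis r t) + of_real (sin t) * q (w + rcis r t)" for r t
  have contQ: "continuous_on S (\<lambda>x. Q (a x) (b x))" if "continuous_on S a" "continuous_on S b"
    for S :: "'x::t2_space set" and a b
    unfolding Q_def rcis_def
    by (intro continuous_intros that continuous_on_compose2[OF contp] continuous_on_compose2[OF contq]) auto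
  have Qout: "Q r t = 0" if "r \<ge> R" for r t
  proof -
    have "w + rcis r t \<notin> K" using that R by (intro out) auto
    then have "frechet_derivative \<phi> (at (w + rcis r t)) = (\<lambda>h. 0)"
      using K by (intro frechet_derivative_eq_0_outside[of K]) (auto intro: compact_imp_closed)
    then show ?thesis by (simp add: Q_def p_def q_def)
  qed
  \<comment> \<open>The tangential derivative integrates to 0 over each circle, which leaves the radial part \<open>Q\<close>.\<close>
  have inner: "r *\<^sub>R (LINT t:{0..2*pi}|lborel. h (rcis r t)) = (LINT t:{0..2*pi}|lborel. Q r t) / 2" if r: "r > 0" for r
  proof -
    \<comment> \<open>The derivative of \<open>\<phi>\<close> along the circle with respect to the
      angle, which explains the factor \<open>r\<close>.\<close>
    define Q' where "Q' t = of_real r * (- of_real (sin t) * p (w + rcis r t) + of_real (cos t) * q (w + rcis r t))" for t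
    have contQ': "continuous_on UNIV Q'"
      unfolding Q'_def[abs_def] rcis_def
      by (intro continuous_intros continuous_on_compose2[OF contp] continuous_on_compose2[OF contq]) auto
    have "(LBINT t. indicator {0..2*pi} t *\<^sub>R Q' t) = \<phi> (w + rcis r (2 * pi)) - \<phi> (w + rcis r 0)"
    proof (rule integral_FTC_atLeastAtMost)
      fix t :: real
      have "((\<lambda>t. w + rcis r t) has_vector_derivative (rcis r t * \<i>)) (at t within {0..2*pi})"
        unfolding rcis_def has_vector_derivative_def
        by (auto intro!: derivative_eq_intros simp: scaleR_conv_of_real fun_eq_iff algebra_simps)
      then have "((\<lambda>t. \<phi> (w + rcis r t)) has_vector_derivative (frechet_derivative \<phi> (at (w + rcis r t)) (rcis r t * \<i>))) (at t within {0..2*pi})"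
        by (rule chain)
      moreover have "frechet_derivative \<phi> (at (w + rcis r t)) (rcis r t * \<i>) = Q' t"
        by (subst frech) (simp add: Q'_def p_def q_def algebra_simps)
      ultimately show "((\<lambda>t. \<phi> (w + rcis r t)) has_vector_derivative Q' t) (at t within {0..2*pi})"
        by simp
    qed (use contQ' in \<open>auto intro: continuous_on_subset\<close>)
    then have Q'0: "(LINT t:{0..2*pi}|lborel. Q' t) = 0"
      by (simp add: set_lebesgue_integral_def rcis_def)
    \<comment> \<open>Multiplying \<open>p + \<i> * q\<close> by \<open>cis (- t)\<close> rotates
      the Cartesian derivatives into the radial and the tangential one.\<close>
    have eq: "h (rcis r t) = (1 / (2 * r)) *\<^sub>R Q r t + (\<i> / (2 * r * r)) * Q' t" for t
    proof -
      have "h (rcis r t) = cis (- t) * (p (w + rcis r t) + \<i> * q (w + rcis r t)) / (2 * r)"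
      proof -
        have "h (rcis r t) = (p (w + rcis r t) + \<i> * q (w + rcis r t)) / 2 / rcis r t"
          unfolding h_def wz ..
        also have "X / 2 / rcis r t = cis (- t) * X / (2 * r)" for X
          using r by (simp add: rcis_def cis_inverse[symmetric] field_simps)
        finally show ?thesis .
      qed
      moreover have "cis (- t) = of_real (cos t) - \<i> * of_real (sin t)"
        by (simp add: complex_eq_iff)
      moreover have "(of_real c - \<i> * of_real s) * (a + \<i> * b) / of_real (2 * r)
         = (1 / (2 * r)) *\<^sub>R (of_real c * a + of_real s * b)
           + (\<i> / (2 * r * r)) * (of_real r * (- of_real s * a + of_real c * b))" for a b :: complex and c s :: real
      proof -
        have 1: "(\<i> / (2 * r * r)) * (of_real r * X) = 1 / of_real (2 * r) * (\<i> * X)" for X :: complex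
          using r by simp
        have 2: "(1 / (2 * r)) *\<^sub>R X = 1 / of_real (2 * r) * X" for X :: complex
          by (simp add: scaleR_conv_of_real)
        have 3: "X / of_real (2 * r) = 1 / of_real (2 * r) * X" for X :: complex
          by simp
        have 4: "(of_real c - \<i> * of_real s) * (a + \<i> * b)
            = (of_real c * a + of_real s * b) + \<i> * (- of_real s * a + of_real c * b)"
          by (simp add: algebra_simps)
        show ?thesis
          unfolding 1 2 4 by (subst 3) (rule distrib_left)
      qed
      ultimately show ?thesis
        unfolding Q_def Q'_def by metis
    qed
    have "(LINT t:{0..2*pi}|lborel. h (rcis r t))
       = (LINT t:{0..2*pi}|lborel. (1 / (2 * r)) *\<^sub>R Q r t) + (LINT t:{0..2*pi}|lborel. (\<i> / (2 * r * r)) * Q' t)"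
      unfolding eq by (intro set_integral_add set_integrable_circle continuous_intros contQ' contQ)
    also have "\<dots> = (1 / (2 * r)) *\<^sub>R (LINT t:{0..2*pi}|lborel. Q r t)"
      using Q'0 by simp
    finally show ?thesis using r by (simp add: scaleR_conv_of_real)
  qed
  have "(LINT z|lborel. wirtinger_zbar \<phi> z / (z - w)) = (LINT z|lborel. h z)"
    by (subst integral_translate[where c = w]) (auto simp: h_def[abs_def])
  also have "\<dots> = (LINT r:{0<..}|lborel. r *\<^sub>R (LINT t:{0..2*pi}|lborel. h (rcis r t)))"
    by (rule integral_polar[OF inth])
  also have "\<dots> = (LINT r:{0<..}|lborel. (LINT t:{0..2*pi}|lborel. Q r t) / 2)"
    by (intro set_lebesgue_integral_cong) (auto simp: inner)
  also have "\<dots> = (LINT r:{0..R}|lborel. (LINT t:{0..2*pi}|lborel. Q r t) / 2)"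
    unfolding set_lebesgue_integral_def
  proof (rule integral_cong_AE)
    have [measurable]: "(\<lambda>x. Q (fst x) (snd x)) \<in> borel_measurable (borel \<Otimes>\<^sub>M borel)"
      unfolding borel_prod by (intro borel_measurable_continuous_onI contQ continuous_intros)
    show "(\<lambda>x. indicat_real {0<..} x *\<^sub>R ((LBINT t. indicat_real {0..2 * pi} t *\<^sub>R Q x t) / 2)) \<in> borel_measurable lborel"
      "(\<lambda>x. indicat_real {0..R} x *\<^sub>R ((LBINT t. indicat_real {0..2 * pi} t *\<^sub>R Q x t) / 2)) \<in> borel_measurable lborel"
      by measurable
    show "AE x in lborel. indicat_real {0<..} x *\<^sub>R ((LBINT t. indicat_real {0..2 * pi} t *\<^sub>R Q x t) / 2)
       = indicat_real {0..R} x *\<^sub>R ((LBINT t. indicat_real {0..2 * pi} t *\<^sub>R Q x t) / 2)"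
      using AE_lborel_singleton[of 0]
    proof eventually_elim
      case (elim x)
      then show ?case using Qout[of x] by (cases "x \<ge> R") (auto simp: indicator_def)
    qed
  qed
  also have "\<dots> = (LINT r:{0..R}|lborel. (LINT t:{0..2*pi}|lborel. Q r t)) / 2"
    by simp
  also have "(LINT r:{0..R}|lborel. (LINT t:{0..2*pi}|lborel. Q r t))
     = (LINT r|lborel. LINT t|lborel. indicator {0..R} r *\<^sub>R indicator {0..2*pi} t *\<^sub>R Q r t)"
    by (simp add: set_lebesgue_integral_def del: scaleR_scaleR)
  also have "\<dots> = (LINT t|lborel. LINT r|lborel. indicator {0..R} r *\<^sub>R indicator {0..2*pi} t *\<^sub>R Q r t)"
  proof (rule lborel_pair.Fubini_integral[symmetric])
    have "integrable lborel (\<lambda>x. indicator (cbox (0, 0) (R, 2 * pi)) x *\<^sub>R (\<lambda>x. Q (fst x) (snd x)) x)"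
      by (intro borel_integrable_compact contQ continuous_intros) auto
    also have "(\<lambda>x. indicator (cbox (0, 0) (R, 2 * pi)) x *\<^sub>R (\<lambda>x. Q (fst x) (snd x)) x)
      = (\<lambda>(t, r). indicator {0..R} t *\<^sub>R indicator {0..2*pi} r *\<^sub>R Q t r)"
      by (auto simp: fun_eq_iff indicator_def cbox_Pair_eq)
    finally show "integrable (lborel \<Otimes>\<^sub>M lborel) (\<lambda>(r, t). indicator {0..R} r *\<^sub>R indicator {0..2*pi} t *\<^sub>R Q r t)"
      by (simp only: lborel_prod)
  qed
  also have "\<dots> = (LINT t|lborel. indicator {0..2*pi} t *\<^sub>R (LINT r|lborel. indicator {0..R} r *\<^sub>R Q r t))"
  proof (intro Bochner_Integration.integral_cong refl)
    fix t :: real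
    show "(LINT r|lborel. indicator {0..R} r *\<^sub>R indicator {0..2*pi} t *\<^sub>R Q r t)
       = indicator {0..2*pi} t *\<^sub>R (LINT r|lborel. indicator {0..R} r *\<^sub>R Q r t)"
      by (cases "t \<in> {0..2*pi}") simp_all
  qed
  also have "\<dots> = (LINT t|lborel. indicator {0..2*pi} t *\<^sub>R (- \<phi> w))"
  proof (intro Bochner_Integration.integral_cong refl arg_cong2[where f = "(*\<^sub>R)"])
    fix t :: real
    have "(LINT r|lborel. indicator {0..R} r *\<^sub>R Q r t) = \<phi> (w + rcis R t) - \<phi> (w + rcis 0 t)"
    proof (rule integral_FTC_atLeastAtMost)
      fix r :: real
      have "((\<lambda>r. w + rcis r t) has_vector_derivative (cis t)) (at r within {0..R})"
        unfolding rcis_def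
        by (auto intro!: derivative_eq_intros simp: has_vector_derivative_def scaleR_conv_of_real fun_eq_iff)
      then have "((\<lambda>r. \<phi> (w + rcis r t)) has_vector_derivative (frechet_derivative \<phi> (at (w + rcis r t)) (cis t))) (at r within {0..R})"
        by (rule chain)
      moreover have "frechet_derivative \<phi> (at (w + rcis r t)) (cis t) = Q r t"
        by (subst frech) (simp add: Q_def p_def q_def)
      ultimately show "((\<lambda>r. \<phi> (w + rcis r t)) has_vector_derivative Q r t) (at r within {0..R})"
        by simp
    qed (use R contQ[OF continuous_on_id continuous_on_const] in \<open>auto intro: continuous_on_subset\<close>)
    also have "\<phi> (w + rcis R t) = 0"
      using R by (intro K(3) out) auto
    finally show "(LINT r|lborel. indicator {0..R} r *\<^sub>R Q r t) = - \<phi> w" by simp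
  qed
  also have "\<dots> = - (2 * pi * \<phi> w)"
    by (simp add: scaleR_conv_of_real)
  finally show "(LINT z|lborel. wirtinger_zbar \<phi> z / (z - w)) = - pi * \<phi> w" by simp
qed

text \<open>Leibniz' rule, in which the term with the derivative of \<open>F\<close> drops out by
  holomorphy. \<open>F\<close> is controlled near the support only; elsewhere the product is 0
  whatever \<open>F\<close> is, so continuity of the derivatives is checked on the open cover by
  \<open>V\<close> and \<open>- K\<close>.\<close>

lemma
  assumes \<phi>: "C1_compact_disk \<phi>" and K: "compact K" "K \<subseteq> disk" "\<And>z. z \<notin> K \<Longrightarrow> \<phi> z = 0"
    and V: "open V" "K \<subseteq> V" and F: "F holomorphic_on V"
  shows C1_compact_disk_mult_holomorphic: "C1_compact_disk (\<lambda>z. F z * \<phi> z)"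
    and wirtinger_zbar_mult_holomorphic: "wirtinger_zbar (\<lambda>z. F z * \<phi> z) z = F z * wirtinger_zbar \<phi> z"
proof -
  define D where "D z h = F z * frechet_derivative \<phi> (at z) h + deriv F z * h * \<phi> z" for z h
  have out: "D z = (\<lambda>h. 0)" if "z \<notin> K" for z
    using frechet_derivative_eq_0_outside[of K \<phi> z] K that
    by (auto simp: D_def fun_eq_iff intro: compact_imp_closed)
  have der: "((\<lambda>z. F z * \<phi> z) has_derivative D z) (at z)" for z
  proof (cases "z \<in> V")
    case True
    have 1: "(F has_derivative (\<lambda>h. deriv F z * h)) (at z)"
      using holomorphic_derivI[OF F V(1) True] by (simp add: has_field_derivative_def)
    have 2: "(\<phi> has_derivative frechet_derivative \<phi> (at z)) (at z)"
      using \<phi> by (auto simp: C1_compact_disk_def frechet_derivative_works)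
    show ?thesis
      using has_derivative_mult[OF 1 2] by (simp add: D_def[abs_def])
  next
    case False
    then have "z \<notin> K" using V by auto
    moreover have "((\<lambda>z. F z * \<phi> z) has_derivative (\<lambda>h. 0)) (at z)"
      by (rule has_derivative_transform_within_open[where f = "\<lambda>_. 0" and s = "- K"])
         (use K \<open>z \<notin> K\<close> in \<open>auto intro: compact_imp_closed\<close>)
    ultimately show ?thesis using out by simp
  qed
  then have fr: "frechet_derivative (\<lambda>z. F z * \<phi> z) (at z) = D z" for z
    using frechet_derivative_at by metis
  have cont: "continuous_on UNIV (\<lambda>z. D z h)" if "h = 1 \<or> h = \<i>" for h
  proof -
    have "continuous_on V (\<lambda>z. D z h)"
    proof -
      have "continuous_on V F" "continuous_on V (deriv F)"
        using F V holomorphic_deriv holomorphic_on_imp_continuous_on by blast+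
      moreover have "continuous_on UNIV \<phi>"
        using \<phi> unfolding C1_compact_disk_def
        by (meson continuous_at_imp_continuous_on differentiable_imp_continuous_within)
      moreover have "continuous_on UNIV (\<lambda>z. frechet_derivative \<phi> (at z) h)"
        using \<phi> that unfolding C1_compact_disk_def by auto
      ultimately show ?thesis unfolding D_def
        by (intro continuous_intros) (auto intro: continuous_on_subset)
    qed
    moreover have "continuous_on (- K) (\<lambda>z. D z h)"
      using out by (subst continuous_on_cong[where g = "\<lambda>_. 0"]) auto
    ultimately have "continuous_on (V \<union> - K) (\<lambda>z. D z h)"
      using V K by (intro continuous_on_open_Un) (auto intro: compact_imp_closed)
    moreover have "V \<union> - K = UNIV" using V(2) by blast
    ultimately show ?thesis by (simp only:)
  qed
  show "C1_compact_disk (\<lambda>z. F z * \<phi> z)"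
    unfolding C1_compact_disk_def
  proof (intro conjI allI exI[of _ K] impI)
    show "(\<lambda>z. F z * \<phi> z) differentiable at z" for z
      using der differentiable_def by blast
  qed (use K cont fr in auto)
  show "wirtinger_zbar (\<lambda>z. F z * \<phi> z) z = F z * wirtinger_zbar \<phi> z"
    unfolding wirtinger_zbar_def fr D_def by (simp add: field_simps)
qed

text \<open>Cauchy--Pompeiu at the point 0, applied to \<open>z * F z * \<phi> z\<close>: the
  division by \<open>z\<close> returns the integrand, and the function has value 0 at 0. This takes
  the place of Green's formula.\<close>

lemma
  assumes \<phi>: "C1_compact_disk \<phi>" and F: "F holomorphic_on disk"
  shows integrable_holomorphic_wirtinger: "integrable lborel (\<lambda>z. F z * wirtinger_zbar \<phi> z)"
    and integral_holomorphic_wirtinger: "(LINT z|lborel. F z * wirtinger_zbar \<phi> z) = 0"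
proof -
  obtain K where K: "compact K" "K \<subseteq> disk" "\<And>z. z \<notin> K \<Longrightarrow> \<phi> z = 0"
    "\<And>z. z \<notin> K \<Longrightarrow> wirtinger_zbar \<phi> z = 0"
    using \<phi> by (rule C1_compact_diskE) blast
  have [measurable]: "wirtinger_zbar \<phi> \<in> borel_measurable borel"
    by (intro borel_measurable_continuous_onI wirtinger_zbar_continuous[OF \<phi>])
  have "integrable lborel (\<lambda>z. indicator K z *\<^sub>R (F z * wirtinger_zbar \<phi> z))"
    using K by (intro borel_integrable_compact continuous_intros
         continuous_on_subset[OF holomorphic_on_imp_continuous_on[OF F]]
         continuous_on_subset[OF wirtinger_zbar_continuous[OF \<phi>]]) auto
  also have "(\<lambda>z. indicator K z *\<^sub>R (F z * wirtinger_zbar \<phi> z)) = (\<lambda>z. F z * wirtinger_zbar \<phi> z)"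
    using K by (auto simp: indicator_def fun_eq_iff)
  finally show int: "integrable lborel (\<lambda>z. F z * wirtinger_zbar \<phi> z)" .
  have F': "(\<lambda>z. z * F z) holomorphic_on disk"
    by (intro holomorphic_intros F)
  note C = C1_compact_disk_mult_holomorphic[OF \<phi> K(1-3) open_ball K(2) F']
  note W = wirtinger_zbar_mult_holomorphic[OF \<phi> K(1-3) open_ball K(2) F']
  have "(LINT z|lborel. F z * wirtinger_zbar \<phi> z)
     = (LINT z|lborel. wirtinger_zbar (\<lambda>z. z * F z * \<phi> z) z / (z - 0))"
  proof (rule integral_cong_AE)
    show "(\<lambda>z. F z * wirtinger_zbar \<phi> z) \<in> borel_measurable lborel"
      using int by auto
    show "(\<lambda>z. wirtinger_zbar (\<lambda>z. z * F z * \<phi> z) z / (z - 0)) \<in> borel_measurable lborel"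
      using Cauchy_Pompeiu_integrable[OF C, of 0] by auto
    show "AE z in lborel. F z * wirtinger_zbar \<phi> z = wirtinger_zbar (\<lambda>z. z * F z * \<phi> z) z / (z - 0)"
      using AE_lborel_singleton[of 0] by eventually_elim (simp add: W)
  qed
  also have "\<dots> = 0"
    using Cauchy_Pompeiu[OF C, of 0] by simp
  finally show "(LINT z|lborel. F z * wirtinger_zbar \<phi> z) = 0" .
qed

section \<open>Integral operators with weakly singular kernels\<close>

lemma L1_loc_disk_cong_AE:
  assumes eq: "AE z in lborel. z \<in> disk \<longrightarrow> u z = v z"
  shows "L1_loc_disk u \<longleftrightarrow> L1_loc_disk v"
proof -
  have "integrable (lebesgue_on K) u \<longleftrightarrow> integrable (lebesgue_on K) v" if K: "compact K" "K \<subseteq> disk" for K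
  proof -
    interpret complete_measure "lebesgue_on K"
      using K by (intro complete_measure_lebesgue_on) (auto intro: lmeasurable_compact fmeasurableD)
    show ?thesis
    proof (rule integrable_cong_AE_complete)
      show "AE x in lebesgue_on K. u x = v x"
      proof (subst AE_restrict_space_iff)
        show "AE x in lebesgue. x \<in> K \<longrightarrow> u x = v x"
          using AE_completion[OF eq] by eventually_elim (use K in auto)
      qed (use K in \<open>auto intro: lmeasurable_compact fmeasurableD\<close>)
    qed
  qed
  then show ?thesis unfolding L1_loc_disk_def by auto
qed

lemma L1_loc_diskD:
  assumes "L1_loc_disk u" "compact K" "K \<subseteq> disk"
  shows "integrable (lebesgue_on K) u"
  using assms unfolding L1_loc_disk_def by simp

lemma L1_loc_disk_diff:
  assumes "L1_loc_disk u" "L1_loc_disk v"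
  shows "L1_loc_disk (\<lambda>z. u z - v z)"
  unfolding L1_loc_disk_def
  by (intro allI impI Bochner_Integration.integrable_diff L1_loc_diskD[OF assms(1)] L1_loc_diskD[OF assms(2)]) auto

lemma lebesgue_on_disk_integral_cong_AE:
  fixes u v :: "complex \<Rightarrow> 'b::{banach, second_countable_topology}"
  assumes eq: "AE z in lborel. z \<in> disk \<longrightarrow> u z = v z"
  shows "(LINT z|lebesgue_on disk. u z) = (LINT z|lebesgue_on disk. v z)"
proof -
  interpret complete_measure "lebesgue_on disk"
    by (intro complete_measure_lebesgue_on) auto
  show ?thesis
    using AE_completion[OF eq] by (intro integral_cong_AE_complete) (simp add: AE_restrict_space_iff)
qed

lemma has_weak_dzbar_cong_AE:
  assumes u: "AE z in lborel. z \<in> disk \<longrightarrow> u z = u' z"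
    and g: "AE z in lborel. z \<in> disk \<longrightarrow> g z = g' z"
  shows "has_weak_dzbar u g \<longleftrightarrow> has_weak_dzbar u' g'"
proof -
  have "(LINT z|lebesgue_on disk. u z * wirtinger_zbar \<phi> z) = (LINT z|lebesgue_on disk. u' z * wirtinger_zbar \<phi> z)"
      "(LINT z|lebesgue_on disk. g z * \<phi> z) = (LINT z|lebesgue_on disk. g' z * \<phi> z)" for \<phi>
    by (rule lebesgue_on_disk_integral_cong_AE, use u in eventually_elim, auto)
       (rule lebesgue_on_disk_integral_cong_AE, use g in eventually_elim, auto)
  then show ?thesis
    unfolding has_weak_dzbar_def
    using L1_loc_disk_cong_AE[OF u] L1_loc_disk_cong_AE[OF g] by simp
qed

lemma L1_loc_diskI:
  assumes "set_integrable lborel disk u" "u \<in> borel_measurable borel"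
  shows "L1_loc_disk u"
  unfolding L1_loc_disk_def
proof (intro allI impI)
  fix K assume K: "compact K \<and> K \<subseteq> disk"
  then have "set_integrable lborel K u"
    using assms(1) by (intro set_integrable_subset[of lborel disk u K]) (auto intro: borel_compact)
  then show "integrable (lebesgue_on K) u"
    using K assms(2) by (subst lebesgue_on_integrable_iff[where F = u]) (auto intro: borel_compact)
qed

text \<open>The values of \<open>u\<close> outside the disk are arbitrary, so \<open>u\<close>
  itself may fail to be Borel; its cut-off to \<open>K\<close> serves as the representative.\<close>

lemma L1_loc_disk_continuous:
  assumes "continuous_on disk u" shows "L1_loc_disk u"
  unfolding L1_loc_disk_def
proof (intro allI impI)
  fix K assume K: "compact K \<and> K \<subseteq> disk"
  have int: "integrable lborel (\<lambda>x. indicator K x *\<^sub>R u x)"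
    using K assms by (intro borel_integrable_compact) (auto intro: continuous_on_subset)
  then have "set_integrable lborel K (\<lambda>x. indicator K x *\<^sub>R u x)"
    unfolding set_integrable_def by (rule back_subst[where P = "integrable lborel"]) (auto simp: indicator_def)
  then show "integrable (lebesgue_on K) u"
    using K borel_measurable_integrable[OF int]
    by (subst lebesgue_on_integrable_iff[where F = "\<lambda>x. indicator K x *\<^sub>R u x"]) (auto intro: borel_compact)
qed

text \<open>The disk lies in the ball of radius 2 around any of its points; hence
  \<open>4 * pi = 2 * pi * 2\<close>, uniformly in \<open>w\<close>.\<close>

lemma nn_integral_kernel_le:
  assumes "w \<in> disk"
  shows "(\<integral>\<^sup>+z. inverse (ennreal (cmod (w - z))) * indicator disk z \<partial>lborel) \<le> ennreal (4 * pi)"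
proof -
  have "(\<integral>\<^sup>+z. inverse (ennreal (cmod (w - z))) * indicator disk z \<partial>lborel)
    = (\<integral>\<^sup>+z. inverse (ennreal (cmod (w - (w + z)))) * indicator disk (w + z) \<partial>lborel)"
    by (rule nn_integral_translate) measurable
  also have "\<dots> \<le> (\<integral>\<^sup>+z. inverse (ennreal (cmod z)) * indicator (ball 0 2) z \<partial>lborel)"
  proof (intro nn_integral_mono)
    fix z
    have "cmod z < 2" if "cmod (w + z) < 1"
      using norm_triangle_ineq4[of "w + z" w] that assms by simp
    then show "inverse (ennreal (cmod (w - (w + z)))) * indicator disk (w + z) \<le> inverse (ennreal (cmod z)) * indicator (ball 0 2) z"
      by (auto simp: indicator_def)
  qed
  also have "\<dots> = ennreal (4 * pi)" by (subst nn_integral_inverse_norm) auto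
  finally show ?thesis .
qed

text \<open>By Tonelli the kernel may be integrated in \<open>z\<close> first, where the bound is
  uniform in \<open>w\<close>; the result is at most \<open>4 * pi\<close> times the L1 norm of
  \<open>g\<close>. Convergence for almost every point and on almost every circle is derived from
  this.\<close>

lemma nn_integral_double_kernel:
  fixes g :: "complex \<Rightarrow> complex"
  assumes g: "integrable lborel g" and supp: "\<And>w. w \<notin> disk \<Longrightarrow> g w = 0"
  shows "(\<integral>\<^sup>+z. \<integral>\<^sup>+w. ennreal (cmod (g w)) * (inverse (ennreal (cmod (w - z))) * indicator disk z) \<partial>lborel \<partial>lborel) < \<infinity>"
proof -
  have [measurable]: "g \<in> borel_measurable borel" using g by auto
  have "(\<integral>\<^sup>+z. \<integral>\<^sup>+w. ennreal (cmod (g w)) * (inverse (ennreal (cmod (w - z))) * indicator disk z) \<partial>lborel \<partial>lborel)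
     = (\<integral>\<^sup>+w. \<integral>\<^sup>+z. ennreal (cmod (g w)) * (inverse (ennreal (cmod (w - z))) * indicator disk z) \<partial>lborel \<partial>lborel)"
    by (rule lborel_pair.Fubini') (simp add: case_prod_beta' del: lborel_prod)
  also have "\<dots> = (\<integral>\<^sup>+w. ennreal (cmod (g w)) * (\<integral>\<^sup>+z. (inverse (ennreal (cmod (w - z))) * indicator disk z) \<partial>lborel) \<partial>lborel)"
    by (intro nn_integral_cong nn_integral_cmult) measurable
  also have "\<dots> \<le> (\<integral>\<^sup>+w. ennreal (cmod (g w)) * ennreal (4 * pi) \<partial>lborel)"
  proof (rule nn_integral_mono)
    fix w
    show "ennreal (cmod (g w)) * (\<integral>\<^sup>+z. (inverse (ennreal (cmod (w - z))) * indicator disk z) \<partial>lborel)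
       \<le> ennreal (cmod (g w)) * ennreal (4 * pi)"
      using nn_integral_kernel_le[of w] supp[of w] by (cases "w \<in> disk") (auto intro: mult_left_mono)
  qed
  also have "\<dots> = (\<integral>\<^sup>+w. ennreal (cmod (g w)) \<partial>lborel) * ennreal (4 * pi)"
    by (rule nn_integral_multc) measurable
  also have "\<dots> < \<infinity>"
    using g by (simp add: integrable_iff_bounded ennreal_mult_less_top)
  finally show ?thesis .
qed

text \<open>Collects what the Fubini arguments need of either kernel. On the diagonal the bound is
  void, because \<open>inverse (ennreal 0)\<close> is infinite; off the disk nothing is asked, since
  densities and weights vanish there.\<close>

definition singular_kernel :: "(complex \<Rightarrow> complex \<Rightarrow> complex) \<Rightarrow> bool" where
  "singular_kernel k \<longleftrightarrow> (\<lambda>p. k (fst p) (snd p)) \<in> borel_measurable (borel \<Otimes>\<^sub>M borel) \<and>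
     (\<forall>z\<in>disk. \<forall>w\<in>disk. ennreal (cmod (k z w)) \<le> inverse (ennreal (cmod (w - z))))"

definition kernel_integral :: "(complex \<Rightarrow> complex \<Rightarrow> complex) \<Rightarrow> (complex \<Rightarrow> complex) \<Rightarrow> complex \<Rightarrow> complex" where
  "kernel_integral k g z = (LINT w|lborel. g w * k z w)"

definition cauchy_kernel :: "complex \<Rightarrow> complex \<Rightarrow> complex" where
  "cauchy_kernel z w = 1 / (w - z)"

text \<open>For \<open>z \<noteq> 0\<close> this is minus the conjugate of the Cauchy kernel at the
  mirror image \<open>1 / cnj z\<close> of \<open>z\<close> in the unit circle. In contrast to the
  Cauchy kernel it has no pole in the disk.\<close>

definition reflected_kernel :: "complex \<Rightarrow> complex \<Rightarrow> complex" where
  "reflected_kernel z w = z / (1 - z * cnj w)"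

lemma cauchy_kernel_singular: "singular_kernel cauchy_kernel"
  unfolding singular_kernel_def
proof (intro conjI ballI)
  show "(\<lambda>p. cauchy_kernel (fst p) (snd p)) \<in> borel_measurable (borel \<Otimes>\<^sub>M borel)"
    unfolding cauchy_kernel_def by measurable
  show "ennreal (cmod (cauchy_kernel z w)) \<le> inverse (ennreal (cmod (w - z)))" for z w
    by (cases "w = z") (simp_all add: cauchy_kernel_def norm_divide inverse_ennreal inverse_eq_divide)
qed

lemma borel_measurable_cnj [measurable]: "cnj \<in> borel_measurable borel"
  by (intro borel_measurable_continuous_onI continuous_intros)

text \<open>The squares of \<open>cmod (1 - z * cnj w)\<close> and \<open>cmod (w - z)\<close>
  differ by \<open>(1 - (cmod z)^2) * (1 - (cmod w)^2)\<close>, which is nonnegative on the disk. As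
  the numerator is below 1 in modulus, the bound of the Cauchy kernel carries over.\<close>

lemma reflected_kernel_singular: "singular_kernel reflected_kernel"
  unfolding singular_kernel_def
proof (intro conjI ballI)
  show "(\<lambda>p. reflected_kernel (fst p) (snd p)) \<in> borel_measurable (borel \<Otimes>\<^sub>M borel)"
    unfolding reflected_kernel_def by measurable
  fix z w assume "z \<in> disk" "w \<in> disk"
  then have z: "cmod z < 1" "cmod w < 1" by auto
  show "ennreal (cmod (reflected_kernel z w)) \<le> inverse (ennreal (cmod (w - z)))"
  proof (cases "w = z")
    case False
    have "(cmod (1 - z * cnj w))\<^sup>2 - (cmod (w - z))\<^sup>2 = (1 - (cmod z)\<^sup>2) * (1 - (cmod w)\<^sup>2)"
      by (simp only: cmod_power2) (simp add: power2_eq_square algebra_simps)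
    also have "\<dots> \<ge> 0"
      using z by (intro mult_nonneg_nonneg) (auto simp: power_le_one)
    finally have "cmod (w - z) \<le> cmod (1 - z * cnj w)"
      by (simp add: power2_le_iff_abs_le[symmetric] abs_le_square_iff)
    moreover have "cmod (w - z) > 0" using False by simp
    ultimately have "cmod z / cmod (1 - z * cnj w) \<le> 1 / cmod (w - z)"
      using z by (intro frac_le) auto
    then show ?thesis
      using False by (simp add: reflected_kernel_def norm_divide inverse_ennreal inverse_eq_divide ennreal_leI)
  qed auto
qed

text \<open>The absolute convergence behind the pairings over the disk. The weight \<open>m\<close>
  will be the indicator of a disk, for integrability and mean values of potentials, or a Wirtinger
  derivative, for weak derivatives.\<close>

lemma kernel_product_integrable:
  assumes g: "integrable lborel g" "\<And>w. w \<notin> disk \<Longrightarrow> g w = 0" and k: "singular_kernel k"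
    and m: "m \<in> borel_measurable borel" "\<And>z. cmod (m z) \<le> M * indicator disk z"
  shows "integrable (lborel \<Otimes>\<^sub>M lborel) (\<lambda>(z, w). m z * (g w * k z w))"
proof (rule integrableI_bounded)
  have [measurable]: "g \<in> borel_measurable borel" "m \<in> borel_measurable borel"
      "(\<lambda>p. k (fst p) (snd p)) \<in> borel_measurable (borel \<Otimes>\<^sub>M borel)"
    using g m k by (auto simp: singular_kernel_def)
  have M: "M \<ge> 0"
    using order_trans[OF norm_ge_zero m(2)[of 0]] by simp
  show "(\<lambda>(z, w). m z * (g w * k z w)) \<in> borel_measurable (lborel \<Otimes>\<^sub>M lborel)"
    by (simp add: case_prod_beta' del: lborel_prod)
  have "(\<integral>\<^sup>+p. ennreal (norm (case p of (z, w) \<Rightarrow> m z * (g w * k z w))) \<partial>(lborel \<Otimes>\<^sub>M lborel))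
     = (\<integral>\<^sup>+z. \<integral>\<^sup>+w. ennreal (norm (m z * (g w * k z w))) \<partial>lborel \<partial>lborel)"
    by (subst lborel.nn_integral_fst[symmetric]) (simp_all add: case_prod_beta' del: lborel_prod)
  also have "\<dots> \<le> (\<integral>\<^sup>+z. \<integral>\<^sup>+w. ennreal M * (ennreal (cmod (g w)) * (inverse (ennreal (cmod (w - z))) * indicator disk z)) \<partial>lborel \<partial>lborel)"
  proof (intro nn_integral_mono)
    fix z w :: complex
    show "ennreal (norm (m z * (g w * k z w))) \<le> ennreal M * (ennreal (cmod (g w)) * (inverse (ennreal (cmod (w - z))) * indicator disk z))"
    proof (cases "z \<in> disk \<and> w \<in> disk")
      case True
      then have "ennreal (cmod (k z w)) \<le> inverse (ennreal (cmod (w - z)))"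
        using k by (auto simp: singular_kernel_def)
      moreover have "ennreal (cmod (m z)) \<le> ennreal M" using m(2)[of z] True by (auto intro: ennreal_leI)
      ultimately show ?thesis using True
        by (auto simp: norm_mult ennreal_mult intro!: mult_mono)
    next
      case False
      then show ?thesis using m(2)[of z] g(2)[of w] by auto
    qed
  qed
  also have "\<dots> = ennreal M * (\<integral>\<^sup>+z. \<integral>\<^sup>+w. (ennreal (cmod (g w)) * (inverse (ennreal (cmod (w - z))) * indicator disk z)) \<partial>lborel \<partial>lborel)"
    by (simp add: nn_integral_cmult)
  also have "\<dots> < \<infinity>"
    using nn_integral_double_kernel[OF g] by (simp add: ennreal_mult_less_top)
  finally show "(\<integral>\<^sup>+p. ennreal (norm (case p of (z, w) \<Rightarrow> m z * (g w * k z w))) \<partial>(lborel \<Otimes>\<^sub>M lborel)) < \<infinity>" .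
qed

lemma
  assumes g: "integrable lborel g" "\<And>w. w \<notin> disk \<Longrightarrow> g w = 0" and k: "singular_kernel k"
  shows kernel_integrable_AE: "AE z in lborel. z \<in> disk \<longrightarrow> integrable lborel (\<lambda>w. g w * k z w)"
    and kernel_integral_integrable: "set_integrable lborel disk (kernel_integral k g)"
    and kernel_integral_measurable: "kernel_integral k g \<in> borel_measurable borel"
proof -
  have [measurable]: "g \<in> borel_measurable borel"
      "(\<lambda>p. k (fst p) (snd p)) \<in> borel_measurable (borel \<Otimes>\<^sub>M borel)"
    using g k by (auto simp: singular_kernel_def)
  have int: "integrable (lborel \<Otimes>\<^sub>M lborel) (\<lambda>(z, w). indicator disk z * (g w * k z w))"
    by (rule kernel_product_integrable[OF g k, where M = 1]) (auto simp: indicator_def)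
  show "AE z in lborel. z \<in> disk \<longrightarrow> integrable lborel (\<lambda>w. g w * k z w)"
    using lborel_pair.AE_integrable_fst'[OF int] by eventually_elim auto
  have "(\<lambda>z. LINT w|lborel. (case (z, w) of (z, w) \<Rightarrow> indicator disk z * (g w * k z w)))
      = (\<lambda>z. indicator disk z *\<^sub>R kernel_integral k g z)"
    by (auto simp: kernel_integral_def fun_eq_iff indicator_def)
  then show "set_integrable lborel disk (kernel_integral k g)"
    using lborel_pair.integrable_fst'[OF int] by (simp add: set_integrable_def)
  show "kernel_integral k g \<in> borel_measurable borel"
    unfolding kernel_integral_def[abs_def] by measurable
qed

lemma kernel_integral_pairing:
  assumes g: "integrable lborel g" "\<And>w. w \<notin> disk \<Longrightarrow> g w = 0" and k: "singular_kernel k"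
    and m: "m \<in> borel_measurable borel" "\<And>z. cmod (m z) \<le> M * indicator disk z"
  shows "integrable lborel (\<lambda>z. kernel_integral k g z * m z)"
    and "(LINT z|lborel. kernel_integral k g z * m z) = (LINT w|lborel. g w * (LINT z|lborel. m z * k z w))"
proof -
  note int = kernel_product_integrable[OF g k m]
  have eq: "(\<lambda>z. LINT w|lborel. (case (z, w) of (z, w) \<Rightarrow> m z * (g w * k z w))) = (\<lambda>z. kernel_integral k g z * m z)"
    by (simp add: kernel_integral_def mult.commute)
  show "integrable lborel (\<lambda>z. kernel_integral k g z * m z)"
    using lborel_pair.integrable_fst'[OF int] unfolding eq .
  have "(LINT z|lborel. kernel_integral k g z * m z) = (LINT z|lborel. LINT w|lborel. m z * (g w * k z w))"
    by (simp add: kernel_integral_def mult.commute)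
  also have "\<dots> = (LINT w|lborel. LINT z|lborel. m z * (g w * k z w))"
    by (rule lborel_pair.Fubini_integral[OF int, symmetric])
  also have "\<dots> = (LINT w|lborel. g w * (LINT z|lborel. m z * k z w))"
    by (intro Bochner_Integration.integral_cong refl, subst integral_mult_right_zero[symmetric])
       (simp add: mult.left_commute)
  finally show "(LINT z|lborel. kernel_integral k g z * m z) = (LINT w|lborel. g w * (LINT z|lborel. m z * k z w))" .
qed

text \<open>Fubini moves the pairing with \<open>wirtinger_zbar \<phi>\<close> onto the kernels.
  Cauchy--Pompeiu turns the Cauchy part into \<open>pi\<close> times the integral of
  \<open>g * \<phi>\<close>, which dictates the factor \<open>- 1 / pi\<close>; \<open>H\<close> and
  the reflected kernel are holomorphic in \<open>z\<close> and pair to 0.\<close>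

lemma has_weak_dzbar_kernel_integrals:
  assumes g: "integrable lborel g" "\<And>w. w \<notin> disk \<Longrightarrow> g w = 0" and H: "H holomorphic_on disk"
  shows "has_weak_dzbar (\<lambda>z. H z - (kernel_integral cauchy_kernel g z
            + kernel_integral reflected_kernel (\<lambda>w. cnj (g w)) z) / pi) g"
    (is "has_weak_dzbar ?u g")
  unfolding has_weak_dzbar_def
proof (intro conjI allI impI)
  have g': "integrable lborel (\<lambda>w. cnj (g w))" "\<And>w. w \<notin> disk \<Longrightarrow> cnj (g w) = 0"
    using g by auto
  let ?C = "kernel_integral cauchy_kernel g"
  let ?E = "kernel_integral reflected_kernel (\<lambda>w. cnj (g w))"
  note C = kernel_integral_integrable[OF g cauchy_kernel_singular] kernel_integral_measurable[OF g cauchy_kernel_singular]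
  note E = kernel_integral_integrable[OF g' reflected_kernel_singular] kernel_integral_measurable[OF g' reflected_kernel_singular]
  show "L1_loc_disk ?u"
  proof -
    have 1: "L1_loc_disk (\<lambda>z. (?C z + ?E z) / pi)"
      using C E by (intro L1_loc_diskI) (auto intro!: set_integral_add simp: divide_inverse)
    have 2: "L1_loc_disk H" using H by (intro L1_loc_disk_continuous holomorphic_on_imp_continuous_on)
    show ?thesis using 1 2 unfolding L1_loc_disk_def by (auto intro: Bochner_Integration.integrable_diff)
  qed
  show "L1_loc_disk g"
  proof (rule L1_loc_diskI)
    show "set_integrable lborel disk g" unfolding set_integrable_def
      by (rule back_subst[where P = "integrable lborel", OF g(1)]) (use g(2) in \<open>auto simp: indicator_def fun_eq_iff\<close>)
  qed (use g in auto)
  fix \<phi> assume \<phi>: "C1_compact_disk \<phi>"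
  obtain M where M: "M \<ge> 0" "\<And>z. cmod (wirtinger_zbar \<phi> z) \<le> M * indicator disk z"
    using \<phi> by (rule C1_compact_disk_bounded) blast
  obtain K where K: "compact K" "K \<subseteq> disk" "\<And>z. z \<notin> K \<Longrightarrow> \<phi> z = 0" "\<And>z. z \<notin> K \<Longrightarrow> wirtinger_zbar \<phi> z = 0"
    using \<phi> by (rule C1_compact_diskE) blast
  have out: "\<phi> z = 0" "wirtinger_zbar \<phi> z = 0" if "z \<notin> disk" for z
    using K(2-4) that by blast+
  have [measurable]: "wirtinger_zbar \<phi> \<in> borel_measurable borel"
    by (intro borel_measurable_continuous_onI wirtinger_zbar_continuous[OF \<phi>])
  have [measurable]: "\<phi> \<in> borel_measurable borel"
    using \<phi> unfolding C1_compact_disk_def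
    by (meson borel_measurable_continuous_onI continuous_at_imp_continuous_on differentiable_imp_continuous_within)
  have [measurable]: "g \<in> borel_measurable borel" using g by auto
  note H' = integrable_holomorphic_wirtinger[OF \<phi> H] integral_holomorphic_wirtinger[OF \<phi> H]
  note C' = kernel_integral_pairing[OF g cauchy_kernel_singular _ M(2)]
  note E' = kernel_integral_pairing[OF g' reflected_kernel_singular _ M(2)]
  have Cv: "(LINT z|lborel. ?C z * wirtinger_zbar \<phi> z) = pi * (LINT w|lborel. g w * \<phi> w)"
  proof -
    have "(LINT z|lborel. wirtinger_zbar \<phi> z * cauchy_kernel z w) = pi * \<phi> w" for w
    proof -
      have "(LINT z|lborel. wirtinger_zbar \<phi> z * cauchy_kernel z w) = (LINT z|lborel. - (wirtinger_zbar \<phi> z / (z - w)))"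
        by (intro Bochner_Integration.integral_cong refl)
           (simp add: cauchy_kernel_def minus_divide_right)
      then show ?thesis by (simp add: Cauchy_Pompeiu[OF \<phi>])
    qed
    then show ?thesis
      by (subst C') (auto simp: mult.left_commute[of _ "of_real pi"])
  qed
  have Ev: "(LINT z|lborel. ?E z * wirtinger_zbar \<phi> z) = 0"
  proof -
    have "cnj (g w) * (LINT z|lborel. wirtinger_zbar \<phi> z * reflected_kernel z w) = 0" for w
    proof (cases "w \<in> disk")
      case True
      have nz: "1 - z * cnj w \<noteq> 0" if "z \<in> disk" for z
      proof -
        have "cmod (z * cnj w) < 1" using that True by (simp add: norm_mult) (metis mult_strict_mono' mult_1 norm_ge_zero)
        then show ?thesis by auto
      qed
      have "(\<lambda>z. reflected_kernel z w) holomorphic_on disk"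
        unfolding reflected_kernel_def using nz by (intro holomorphic_intros) auto
      from integral_holomorphic_wirtinger[OF \<phi> this] show ?thesis by (simp add: mult.commute)
    qed (use g in auto)
    then have "(\<lambda>w. cnj (g w) * (LINT z|lborel. wirtinger_zbar \<phi> z * reflected_kernel z w)) = (\<lambda>w. 0)"
      by (rule ext)
    then show ?thesis by (subst E') simp_all
  qed
  have "(LINT z|lebesgue_on disk. ?u z * wirtinger_zbar \<phi> z)
      = (LINT z:disk|lborel. H z * wirtinger_zbar \<phi> z - (?C z + ?E z) / pi * wirtinger_zbar \<phi> z)"
    using H'(1) C(2) E(2)
    by (intro lebesgue_on_integral_eq) (auto simp: left_diff_distrib intro!: borel_measurable_diff dest: borel_measurable_integrable)
  also have "\<dots> = (LINT z|lborel. H z * wirtinger_zbar \<phi> z - (?C z * wirtinger_zbar \<phi> z + ?E z * wirtinger_zbar \<phi> z) / pi)"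
    unfolding set_lebesgue_integral_def
    using out by (intro Bochner_Integration.integral_cong refl) (simp add: indicator_def field_simps)
  also have "\<dots> = - (LINT w|lborel. g w * \<phi> w)"
    using H' C'(1) E'(1) Cv Ev by simp
  also have "(LINT w|lborel. g w * \<phi> w) = (LINT w:disk|lborel. g w * \<phi> w)"
    unfolding set_lebesgue_integral_def
    using out by (intro Bochner_Integration.integral_cong refl) (simp add: indicator_def)
  also have "\<dots> = (LINT w|lebesgue_on disk. g w * \<phi> w)"
    by (rule lebesgue_on_integral_eq[symmetric]) auto
  finally show "(LINT z|lebesgue_on disk. ?u z * wirtinger_zbar \<phi> z) = - (LINT z|lebesgue_on disk. g z * \<phi> z)" .
qed

text \<open>By partial fractions, the only part of the kernel that may fail to be integrable in \<open>w\<close> for almost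
  every \<open>z\<close> does not depend on \<open>z\<close>.\<close>

lemma T_kernel_eq:
  assumes "w \<noteq> 0" "w \<noteq> z" "1 - z * cnj w \<noteq> 0"
  shows "T_kernel g z w = - 2 * \<i> * Im (g w / w) + 2 * (g w * cauchy_kernel z w)
     + 2 * (cnj (g w) * reflected_kernel z w)"
proof -
  have 1: "(w + z) / (w - z) / w = - 1 / w + 2 / (w - z)"
    using assms by (simp add: field_simps)
  have 2: "(1 + z * cnj w) / (1 - z * cnj w) / cnj w = 1 / cnj w + 2 * (z / (1 - z * cnj w))"
    using assms by (simp add: field_simps)
  have 3: "- 2 * \<i> * Im x = cnj x - x" for x
    by (simp add: complex_eq_iff)
  have "T_kernel g z w = g w * ((w + z) / (w - z) / w) + cnj (g w) * ((1 + z * cnj w) / (1 - z * cnj w) / cnj w)"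
    by (simp add: T_kernel_def mult.commute)
  also have "\<dots> = (cnj (g w / w) - g w / w) + 2 * (g w * cauchy_kernel z w) + 2 * (cnj (g w) * reflected_kernel z w)"
    unfolding 1 2 cauchy_kernel_def reflected_kernel_def by (simp add: algebra_simps)
  finally show ?thesis unfolding 3 .
qed

text \<open>The two singular kernels are integrable in \<open>w\<close> for almost every
  \<open>z\<close>, and the disk is not a null set, so at some \<open>z\<close> the full kernel is
  integrable along with them. There \<open>Im (g w / w)\<close> is a combination of integrable
  functions, and as it is independent of \<open>z\<close>, one such point is enough.\<close>

lemma
  assumes g: "integrable lborel g" "\<And>w. w \<notin> disk \<Longrightarrow> g w = 0"
    and T: "AE z in lborel. z \<in> disk \<longrightarrow> integrable lborel (T_kernel g z)"
  shows T_kernel_integrable_imp: "integrable lborel (\<lambda>w. Im (g w / w))"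
    and integral_T_kernel: "AE z in lborel. z \<in> disk \<longrightarrow>
      (LINT w|lborel. T_kernel g z w) = - 2 * \<i> * (LINT w|lborel. Im (g w / w))
        + 2 * kernel_integral cauchy_kernel g z + 2 * kernel_integral reflected_kernel (\<lambda>w. cnj (g w)) z"
proof -
  have g': "integrable lborel (\<lambda>w. cnj (g w))" "\<And>w. w \<notin> disk \<Longrightarrow> cnj (g w) = 0"
    using g by auto
  have [measurable]: "g \<in> borel_measurable borel" using g by auto
  have eq: "AE w in lborel. T_kernel g z w = - 2 * \<i> * Im (g w / w) + 2 * (g w * cauchy_kernel z w)
     + 2 * (cnj (g w) * reflected_kernel z w)" if "z \<in> disk" for z
    using AE_lborel_singleton[of 0] AE_lborel_singleton[of z]
  proof eventually_elim
    case (elim w)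
    show ?case
    proof (cases "w \<in> disk")
      case True
      have "cmod (z * cnj w) < 1" using that True by (simp add: norm_mult) (metis mult_strict_mono' mult_1 norm_ge_zero)
      then have "1 - z * cnj w \<noteq> 0" by auto
      then show ?thesis using elim by (intro T_kernel_eq)
    next
      case False
      then show ?thesis using g(2) by (simp add: T_kernel_def)
    qed
  qed
  have Ci: "AE z in lborel. z \<in> disk \<longrightarrow> integrable lborel (\<lambda>w. g w * cauchy_kernel z w)"
    by (rule kernel_integrable_AE[OF g cauchy_kernel_singular])
  have Ei: "AE z in lborel. z \<in> disk \<longrightarrow> integrable lborel (\<lambda>w. cnj (g w) * reflected_kernel z w)"
    by (rule kernel_integrable_AE[OF g' reflected_kernel_singular])
  have good: "AE z in lborel. z \<in> disk \<longrightarrow> integrable lborel (T_kernel g z)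
     \<and> integrable lborel (\<lambda>w. g w * cauchy_kernel z w) \<and> integrable lborel (\<lambda>w. cnj (g w) * reflected_kernel z w)"
    using T Ci Ei by eventually_elim auto
  have "\<exists>z\<in>disk. integrable lborel (T_kernel g z)
     \<and> integrable lborel (\<lambda>w. g w * cauchy_kernel z w) \<and> integrable lborel (\<lambda>w. cnj (g w) * reflected_kernel z w)"
  proof (rule ccontr)
    assume neg: "\<not> ?thesis"
    have "AE z in lborel. z \<notin> disk"
      using good by eventually_elim (use neg in auto)
    then have "disk \<in> null_sets lborel"
      by (subst AE_iff_null_sets) auto
    then show False
      by (metis ball_eq_empty null_sets_completionI open_ball negligible_iff_null_sets open_not_negligible not_one_le_zero)
  qed
  then obtain z where z: "z \<in> disk" "integrable lborel (T_kernel g z)"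
     "integrable lborel (\<lambda>w. g w * cauchy_kernel z w)" "integrable lborel (\<lambda>w. cnj (g w) * reflected_kernel z w)"
    by blast
  have "integrable lborel (\<lambda>w. T_kernel g z w - 2 * (g w * cauchy_kernel z w) - 2 * (cnj (g w) * reflected_kernel z w))"
    using z by simp
  also have "?this \<longleftrightarrow> integrable lborel (\<lambda>w. - 2 * \<i> * Im (g w / w))"
  proof (rule integrable_cong_AE)
    show "AE w in lborel. T_kernel g z w - 2 * (g w * cauchy_kernel z w) - 2 * (cnj (g w) * reflected_kernel z w) = - 2 * \<i> * Im (g w / w)"
      using eq[OF z(1)] by eventually_elim simp
    show "(\<lambda>w. - 2 * \<i> * Im (g w / w)) \<in> borel_measurable lborel" by measurable
  qed (use z in auto)
  finally have "integrable lborel (\<lambda>w. \<i> / 2 * (- 2 * \<i> * Im (g w / w)))"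
    by (rule integrable_mult_right)
  then have "integrable lborel (\<lambda>w. complex_of_real (Im (g w / w)))"
    by simp
  then show im: "integrable lborel (\<lambda>w. Im (g w / w))"
    by (simp only: complex_of_real_integrable_eq)
  show "AE z in lborel. z \<in> disk \<longrightarrow>
      (LINT w|lborel. T_kernel g z w) = - 2 * \<i> * (LINT w|lborel. Im (g w / w))
        + 2 * kernel_integral cauchy_kernel g z + 2 * kernel_integral reflected_kernel (\<lambda>w. cnj (g w)) z"
    using good
  proof (eventually_elim, intro impI)
    fix z assume "z \<in> disk" "z \<in> disk \<longrightarrow> integrable lborel (T_kernel g z)
     \<and> integrable lborel (\<lambda>w. g w * cauchy_kernel z w) \<and> integrable lborel (\<lambda>w. cnj (g w) * reflected_kernel z w)"
    then have z: "z \<in> disk" "integrable lborel (T_kernel g z)"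
     "integrable lborel (\<lambda>w. g w * cauchy_kernel z w)" "integrable lborel (\<lambda>w. cnj (g w) * reflected_kernel z w)"
      by auto
    have im': "integrable lborel (\<lambda>w. complex_of_real (Im (g w / w)))"
      using im by (rule integrable_of_real)
    have "(LINT w|lborel. T_kernel g z w) = (LINT w|lborel. - 2 * \<i> * Im (g w / w) + 2 * (g w * cauchy_kernel z w)
     + 2 * (cnj (g w) * reflected_kernel z w))"
      using z im' by (intro integral_cong_AE eq[OF z(1)]) (auto dest: borel_measurable_integrable)
    also have "\<dots> = (LINT w|lborel. - 2 * \<i> * Im (g w / w)) + (LINT w|lborel. 2 * (g w * cauchy_kernel z w))
      + (LINT w|lborel. 2 * (cnj (g w) * reflected_kernel z w))"
      using z im' by simp
    finally show "(LINT w|lborel. T_kernel g z w) = - 2 * \<i> * (LINT w|lborel. Im (g w / w))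
        + 2 * kernel_integral cauchy_kernel g z + 2 * kernel_integral reflected_kernel (\<lambda>w. cnj (g w)) z"
      by (simp add: kernel_integral_def)
  qed
qed

section \<open>Boundary behaviour of the kernel integrals\<close>

text \<open>The double integral of \<open>g\<close> against the dominating kernel is finite. In
  polar coordinates almost every circle inherits a finite integral, so Fubini becomes available on
  the product of the circle and the plane.\<close>

lemma kernel_circle_integrable:
  fixes g :: "complex \<Rightarrow> complex"
  assumes g: "integrable lborel g" "\<And>w. w \<notin> disk \<Longrightarrow> g w = 0" and k: "singular_kernel k"
  shows "AE r in lborel. 0 < r \<and> r < 1 \<longrightarrow>
    integrable (lborel \<Otimes>\<^sub>M lborel) (\<lambda>(t, w). indicator {0..2*pi} t *\<^sub>R (g w * k (rcis r t) w))"
proof -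
  have [measurable]: "g \<in> borel_measurable borel"
      "(\<lambda>p. k (fst p) (snd p)) \<in> borel_measurable (borel \<Otimes>\<^sub>M borel)"
    using g k by (auto simp: singular_kernel_def)
  define N where "N z = (\<integral>\<^sup>+w. ennreal (cmod (g w)) * (inverse (ennreal (cmod (w - z))) * indicator disk z) \<partial>lborel)" for z
  have [measurable]: "N \<in> borel_measurable borel" unfolding N_def[abs_def] by measurable
  have "(\<integral>\<^sup>+z. N z \<partial>lborel) < \<infinity>" using nn_integral_double_kernel[OF g] by (simp add: N_def)
  then have "AE r in lborel. ennreal r * indicator {0<..} r * (\<integral>\<^sup>+t. N (rcis r t) * indicator {0..2*pi} t \<partial>lborel) \<noteq> \<infinity>"
    by (subst (asm) nn_integral_polar', measurable, intro nn_integral_PInf_AE) auto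
  then show ?thesis
  proof (eventually_elim, intro impI)
    fix r :: real
    assume r: "0 < r \<and> r < 1"
      and fin: "ennreal r * indicator {0<..} r * (\<integral>\<^sup>+t. N (rcis r t) * indicator {0..2*pi} t \<partial>lborel) \<noteq> \<infinity>"
    have [measurable]: "(\<lambda>p. k (rcis r (fst p)) (snd p)) \<in> borel_measurable (borel \<Otimes>\<^sub>M borel)"
      by (rule measurable_compose[where f = "\<lambda>p. (rcis r (fst p), snd p)" and g = "\<lambda>p. k (fst p) (snd p)", simplified]) measurable
    show "integrable (lborel \<Otimes>\<^sub>M lborel) (\<lambda>(t, w). indicator {0..2*pi} t *\<^sub>R (g w * k (rcis r t) w))"
    proof (rule integrableI_bounded)
      show "(\<lambda>(t, w). indicator {0..2*pi} t *\<^sub>R (g w * k (rcis r t) w)) \<in> borel_measurable (lborel \<Otimes>\<^sub>M lborel)"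
        by (simp add: case_prod_beta' del: lborel_prod)
      have "(\<integral>\<^sup>+p. ennreal (norm (case p of (t, w) \<Rightarrow> indicator {0..2*pi} t *\<^sub>R (g w * k (rcis r t) w))) \<partial>(lborel \<Otimes>\<^sub>M lborel))
         = (\<integral>\<^sup>+t. \<integral>\<^sup>+w. ennreal (norm (indicator {0..2*pi} t *\<^sub>R (g w * k (rcis r t) w))) \<partial>lborel \<partial>lborel)"
        by (subst lborel.nn_integral_fst[symmetric]) (simp_all add: case_prod_beta' del: lborel_prod)
      also have "\<dots> \<le> (\<integral>\<^sup>+t. N (rcis r t) * indicator {0..2*pi} t \<partial>lborel)"
      proof (rule nn_integral_mono)
        fix t
        have "(\<integral>\<^sup>+w. ennreal (norm (g w * k (rcis r t) w)) \<partial>lborel) \<le> N (rcis r t)"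
          unfolding N_def
        proof (rule nn_integral_mono)
          fix w
          have "rcis r t \<in> disk" using r by simp
          then show "ennreal (norm (g w * k (rcis r t) w))
            \<le> ennreal (cmod (g w)) * (inverse (ennreal (cmod (w - rcis r t))) * indicator disk (rcis r t))"
            using k g(2)[of w] unfolding singular_kernel_def
            by (cases "w \<in> disk") (auto simp: norm_mult ennreal_mult intro!: mult_left_mono)
        qed
        then show "(\<integral>\<^sup>+w. ennreal (norm (indicator {0..2*pi} t *\<^sub>R (g w * k (rcis r t) w))) \<partial>lborel) \<le> N (rcis r t) * indicator {0..2*pi} t"
          by (auto simp: indicator_def)
      qed
      also have "\<dots> < \<infinity>"
        using fin r by (auto simp: ennreal_mult_eq_top_iff less_top)
      finally show "(\<integral>\<^sup>+p. ennreal (norm (case p of (t, w) \<Rightarrow> indicator {0..2*pi} t *\<^sub>R (g w * k (rcis r t) w))) \<partial>(lborel \<Otimes>\<^sub>M lborel)) < \<infinity>" .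
    qed
  qed
qed

text \<open>\<open>\<phi>\<close> is bounded on the interval of angles, so the integrand with the
  factor \<open>\<phi> t\<close> is dominated by a multiple of the one without it.\<close>

lemma kernel_circle_pairing:
  fixes g :: "complex \<Rightarrow> complex"
  assumes int: "integrable (lborel \<Otimes>\<^sub>M lborel) (\<lambda>(t, w). indicator {0..2*pi} t *\<^sub>R (g w * k (rcis r t) w))"
    and \<phi>: "continuous_on UNIV (\<phi> :: real \<Rightarrow> real)"
  shows "set_integrable lborel {0..2*pi} (\<lambda>t. kernel_integral k g (rcis r t) * \<phi> t)"
    and "(LINT t:{0..2*pi}|lborel. kernel_integral k g (rcis r t) * \<phi> t)
      = (LINT w|lborel. g w * (LINT t:{0..2*pi}|lborel. \<phi> t * k (rcis r t) w))"
proof -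
  have "compact (\<phi> ` {0..2*pi})"
    using \<phi> by (intro compact_continuous_image) (auto intro: continuous_on_subset)
  then obtain M where M: "M > 0" "\<forall>x\<in>\<phi> ` {0..2*pi}. norm x \<le> M"
    using compact_imp_bounded bounded_pos by blast
  have [measurable]: "\<phi> \<in> borel_measurable borel" using \<phi> by (rule borel_measurable_continuous_onI)
  have [measurable]: "(\<lambda>p. case p of (t, w) \<Rightarrow> indicator {0..2*pi} t *\<^sub>R (g w * k (rcis r t) w)) \<in> borel_measurable (lborel \<Otimes>\<^sub>M lborel)"
    using int by auto
  have int': "integrable (lborel \<Otimes>\<^sub>M lborel) (\<lambda>(t, w). indicator {0..2*pi} t *\<^sub>R (g w * k (rcis r t) w) * \<phi> t)"
  proof (rule Bochner_Integration.integrable_bound)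
    show "integrable (lborel \<Otimes>\<^sub>M lborel) (\<lambda>p. M *\<^sub>R (case p of (t, w) \<Rightarrow> indicator {0..2*pi} t *\<^sub>R (g w * k (rcis r t) w)))"
      using int by (rule integrable_scaleR_right)
    have "(\<lambda>p. (case p of (t, w) \<Rightarrow> indicator {0..2*pi} t *\<^sub>R (g w * k (rcis r t) w)) * \<phi> (fst p)) \<in> borel_measurable (lborel \<Otimes>\<^sub>M lborel)"
      by measurable
    then show "(\<lambda>(t, w). indicator {0..2*pi} t *\<^sub>R (g w * k (rcis r t) w) * \<phi> t) \<in> borel_measurable (lborel \<Otimes>\<^sub>M lborel)"
      by (simp add: case_prod_beta' del: lborel_prod)
    show "AE x in lborel \<Otimes>\<^sub>M lborel.
       norm (case x of (t, w) \<Rightarrow> indicator {0..2*pi} t *\<^sub>R (g w * k (rcis r t) w) * \<phi> t)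
       \<le> norm (M *\<^sub>R (case x of (t, w) \<Rightarrow> indicator {0..2*pi} t *\<^sub>R (g w * k (rcis r t) w)))"
    proof (rule AE_I2)
      fix x :: "real \<times> complex"
      obtain t w where x: "x = (t, w)" by (cases x)
      show "norm (case x of (t, w) \<Rightarrow> indicator {0..2*pi} t *\<^sub>R (g w * k (rcis r t) w) * \<phi> t)
       \<le> norm (M *\<^sub>R (case x of (t, w) \<Rightarrow> indicator {0..2*pi} t *\<^sub>R (g w * k (rcis r t) w)))"
      proof (cases "t \<in> {0..2*pi}")
        case True
        then have "\<bar>\<phi> t\<bar> \<le> M" using M by auto
        then show ?thesis
          using True M by (simp add: x norm_mult mult.commute[of _ "\<bar>\<phi> t\<bar>"] mult_right_mono)
      qed (simp add: x)
    qed
  qed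
  have inner: "(LINT w|lborel. indicator {0..2*pi} t *\<^sub>R (g w * k (rcis r t) w) * \<phi> t)
      = indicator {0..2*pi} t *\<^sub>R (kernel_integral k g (rcis r t) * \<phi> t)" for t
    by (simp add: kernel_integral_def)
  show "set_integrable lborel {0..2*pi} (\<lambda>t. kernel_integral k g (rcis r t) * \<phi> t)"
    using lborel_pair.integrable_fst'[OF int'] unfolding set_integrable_def prod.case inner .
  have "(LINT t:{0..2*pi}|lborel. kernel_integral k g (rcis r t) * \<phi> t)
     = (LINT t|lborel. LINT w|lborel. indicator {0..2*pi} t *\<^sub>R (g w * k (rcis r t) w) * \<phi> t)"
    unfolding inner set_lebesgue_integral_def ..
  also have "\<dots> = (LINT w|lborel. LINT t|lborel. indicator {0..2*pi} t *\<^sub>R (g w * k (rcis r t) w) * \<phi> t)"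
    by (rule lborel_pair.Fubini_integral[OF int', symmetric])
  also have "\<dots> = (LINT w|lborel. g w * (LINT t:{0..2*pi}|lborel. \<phi> t * k (rcis r t) w))"
    unfolding set_lebesgue_integral_def
    by (intro Bochner_Integration.integral_cong refl, subst integral_mult_right_zero[symmetric],
        intro Bochner_Integration.integral_cong refl) (simp add: scaleR_conv_of_real)
  finally show "(LINT t:{0..2*pi}|lborel. kernel_integral k g (rcis r t) * \<phi> t)
      = (LINT w|lborel. g w * (LINT t:{0..2*pi}|lborel. \<phi> t * k (rcis r t) w))" .
qed

lemma set_integral_cnj:
  fixes f :: "'a \<Rightarrow> complex"
  shows "(LINT t:S|M. cnj (f t)) = cnj (LINT t:S|M. f t)"
proof -
  have "(LINT t:S|M. cnj (f t)) = (LINT t|M. cnj (indicator S t *\<^sub>R f t))"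
    by (simp add: set_lebesgue_integral_def)
  also have "\<dots> = cnj (LINT t:S|M. f t)"
    by (simp add: set_lebesgue_integral_def del: complex_cnj_scaleR)
  finally show ?thesis .
qed

text \<open>For \<open>w\<close> outside, the kernel is holomorphic in \<open>z\<close> and its mean
  is its value \<open>1 / w\<close> at 0. For \<open>w\<close> inside, the relation
  \<open>cnj z = r^2 / z\<close> on the circle turns the kernel into the conjugate of
  \<open>z / (cnj w * z - r^2)\<close>, which is holomorphic inside and vanishes at 0.\<close>

lemma cauchy_kernel_circle_mean:
  fixes w :: complex
  assumes r: "r > 0" and w: "cmod w \<noteq> r"
  shows "(LINT t:{0..2*pi}|lborel. cauchy_kernel (rcis r t) w) = (if cmod w > r then 2 * pi / w else 0)"
proof (cases "cmod w > r")
  case True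
  have nz: "w - z \<noteq> 0" if "z \<in> cball 0 r" for z
    using that True by auto
  have "(LINT t:{0..2*pi}|lborel. (\<lambda>z. 1 / (w - z)) (rcis r t)) = 2 * pi * (1 / (w - 0))"
    by (rule integral_circle_mean) (use r nz in \<open>auto intro!: continuous_intros holomorphic_intros\<close>)
  then show ?thesis using True by (simp add: cauchy_kernel_def)
next
  case False
  then have wr: "cmod w < r" using w by simp
  have nz: "cnj w * z - of_real (r\<^sup>2) \<noteq> 0" if "z \<in> cball 0 r" for z
  proof
    assume "cnj w * z - of_real (r\<^sup>2) = 0"
    then have "cmod (cnj w * z) = r\<^sup>2" by (simp add: norm_power)
    moreover have "cmod w * cmod z \<le> cmod w * r"
      using that by (intro mult_left_mono) auto
    moreover have "cmod w * r < r * r"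
      using wr r by simp
    ultimately show False by (simp add: norm_mult power2_eq_square)
  qed
  have "cauchy_kernel (rcis r t) w = cnj (rcis r t / (cnj w * rcis r t - of_real (r\<^sup>2)))" for t
  proof -
    have 1: "rcis r t * cnj (rcis r t) = of_real (r\<^sup>2)"
      using complex_norm_square[of "rcis r t"] by simp
    have 2: "rcis r t \<noteq> 0" using r by simp
    have "cnj (rcis r t / (cnj w * rcis r t - of_real (r\<^sup>2))) = cnj (rcis r t) / (w * cnj (rcis r t) - rcis r t * cnj (rcis r t))"
      by (simp add: 1)
    also have "\<dots> = cnj (rcis r t) / ((w - rcis r t) * cnj (rcis r t))"
      by (simp add: algebra_simps)
    also have "\<dots> = 1 / (w - rcis r t)" using 2 by simp
    finally show ?thesis by (simp add: cauchy_kernel_def)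
  qed
  then have "(LINT t:{0..2*pi}|lborel. cauchy_kernel (rcis r t) w)
      = cnj (LINT t:{0..2*pi}|lborel. rcis r t / (cnj w * rcis r t - of_real (r\<^sup>2)))"
    by (simp only: set_integral_cnj)
  moreover have "(LINT t:{0..2*pi}|lborel. (\<lambda>z. z / (cnj w * z - of_real (r\<^sup>2))) (rcis r t)) = 2 * pi * (0 / (cnj w * 0 - of_real (r\<^sup>2)))"
    by (rule integral_circle_mean) (use r nz in \<open>auto intro!: continuous_intros holomorphic_intros\<close>)
  ultimately show ?thesis using False by simp
qed

text \<open>Multiplying numerator and denominator by \<open>cnj z\<close> and replacing
  \<open>z * cnj z\<close> by \<open>r^2\<close> moves the pole across the circle.\<close>

lemma reflected_kernel_circle:
  assumes r: "0 < r"
  shows "reflected_kernel (rcis r t) w = - (r\<^sup>2 * cnj (cauchy_kernel (rcis r t) (r\<^sup>2 * w)))"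
proof -
  let ?z = "rcis r t"
  have z: "?z \<noteq> 0" using r by simp
  have 1: "?z * cnj ?z = of_real (r\<^sup>2)"
    using complex_norm_square[of ?z] by simp
  have "reflected_kernel ?z w = cnj ?z * ?z / (cnj ?z * (1 - ?z * cnj w))"
    using z by (simp add: reflected_kernel_def)
  also have "cnj ?z * (1 - ?z * cnj w) = cnj ?z - (?z * cnj ?z) * cnj w"
    by (simp add: algebra_simps)
  also have "cnj ?z * ?z = of_real (r\<^sup>2)" using 1 by (simp only: mult.commute)
  also have "of_real (r\<^sup>2) / (cnj ?z - (?z * cnj ?z) * cnj w) = - (r\<^sup>2 * cnj (cauchy_kernel ?z (r\<^sup>2 * w)))"
    unfolding 1 cauchy_kernel_def
    by (simp add: minus_divide_right[symmetric] divide_minus_left[symmetric] del: divide_minus_left)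
       (metis minus_diff_eq minus_divide_divide)
  finally show ?thesis by simp
qed

section \<open>Test functions on the circle and uniform bounds for their pairing with the Cauchy
  kernel\<close>

lemma smooth_circle_continuous:
  assumes "smooth_circle \<phi>"
  shows "continuous_on UNIV \<phi>" "continuous_on UNIV (deriv \<phi>)" "(\<phi> has_real_derivative deriv \<phi> t) (at t)"
proof -
  have *: "((deriv ^^ k) \<phi>) differentiable (at t)" for k t
    using assms by (simp add: smooth_circle_def)
  show "continuous_on UNIV \<phi>"
    using *[of 0] by (simp add: continuous_at_imp_continuous_on differentiable_imp_continuous_within)
  show "continuous_on UNIV (deriv \<phi>)"
    using *[of 1] by (simp add: continuous_at_imp_continuous_on differentiable_imp_continuous_within)
  show "(\<phi> has_real_derivative deriv \<phi> t) (at t)"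
    using *[of 0 t] by (simp add: DERIV_deriv_iff_real_differentiable)
qed

text \<open>The chord is \<open>2 * sin y\<close> with \<open>y = \<bar>x\<bar> / 2\<close>, and
  \<open>sin y \<ge> y - y^3 / 6 \<ge> y / 2\<close> as long as \<open>y^2 \<le> 3\<close>. The
  number 8/5 is a rational upper bound for \<open>pi / 2\<close>.\<close>

lemma arc_le_chord:
  assumes "\<bar>x\<bar> \<le> pi"
  shows "\<bar>x\<bar> \<le> 2 * cmod (cis x - 1)"
proof -
  define y where "y = \<bar>x\<bar> / 2"
  have y: "0 \<le> y" "y \<le> 8 / 5"
    using assms pi_less_4 pi_approx by (auto simp: y_def)
  have "\<bar>sin y - (\<Sum>m<3. sin_coeff m * y ^ m)\<bar> \<le> inverse (fact 3) * \<bar>y\<bar> ^ 3"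
    by (rule Maclaurin_sin_bound)
  then have "\<bar>sin y - y\<bar> \<le> y ^ 3 / 6"
    using y by (simp add: sin_coeff_def eval_nat_numeral fact_reduce field_simps)
  then have "y - y ^ 3 / 6 \<le> sin y" by linarith
  moreover have "y ^ 3 / 6 \<le> y / 2"
  proof -
    have "y * y \<le> 8/5 * (8/5)" using y by (intro mult_mono) auto
    then have "y * y \<le> 3" by simp
    then have "y * (y * y) \<le> y * 3" using y by (intro mult_left_mono) auto
    then show ?thesis by (simp add: power3_eq_cube)
  qed
  ultimately have "y / 2 \<le> sin y" by simp
  moreover have "cmod (cis x - 1) = 2 * \<bar>sin (x / 2)\<bar>"
    using dist_exp_i_1[of x] by (simp add: cis_conv_exp)
  moreover have "\<bar>sin (x / 2)\<bar> \<ge> sin y"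
    by (cases "x \<ge> 0") (auto simp: y_def)
  ultimately show ?thesis by (simp add: y_def)
qed

text \<open>The mean value theorem gives a Lipschitz bound in the angle, and arcs are comparable to
  chords. Angles near 0 and near \<open>2 * pi\<close> are close on the circle but not on the line;
  one of them is then shifted by a period, which is why the derivative is bounded on
  \<open>{-2*pi..4*pi}\<close>.\<close>

lemma smooth_circle_chord:
  assumes \<phi>: "smooth_circle \<phi>"
  obtains L where "L \<ge> 0" "\<And>s t. s \<in> {0..2*pi} \<Longrightarrow> t \<in> {0..2*pi} \<Longrightarrow> \<bar>\<phi> s - \<phi> t\<bar> \<le> L * cmod (cis s - cis t)"
proof -
  note S = smooth_circle_continuous[OF \<phi>]
  have per: "\<phi> (t + 2 * pi) = \<phi> t" for t using \<phi> by (simp add: smooth_circle_def)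
  have per': "\<phi> (t - 2 * pi) = \<phi> t" for t using per[of "t - 2 * pi"] by simp
  have "compact (deriv \<phi> ` {-2*pi..4*pi})"
    using S(2) by (intro compact_continuous_image) (auto intro: continuous_on_subset)
  then obtain M where M: "M > 0" "\<forall>x\<in>deriv \<phi> ` {-2*pi..4*pi}. norm x \<le> M"
    using compact_imp_bounded bounded_pos by blast
  have lip: "\<bar>\<phi> s - \<phi> t\<bar> \<le> M * \<bar>s - t\<bar>" if "s \<in> {-2*pi..4*pi}" "t \<in> {-2*pi..4*pi}" for s t
  proof -
    have "norm (\<phi> s - \<phi> t) \<le> M * norm (s - t)"
      using that M(2)
      by (intro field_differentiable_bound[where S = "{-2*pi..4*pi}" and f' = "deriv \<phi>"])
         (auto intro: has_field_derivative_at_within[OF S(3)])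
    then show ?thesis by simp
  qed
  have close: "\<bar>\<phi> s - \<phi> t\<bar> \<le> 2 * M * cmod (cis s - cis t)"
    if "s \<in> {-2*pi..4*pi}" "t \<in> {-2*pi..4*pi}" "\<bar>s - t\<bar> \<le> pi" for s t
  proof -
    have "cis s - cis t = cis t * (cis (s - t) - 1)"
      by (simp add: algebra_simps cis_mult)
    then have "cmod (cis s - cis t) = cmod (cis (s - t) - 1)" by (simp add: norm_mult)
    then have "\<bar>s - t\<bar> \<le> 2 * cmod (cis s - cis t)" using arc_le_chord[OF that(3)] by simp
    then have "M * \<bar>s - t\<bar> \<le> M * (2 * cmod (cis s - cis t))" using M by (intro mult_left_mono) auto
    then show ?thesis using lip[OF that(1,2)] by simp
  qed
  have cisp: "cis (s + 2 * pi) = cis s" "cis (s - 2 * pi) = cis s" for s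
    by (simp_all add: complex_eq_iff cos_diff sin_diff)
  show ?thesis
  proof (rule that[of "2 * M"])
    fix s t assume s: "s \<in> {0..2*pi}" and t: "t \<in> {0..2*pi}"
    consider "\<bar>s - t\<bar> \<le> pi" | "\<bar>s - (t + 2 * pi)\<bar> \<le> pi" | "\<bar>s - (t - 2 * pi)\<bar> \<le> pi"
      using s t by force
    then show "\<bar>\<phi> s - \<phi> t\<bar> \<le> 2 * M * cmod (cis s - cis t)"
    proof cases
      case 1
      then show ?thesis using s t by (intro close) auto
    next
      case 2
      then show ?thesis using close[of s "t + 2 * pi"] s t by (simp add: per cisp)
    next
      case 3
      then show ?thesis using close[of s "t - 2 * pi"] s t by (simp add: per' cisp)
    qed
  qed (use M in auto)
qed

lemma cauchy_kernel_circle_continuous: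
  assumes "cmod w \<noteq> r" "r \<ge> 0"
  shows "continuous_on UNIV (\<lambda>t. cauchy_kernel (rcis r t) w)"
proof -
  have "w - rcis r t \<noteq> 0" for t using assms by auto
  then show ?thesis unfolding cauchy_kernel_def rcis_def by (intro continuous_intros) (auto simp: rcis_def)
qed

text \<open>Subtracting from \<open>\<phi>\<close> its value at the direction of \<open>w\<close> tames the singularity of the Cauchy kernel, and
  the mean of the kernel itself is explicit.\<close>

lemma cauchy_kernel_circle_bounded:
  assumes \<phi>: "smooth_circle \<phi>"
  obtains B where "B \<ge> 0" "\<And>w r. 1/2 \<le> r \<Longrightarrow> cmod w \<noteq> r \<Longrightarrow>
      cmod (LINT t:{0..2*pi}|lborel. \<phi> t * cauchy_kernel (rcis r t) w) \<le> B"
proof -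
  note S = smooth_circle_continuous[OF \<phi>]
  obtain L where L: "L \<ge> 0" "\<And>s t. s \<in> {0..2*pi} \<Longrightarrow> t \<in> {0..2*pi} \<Longrightarrow> \<bar>\<phi> s - \<phi> t\<bar> \<le> L * cmod (cis s - cis t)"
    using smooth_circle_chord[OF \<phi>] by blast
  have "compact (\<phi> ` {0..2*pi})"
    using S by (intro compact_continuous_image) (auto intro: continuous_on_subset)
  then obtain M where M: "M > 0" "\<forall>x\<in>\<phi> ` {0..2*pi}. norm x \<le> M"
    using compact_imp_bounded bounded_pos by blast
  show ?thesis
  \<comment> \<open>Length \<open>2 * pi\<close> times the pointwise bound \<open>4 * L\<close> for
    the subtracted part, plus \<open>M\<close> times the bound \<open>4 * pi\<close> for the mean of
    the kernel.\<close>
  proof (rule that[of "8 * pi * L + 4 * pi * M"])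
    show "8 * pi * L + 4 * pi * M \<ge> 0" using L M by simp
    fix w r assume r: "1/2 \<le> (r::real)" and w: "cmod w \<noteq> r"
    define \<theta> where "\<theta> = Arg2pi w"
    have \<theta>: "\<theta> \<in> {0..2*pi}" using Arg2pi_ge_0[of w] Arg2pi_lt_2pi[of w] by (simp add: \<theta>_def less_imp_le)
    have w_eq: "w = rcis (cmod w) \<theta>"
      using Arg2pi_eq[of w] by (simp add: \<theta>_def rcis_def cis_conv_exp)
    have cont: "continuous_on UNIV (\<lambda>t. cauchy_kernel (rcis r t) w)"
      using w r by (intro cauchy_kernel_circle_continuous) auto
    have bd: "cmod (of_real (\<phi> t - \<phi> \<theta>) * cauchy_kernel (rcis r t) w) \<le> 4 * L" if t: "t \<in> {0..2*pi}" for t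
    proof -
      \<comment> \<open>The radial projection of \<open>w\<close> is a nearest point of the circle,
        so it is at most \<open>2 * cmod (rcis r t - w)\<close> away from \<open>rcis r t\<close>;
        dividing by \<open>r \<ge> 1/2\<close> yields the factor 4.\<close>
      have "r * cmod (cis t - cis \<theta>) = cmod (rcis r t - rcis r \<theta>)"
        using r by (simp add: rcis_def right_diff_distrib[symmetric] norm_mult)
      also have "\<dots> \<le> cmod (rcis r t - w) + cmod (w - rcis r \<theta>)"
        using norm_triangle_ineq[of "rcis r t - w" "w - rcis r \<theta>"] by simp
      also have "cmod (w - rcis r \<theta>) = \<bar>cmod w - r\<bar>"
        by (subst w_eq) (simp add: rcis_def left_diff_distrib[symmetric] norm_mult of_real_diff[symmetric] del: of_real_diff)
      also have "\<dots> \<le> cmod (rcis r t - w)"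
        using norm_triangle_ineq3[of w "rcis r t"] r by (simp add: norm_minus_commute)
      finally have "1/2 * cmod (cis t - cis \<theta>) \<le> 2 * cmod (rcis r t - w)"
        using r mult_right_mono[of "1/2" r "cmod (cis t - cis \<theta>)"] by simp
      then have chord: "cmod (cis t - cis \<theta>) \<le> 4 * cmod (w - rcis r t)"
        by (simp add: norm_minus_commute)
      have pos: "cmod (w - rcis r t) > 0" using w r by auto
      have "\<bar>\<phi> t - \<phi> \<theta>\<bar> \<le> L * cmod (cis t - cis \<theta>)" using L(2)[OF t \<theta>] .
      also have "\<dots> \<le> L * (4 * cmod (w - rcis r t))" using chord L(1) by (rule mult_left_mono)
      finally show ?thesis using pos
        by (simp add: cauchy_kernel_def norm_mult norm_divide divide_le_eq of_real_diff[symmetric] del: of_real_diff)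
    qed
    have "(LINT t:{0..2*pi}|lborel. \<phi> t * cauchy_kernel (rcis r t) w)
       = (LINT t:{0..2*pi}|lborel. of_real (\<phi> t - \<phi> \<theta>) * cauchy_kernel (rcis r t) w + \<phi> \<theta> * cauchy_kernel (rcis r t) w)"
      by (simp add: algebra_simps)
    also have "\<dots> = (LINT t:{0..2*pi}|lborel. of_real (\<phi> t - \<phi> \<theta>) * cauchy_kernel (rcis r t) w)
       + \<phi> \<theta> * (LINT t:{0..2*pi}|lborel. cauchy_kernel (rcis r t) w)"
      using S(1) cont by (subst set_integral_add) (auto intro!: set_integrable_circle continuous_intros)
    also have "cmod \<dots> \<le> 4 * L * (2 * pi) + M * (4 * pi)"
    proof (rule norm_triangle_le, rule add_mono)
      have "cmod (LINT t:{0..2*pi}|lborel. of_real (\<phi> t - \<phi> \<theta>) * cauchy_kernel (rcis r t) w)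
         \<le> (LINT t:{0..2*pi}|lborel. 4 * L)"
        unfolding set_lebesgue_integral_def
      proof (rule order_trans[OF integral_norm_bound], rule integral_mono)
        show "integrable lborel (\<lambda>x. norm (indicat_real {0..2 * pi} x *\<^sub>R (of_real (\<phi> x - \<phi> \<theta>) * cauchy_kernel (rcis r x) w)))"
          using S(1) cont
          by (intro integrable_norm set_integrable_circle[unfolded set_integrable_def] continuous_intros) auto
        show "norm (indicat_real {0..2 * pi} x *\<^sub>R (of_real (\<phi> x - \<phi> \<theta>) * cauchy_kernel (rcis r x) w)) \<le> indicat_real {0..2 * pi} x *\<^sub>R (4 * L)" for x
          using bd[of x] by (simp add: indicator_def)
      qed (auto simp: integrable_mult_left)
      then show "cmod (LINT t:{0..2*pi}|lborel. of_real (\<phi> t - \<phi> \<theta>) * cauchy_kernel (rcis r t) w) \<le> 4 * L * (2 * pi)"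
        by (simp add: set_lebesgue_integral_def mult_ac)
      have "cmod (LINT t:{0..2*pi}|lborel. cauchy_kernel (rcis r t) w) \<le> 4 * pi"
      proof -
        have "2 * pi / cmod w \<le> 4 * pi" if "cmod w > r"
        proof -
          have "2 * pi / cmod w \<le> 2 * pi / (1/2)" using that r by (intro divide_left_mono) auto
          then show ?thesis by simp
        qed
        then show ?thesis
          using w r by (subst cauchy_kernel_circle_mean) (auto simp: norm_divide norm_mult)
      qed
      moreover have "\<bar>\<phi> \<theta>\<bar> \<le> M" using M \<theta> by auto
      ultimately show "cmod (\<phi> \<theta> * (LINT t:{0..2*pi}|lborel. cauchy_kernel (rcis r t) w)) \<le> M * (4 * pi)"
        using M by (auto simp: norm_mult intro: mult_mono)
    qed
    finally show "cmod (LINT t:{0..2*pi}|lborel. \<phi> t * cauchy_kernel (rcis r t) w) \<le> 8 * pi * L + 4 * pi * M"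
      by (simp add: mult_ac)
  qed
qed

text \<open>What the Cauchy kernel and the reflected kernel together contribute to the pairing with \<open>\<phi>\<close>: on the
  circle of radius \<open>r\<close> the reflected kernel is, up to conjugation, the Cauchy kernel with pole \<open>r\<^sup>2 * w\<close>.\<close>

definition reflection_difference :: "(real \<Rightarrow> real) \<Rightarrow> real \<Rightarrow> complex \<Rightarrow> complex" where
  "reflection_difference \<phi> r w = (LINT t:{0..2*pi}|lborel. \<phi> t * cauchy_kernel (rcis r t) w)
     - r\<^sup>2 * (LINT t:{0..2*pi}|lborel. \<phi> t * cauchy_kernel (rcis r t) (r\<^sup>2 * w))"

text \<open>The two kernels differ by \<open>z * (r^2 - 1)\<close> over a product of two distances,
  each at least \<open>r - cmod w\<close>. For fixed \<open>w\<close> in the disk only the numerator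
  degenerates as \<open>r\<close> tends to 1.\<close>

lemma reflection_difference_tendsto:
  assumes \<phi>: "continuous_on UNIV \<phi>" and w: "cmod w < 1"
  shows "((\<lambda>r. reflection_difference \<phi> r w) \<longlongrightarrow> 0) (at_left 1)"
proof -
  have "compact (\<phi> ` {0..2*pi})"
    using \<phi> by (intro compact_continuous_image) (auto intro: continuous_on_subset)
  then obtain M where M: "M > 0" "\<forall>x\<in>\<phi> ` {0..2*pi}. norm x \<le> M"
    using compact_imp_bounded bounded_pos by blast
  have bound: "norm (reflection_difference \<phi> r w) \<le> 2 * pi * (M * ((1 - r\<^sup>2) / ((r - cmod w) * (r - cmod w))))"
    if r: "cmod w < r" "0 < r" "r < 1" for r
  proof -
    have r2: "0 < r\<^sup>2" "r\<^sup>2 < 1" using r by (auto simp: power_less_one_iff)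
    have r2w: "cmod (r\<^sup>2 * w) \<le> cmod w"
      using r2 by (simp add: norm_mult norm_power mult_left_le_one_le)
    have c1: "continuous_on UNIV (\<lambda>t. cauchy_kernel (rcis r t) w)"
      using r by (intro cauchy_kernel_circle_continuous) auto
    have c2: "continuous_on UNIV (\<lambda>t. cauchy_kernel (rcis r t) (r\<^sup>2 * w))"
      using r r2w by (intro cauchy_kernel_circle_continuous) auto
    let ?f = "\<lambda>t. \<phi> t * cauchy_kernel (rcis r t) w - r\<^sup>2 * (\<phi> t * cauchy_kernel (rcis r t) (r\<^sup>2 * w))"
    have contf: "continuous_on UNIV ?f"
      by (intro continuous_intros \<phi> c1 c2)
    have bd: "norm (?f t) \<le> M * ((1 - r\<^sup>2) / ((r - cmod w) * (r - cmod w)))" if t: "t \<in> {0..2*pi}" for t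
    proof -
      let ?z = "rcis r t"
      have n1: "r - cmod w \<le> cmod (w - ?z)"
        using norm_triangle_ineq3[of w ?z] r by simp
      have n2: "r - cmod w \<le> cmod (r\<^sup>2 * w - ?z)"
        using norm_triangle_ineq3[of "r\<^sup>2 * w" ?z] r r2w by simp
      have nz: "w - ?z \<noteq> 0" "of_real (r\<^sup>2) * w - ?z \<noteq> 0" using n1 n2 r by auto
      have f: "?f t = \<phi> t * (1 / (w - ?z) - of_real (r\<^sup>2) / (of_real (r\<^sup>2) * w - ?z))"
        by (simp add: cauchy_kernel_def algebra_simps)
      have frac: "1 / (w - ?z) - of_real (r\<^sup>2) / (of_real (r\<^sup>2) * w - ?z)
          = (?z * (of_real (r\<^sup>2) - 1)) / ((w - ?z) * (of_real (r\<^sup>2) * w - ?z))"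
        using nz by (simp add: diff_frac_eq) (simp add: algebra_simps)
      have "norm (?f t) = \<bar>\<phi> t\<bar> * (r * (1 - r\<^sup>2) / (cmod (w - ?z) * cmod (r\<^sup>2 * w - ?z)))"
      proof -
        have "of_real (r\<^sup>2) - 1 = complex_of_real (r\<^sup>2 - 1)" by simp
        then have "cmod (of_real (r\<^sup>2) - 1) = 1 - r\<^sup>2"
          using r2 by (simp only: norm_of_real)
        then show ?thesis unfolding f frac using r by (simp add: norm_mult norm_divide)
      qed
      also have "\<dots> \<le> M * ((1 - r\<^sup>2) / ((r - cmod w) * (r - cmod w)))"
      proof (intro mult_mono frac_le)
        show "\<bar>\<phi> t\<bar> \<le> M" using M t by auto
        show "r * (1 - r\<^sup>2) \<le> 1 - r\<^sup>2" using r r2 by (intro mult_left_le_one_le) auto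
      qed (use M r r2 n1 n2 in auto)
      finally show ?thesis .
    qed
    have e: "reflection_difference \<phi> r w = (LINT t:{0..2*pi}|lborel. ?f t)"
    proof -
      have i1: "set_integrable lborel {0..2*pi} (\<lambda>t. \<phi> t * cauchy_kernel (rcis r t) w)"
        by (intro set_integrable_circle continuous_intros \<phi> c1)
      have i2: "set_integrable lborel {0..2*pi} (\<lambda>t. r\<^sup>2 * (\<phi> t * cauchy_kernel (rcis r t) (r\<^sup>2 * w)))"
        by (intro set_integrable_circle continuous_intros \<phi> c2)
      show ?thesis
        unfolding reflection_difference_def set_integral_diff(2)[OF i1 i2] by simp
    qed
    have n: "norm (LINT t:{0..2*pi}|lborel. ?f t) \<le> (LINT t:{0..2*pi}|lborel. M * ((1 - r\<^sup>2) / ((r - cmod w) * (r - cmod w))))"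
      unfolding set_lebesgue_integral_def
    proof (rule order_trans[OF integral_norm_bound], rule integral_mono)
      show "integrable lborel (\<lambda>x. norm (indicat_real {0..2 * pi} x *\<^sub>R ?f x))"
        using set_integrable_circle[OF contf] unfolding set_integrable_def by (rule integrable_norm)
      show "norm (indicat_real {0..2 * pi} x *\<^sub>R ?f x) \<le> indicat_real {0..2 * pi} x *\<^sub>R (M * ((1 - r\<^sup>2) / ((r - cmod w) * (r - cmod w))))" for x
        using bd[of x] by (simp add: indicator_def)
    qed (auto simp: integrable_mult_left)
    have v: "(LINT t:{0..2*pi}|lborel. M * ((1 - r\<^sup>2) / ((r - cmod w) * (r - cmod w))))
        = 2 * pi * (M * ((1 - r\<^sup>2) / ((r - cmod w) * (r - cmod w))))"
      by (simp add: set_lebesgue_integral_def)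
    show ?thesis using n unfolding e v .
  qed
  have "((\<lambda>r. 2 * pi * (M * ((1 - r\<^sup>2) / ((r - cmod w) * (r - cmod w))))) \<longlongrightarrow>
      2 * pi * (M * ((1 - 1\<^sup>2) / ((1 - cmod w) * (1 - cmod w))))) (at_left 1)"
    using w by (intro tendsto_intros) auto
  then have "((\<lambda>r. 2 * pi * (M * ((1 - r\<^sup>2) / ((r - cmod w) * (r - cmod w))))) \<longlongrightarrow> 0) (at_left 1)"
    by simp
  moreover have "eventually (\<lambda>r. norm (reflection_difference \<phi> r w) \<le>
      2 * pi * (M * ((1 - r\<^sup>2) / ((r - cmod w) * (r - cmod w))))) (at_left 1)"
    using eventually_at_left_real[OF w] by eventually_elim (rule bound, auto intro: order.strict_trans1[OF norm_ge_zero])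
  ultimately show ?thesis
    by (rule Lim_null_comparison[rotated])
qed

lemma AE_norm_neq: "AE w in lborel. cmod w \<noteq> r"
proof -
  have "sphere (0::complex) r \<in> null_sets lebesgue"
    using negligible_sphere[of "0::complex" r] by (simp add: negligible_iff_null_sets)
  then have "sphere (0::complex) r \<in> null_sets lborel"
    using null_sets_completion_iff by (metis borel_closed closed_sphere sets_lborel)
  then show ?thesis
    by (rule AE_I') auto
qed

text \<open>Dominated convergence: the integrand tends to 0 for each fixed \<open>w\<close>, and
  \<open>cauchy_kernel_circle_bounded\<close> bounds the difference by \<open>2 * B\<close>
  independently of \<open>w\<close> and \<open>r\<close>, off the null set
  \<open>cmod w = r\<close>.\<close>

lemma reflection_difference_integral_tendsto:
  fixes g :: "complex \<Rightarrow> complex"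
  assumes g: "integrable lborel g" "\<And>w. w \<notin> disk \<Longrightarrow> g w = 0" and \<phi>: "smooth_circle \<phi>"
  shows "((\<lambda>r. LINT w|lborel. g w * reflection_difference \<phi> r w) \<longlongrightarrow> 0) (at_left 1)"
proof (rule tendsto_at_left_sequentially[where b = "1/2"])
  note S = smooth_circle_continuous[OF \<phi>]
  have [measurable]: "\<phi> \<in> borel_measurable borel" using S(1) by (rule borel_measurable_continuous_onI)
  have [measurable]: "g \<in> borel_measurable borel" using g by auto
  obtain B where B: "B \<ge> 0" "\<And>w r. 1/2 \<le> r \<Longrightarrow> cmod w \<noteq> r \<Longrightarrow>
      cmod (LINT t:{0..2*pi}|lborel. \<phi> t * cauchy_kernel (rcis r t) w) \<le> B"
    using cauchy_kernel_circle_bounded[OF \<phi>] by blast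
  fix s :: "nat \<Rightarrow> real"
  assume s: "\<And>n. s n < 1" "\<And>n. 1/2 < s n" "incseq s" "s \<longlonglongrightarrow> 1"
  have bound: "cmod (reflection_difference \<phi> (s n) w) \<le> 2 * B" if "cmod w \<noteq> s n" "cmod w < 1" for n w
  proof -
    have sn: "1/2 < s n" "s n < 1" using s by auto
    \<comment> \<open>The second pole lies strictly inside the circle, so the uniform bound applies
      to it without exception.\<close>
    have "cmod ((s n)\<^sup>2 * w) < s n"
    proof -
      have "s n * cmod w < 1" using sn that by (metis less_eq_real_def mult_strict_mono' mult_1 norm_ge_zero order_less_trans zero_less_divide_1_iff zero_less_numeral)
      then have "s n * (s n * cmod w) < s n * 1" using sn by (intro mult_strict_left_mono) auto
      then show ?thesis by (simp add: norm_mult norm_power power2_eq_square)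
    qed
    then have 2: "cmod (LINT t:{0..2*pi}|lborel. \<phi> t * cauchy_kernel (rcis (s n) t) ((s n)\<^sup>2 * w)) \<le> B"
      using sn by (intro B) auto
    have 1: "cmod (LINT t:{0..2*pi}|lborel. \<phi> t * cauchy_kernel (rcis (s n) t) w) \<le> B"
      using sn that by (intro B) auto
    have "cmod ((s n)\<^sup>2 * (LINT t:{0..2*pi}|lborel. \<phi> t * cauchy_kernel (rcis (s n) t) ((s n)\<^sup>2 * w))) \<le> 1 * B"
      unfolding norm_mult using sn 2 by (intro mult_mono) (auto simp: norm_power power_le_one)
    with 1 show ?thesis unfolding reflection_difference_def
      by (intro order_trans[OF norm_triangle_ineq4]) simp
  qed
  have "(\<lambda>n. LINT w|lborel. g w * reflection_difference \<phi> (s n) w) \<longlonglongrightarrow> (LINT w|(lborel :: complex measure). (0::complex))"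
  proof (rule integral_dominated_convergence)
    show "(\<lambda>w. g w * reflection_difference \<phi> (s n) w) \<in> borel_measurable lborel" for n
      unfolding reflection_difference_def cauchy_kernel_def set_lebesgue_integral_def by measurable
    show "integrable lborel (\<lambda>w. cmod (g w) * (2 * B))" using g by auto
    show "AE w in lborel. (\<lambda>n. g w * reflection_difference \<phi> (s n) w) \<longlonglongrightarrow> 0"
    proof (rule AE_I2)
      fix w
      show "(\<lambda>n. g w * reflection_difference \<phi> (s n) w) \<longlonglongrightarrow> 0"
      proof (cases "w \<in> disk")
        case True
        have "filterlim s (at_left 1) sequentially"
          using s(1)[THEN less_imp_neq] s(1,4) by (auto simp: filterlim_at)
        then have "(\<lambda>n. reflection_difference \<phi> (s n) w) \<longlonglongrightarrow> 0"
          using True by (intro filterlim_compose[OF reflection_difference_tendsto[OF S(1)]]) auto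
        then show ?thesis by (rule tendsto_mult_right_zero)
      qed (use g in auto)
    qed
    show "AE w in lborel. norm (g w * reflection_difference \<phi> (s n) w) \<le> cmod (g w) * (2 * B)" for n
      using AE_norm_neq[of "s n"]
    proof eventually_elim
      case (elim w)
      then show ?case
        using bound[of w n] g(2)[of w] by (cases "w \<in> disk") (auto simp: norm_mult intro: mult_left_mono)
    qed
  qed simp
  then show "(\<lambda>n. LINT w|lborel. g w * reflection_difference \<phi> (s n) w) \<longlonglongrightarrow> 0" by simp
qed simp

text \<open>After Fubini the reflected part is minus the conjugate of \<open>r^2\<close> times an
  integral of \<open>g\<close> against the Cauchy kernel with pole \<open>r^2 * w\<close>. Real
  parts do not see the conjugation, so the two parts combine into
  \<open>reflection_difference\<close>, whereas their imaginary parts would add up.\<close>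

lemma has_boundary_value_kernel_integrals:
  fixes g :: "complex \<Rightarrow> complex"
  assumes g: "integrable lborel g" "\<And>w. w \<notin> disk \<Longrightarrow> g w = 0"
  shows "has_boundary_value (\<lambda>z. Re (kernel_integral cauchy_kernel g z
            + kernel_integral reflected_kernel (\<lambda>w. cnj (g w)) z)) (\<lambda>z. 0)"
proof -
  have g': "integrable lborel (\<lambda>w. cnj (g w))" "\<And>w. w \<notin> disk \<Longrightarrow> cnj (g w) = 0"
    using g by auto
  let ?C = "kernel_integral cauchy_kernel g"
  let ?E = "kernel_integral reflected_kernel (\<lambda>w. cnj (g w))"
  have [measurable]: "?C \<in> borel_measurable borel"
    by (rule kernel_integral_measurable[OF g cauchy_kernel_singular])
  have [measurable]: "?E \<in> borel_measurable borel"
    by (rule kernel_integral_measurable[OF g' reflected_kernel_singular])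
  have AE_C: "AE r in lborel. 0 < r \<and> r < 1 \<longrightarrow>
    integrable (lborel \<Otimes>\<^sub>M lborel) (\<lambda>(t, w). indicator {0..2*pi} t *\<^sub>R (g w * cauchy_kernel (rcis r t) w))"
    by (rule kernel_circle_integrable[OF g cauchy_kernel_singular])
  have AE_E: "AE r in lborel. 0 < r \<and> r < 1 \<longrightarrow>
    integrable (lborel \<Otimes>\<^sub>M lborel) (\<lambda>(t, w). indicator {0..2*pi} t *\<^sub>R (cnj (g w) * reflected_kernel (rcis r t) w))"
    by (rule kernel_circle_integrable[OF g' reflected_kernel_singular])
  have sum: "set_integrable lborel {0..2*pi} (\<lambda>t. (?C (rcis r t) + ?E (rcis r t)) * \<phi> t)"
    if C: "integrable (lborel \<Otimes>\<^sub>M lborel) (\<lambda>(t, w). indicator {0..2*pi} t *\<^sub>R (g w * cauchy_kernel (rcis r t) w))"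
      and E: "integrable (lborel \<Otimes>\<^sub>M lborel) (\<lambda>(t, w). indicator {0..2*pi} t *\<^sub>R (cnj (g w) * reflected_kernel (rcis r t) w))"
      and \<phi>: "continuous_on UNIV (\<phi> :: real \<Rightarrow> real)" for r \<phi>
    using kernel_circle_pairing(1)[OF C \<phi>] kernel_circle_pairing(1)[OF E \<phi>]
    by (simp add: distrib_right set_integral_add(1))
  have sumRe: "set_integrable lborel {0..2*pi} (\<lambda>t. Re (?C (rcis r t) + ?E (rcis r t)) * \<phi> t)
      \<and> (LINT t:{0..2*pi}|lborel. Re (?C (rcis r t) + ?E (rcis r t)) * \<phi> t)
          = Re (LINT t:{0..2*pi}|lborel. (?C (rcis r t) + ?E (rcis r t)) * \<phi> t)"
    if C: "integrable (lborel \<Otimes>\<^sub>M lborel) (\<lambda>(t, w). indicator {0..2*pi} t *\<^sub>R (g w * cauchy_kernel (rcis r t) w))"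
      and E: "integrable (lborel \<Otimes>\<^sub>M lborel) (\<lambda>(t, w). indicator {0..2*pi} t *\<^sub>R (cnj (g w) * reflected_kernel (rcis r t) w))"
      and \<phi>: "continuous_on UNIV (\<phi> :: real \<Rightarrow> real)" for r \<phi>
  proof -
    have eq: "indicator {0..2*pi} t *\<^sub>R (Re (?C (rcis r t) + ?E (rcis r t)) * \<phi> t)
       = Re (indicator {0..2*pi} t *\<^sub>R ((?C (rcis r t) + ?E (rcis r t)) * \<phi> t))" for t
      by simp
    show ?thesis
      using sum[OF C E \<phi>] unfolding set_integrable_def set_lebesgue_integral_def eq
      by (auto simp del: scaleR_complex.simps times_complex.simps plus_complex.simps)
  qed
  show "has_boundary_value (\<lambda>z. Re (?C z + ?E z)) (\<lambda>z. 0)"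
    unfolding has_boundary_value_def
  proof (intro allI impI)
    fix \<phi> assume \<phi>: "smooth_circle \<phi>"
    note S = smooth_circle_continuous[OF \<phi>]
    have [measurable]: "\<phi> \<in> borel_measurable borel" using S(1) by (rule borel_measurable_continuous_onI)
    let ?D = "\<lambda>r. Re (LINT w|lborel. g w * reflection_difference \<phi> r w)"
    have key: "(LINT t|lebesgue_on {0..2*pi}. Re (?C (rcis r t) + ?E (rcis r t)) * \<phi> t) = ?D r"
      if r: "1/2 < r" "r < 1"
        and C: "integrable (lborel \<Otimes>\<^sub>M lborel) (\<lambda>(t, w). indicator {0..2*pi} t *\<^sub>R (g w * cauchy_kernel (rcis r t) w))"
        and E: "integrable (lborel \<Otimes>\<^sub>M lborel) (\<lambda>(t, w). indicator {0..2*pi} t *\<^sub>R (cnj (g w) * reflected_kernel (rcis r t) w))" for r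
    proof -
      let ?J = "\<lambda>w. LINT t:{0..2*pi}|lborel. \<phi> t * cauchy_kernel (rcis r t) w"
      have [measurable]: "?J \<in> borel_measurable borel"
        unfolding cauchy_kernel_def set_lebesgue_integral_def by measurable
      have [measurable]: "g \<in> borel_measurable borel" using g by auto
      obtain B where B: "B \<ge> 0" "\<And>w r. 1/2 \<le> r \<Longrightarrow> cmod w \<noteq> r \<Longrightarrow>
          cmod (LINT t:{0..2*pi}|lborel. \<phi> t * cauchy_kernel (rcis r t) w) \<le> B"
        using cauchy_kernel_circle_bounded[OF \<phi>] by blast
      \<comment> \<open>Stated for a dilation by \<open>c\<close> in order to serve both poles, with
        \<open>c = 1\<close> and \<open>c = r^2\<close>.\<close>
      have J_int: "integrable lborel (\<lambda>w. g w * ?J (of_real c * w))" if "c \<noteq> 0" for c :: real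
      proof (rule Bochner_Integration.integrable_bound)
        show "integrable lborel (\<lambda>w. cmod (g w) * B)" using g by auto
        show "(\<lambda>w. g w * ?J (of_real c * w)) \<in> borel_measurable lborel" by measurable
        show "AE w in lborel. norm (g w * ?J (of_real c * w)) \<le> norm (cmod (g w) * B)"
          using AE_norm_neq[of "r / \<bar>c\<bar>"]
        proof eventually_elim
          case (elim w)
          then have "cmod (of_real c * w) \<noteq> r" using that by (auto simp: norm_mult field_simps)
          then have "cmod (?J (of_real c * w)) \<le> B" using r by (intro B) auto
          then show ?case using B by (simp add: norm_mult mult_left_mono)
        qed
      qed
      have Ek: "(LINT t:{0..2*pi}|lborel. \<phi> t * reflected_kernel (rcis r t) w) = - (of_real (r\<^sup>2) * cnj (?J (of_real (r\<^sup>2) * w)))" for w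
      proof -
        have "(LINT t:{0..2*pi}|lborel. \<phi> t * reflected_kernel (rcis r t) w)
          = (LINT t:{0..2*pi}|lborel. (- (of_real (r\<^sup>2))) * cnj (\<phi> t * cauchy_kernel (rcis r t) (of_real (r\<^sup>2) * w)))"
          using r by (intro set_lebesgue_integral_cong) (auto simp: reflected_kernel_circle)
        also have "\<dots> = - (of_real (r\<^sup>2)) * cnj (?J (of_real (r\<^sup>2) * w))"
          by (simp only: set_integral_mult_right set_integral_cnj)
        finally show ?thesis by simp
      qed
      have "(LINT t:{0..2*pi}|lborel. (?C (rcis r t) + ?E (rcis r t)) * \<phi> t)
         = (LINT w|lborel. g w * ?J w) + (LINT w|lborel. cnj (g w) * (- (of_real (r\<^sup>2) * cnj (?J (of_real (r\<^sup>2) * w)))))"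
        using kernel_circle_pairing[OF C S(1)] kernel_circle_pairing[OF E S(1)]
        by (simp add: distrib_right Ek)
      also have "(LINT w|lborel. cnj (g w) * (- (of_real (r\<^sup>2) * cnj (?J (of_real (r\<^sup>2) * w))))) = (LINT w|lborel. cnj (- (of_real (r\<^sup>2) * (g w * ?J (of_real (r\<^sup>2) * w)))))"
        by (intro Bochner_Integration.integral_cong refl) simp
      also have "\<dots> = cnj (LINT w|lborel. - (of_real (r\<^sup>2) * (g w * ?J (of_real (r\<^sup>2) * w))))"
        by (rule Bochner_Integration.integral_cnj)
      finally have "Re (LINT t:{0..2*pi}|lborel. (?C (rcis r t) + ?E (rcis r t)) * \<phi> t)
         = Re ((LINT w|lborel. g w * ?J w) + (LINT w|lborel. - (of_real (r\<^sup>2) * (g w * ?J (of_real (r\<^sup>2) * w)))))"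
        by simp
      also have "(LINT w|lborel. g w * ?J w) + (LINT w|lborel. - (of_real (r\<^sup>2) * (g w * ?J (of_real (r\<^sup>2) * w))))
         = (LINT w|lborel. g w * ?J w + (- (of_real (r\<^sup>2) * (g w * ?J (of_real (r\<^sup>2) * w)))))"
        using J_int[of 1] J_int[of "r\<^sup>2"] r
        by (subst Bochner_Integration.integral_add) auto
      also have "\<dots> = (LINT w|lborel. g w * reflection_difference \<phi> r w)"
        by (intro Bochner_Integration.integral_cong refl) (simp add: reflection_difference_def algebra_simps)
      finally have "Re (LINT t:{0..2*pi}|lborel. (?C (rcis r t) + ?E (rcis r t)) * \<phi> t) = ?D r" .
      moreover have "(LINT t|lebesgue_on {0..2*pi}. Re (?C (rcis r t) + ?E (rcis r t)) * \<phi> t)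
         = (LINT t:{0..2*pi}|lborel. Re (?C (rcis r t) + ?E (rcis r t)) * \<phi> t)"
        by (rule lebesgue_on_integral_eq) auto
      ultimately show ?thesis using sumRe[OF C E S(1)] by simp
    qed
    have "eventually (\<lambda>r. (1/2 < r \<and> r < 1) \<and> (0 < r \<and> r < 1 \<longrightarrow>
        integrable (lborel \<Otimes>\<^sub>M lborel) (\<lambda>(t, w). indicator {0..2*pi} t *\<^sub>R (g w * cauchy_kernel (rcis r t) w)) \<and>
        integrable (lborel \<Otimes>\<^sub>M lborel) (\<lambda>(t, w). indicator {0..2*pi} t *\<^sub>R (cnj (g w) * reflected_kernel (rcis r t) w))))
       (inf (at_left 1) (ae_filter lebesgue))"
      unfolding eventually_inf
    proof (intro exI conjI)
      show "eventually (\<lambda>r. 1/2 < r \<and> r < 1) (at_left (1::real))"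
        using eventually_at_left_real[of "1/2" 1] by simp
      show "AE r in lebesgue. (0 < r \<and> r < 1 \<longrightarrow>
        integrable (lborel \<Otimes>\<^sub>M lborel) (\<lambda>(t, w). indicator {0..2*pi} t *\<^sub>R (g w * cauchy_kernel (rcis r t) w)) \<and>
        integrable (lborel \<Otimes>\<^sub>M lborel) (\<lambda>(t, w). indicator {0..2*pi} t *\<^sub>R (cnj (g w) * reflected_kernel (rcis r t) w)))"
        using AE_completion[OF AE_C] AE_completion[OF AE_E] by eventually_elim blast
    qed blast
    then have ev: "eventually (\<lambda>r. (LINT t|lebesgue_on {0..2*pi}. Re (?C (rcis r t) + ?E (rcis r t)) * \<phi> t) = ?D r)
       (inf (at_left 1) (ae_filter lebesgue))"
      by eventually_elim (use key in auto)
    have "(?D \<longlongrightarrow> 0) (at_left 1)"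
      using tendsto_Re[OF reflection_difference_integral_tendsto[OF g \<phi>]] by simp
    then have "(?D \<longlongrightarrow> 0) (inf (at_left 1) (ae_filter lebesgue))"
      by (rule tendsto_mono[OF inf_le1])
    then show "((\<lambda>r. LINT t|lebesgue_on {0..2*pi}. Re (?C (rcis r t) + ?E (rcis r t)) * \<phi> t) \<longlongrightarrow>
        (LINT t|lebesgue_on {0..2*pi}. 0 * \<phi> t)) (inf (at_left 1) (ae_filter lebesgue))"
      using tendsto_cong[OF ev] by simp
  qed
qed

section \<open>Boundary values of locally integrable functions\<close>

lemma AE_circles_cong:
  assumes "AE z in lborel. z \<in> disk \<longrightarrow> u z = v z"
  shows "AE r in lborel. 0 < r \<and> r < 1 \<longrightarrow> (AE t in lebesgue_on {0..2*pi}. u (rcis r t) = v (rcis r t))"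
  using AE_polar[OF assms]
proof (eventually_elim, intro impI)
  fix r :: real
  assume r: "0 < r \<longrightarrow> (AE t in lborel. t \<in> {0..2 * pi} \<longrightarrow> rcis r t \<in> disk \<longrightarrow> u (rcis r t) = v (rcis r t))"
    "0 < r \<and> r < 1"
  then have "AE t in lborel. t \<in> {0..2 * pi} \<longrightarrow> u (rcis r t) = v (rcis r t)" by simp
  then show "AE t in lebesgue_on {0..2*pi}. u (rcis r t) = v (rcis r t)"
    by (subst AE_restrict_space_iff) (auto intro: AE_completion)
qed

text \<open>Local integrability controls compact subdisks only, so the circles are treated inside
  the disks of radius \<open>1 - 1 / Suc n\<close>; the countably many null sets of radii are then
  united.\<close>

lemma L1_loc_circle_integrable:
  assumes u: "L1_loc_disk u"
  shows "AE r in lborel. 0 < r \<and> r < 1 \<longrightarrow> integrable (lebesgue_on {0..2*pi}) (\<lambda>t. u (rcis r t))"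
proof -
  have n: "AE r in lborel. 0 < r \<and> r < 1 - 1 / real (Suc n) \<longrightarrow> integrable (lebesgue_on {0..2*pi}) (\<lambda>t. u (rcis r t))" for n
  proof -
    let ?K = "cball (0::complex) (1 - 1 / real (Suc n))"
    have int_u: "integrable (lebesgue_on ?K) u"
    proof -
      have "?K \<subseteq> disk"
      proof
        fix x assume "x \<in> ?K"
        then have "cmod x \<le> 1 - 1 / real (Suc n)" by (simp only: mem_cball dist_0_norm)
        moreover have "1 / real (Suc n) > 0" by simp
        ultimately have "cmod x < 1" by linarith
        then show "x \<in> disk" by simp
      qed
      then show ?thesis
        using u compact_cball[of 0 "1 - 1 / real (Suc n)"] unfolding L1_loc_disk_def by (elim allE impE) (rule conjI)
    qed
    obtain F where F: "F \<in> borel_measurable borel" "AE x in lborel. x \<in> ?K \<longrightarrow> u x = F x" "\<And>x. x \<notin> ?K \<Longrightarrow> F x = 0"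
      by (rule lebesgue_on_borel_representative[OF borel_measurable_integrable[OF int_u] borel_closed[OF closed_cball]]) blast
    have "set_integrable lborel ?K F"
      using int_u
      by (subst (asm) lebesgue_on_integrable_iff[OF _ F(2,1)]) auto
    then have int: "integrable lborel F"
      unfolding set_integrable_def by (rule back_subst[where P = "integrable lborel"]) (use F(3) in \<open>auto simp: indicator_def fun_eq_iff\<close>)
    show ?thesis
      using integrable_polar[OF int] AE_polar[OF F(2)]
    proof (eventually_elim, intro impI)
      fix r :: real
      assume r: "0 < r \<longrightarrow> set_integrable lborel {0..2 * pi} (\<lambda>t. F (rcis r t))"
        "0 < r \<longrightarrow> (AE t in lborel. t \<in> {0..2 * pi} \<longrightarrow> rcis r t \<in> ?K \<longrightarrow> u (rcis r t) = F (rcis r t))"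
        "0 < r \<and> r < 1 - 1 / real (Suc n)"
      then have "AE t in lborel. t \<in> {0..2 * pi} \<longrightarrow> u (rcis r t) = F (rcis r t)" by (simp del: of_nat_Suc)
      then show "integrable (lebesgue_on {0..2*pi}) (\<lambda>t. u (rcis r t))"
        using r F(1) by (subst lebesgue_on_integrable_iff[where F = "\<lambda>t. F (rcis r t)"]) auto
    qed
  qed
  then have "AE r in lborel. \<forall>n. 0 < r \<and> r < 1 - 1 / real (Suc n) \<longrightarrow> integrable (lebesgue_on {0..2*pi}) (\<lambda>t. u (rcis r t))"
    by (subst AE_all_countable) blast
  then show ?thesis
  proof (eventually_elim, intro impI)
    fix r :: real
    assume *: "\<forall>n. 0 < r \<and> r < 1 - 1 / real (Suc n) \<longrightarrow> integrable (lebesgue_on {0..2*pi}) (\<lambda>t. u (rcis r t))"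
      and r: "0 < r \<and> r < 1"
    then obtain n where "1 / real (Suc n) < 1 - r"
      using nat_approx_posE[of "1 - r"] by auto
    then show "integrable (lebesgue_on {0..2*pi}) (\<lambda>t. u (rcis r t))"
      using * r by (auto simp: algebra_simps)
  qed
qed

lemma integrable_mult_continuous:
  assumes f: "integrable (lebesgue_on {0..2*pi}) f" and \<phi>: "continuous_on UNIV (\<phi> :: real \<Rightarrow> real)"
  shows "integrable (lebesgue_on {0..2*pi}) (\<lambda>t. f t * \<phi> t :: real)"
proof -
  have "compact (\<phi> ` {0..2*pi})"
    using \<phi> by (intro compact_continuous_image) (auto intro: continuous_on_subset)
  then obtain M where M: "M > 0" "\<forall>x\<in>\<phi> ` {0..2*pi}. norm x \<le> M"
    using compact_imp_bounded bounded_pos by blast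
  have [measurable]: "\<phi> \<in> borel_measurable (lebesgue_on {0..2*pi})"
    using \<phi> by (intro continuous_imp_measurable_on_sets_lebesgue) (auto intro: continuous_on_subset)
  have [measurable]: "f \<in> borel_measurable (lebesgue_on {0..2*pi})" using f by auto
  show ?thesis
  proof (rule Bochner_Integration.integrable_bound)
    show "integrable (lebesgue_on {0..2*pi}) (\<lambda>t. M * f t)" using f by auto
    show "AE t in lebesgue_on {0..2*pi}. norm (f t * \<phi> t) \<le> norm (M * f t)"
    proof (rule AE_I2)
      fix t assume "t \<in> space (lebesgue_on {0..2*pi})"
      then have "\<bar>\<phi> t\<bar> \<le> M" using M by auto
      then show "norm (f t * \<phi> t) \<le> norm (M * f t)"
        using M by (simp add: abs_mult mult.commute[of "\<bar>f t\<bar>"] mult_right_mono)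
    qed
  qed measurable
qed

text \<open>Interface to the filter of \<open>has_boundary_value\<close>, which ignores null sets of
  radii.\<close>

lemma eventually_radius:
  fixes P :: "real \<Rightarrow> bool"
  assumes "AE r in lborel. 0 < r \<and> r < 1 \<longrightarrow> P r"
  shows "eventually P (inf (at_left 1) (ae_filter lebesgue))"
  unfolding eventually_inf
proof (intro exI conjI)
  show "eventually (\<lambda>r. 0 < r \<and> r < 1) (at_left (1::real))"
    using eventually_at_left_real[of 0 1] by simp
  show "AE r in lebesgue. 0 < r \<and> r < 1 \<longrightarrow> P r" by (rule AE_completion[OF assms])
qed auto

text \<open>A null set of the disk meets almost every circle in a null set of angles, and the
  remaining radii are invisible to the filter. These exceptional radii do not depend on the test
  function.\<close>

lemma has_boundary_value_cong_AE:
  fixes u v :: "complex \<Rightarrow> real"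
  assumes eq: "AE z in lborel. z \<in> disk \<longrightarrow> u z = v z"
  shows "has_boundary_value u b \<longleftrightarrow> has_boundary_value v b"
proof -
  interpret complete_measure "lebesgue_on {0..2*pi}"
    by (intro complete_measure_lebesgue_on) auto
  have "AE r in lborel. 0 < r \<and> r < 1 \<longrightarrow> (\<forall>\<phi> :: real \<Rightarrow> real. (LINT t|lebesgue_on {0..2*pi}. u (rcis r t) * \<phi> t)
      = (LINT t|lebesgue_on {0..2*pi}. v (rcis r t) * \<phi> t))"
    using AE_circles_cong[OF eq]
  proof (eventually_elim, intro impI allI)
    fix r :: real and \<phi> :: "real \<Rightarrow> real"
    assume *: "0 < r \<and> r < 1 \<longrightarrow> (AE t in lebesgue_on {0..2*pi}. u (rcis r t) = v (rcis r t))"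
      and r: "0 < r \<and> r < 1"
    have "AE t in lebesgue_on {0..2*pi}. u (rcis r t) = v (rcis r t)" using * r by blast
    then have "AE t in lebesgue_on {0..2*pi}. u (rcis r t) * \<phi> t = v (rcis r t) * \<phi> t"
      by eventually_elim simp
    then show "(LINT t|lebesgue_on {0..2*pi}. u (rcis r t) * \<phi> t)
      = (LINT t|lebesgue_on {0..2*pi}. v (rcis r t) * \<phi> t)"
      by (rule integral_cong_AE_complete)
  qed
  then have ev: "eventually (\<lambda>r. \<forall>\<phi> :: real \<Rightarrow> real. (LINT t|lebesgue_on {0..2*pi}. u (rcis r t) * \<phi> t)
      = (LINT t|lebesgue_on {0..2*pi}. v (rcis r t) * \<phi> t)) (inf (at_left 1) (ae_filter lebesgue))"
    by (rule eventually_radius)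
  have "((\<lambda>r. LINT t|lebesgue_on {0..2*pi}. u (rcis r t) * \<phi> t) \<longlongrightarrow> l) (inf (at_left 1) (ae_filter lebesgue))
     \<longleftrightarrow> ((\<lambda>r. LINT t|lebesgue_on {0..2*pi}. v (rcis r t) * \<phi> t) \<longlongrightarrow> l) (inf (at_left 1) (ae_filter lebesgue))"
    for \<phi> :: "real \<Rightarrow> real" and l
    by (rule tendsto_cong) (use ev in eventually_elim, blast)
  then show ?thesis unfolding has_boundary_value_def by simp
qed

text \<open>Integrals of non-integrable functions are 0 by default and not additive, so
  integrability on almost every circle is what makes the subtraction legitimate.\<close>

lemma has_boundary_value_diff:
  assumes u: "has_boundary_value u a" "AE r in lborel. 0 < r \<and> r < 1 \<longrightarrow> integrable (lebesgue_on {0..2*pi}) (\<lambda>t. u (rcis r t))"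
    and v: "has_boundary_value v b" "AE r in lborel. 0 < r \<and> r < 1 \<longrightarrow> integrable (lebesgue_on {0..2*pi}) (\<lambda>t. v (rcis r t))"
    and a: "integrable (lebesgue_on {0..2*pi}) (\<lambda>t. a (cis t))"
    and b: "integrable (lebesgue_on {0..2*pi}) (\<lambda>t. b (cis t))"
  shows "has_boundary_value (\<lambda>z. u z - v z) (\<lambda>z. a z - b z)"
  unfolding has_boundary_value_def
proof (intro allI impI)
  fix \<phi> assume \<phi>: "smooth_circle \<phi>"
  note S = smooth_circle_continuous(1)[OF \<phi>]
  have ev: "eventually (\<lambda>r. (LINT t|lebesgue_on {0..2*pi}. u (rcis r t) * \<phi> t) - (LINT t|lebesgue_on {0..2*pi}. v (rcis r t) * \<phi> t)
      = (LINT t|lebesgue_on {0..2*pi}. (u (rcis r t) - v (rcis r t)) * \<phi> t)) (inf (at_left 1) (ae_filter lebesgue))"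
  proof (rule eventually_radius, use u(2) v(2) in eventually_elim, intro impI)
    fix r :: real
    assume "0 < r \<and> r < 1 \<longrightarrow> integrable (lebesgue_on {0..2*pi}) (\<lambda>t. u (rcis r t))"
      "0 < r \<and> r < 1 \<longrightarrow> integrable (lebesgue_on {0..2*pi}) (\<lambda>t. v (rcis r t))" "0 < r \<and> r < 1"
    then show "(LINT t|lebesgue_on {0..2*pi}. u (rcis r t) * \<phi> t) - (LINT t|lebesgue_on {0..2*pi}. v (rcis r t) * \<phi> t)
      = (LINT t|lebesgue_on {0..2*pi}. (u (rcis r t) - v (rcis r t)) * \<phi> t)"
      using S by (simp add: left_diff_distrib integrable_mult_continuous)
  qed
  have lim: "(LINT t|lebesgue_on {0..2*pi}. (a (cis t) - b (cis t)) * \<phi> t)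
     = (LINT t|lebesgue_on {0..2*pi}. a (cis t) * \<phi> t) - (LINT t|lebesgue_on {0..2*pi}. b (cis t) * \<phi> t)"
    using a b S by (simp add: left_diff_distrib integrable_mult_continuous)
  show "((\<lambda>r. LINT t|lebesgue_on {0..2*pi}. (u (rcis r t) - v (rcis r t)) * \<phi> t) \<longlongrightarrow>
      (LINT t|lebesgue_on {0..2*pi}. (a (cis t) - b (cis t)) * \<phi> t)) (inf (at_left 1) (ae_filter lebesgue))"
    unfolding lim tendsto_cong[OF ev, symmetric]
    using u(1) v(1) \<phi> unfolding has_boundary_value_def by (intro tendsto_diff) auto
qed

section \<open>The Schwarz integral\<close>

text \<open>The integral in the \<open>p_minus\<close> component of the solution; the one in the
  \<open>p_plus\<close> component is its conjugate by \<open>conj_schwarz_integral\<close>.\<close>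

definition schwarz_integral :: "(complex \<Rightarrow> real) \<Rightarrow> complex \<Rightarrow> complex" where
  "schwarz_integral b z = 1 / (2 * pi * \<i>) *
     contour_integral (circlepath 0 1) (\<lambda>\<zeta>. b \<zeta> * ((\<zeta> + z) / (\<zeta> - z)) * (1 / \<zeta>))"

lemma rcis_1: "rcis 1 t = cis t"
  by (simp add: rcis_def)

lemma schwarz_integral_eq:
  assumes b: "continuous_on (sphere 0 1) b" and z: "z \<in> disk"
  shows "schwarz_integral b z = (LINT s:{0..2*pi}|lborel. b (cis s) * ((cis s + z) / (cis s - z))) / (2 * pi)"
proof -
  have "continuous_on (sphere 0 1) (\<lambda>\<zeta>. b \<zeta> * ((\<zeta> + z) / (\<zeta> - z)) * (1 / \<zeta>))"
    using z by (intro continuous_intros b) auto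
  from circlepath_integral_eq[OF this]
  have "((\<lambda>\<zeta>. b \<zeta> * ((\<zeta> + z) / (\<zeta> - z)) * (1 / \<zeta>)) has_contour_integral
     (LINT t:{0..2*pi}|lborel. b (rcis 1 t) * ((rcis 1 t + z) / (rcis 1 t - z)) * (1 / rcis 1 t) * \<i> * rcis 1 t)) (circlepath 0 1)"
    by simp
  then have "contour_integral (circlepath 0 1) (\<lambda>\<zeta>. b \<zeta> * ((\<zeta> + z) / (\<zeta> - z)) * (1 / \<zeta>))
    = (LINT t:{0..2*pi}|lborel. b (rcis 1 t) * ((rcis 1 t + z) / (rcis 1 t - z)) * (1 / rcis 1 t) * \<i> * rcis 1 t)"
    by (rule contour_integral_unique)
  also have "\<dots> = (LINT t:{0..2*pi}|lborel. \<i> * (b (cis t) * ((cis t + z) / (cis t - z))))"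
    by (intro set_lebesgue_integral_cong) (auto simp: rcis_1)
  also have "\<dots> = \<i> * (LINT t:{0..2*pi}|lborel. (b (cis t) * ((cis t + z) / (cis t - z))))"
    by (rule set_integral_mult_right)
  finally show ?thesis by (simp add: schwarz_integral_def)
qed

text \<open>By partial fractions the kernel is \<open>2 / (\<zeta> - z) - 1 / \<zeta>\<close>. Only
  the first term depends on \<open>z\<close>, and its Cauchy integral may be differentiated under
  the integral sign.\<close>

lemma schwarz_integral_holomorphic:
  assumes b: "continuous_on (sphere 0 1) b"
  shows "schwarz_integral b holomorphic_on disk"
proof -
  define F where "F z = contour_integral (circlepath 0 1) (\<lambda>\<zeta>. of_real (2 * b \<zeta>) / (\<zeta> - z))" for z
  have cF: "(\<lambda>\<zeta>. of_real (2 * b \<zeta>) / (\<zeta> - z)) contour_integrable_on (circlepath 0 1)" if "z \<in> disk" for z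
  proof -
    have "continuous_on (sphere 0 1) (\<lambda>\<zeta>. complex_of_real (2 * b \<zeta>) / (\<zeta> - z))"
      using that by (intro continuous_intros b) auto
    from circlepath_integral_eq[OF this] show ?thesis by (auto simp: contour_integrable_on_def)
  qed
  have c0: "(\<lambda>\<zeta>. complex_of_real (b \<zeta>) / \<zeta>) contour_integrable_on (circlepath 0 1)"
  proof -
    have "continuous_on (sphere 0 1) (\<lambda>\<zeta>. complex_of_real (b \<zeta>) / \<zeta>)"
      by (intro continuous_intros b) auto
    from circlepath_integral_eq[OF this] show ?thesis by (auto simp: contour_integrable_on_def)
  qed
  have "F holomorphic_on disk"
    unfolding holomorphic_on_open[OF open_ball]
  proof
    fix z :: complex assume z: "z \<in> disk"
    have "(F has_field_derivative (of_nat 1 * contour_integral (circlepath 0 1) (\<lambda>u. of_real (2 * b u)/(u-z)^(Suc 1)))) (at z)"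
    proof (rule Cauchy_next_derivative_circlepath(2))
      show "continuous_on (path_image (circlepath 0 1)) (\<lambda>u. complex_of_real (2 * b u))"
        by (auto intro!: continuous_intros b)
      show "((\<lambda>u. complex_of_real (2 * b u) / (u - w) ^ 1) has_contour_integral F w) (circlepath 0 1)" if "w \<in> disk" for w
        using has_contour_integral_integral[OF cF[OF that]] by (simp add: F_def)
    qed (use z in auto)
    then show "\<exists>f'. (F has_field_derivative f') (at z)" by blast
  qed
  then have "(\<lambda>z. 1 / (2 * pi * \<i>) * (F z - contour_integral (circlepath 0 1) (\<lambda>\<zeta>. complex_of_real (b \<zeta>) / \<zeta>))) holomorphic_on disk"
    by (intro holomorphic_intros)
  then show ?thesis
  proof (rule holomorphic_transform)
    fix z :: complex assume z: "z \<in> disk"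
    have "F z - contour_integral (circlepath 0 1) (\<lambda>\<zeta>. complex_of_real (b \<zeta>) / \<zeta>)
       = contour_integral (circlepath 0 1) (\<lambda>\<zeta>. of_real (2 * b \<zeta>) / (\<zeta> - z) - complex_of_real (b \<zeta>) / \<zeta>)"
      unfolding F_def by (rule contour_integral_diff[OF cF[OF z] c0, symmetric])
    also have "\<dots> = contour_integral (circlepath 0 1) (\<lambda>\<zeta>. b \<zeta> * ((\<zeta> + z) / (\<zeta> - z)) * (1 / \<zeta>))"
    proof (rule contour_integral_cong[OF refl])
      fix \<zeta> :: complex assume "\<zeta> \<in> path_image (circlepath 0 1)"
      then have "\<zeta> - z \<noteq> 0" "\<zeta> \<noteq> 0" using z by auto
      then show "of_real (2 * b \<zeta>) / (\<zeta> - z) - complex_of_real (b \<zeta>) / \<zeta> = b \<zeta> * ((\<zeta> + z) / (\<zeta> - z)) * (1 / \<zeta>)"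
        by (simp add: field_simps)
    qed
    finally show "1 / (2 * pi * \<i>) * (F z - contour_integral (circlepath 0 1) (\<lambda>\<zeta>. complex_of_real (b \<zeta>) / \<zeta>)) = schwarz_integral b z"
      by (simp add: schwarz_integral_def)
  qed
qed

lemma schwarz_kernel_continuous:
  assumes "z \<in> disk" shows "continuous_on UNIV (\<lambda>s. (cis s + z) / (cis s - z))"
proof -
  have "cis s - z \<noteq> 0" for s using assms by auto
  then show ?thesis by (intro continuous_intros) auto
qed

lemma set_integral_Re:
  assumes "set_integrable M S (f :: _ \<Rightarrow> complex)"
  shows "set_integrable M S (\<lambda>x. Re (f x))" "(LINT x:S|M. Re (f x)) = Re (LINT x:S|M. f x)"
proof -
  have eq: "indicator S x *\<^sub>R Re (f x) = Re (indicator S x *\<^sub>R f x)" for x by simp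
  show "set_integrable M S (\<lambda>x. Re (f x))" "(LINT x:S|M. Re (f x)) = Re (LINT x:S|M. f x)"
    using assms unfolding set_integrable_def set_lebesgue_integral_def eq
    by (auto simp del: scaleR_complex.simps)
qed

definition poisson_kernel :: "complex \<Rightarrow> real \<Rightarrow> real" where
  "poisson_kernel z s = Re ((cis s + z) / (cis s - z))"

lemma poisson_kernel_nonneg:
  assumes "z \<in> disk" shows "poisson_kernel z s \<ge> 0"
proof -
  have "Re ((cis s + z) * cnj (cis s - z)) = (cmod (cis s))\<^sup>2 - (cmod z)\<^sup>2"
    by (simp only: cmod_power2) (simp add: power2_eq_square algebra_simps)
  also have "\<dots> \<ge> 0" using assms by (simp add: power_le_one)
  finally have "0 \<le> Re ((cis s + z) * cnj (cis s - z)) / (cmod (cis s - z))\<^sup>2" by simp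
  then show ?thesis unfolding poisson_kernel_def by (subst complex_div_cnj) (simp del: of_real_power add: Re_divide_of_real of_real_power[symmetric])
qed

lemma poisson_kernel_continuous:
  assumes "z \<in> disk" shows "continuous_on UNIV (poisson_kernel z)"
  unfolding poisson_kernel_def[abs_def] by (intro continuous_intros schwarz_kernel_continuous[OF assms])

text \<open>On the unit circle \<open>(\<zeta> + z) / (\<zeta> - z)\<close> is the conjugate of
  \<open>f \<zeta>\<close>, and \<open>f\<close> is holomorphic on the disk, so everything reduces
  to circle means of holomorphic functions. The functions 1 and \<open>\<zeta>\<close> are the test
  functions of Korovkin's argument.\<close>

lemma
  fixes z :: complex
  assumes z: "z \<in> disk"
  shows poisson_kernel_mean: "(LINT s:{0..2*pi}|lborel. poisson_kernel z s) = 2 * pi"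
    and poisson_kernel_moment: "(LINT s:{0..2*pi}|lborel. poisson_kernel z s * cis s) = 2 * pi * z"
proof -
  define f where "f \<zeta> = (1 + cnj z * \<zeta>) / (1 - cnj z * \<zeta>)" for \<zeta>
  have nz: "1 - cnj z * \<zeta> \<noteq> 0" if "\<zeta> \<in> cball 0 1" for \<zeta>
  proof
    assume "1 - cnj z * \<zeta> = 0"
    then have "cmod (cnj z * \<zeta>) = 1" by simp
    moreover have "cmod z * cmod \<zeta> \<le> cmod z" using that by (simp add: mult_left_le)
    ultimately show False using z by (simp add: norm_mult)
  qed
  have hf: "f holomorphic_on ball 0 1" "continuous_on (cball 0 1) f"
    unfolding f_def using nz by (auto intro!: holomorphic_intros continuous_intros)
  have fc: "continuous_on UNIV (\<lambda>s. f (cis s))"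
    by (intro continuous_on_compose2[OF hf(2)] continuous_intros) auto
  have kern: "(cis s + z) / (cis s - z) = cnj (f (cis s))" for s
  proof -
    have "cis s \<noteq> 0" by simp
    then have "(cis s + z) / (cis s - z) = (cnj (cis s) * (cis s + z)) / (cnj (cis s) * (cis s - z))"
      by (simp del: cis_cnj)
    also have "\<dots> = (1 + z * cnj (cis s)) / (1 - z * cnj (cis s))"
      by (simp add: algebra_simps cis_cnj cis_mult)
    finally show ?thesis by (simp add: f_def)
  qed
  have pk: "poisson_kernel z s = Re (f (cis s))" for s
    by (simp add: poisson_kernel_def kern)
  have m0: "(LINT s:{0..2*pi}|lborel. f (cis s)) = 2 * pi"
    using integral_circle_mean[OF hf(2,1)] by (simp add: rcis_1 f_def)
  show "(LINT s:{0..2*pi}|lborel. poisson_kernel z s) = 2 * pi"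
    unfolding pk using set_integral_Re[OF set_integrable_circle[OF fc]] m0 by simp
  have m1: "(LINT s:{0..2*pi}|lborel. cis s * f (cis s)) = 0"
  proof -
    have "(LINT s:{0..2*pi}|lborel. (\<lambda>\<zeta>. \<zeta> * f \<zeta>) (rcis 1 s)) = 2 * pi * (0 * f 0)"
      by (rule integral_circle_mean) (use hf in \<open>auto intro!: holomorphic_intros continuous_intros\<close>)
    then show ?thesis by (simp add: rcis_1)
  qed
  have m2: "(LINT s:{0..2*pi}|lborel. cis s * cnj (f (cis s))) = 4 * pi * z"
  proof -
    \<comment> \<open>Chosen such that \<open>f \<zeta> = 1 + \<zeta> * ?h \<zeta>\<close>; on the
      circle this makes \<open>\<zeta> * cnj (f \<zeta>)\<close> the conjugate of a holomorphic
      function plus \<open>\<zeta>\<close>.\<close>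
    let ?h = "\<lambda>\<zeta>. 2 * cnj z / (1 - cnj z * \<zeta>)"
    have hh: "?h holomorphic_on ball 0 1" "continuous_on (cball 0 1) ?h"
      using nz by (auto intro!: holomorphic_intros continuous_intros)
    have hc: "continuous_on UNIV (\<lambda>s. ?h (cis s))"
      by (intro continuous_on_compose2[OF hh(2)] continuous_intros) auto
    have eq: "cis s * cnj (f (cis s)) = cnj (?h (cis s)) + cis s" for s
    proof -
      have n: "1 - cnj z * cis s \<noteq> 0" by (intro nz) simp
      have "f (cis s) = cis s * ?h (cis s) + 1"
        unfolding f_def using n by (simp add: field_simps)
      then have "cnj (f (cis s)) = cnj (cis s) * cnj (?h (cis s)) + 1" by simp
      then have "cis s * cnj (f (cis s)) = (cis s * cnj (cis s)) * cnj (?h (cis s)) + cis s"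
        by (simp only: distrib_left mult.assoc mult_1_right)
      then show ?thesis by (simp add: cis_cnj cis_mult)
    qed
    have h0: "(LINT s:{0..2*pi}|lborel. ?h (cis s)) = 4 * pi * cnj z"
      using integral_circle_mean[OF hh(2,1)] by (simp add: rcis_1)
    have c0: "(LINT s:{0..2*pi}|lborel. cis s) = 0"
      using integral_circle_mean[of 1 "\<lambda>\<zeta>. \<zeta>"] by (simp add: rcis_1)
    have "(LINT s:{0..2*pi}|lborel. cis s * cnj (f (cis s))) = (LINT s:{0..2*pi}|lborel. cnj (?h (cis s))) + (LINT s:{0..2*pi}|lborel. cis s)"
      unfolding eq by (intro set_integral_add set_integrable_circle continuous_intros hc)
    also have "(LINT s:{0..2*pi}|lborel. cnj (?h (cis s))) = cnj (4 * pi * cnj z)"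
      by (simp only: set_integral_cnj h0)
    finally show ?thesis using c0 by simp
  qed
  have eq: "poisson_kernel z s * cis s = (cis s * f (cis s) + cis s * cnj (f (cis s))) / 2" for s
    unfolding pk by (simp add: complex_add_cnj distrib_left[symmetric])
  have "(LINT s:{0..2*pi}|lborel. poisson_kernel z s * cis s)
     = (LINT s:{0..2*pi}|lborel. cis s * f (cis s) + cis s * cnj (f (cis s))) / 2"
    unfolding eq by (rule set_integral_divide_zero)
  also have "(LINT s:{0..2*pi}|lborel. cis s * f (cis s) + cis s * cnj (f (cis s)))
     = (LINT s:{0..2*pi}|lborel. cis s * f (cis s)) + (LINT s:{0..2*pi}|lborel. cis s * cnj (f (cis s)))"
    by (intro set_integral_add set_integrable_circle continuous_intros fc)
  finally show "(LINT s:{0..2*pi}|lborel. poisson_kernel z s * cis s) = 2 * pi * z"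
    using m1 m2 by simp
qed

lemma Re_schwarz_integral:
  assumes b: "continuous_on (sphere 0 1) b" and z: "z \<in> disk"
  shows "Re (schwarz_integral b z) = (LINT s:{0..2*pi}|lborel. poisson_kernel z s * b (cis s)) / (2 * pi)"
proof -
  have bc: "continuous_on UNIV (\<lambda>s. b (cis s))"
    by (intro continuous_on_compose2[OF b] continuous_intros) auto
  have int: "set_integrable lborel {0..2*pi} (\<lambda>s. b (cis s) * ((cis s + z) / (cis s - z)))"
    by (intro set_integrable_circle continuous_on_mult continuous_on_of_real bc schwarz_kernel_continuous[OF z])
  have "Re (schwarz_integral b z) = Re (LINT s:{0..2*pi}|lborel. b (cis s) * ((cis s + z) / (cis s - z))) / (2 * pi)"
    unfolding schwarz_integral_eq[OF b z] by (metis Re_divide_of_real of_real_mult of_real_numeral)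
  also have "Re (LINT s:{0..2*pi}|lborel. b (cis s) * ((cis s + z) / (cis s - z)))
     = (LINT s:{0..2*pi}|lborel. Re (b (cis s) * ((cis s + z) / (cis s - z))))"
    by (rule set_integral_Re(2)[OF int, symmetric])
  also have "\<dots> = (LINT s:{0..2*pi}|lborel. poisson_kernel z s * b (cis s))"
  proof -
    have "Re (complex_of_real x * w) = Re w * x" for x w by simp
    then show ?thesis unfolding poisson_kernel_def by (simp only:)
  qed
  finally show ?thesis .
qed

text \<open>Korovkin's argument: by uniform continuity the oscillation of \<open>b\<close> around \<open>a\<close> is at most
  \<open>e + K * (cmod (\<zeta> - a))\<^sup>2\<close>, and the Poisson integral of the right-hand side is explicit.\<close>

lemma poisson_uniform:
  assumes b: "continuous_on (sphere 0 1) b" and e: "e > 0"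
  obtains d where "0 < d" "d < 1" "\<And>r t. d < r \<Longrightarrow> r < 1 \<Longrightarrow> \<bar>Re (schwarz_integral b (rcis r t)) - b (cis t)\<bar> \<le> e"
proof -
  have "compact (b ` sphere 0 1)" by (intro compact_continuous_image b) auto
  then obtain M where M: "M > 0" "\<forall>x\<in>b ` sphere 0 1. norm x \<le> M"
    using compact_imp_bounded bounded_pos by blast
  have "uniformly_continuous_on (sphere 0 1) b"
    by (intro compact_uniformly_continuous b) auto
  then obtain \<delta> where \<delta>: "\<delta> > 0" "\<And>x y. x \<in> sphere 0 1 \<Longrightarrow> y \<in> sphere 0 1 \<Longrightarrow> dist y x < \<delta> \<Longrightarrow> dist (b y) (b x) < e / 2"
    using e unfolding uniformly_continuous_on_def by (metis half_gt_zero)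
  \<comment> \<open>At distance at least \<open>\<delta>\<close> the oscillation is bounded by
    \<open>2 * M\<close>, which equals \<open>K * \<delta>^2\<close>.\<close>
  define K where "K = 2 * M / \<delta>\<^sup>2"
  have K: "K > 0" using M \<delta> by (simp add: K_def)
  have osc: "\<bar>b (cis s) - b (cis t)\<bar> \<le> e / 2 + K * (2 - 2 * Re (cis s * cnj (cis t)))" for s t
  proof -
    \<comment> \<open>On the circle the squared chord is real-affine in \<open>cis s\<close>, so the
      mean and the first moment of the Poisson kernel determine its Poisson integral.\<close>
    have sq: "2 - 2 * Re (cis s * cnj (cis t)) = (cmod (cis s - cis t))\<^sup>2"
    proof -
      have "(cmod (cis s - cis t))\<^sup>2 = (cmod (cis s))\<^sup>2 + (cmod (cis t))\<^sup>2 - 2 * Re (cis s * cnj (cis t))"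
        by (simp only: cmod_power2) (simp add: power2_eq_square algebra_simps)
      then show ?thesis by simp
    qed
    show ?thesis
    proof (cases "dist (cis s) (cis t) < \<delta>")
      case True
      then have "\<bar>b (cis s) - b (cis t)\<bar> < e / 2" using \<delta>(2)[of "cis t" "cis s"] by (simp add: dist_real_def)
      moreover have "K * (2 - 2 * Re (cis s * cnj (cis t))) \<ge> 0" using K unfolding sq by simp
      ultimately show ?thesis by linarith
    next
      case False
      have "\<bar>b (cis s) - b (cis t)\<bar> \<le> \<bar>b (cis s)\<bar> + \<bar>b (cis t)\<bar>" by (rule abs_triangle_ineq4)
      also have "\<dots> \<le> 2 * M"
      proof -
        have "cis x \<in> sphere 0 1" for x by simp
        then have "\<bar>b (cis x)\<bar> \<le> M" for x using M(2) by (metis imageI real_norm_def)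
        from add_mono[OF this[of s] this[of t]] show ?thesis by simp
      qed
      also have "\<dots> = K * \<delta>\<^sup>2" using \<delta> by (simp add: K_def)
      also have "\<dots> \<le> K * (cmod (cis s - cis t))\<^sup>2"
        using False \<delta> K by (intro mult_left_mono power_mono) (auto simp: dist_norm)
      finally show ?thesis using e sq by simp
    qed
  qed
  have bc: "continuous_on UNIV (\<lambda>s. b (cis s))"
    by (intro continuous_on_compose2[OF b] continuous_intros) auto
  have main: "\<bar>Re (schwarz_integral b (rcis r t)) - b (cis t)\<bar> \<le> e / 2 + K * (2 - 2 * r)" if r: "0 < r" "r < 1" for r t
  proof -
    let ?z = "rcis r t"
    have z: "?z \<in> disk" using r by simp
    note P = poisson_kernel_continuous[OF z]
    have "Re (schwarz_integral b ?z) - b (cis t) = (LINT s:{0..2*pi}|lborel. poisson_kernel ?z s * (b (cis s) - b (cis t))) / (2 * pi)"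
    proof -
      have "(LINT s:{0..2*pi}|lborel. poisson_kernel ?z s * (b (cis s) - b (cis t)))
        = (LINT s:{0..2*pi}|lborel. poisson_kernel ?z s * b (cis s)) - (LINT s:{0..2*pi}|lborel. poisson_kernel ?z s * b (cis t))"
        unfolding right_diff_distrib by (intro set_integral_diff set_integrable_circle continuous_intros P bc)
      also have "(LINT s:{0..2*pi}|lborel. poisson_kernel ?z s * b (cis t)) = 2 * pi * b (cis t)"
        by (simp add: poisson_kernel_mean[OF z])
      finally show ?thesis by (simp add: Re_schwarz_integral[OF b z] diff_divide_distrib)
    qed
    also have "\<bar>\<dots>\<bar> \<le> (LINT s:{0..2*pi}|lborel. poisson_kernel ?z s * (e / 2 + K * (2 - 2 * Re (cis s * cnj (cis t))))) / (2 * pi)"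
    proof -
      have "\<bar>LINT s:{0..2*pi}|lborel. poisson_kernel ?z s * (b (cis s) - b (cis t))\<bar>
        \<le> (LINT s:{0..2*pi}|lborel. poisson_kernel ?z s * (e / 2 + K * (2 - 2 * Re (cis s * cnj (cis t)))))"
        unfolding set_lebesgue_integral_def
      proof (rule order_trans[OF integral_abs_bound], rule integral_mono)
        show "integrable lborel (\<lambda>s. \<bar>indicat_real {0..2 * pi} s *\<^sub>R (poisson_kernel ?z s * (b (cis s) - b (cis t)))\<bar>)"
          by (intro integrable_abs set_integrable_circle[unfolded set_integrable_def] continuous_intros P bc)
        show "integrable lborel (\<lambda>s. indicat_real {0..2 * pi} s *\<^sub>R (poisson_kernel ?z s * (e / 2 + K * (2 - 2 * Re (cis s * cnj (cis t))))))"
          by (intro set_integrable_circle[unfolded set_integrable_def] continuous_intros P)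
        show "\<bar>indicat_real {0..2 * pi} s *\<^sub>R (poisson_kernel ?z s * (b (cis s) - b (cis t)))\<bar>
           \<le> indicat_real {0..2 * pi} s *\<^sub>R (poisson_kernel ?z s * (e / 2 + K * (2 - 2 * Re (cis s * cnj (cis t)))))" for s
          using mult_left_mono[OF osc[of s t] poisson_kernel_nonneg[OF z, of s]] poisson_kernel_nonneg[OF z, of s]
          by (cases "s \<in> {0..2*pi}") (simp_all add: abs_mult)
      qed
      then show ?thesis by (simp add: divide_right_mono)
    qed
    also have "(LINT s:{0..2*pi}|lborel. poisson_kernel ?z s * (e / 2 + K * (2 - 2 * Re (cis s * cnj (cis t)))))
      = 2 * pi * (e / 2 + K * (2 - 2 * r))"
    proof -
      have eq: "poisson_kernel ?z s * (e / 2 + K * (2 - 2 * Re (cis s * cnj (cis t))))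
        = (e / 2 + 2 * K) * poisson_kernel ?z s - 2 * K * Re (cnj (cis t) * (poisson_kernel ?z s * cis s))" for s
        by (simp add: algebra_simps)
      have c: "continuous_on UNIV (\<lambda>s. cnj (cis t) * (poisson_kernel ?z s * cis s))"
        by (intro continuous_intros P)
      have "(LINT s:{0..2*pi}|lborel. poisson_kernel ?z s * (e / 2 + K * (2 - 2 * Re (cis s * cnj (cis t)))))
        = (LINT s:{0..2*pi}|lborel. (e / 2 + 2 * K) * poisson_kernel ?z s) - (LINT s:{0..2*pi}|lborel. 2 * K * Re (cnj (cis t) * (poisson_kernel ?z s * cis s)))"
        unfolding eq by (intro set_integral_diff set_integrable_circle continuous_intros P)
      also have "(LINT s:{0..2*pi}|lborel. (e / 2 + 2 * K) * poisson_kernel ?z s) = (e / 2 + 2 * K) * (2 * pi)"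
        by (simp only: set_integral_mult_right poisson_kernel_mean[OF z])
      also have "(LINT s:{0..2*pi}|lborel. 2 * K * Re (cnj (cis t) * (poisson_kernel ?z s * cis s))) = 2 * K * Re (cnj (cis t) * (2 * pi * ?z))"
        by (simp only: set_integral_mult_right set_integral_Re[OF set_integrable_circle[OF c]] poisson_kernel_moment[OF z])
      also have "Re (cnj (cis t) * (2 * pi * ?z)) = 2 * pi * r"
      proof -
        have "Re (cnj (cis t) * (2 * pi * ?z)) = 2 * pi * r * (cos t * cos t + sin t * sin t)"
          by (simp add: algebra_simps del: sin_cos_squared_add3)
        then show ?thesis by (simp only: sin_cos_squared_add3)
      qed
      finally show ?thesis by (simp add: algebra_simps)
    qed
    finally show ?thesis by simp
  qed
  \<comment> \<open>For \<open>r > 1 - e / (4 * K)\<close> the remainder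
    \<open>K * (2 - 2 * r)\<close> is below \<open>e / 2\<close>; the maximum with 1/2 keeps the
    radius positive.\<close>
  define d where "d = max (1/2) (1 - e / (4 * K))"
  show ?thesis
  proof (rule that[of d])
    show "0 < d" "d < 1" using e K by (auto simp: d_def)
    fix r t assume r: "d < r" "r < (1::real)"
    then have "1 - e / (4 * K) < r" by (simp add: d_def)
    then have "K * (2 - 2 * r) \<le> e / 2" using K by (simp add: field_simps)
    then show "\<bar>Re (schwarz_integral b (rcis r t)) - b (cis t)\<bar> \<le> e"
      using main[of r t] r \<open>0 < d\<close> by simp
  qed
qed

lemma has_boundary_value_schwarz:
  assumes b: "continuous_on (sphere 0 1) b"
  shows "has_boundary_value (\<lambda>z. Re (schwarz_integral b z)) b"
  unfolding has_boundary_value_def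
proof (intro allI impI)
  fix \<phi> assume "smooth_circle \<phi>"
  then have \<phi>: "continuous_on UNIV \<phi>" by (rule smooth_circle_continuous)
  have bc: "continuous_on UNIV (\<lambda>s. b (cis s))"
    by (intro continuous_on_compose2[OF b] continuous_intros) auto
  have "compact (\<phi> ` {0..2*pi})"
    using \<phi> by (intro compact_continuous_image) (auto intro: continuous_on_subset)
  then obtain M where M: "M > 0" "\<forall>x\<in>\<phi> ` {0..2*pi}. norm x \<le> M"
    using compact_imp_bounded bounded_pos by blast
  have [measurable]: "\<phi> \<in> borel_measurable borel" "(\<lambda>s. b (cis s)) \<in> borel_measurable borel"
    using \<phi> bc by (auto intro: borel_measurable_continuous_onI)
  have cH: "continuous_on UNIV (\<lambda>t. Re (schwarz_integral b (rcis r t)))" if "0 < r" "r < 1" for r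
    using that unfolding rcis_def
    by (intro continuous_intros continuous_on_compose2[OF holomorphic_on_imp_continuous_on[OF schwarz_integral_holomorphic[OF b]]])
       (auto simp: norm_mult)
  have "((\<lambda>r. LINT t|lebesgue_on {0..2*pi}. Re (schwarz_integral b (rcis r t)) * \<phi> t) \<longlongrightarrow>
         (LINT t|lebesgue_on {0..2*pi}. b (cis t) * \<phi> t)) (at_left 1)"
  proof (rule tendstoI)
    fix e :: real assume e: "e > 0"
    \<comment> \<open>Uniform convergence with tolerance \<open>e'\<close> changes the pairing by at
      most \<open>2 * pi * e' * M = e / 2\<close>.\<close>
    define e' where "e' = e / (4 * pi * M)"
    have e': "e' > 0" using e M by (simp add: e'_def)
    obtain d where d: "0 < d" "d < 1" "\<And>r t. d < r \<Longrightarrow> r < 1 \<Longrightarrow> \<bar>Re (schwarz_integral b (rcis r t)) - b (cis t)\<bar> \<le> e'"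
      using poisson_uniform[OF b e'] by blast
    have "eventually (\<lambda>r. d < r \<and> r < 1) (at_left (1::real))"
      using eventually_at_left_real[OF d(2)] by simp
    then show "eventually (\<lambda>r. dist (LINT t|lebesgue_on {0..2*pi}. Re (schwarz_integral b (rcis r t)) * \<phi> t)
         (LINT t|lebesgue_on {0..2*pi}. b (cis t) * \<phi> t) < e) (at_left 1)"
    proof eventually_elim
      case (elim r)
      then have r: "0 < r" "r < 1" using d by auto
      have [measurable]: "(\<lambda>t. Re (schwarz_integral b (rcis r t))) \<in> borel_measurable borel"
        by (intro borel_measurable_continuous_onI cH r)
      have "(LINT t|lebesgue_on {0..2*pi}. Re (schwarz_integral b (rcis r t)) * \<phi> t) - (LINT t|lebesgue_on {0..2*pi}. b (cis t) * \<phi> t)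
        = (LINT t:{0..2*pi}|lborel. Re (schwarz_integral b (rcis r t)) * \<phi> t) - (LINT t:{0..2*pi}|lborel. b (cis t) * \<phi> t)"
        by (subst (1 2) lebesgue_on_integral_eq[OF _ AE_I2]) auto
      also have "\<dots> = (LINT t:{0..2*pi}|lborel. (Re (schwarz_integral b (rcis r t)) - b (cis t)) * \<phi> t)"
        unfolding left_diff_distrib
        by (intro set_integral_diff(2)[symmetric] set_integrable_circle continuous_on_mult cH[OF r] \<phi> bc)
      also have "\<bar>\<dots>\<bar> \<le> (LINT t:{0..2*pi}|lborel. e' * M)"
        unfolding set_lebesgue_integral_def
      proof (rule order_trans[OF integral_abs_bound], rule integral_mono)
        show "integrable lborel (\<lambda>t. \<bar>indicat_real {0..2*pi} t *\<^sub>R ((Re (schwarz_integral b (rcis r t)) - b (cis t)) * \<phi> t)\<bar>)"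
          by (intro integrable_abs set_integrable_circle[unfolded set_integrable_def] continuous_on_mult continuous_on_diff cH[OF r] \<phi> bc)
        show "\<bar>indicat_real {0..2*pi} t *\<^sub>R ((Re (schwarz_integral b (rcis r t)) - b (cis t)) * \<phi> t)\<bar> \<le> indicat_real {0..2*pi} t *\<^sub>R (e' * M)" for t
          using d(3)[of r t] elim M e'
          by (cases "t \<in> {0..2*pi}") (auto simp: abs_mult intro!: mult_mono)
      qed (auto simp: integrable_mult_left)
      also have "\<dots> = 2 * pi * (e' * M)" by (simp add: set_lebesgue_integral_def)
      also have "\<dots> = e / 2" using M by (simp add: e'_def)
      finally show ?case using e by (simp add: dist_real_def)
    qed
  qed
  then show "((\<lambda>r. LINT t|lebesgue_on {0..2*pi}. Re (schwarz_integral b (rcis r t)) * \<phi> t) \<longlongrightarrow>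
         (LINT t|lebesgue_on {0..2*pi}. b (cis t) * \<phi> t)) (inf (at_left 1) (ae_filter lebesgue))"
    by (rule tendsto_mono[OF inf_le1])
qed

lemma Im_schwarz_integral_0:
  assumes b: "continuous_on (sphere 0 1) b"
  shows "Im (schwarz_integral b 0) = 0"
proof -
  have "schwarz_integral b 0 = (LINT s:{0..2*pi}|lborel. complex_of_real (b (cis s))) / (2 * pi)"
    by (subst schwarz_integral_eq[OF b]) auto
  then show ?thesis by (simp add: set_integral_complex_of_real Im_divide_of_real)
qed

section \<open>Mean values over small disks\<close>

lemma measure_ball_complex:
  assumes "r \<ge> 0" shows "measure lborel (ball (c::complex) r) = pi * r\<^sup>2"
  using assms by (simp add: content_ball unit_ball_vol_2)

text \<open>The centre is a null set, so the punctured limit determines the means.\<close>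

lemma disk_mean_tendsto:
  fixes f :: "complex \<Rightarrow> real"
  assumes int: "set_integrable lborel (ball 0 R) f" and R: "R > 0" and f: "(f \<longlongrightarrow> L) (at 0)"
  shows "((\<lambda>r. (LINT z:ball 0 r|lborel. f z) / (pi * r\<^sup>2)) \<longlongrightarrow> L) (at_right 0)"
proof (rule tendstoI)
  fix e :: real assume e: "e > 0"
  obtain d where d: "d > 0" "\<And>z. z \<noteq> 0 \<Longrightarrow> cmod z < d \<Longrightarrow> \<bar>f z - L\<bar> < e / 2"
    using tendstoD[OF f, of "e / 2"] e by (auto simp: eventually_at dist_real_def)
  have "eventually (\<lambda>r. 0 < r \<and> r < min d R) (at_right (0::real))"
    using eventually_at_right_real[of 0 "min d R"] d(1) R by simp
  then show "eventually (\<lambda>r. dist ((LINT z:ball 0 r|lborel. f z) / (pi * r\<^sup>2)) L < e) (at_right 0)"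
  proof eventually_elim
    case (elim r)
    have i1: "set_integrable lborel (ball 0 r) f"
      using elim by (intro set_integrable_subset[OF int]) auto
    have i2: "set_integrable lborel (ball (0::complex) r) (\<lambda>z. c)" for c :: real
      unfolding set_integrable_def
      by (intro integrable_scaleR_left integrable_real_indicator) (auto intro: emeasure_bounded_finite[OF bounded_ball, unfolded infinity_ennreal_def])
    have v: "(LINT z:ball (0::complex) r|lborel. c) = pi * r\<^sup>2 * c" for c :: real
      using elim by (simp add: set_lebesgue_integral_def measure_ball_complex)
    have "(LINT z:ball 0 r|lborel. f z) - pi * r\<^sup>2 * L = (LINT z:ball 0 r|lborel. f z - L)"
      by (simp add: set_integral_diff(2)[OF i1 i2] v)
    also have "\<bar>\<dots>\<bar> \<le> (LINT z:ball (0::complex) r|lborel. e / 2)"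
      unfolding set_lebesgue_integral_def
    proof (rule order_trans[OF integral_abs_bound], rule integral_mono_AE)
      show "integrable lborel (\<lambda>z. \<bar>indicat_real (ball 0 r) z *\<^sub>R (f z - L)\<bar>)"
        using set_integral_diff(1)[OF i1 i2, of L] unfolding set_integrable_def by (rule integrable_abs)
      show "integrable lborel (\<lambda>z::complex. indicat_real (ball 0 r) z *\<^sub>R (e / 2))"
        using i2[of "e / 2"] unfolding set_integrable_def .
      show "AE z in lborel. \<bar>indicat_real (ball 0 r) z *\<^sub>R (f z - L)\<bar> \<le> indicat_real (ball 0 r) z *\<^sub>R (e / 2)"
        using AE_lborel_singleton[of 0]
      proof eventually_elim
        case (elim z)
        then show ?case using d(2)[of z] \<open>0 < r \<and> r < min d R\<close> by (cases "z \<in> ball 0 r") auto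
      qed
    qed
    also have "\<dots> = pi * r\<^sup>2 * (e / 2)" by (rule v)
    finally have "\<bar>(LINT z:ball 0 r|lborel. f z) - pi * r\<^sup>2 * L\<bar> \<le> pi * r\<^sup>2 * (e / 2)" .
    moreover have p: "pi * r\<^sup>2 > 0" using elim by simp
    ultimately have "\<bar>(LINT z:ball 0 r|lborel. f z) - pi * r\<^sup>2 * L\<bar> / (pi * r\<^sup>2) \<le> e / 2"
      by (simp add: divide_le_eq mult.commute)
    moreover have "\<bar>(LINT z:ball 0 r|lborel. f z) / (pi * r\<^sup>2) - L\<bar> = \<bar>(LINT z:ball 0 r|lborel. f z) - pi * r\<^sup>2 * L\<bar> / (pi * r\<^sup>2)"
    proof -
      have "(LINT z:ball 0 r|lborel. f z) / (pi * r\<^sup>2) - L = ((LINT z:ball 0 r|lborel. f z) - pi * r\<^sup>2 * L) / (pi * r\<^sup>2)"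
        using elim by (simp add: diff_divide_distrib)
      then show ?thesis using p by (simp add: abs_divide)
    qed
    ultimately show ?case using e unfolding dist_real_def by linarith
  qed
qed

text \<open>A circle of radius \<open>r\<close> contributes \<open>2 * pi / w\<close> if
  \<open>r < cmod w\<close> and nothing if it is larger, so \<open>2 * pi * r / w\<close> is
  integrated from 0 to \<open>min \<rho> (cmod w)\<close>.\<close>

lemma cauchy_kernel_disk_integral:
  fixes w :: complex
  assumes w: "w \<in> disk" "w \<noteq> 0" and \<rho>: "0 < \<rho>" "\<rho> < 1"
  shows "(LINT z|lborel. of_real (indicator (ball 0 \<rho>) z) * cauchy_kernel z w) = pi * (min \<rho> (cmod w))\<^sup>2 / w"
proof -
  let ?h = "\<lambda>z. of_real (indicator (ball 0 \<rho>) z) * cauchy_kernel z w"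
  have [measurable]: "?h \<in> borel_measurable borel" unfolding cauchy_kernel_def by measurable
  have inth: "integrable lborel ?h"
  proof (rule integrableI_bounded)
    have "(\<integral>\<^sup>+z. ennreal (norm (?h z)) \<partial>lborel) \<le> (\<integral>\<^sup>+z. inverse (ennreal (cmod (w - z))) * indicator disk z \<partial>lborel)"
    proof (rule nn_integral_mono)
      fix z
      show "ennreal (norm (?h z)) \<le> inverse (ennreal (cmod (w - z))) * indicator disk z"
        using cauchy_kernel_singular w \<rho> unfolding singular_kernel_def
        by (cases "z \<in> ball 0 \<rho>") (auto simp: norm_mult)
    qed
    also have "\<dots> \<le> ennreal (4 * pi)" by (rule nn_integral_kernel_le[OF w(1)])
    also have "\<dots> < \<infinity>" by simp
    finally show "(\<integral>\<^sup>+z. ennreal (norm (?h z)) \<partial>lborel) < \<infinity>" .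
  qed measurable
  let ?m = "min \<rho> (cmod w)"
  have m: "?m > 0" using w \<rho> by simp
  have inner: "(LINT t:{0..2*pi}|lborel. ?h (rcis r t)) = (if r < ?m then 2 * pi / w else 0)"
    if r: "0 < r" "r \<noteq> cmod w" for r
  proof -
    have "(LINT t:{0..2*pi}|lborel. ?h (rcis r t)) = (LINT t:{0..2*pi}|lborel. of_real (indicator {..<\<rho>} r) * cauchy_kernel (rcis r t) w)"
      using r by (intro set_lebesgue_integral_cong) (auto simp: indicator_def)
    also have "\<dots> = of_real (indicator {..<\<rho>} r) * (LINT t:{0..2*pi}|lborel. cauchy_kernel (rcis r t) w)"
      by (rule set_integral_mult_right)
    also have "\<dots> = (if r < ?m then 2 * pi / w else 0)"
      using r cauchy_kernel_circle_mean[of r w] by (auto simp: indicator_def)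
    finally show ?thesis .
  qed
  have "(LINT z|lborel. ?h z) = (LINT r:{0<..}|lborel. r *\<^sub>R (LINT t:{0..2*pi}|lborel. ?h (rcis r t)))"
    by (rule integral_polar[OF inth])
  also have "\<dots> = (LINT r|lborel. indicator {0..?m} r *\<^sub>R (of_real r * (2 * pi / w)))"
    unfolding set_lebesgue_integral_def[of _ "{0<..}"]
  proof (rule integral_cong_AE)
    show "(\<lambda>r. indicat_real {0<..} r *\<^sub>R r *\<^sub>R (LINT t:{0..2*pi}|lborel. ?h (rcis r t))) \<in> borel_measurable lborel"
      unfolding set_lebesgue_integral_def by measurable
    show "AE r in lborel. indicat_real {0<..} r *\<^sub>R r *\<^sub>R (LINT t:{0..2*pi}|lborel. ?h (rcis r t))
      = indicator {0..?m} r *\<^sub>R (of_real r * (2 * pi / w))"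
      using AE_lborel_singleton[of 0] AE_lborel_singleton[of "cmod w"] AE_lborel_singleton[of ?m]
    proof eventually_elim
      case (elim r)
      then show ?case
        using inner[of r] by (cases "r > 0") (auto simp: indicator_def scaleR_conv_of_real)
    qed
  qed measurable
  also have "\<dots> = of_real (?m\<^sup>2 / 2) * (2 * pi / w) - of_real (0\<^sup>2 / 2) * (2 * pi / w)"
  proof (rule integral_FTC_atLeastAtMost)
    fix r :: real
    have "((\<lambda>r. r\<^sup>2 / 2) has_real_derivative r) (at r within {0..?m})"
      by (auto intro!: derivative_eq_intros)
    then have "((\<lambda>r. complex_of_real (r\<^sup>2 / 2)) has_vector_derivative of_real r) (at r within {0..?m})"
      by (intro has_vector_derivative_of_real) (simp add: has_real_derivative_iff_has_vector_derivative)
    then show "((\<lambda>r. of_real (r\<^sup>2 / 2) * (2 * pi / w)) has_vector_derivative of_real r * (2 * pi / w)) (at r within {0..?m})"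
      by (rule has_vector_derivative_mult_left)
  qed (use m in \<open>auto intro!: continuous_intros\<close>)
  also have "\<dots> = pi * ?m\<^sup>2 / w" using w by (simp add: field_simps)
  finally show ?thesis .
qed

text \<open>At 0 the Cauchy integral would be the integral of \<open>g w / w\<close>, of which only
  the imaginary part is known to converge. Averaging first and exchanging the integrals inserts the
  real weight \<open>(min r (cmod w))^2 / r^2\<close>, so that \<open>Im\<close> falls on
  \<open>g w / w\<close> alone. The weight is at most 1 and tends to 1 for
  \<open>w \<noteq> 0\<close>.\<close>

lemma cauchy_integral_disk_mean:
  assumes g: "integrable lborel g" "\<And>w. w \<notin> disk \<Longrightarrow> g w = 0" and im: "integrable lborel (\<lambda>w. Im (g w / w))"
  shows "((\<lambda>r. (LINT z:ball 0 r|lborel. Im (kernel_integral cauchy_kernel g z)) / (pi * r\<^sup>2))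
     \<longlongrightarrow> (LINT w|lborel. Im (g w / w))) (at_right 0)"
proof (rule tendsto_at_right_sequentially[where b = 1])
  fix s :: "nat \<Rightarrow> real"
  assume s: "\<And>n. 0 < s n" "\<And>n. s n < 1" "decseq s" "s \<longlonglongrightarrow> 0"
  have [measurable]: "g \<in> borel_measurable borel" using g by auto
  have eq: "(LINT z:ball 0 (s n)|lborel. Im (kernel_integral cauchy_kernel g z)) / (pi * (s n)\<^sup>2)
     = (LINT w|lborel. Im (g w / w) * ((min (s n) (cmod w))\<^sup>2 / (s n)\<^sup>2))" for n
  proof -
    let ?r = "s n"
    let ?m = "\<lambda>w::complex. (min ?r (cmod w))\<^sup>2"
    have r: "0 < ?r" "?r < 1" using s by auto
    let ?i = "\<lambda>z. complex_of_real (indicator (ball 0 ?r) z)"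
    have i1: "?i \<in> borel_measurable borel" by measurable
    have i2: "cmod (?i z) \<le> 1 * indicator disk z" for z
      using r order_less_trans[of "cmod z" ?r 1] by (auto simp: indicator_def)
    note P = kernel_integral_pairing[OF g cauchy_kernel_singular i1 i2]
    have Pi: "integrable lborel (\<lambda>z. kernel_integral cauchy_kernel g z * ?i z)" by (rule P(1))
    have Pv: "(LINT z|lborel. kernel_integral cauchy_kernel g z * ?i z) = (LINT w|lborel. g w * (LINT z|lborel. ?i z * cauchy_kernel z w))"
      by (rule P(2))
    have "(LINT z:ball 0 ?r|lborel. Im (kernel_integral cauchy_kernel g z)) = (LINT z|lborel. Im (kernel_integral cauchy_kernel g z * ?i z))"
      unfolding set_lebesgue_integral_def by (intro Bochner_Integration.integral_cong refl) (simp add: indicator_def)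
    also have "\<dots> = Im (LINT w|lborel. g w * (LINT z|lborel. ?i z * cauchy_kernel z w))"
      using Pi by (simp only: integral_Im Pv)
    also have "(LINT w|lborel. g w * (LINT z|lborel. ?i z * cauchy_kernel z w)) = (LINT w|lborel. g w * (of_real (pi * ?m w) / w))"
    proof (rule integral_cong_AE)
      show "AE w in lborel. g w * (LINT z|lborel. ?i z * cauchy_kernel z w) = g w * (of_real (pi * ?m w) / w)"
        using AE_lborel_singleton[of 0]
      proof eventually_elim
        case (elim w)
        then show ?case using cauchy_kernel_disk_integral[OF _ _ r, of w] g(2)[of w] by (cases "w \<in> disk") auto
      qed
    qed (unfold cauchy_kernel_def, measurable)
    also have "Im (LINT w|lborel. g w * (of_real (pi * ?m w) / w)) = (LINT w|lborel. Im (g w * (of_real (pi * ?m w) / w)))"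
    proof (rule integral_Im[symmetric], rule Bochner_Integration.integrable_bound)
      show "integrable lborel (\<lambda>w. pi * cmod (g w))" using g by auto
      show "AE w in lborel. norm (g w * (of_real (pi * ?m w) / w)) \<le> norm (pi * cmod (g w))"
      proof (rule AE_I2)
        fix w
        \<comment> \<open>One factor of the square is at most \<open>cmod w\<close> and the other at
          most \<open>?r < 1\<close>, so the singularity is absorbed and
          \<open>pi * cmod (g w)\<close> dominates.\<close>
        have "?m w / cmod w \<le> 1"
        proof (cases "w = 0")
          case False
          have "?m w \<le> 1 * cmod w" unfolding power2_eq_square using r by (intro mult_mono) auto
          then show ?thesis using False by (simp add: divide_le_eq)
        qed auto
        then have "cmod (g w) * pi * (?m w / cmod w) \<le> cmod (g w) * pi * 1"
          by (intro mult_left_mono) auto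
        then show "norm (g w * (of_real (pi * ?m w) / w)) \<le> norm (pi * cmod (g w))"
          by (simp add: norm_mult norm_divide norm_power mult_ac)
      qed
    qed measurable
    also have "(LINT w|lborel. Im (g w * (of_real (pi * ?m w) / w))) = (LINT w|lborel. pi * ?m w * Im (g w / w))"
    proof (intro Bochner_Integration.integral_cong refl)
      fix w
      have "g w * (of_real (pi * ?m w) / w) = of_real (pi * ?m w) * (g w / w)" by simp
      moreover have "Im (complex_of_real x * y) = x * Im y" for x y by simp
      ultimately show "Im (g w * (of_real (pi * ?m w) / w)) = pi * ?m w * Im (g w / w)" by (simp only:)
    qed
    finally have "(LINT z:ball 0 ?r|lborel. Im (kernel_integral cauchy_kernel g z)) / (pi * ?r\<^sup>2) = (LINT w|lborel. pi * ?m w * Im (g w / w)) / (pi * ?r\<^sup>2)"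
      by simp
    also have "\<dots> = (LINT w|lborel. pi * ?m w * Im (g w / w) / (pi * ?r\<^sup>2))"
      by (rule integral_divide_zero[symmetric])
    also have "\<dots> = (LINT w|lborel. Im (g w / w) * (?m w / ?r\<^sup>2))"
      by (intro Bochner_Integration.integral_cong refl) simp
    finally show ?thesis .
  qed
  show "(\<lambda>n. (LINT z:ball 0 (s n)|lborel. Im (kernel_integral cauchy_kernel g z)) / (pi * (s n)\<^sup>2))
     \<longlonglongrightarrow> (LINT w|lborel. Im (g w / w))"
    unfolding eq
  proof (rule integral_dominated_convergence)
    show "integrable lborel (\<lambda>w. \<bar>Im (g w / w)\<bar>)" using im by (rule integrable_abs)
    show "AE w in lborel. (\<lambda>n. Im (g w / w) * ((min (s n) (cmod w))\<^sup>2 / (s n)\<^sup>2)) \<longlonglongrightarrow> Im (g w / w)"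
    proof (rule AE_I2)
      fix w
      show "(\<lambda>n. Im (g w / w) * ((min (s n) (cmod w))\<^sup>2 / (s n)\<^sup>2)) \<longlonglongrightarrow> Im (g w / w)"
      proof (cases "w = 0")
        case False
        then have "eventually (\<lambda>n. s n < cmod w) sequentially"
          using order_tendstoD(2)[OF s(4), of "cmod w"] by simp
        then have "eventually (\<lambda>n. Im (g w / w) * ((min (s n) (cmod w))\<^sup>2 / (s n)\<^sup>2) = Im (g w / w)) sequentially"
        proof eventually_elim
          case (elim n)
          then show ?case using s(1)[of n] by (simp add: min_def)
        qed
        then show ?thesis by (rule tendsto_eventually)
      qed simp
    qed
    show "AE w in lborel. norm (Im (g w / w) * ((min (s n) (cmod w))\<^sup>2 / (s n)\<^sup>2)) \<le> \<bar>Im (g w / w)\<bar>" for n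
    proof (rule AE_I2)
      fix w
      have "(min (s n) (cmod w))\<^sup>2 / (s n)\<^sup>2 \<le> 1"
        using s(1)[of n] by (simp add: divide_le_eq power_mono)
      then have "\<bar>Im (g w / w)\<bar> * ((min (s n) (cmod w))\<^sup>2 / (s n)\<^sup>2) \<le> \<bar>Im (g w / w)\<bar> * 1"
        by (intro mult_left_mono) auto
      then show "norm (Im (g w / w) * ((min (s n) (cmod w))\<^sup>2 / (s n)\<^sup>2)) \<le> \<bar>Im (g w / w)\<bar>"
        by (simp add: abs_mult)
    qed
  qed measurable
qed simp

text \<open>For \<open>cmod z < 1/2\<close> the denominator has modulus at least 1/2, so on the
  support of \<open>g\<close> the kernel is at most \<open>2 * cmod z\<close>.\<close>

lemma reflected_kernel_integral_tendsto_0: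
  assumes g: "integrable lborel g" "\<And>w. w \<notin> disk \<Longrightarrow> g w = 0"
  shows "(kernel_integral reflected_kernel g \<longlongrightarrow> 0) (at 0)"
proof (rule Lim_null_comparison)
  have [measurable]: "g \<in> borel_measurable borel" using g by auto
  have "eventually (\<lambda>z. cmod z < 1/2) (at (0::complex))"
    by (auto simp: eventually_at dist_norm intro!: exI[of _ "1/2"])
  then show "eventually (\<lambda>z. norm (kernel_integral reflected_kernel g z) \<le> 2 * cmod z * (LINT w|lborel. cmod (g w))) (at 0)"
  proof eventually_elim
    case (elim z)
    have b: "norm (g w * reflected_kernel z w) \<le> 2 * cmod z * cmod (g w)" for w
    proof (cases "w \<in> disk")
      case True
      have "cmod (z * cnj w) \<le> 1/2 * 1"
        using True elim unfolding norm_mult by (intro mult_mono) auto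
      then have "1/2 \<le> cmod (1 - z * cnj w)"
        using norm_triangle_ineq2[of 1 "z * cnj w"] by simp
      then have "cmod z / cmod (1 - z * cnj w) \<le> cmod z / (1/2)"
        by (intro divide_left_mono) auto
      then have "cmod (g w) * (cmod z / cmod (1 - z * cnj w)) \<le> cmod (g w) * (cmod z / (1/2))"
        by (intro mult_left_mono) auto
      then show ?thesis by (simp add: reflected_kernel_def norm_mult norm_divide mult_ac)
    qed (use g in auto)
    have "norm (kernel_integral reflected_kernel g z) \<le> (LINT w|lborel. norm (g w * reflected_kernel z w))"
      unfolding kernel_integral_def by (rule integral_norm_bound)
    also have "\<dots> \<le> (LINT w|lborel. 2 * cmod z * cmod (g w))"
    proof (rule integral_mono)
      show i: "integrable lborel (\<lambda>w. 2 * cmod z * cmod (g w))" using g by auto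
      have "integrable lborel (\<lambda>w. g w * reflected_kernel z w)"
        by (rule Bochner_Integration.integrable_bound[OF i])
           (use b in \<open>auto simp: reflected_kernel_def abs_mult\<close>)
      then show "integrable lborel (\<lambda>w. norm (g w * reflected_kernel z w))" by (rule integrable_norm)
    qed (rule b)
    finally show ?case by simp
  qed
  show "((\<lambda>z. 2 * cmod z * (LINT w|lborel. cmod (g w))) \<longlongrightarrow> 0) (at 0)"
    by (auto intro!: tendsto_eq_intros)
qed

section \<open>Existence for one component\<close>

lemma kernel_integrals_Im_mean:
  assumes g: "integrable lborel g" "\<And>w. w \<notin> disk \<Longrightarrow> g w = 0" and im: "integrable lborel (\<lambda>w. Im (g w / w))"
    and h: "isCont h 0" "set_integrable lborel disk h"
  shows "((\<lambda>r. (LINT z:ball 0 r|lborel. h z - (Im (kernel_integral cauchy_kernel g z)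
     + Im (kernel_integral reflected_kernel (\<lambda>w. cnj (g w)) z)) / pi) / (pi * r\<^sup>2))
     \<longlongrightarrow> h 0 - (LINT w|lborel. Im (g w / w)) / pi) (at_right 0)"
proof -
  let ?C = "kernel_integral cauchy_kernel g"
  let ?E = "kernel_integral reflected_kernel (\<lambda>w. cnj (g w))"
  have g': "integrable lborel (\<lambda>w. cnj (g w))" "\<And>w. w \<notin> disk \<Longrightarrow> cnj (g w) = 0"
    using g by auto
  have Im_int: "set_integrable lborel S (\<lambda>z. Im (f z))" if "set_integrable lborel S f" for S and f :: "complex \<Rightarrow> complex"
  proof -
    have eq: "indicator S x *\<^sub>R Im (f x) = Im (indicator S x *\<^sub>R f x)" for x by simp
    show ?thesis using that unfolding set_integrable_def eq by (rule integrable_Im)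
  qed
  have C: "set_integrable lborel disk (\<lambda>z. Im (?C z))"
    by (rule Im_int, rule kernel_integral_integrable[OF g cauchy_kernel_singular])
  have E: "set_integrable lborel disk (\<lambda>z. Im (?E z))"
    by (rule Im_int, rule kernel_integral_integrable[OF g' reflected_kernel_singular])
  have E0: "(?E \<longlongrightarrow> 0) (at 0)" by (rule reflected_kernel_integral_tendsto_0[OF g'])
  have lim: "((\<lambda>r. (LINT z:ball 0 r|lborel. h z) / (pi * r\<^sup>2)
     - ((LINT z:ball 0 r|lborel. Im (?C z)) / (pi * r\<^sup>2) + (LINT z:ball 0 r|lborel. Im (?E z)) / (pi * r\<^sup>2)) / pi)
     \<longlongrightarrow> h 0 - ((LINT w|lborel. Im (g w / w)) + 0) / pi) (at_right 0)"
  proof (intro tendsto_intros)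
    show "((\<lambda>r. (LINT z:ball 0 r|lborel. h z) / (pi * r\<^sup>2)) \<longlongrightarrow> h 0) (at_right 0)"
      using h by (intro disk_mean_tendsto[of 1]) (auto simp: isCont_def)
    show "((\<lambda>r. (LINT z:ball 0 r|lborel. Im (?C z)) / (pi * r\<^sup>2)) \<longlongrightarrow> (LINT w|lborel. Im (g w / w))) (at_right 0)"
      by (rule cauchy_integral_disk_mean[OF g im])
    show "((\<lambda>r. (LINT z:ball 0 r|lborel. Im (?E z)) / (pi * r\<^sup>2)) \<longlongrightarrow> 0) (at_right 0)"
      using E tendsto_Im[OF E0] by (intro disk_mean_tendsto[of 1]) auto
  qed simp
  have "eventually (\<lambda>r. 0 < r \<and> r < 1) (at_right (0::real))"
    using eventually_at_right_real[of 0 1] by simp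
  then have ev: "eventually (\<lambda>r. (LINT z:ball 0 r|lborel. h z) / (pi * r\<^sup>2)
     - ((LINT z:ball 0 r|lborel. Im (?C z)) / (pi * r\<^sup>2) + (LINT z:ball 0 r|lborel. Im (?E z)) / (pi * r\<^sup>2)) / pi
     = (LINT z:ball 0 r|lborel. h z - (Im (?C z) + Im (?E z)) / pi) / (pi * r\<^sup>2)) (at_right 0)"
  proof eventually_elim
    case (elim r)
    have sub: "set_integrable lborel (ball 0 r) f" if "set_integrable lborel disk f" for f :: "complex \<Rightarrow> real"
      using elim by (intro set_integrable_subset[OF that]) auto
    note h' = sub[OF h(2)] note C' = sub[OF C] note E' = sub[OF E]
    have CE: "set_integrable lborel (ball 0 r) (\<lambda>z. (Im (?C z) + Im (?E z)) / pi)"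
      using set_integral_add(1)[OF C' E'] by (rule set_integrable_divide)
    show ?case
      unfolding set_integral_diff(2)[OF h' CE] set_integral_divide_zero set_integral_add(2)[OF C' E']
      by (simp add: diff_divide_distrib add_divide_distrib mult.commute)
  qed
  show ?thesis using lim unfolding tendsto_cong[OF ev] by simp
qed

text \<open>Let \<open>A\<close> be the integral of \<open>Im (g w / w)\<close>. Almost everywhere
  \<open>T_op g\<close> is \<open>\<i> * A / pi\<close> minus \<open>1 / pi\<close> times the sum of
  the kernel integrals; the constant joins the Schwarz integral in \<open>H\<close>. In the mean
  over small disks the kernel integrals contribute \<open>- A / pi\<close> to the imaginary part,
  which leaves \<open>c\<close>.\<close>

theorem schwarz_problem_existence:
  fixes b :: "complex \<Rightarrow> real" and c :: real and g :: "complex \<Rightarrow> complex"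
  assumes b: "continuous_on (sphere 0 1) b"
    and g: "integrable (lebesgue_on disk) g"
    and T: "AE z in lebesgue_on disk. integrable (lebesgue_on disk) (T_kernel g z)"
  defines "u \<equiv> \<lambda>z. schwarz_integral b z + \<i> * c + T_op g z"
  shows "has_weak_dzbar u g" "has_boundary_value (\<lambda>z. Re (u z)) b"
    "mean_value_at_0 (\<lambda>z. Im (u z))" "Im (u 0) = c"
proof -
  obtain G where Gm [measurable]: "G \<in> borel_measurable borel"
    and gG: "AE w in lborel. w \<in> disk \<longrightarrow> g w = G w" and G0: "\<And>w. w \<notin> disk \<Longrightarrow> G w = 0"
    by (rule lebesgue_on_borel_representative[OF borel_measurable_integrable[OF g] borel_open[OF open_ball]]) blast
  have restr: "(\<lambda>w. indicator disk w *\<^sub>R f w) = f" if "\<And>w. w \<notin> disk \<Longrightarrow> f w = 0" for f :: "complex \<Rightarrow> complex"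
    using that by (auto simp: indicator_def fun_eq_iff)
  have GG: "(\<lambda>w. indicator disk w *\<^sub>R G w) = G"
    by (rule restr) (rule G0)
  have G: "integrable lborel G"
    using g lebesgue_on_integrable_iff[OF borel_open[OF open_ball] gG Gm] by (simp add: set_integrable_def GG)
  have Tm [measurable]: "T_kernel G z \<in> borel_measurable borel" for z
    unfolding T_kernel_def[abs_def] by measurable
  have TgG: "AE w in lborel. w \<in> disk \<longrightarrow> T_kernel g z w = T_kernel G z w" for z
    using gG by eventually_elim (simp add: T_kernel_def)
  have TG0: "T_kernel G z w = 0" if "w \<notin> disk" for z w
    using G0[OF that] by (simp add: T_kernel_def)
  have TGG: "(\<lambda>w. indicator disk w *\<^sub>R T_kernel G z w) = T_kernel G z" for z
    by (rule restr) (rule TG0)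
  have T_op_eq: "T_op g z = - 1 / (2 * pi) * (LINT w|lborel. T_kernel G z w)" for z
    unfolding T_op_def lebesgue_on_integral_eq[OF borel_open[OF open_ball] TgG Tm]
    by (simp add: set_lebesgue_integral_def TGG)
  have "AE z in lebesgue_on disk. integrable lborel (T_kernel G z)"
    using T
  proof eventually_elim
    case (elim z)
    then show ?case
      using lebesgue_on_integrable_iff[OF borel_open[OF open_ball] TgG Tm, of z] by (simp add: set_integrable_def TGG)
  qed
  then have TI: "AE z in lborel. z \<in> disk \<longrightarrow> integrable lborel (T_kernel G z)"
    by (subst (asm) AE_restrict_space_iff) (auto simp: AE_completion_iff)
  have im: "integrable lborel (\<lambda>w. Im (G w / w))"
    by (rule T_kernel_integrable_imp[OF G G0 TI])
  define A where "A = (LINT w|lborel. Im (G w / w))"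
  let ?C = "kernel_integral cauchy_kernel G"
  let ?E = "kernel_integral reflected_kernel (\<lambda>w. cnj (G w))"
  define H where "H z = schwarz_integral b z + \<i> * of_real (c + A / pi)" for z
  have G': "integrable lborel (\<lambda>w. cnj (G w))" "\<And>w. w \<notin> disk \<Longrightarrow> cnj (G w) = 0"
    using G G0 by auto
  have [measurable]: "?C \<in> borel_measurable borel" by (rule kernel_integral_measurable[OF G G0 cauchy_kernel_singular])
  have [measurable]: "?E \<in> borel_measurable borel" by (rule kernel_integral_measurable[OF G' reflected_kernel_singular])
  have Hh: "H holomorphic_on disk"
    unfolding H_def by (intro holomorphic_intros schwarz_integral_holomorphic[OF b])
  have int_T: "AE z in lborel. z \<in> disk \<longrightarrow>
      (LINT w|lborel. T_kernel G z w) = - 2 * \<i> * (LINT w|lborel. Im (G w / w)) + 2 * ?C z + 2 * ?E z"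
    by (rule integral_T_kernel[OF G G0 TI])
  have uU: "AE z in lborel. z \<in> disk \<longrightarrow> u z = H z - (?C z + ?E z) / pi"
    using int_T
  proof (eventually_elim, intro impI)
    fix z assume "z \<in> disk" "z \<in> disk \<longrightarrow>
      (LINT w|lborel. T_kernel G z w) = - 2 * \<i> * (LINT w|lborel. Im (G w / w)) + 2 * ?C z + 2 * ?E z"
    then have v: "(LINT w|lborel. T_kernel G z w) = - 2 * \<i> * A + 2 * ?C z + 2 * ?E z"
      by (simp add: A_def)
    show "u z = H z - (?C z + ?E z) / pi"
      unfolding u_def H_def T_op_eq v by (simp add: field_simps)
  qed
  have weak: "has_weak_dzbar (\<lambda>z. H z - (?C z + ?E z) / pi) G"
    by (rule has_weak_dzbar_kernel_integrals[OF G G0 Hh])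
  then show "has_weak_dzbar u g"
    using has_weak_dzbar_cong_AE[OF uU gG] by simp
  have HB: "has_boundary_value (\<lambda>z. Re (H z)) b"
    using has_boundary_value_schwarz[OF b] by (simp add: H_def)
  have CEB: "has_boundary_value (\<lambda>z. Re (?C z + ?E z) / pi) (\<lambda>z. 0)"
  proof -
    have B: "has_boundary_value (\<lambda>z. Re (?C z + ?E z)) (\<lambda>z. 0)"
      by (rule has_boundary_value_kernel_integrals[OF G G0])
    show ?thesis unfolding has_boundary_value_def
    proof (intro allI impI)
      fix \<phi> assume "smooth_circle \<phi>"
      with B have "((\<lambda>r. (LINT t|lebesgue_on {0..2*pi}. Re (?C (rcis r t) + ?E (rcis r t)) * \<phi> t) / pi)
           \<longlongrightarrow> (LINT t|lebesgue_on {0..2*pi}. 0 * \<phi> t) / pi) (inf (at_left 1) (ae_filter lebesgue))"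
        unfolding has_boundary_value_def by (intro tendsto_divide) auto
      moreover have "(LINT t|lebesgue_on {0..2*pi}. Re (?C (rcis r t) + ?E (rcis r t)) * \<phi> t) / pi
         = (LINT t|lebesgue_on {0..2*pi}. Re (?C (rcis r t) + ?E (rcis r t)) / pi * \<phi> t)" for r
        unfolding integral_divide_zero[symmetric] by (intro Bochner_Integration.integral_cong refl) simp
      ultimately show "((\<lambda>r. LINT t|lebesgue_on {0..2*pi}. Re (?C (rcis r t) + ?E (rcis r t)) / pi * \<phi> t)
           \<longlongrightarrow> (LINT t|lebesgue_on {0..2*pi}. 0 * \<phi> t)) (inf (at_left 1) (ae_filter lebesgue))"
        by simp
    qed
  qed
  have H_loc: "L1_loc_disk H"
    by (intro L1_loc_disk_continuous holomorphic_on_imp_continuous_on Hh)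
  have CE_loc: "L1_loc_disk (\<lambda>z. (?C z + ?E z) / pi)"
  proof -
    have 1: "L1_loc_disk (\<lambda>z. H z - (?C z + ?E z) / pi)" using weak by (simp add: has_weak_dzbar_def)
    from L1_loc_disk_diff[OF H_loc 1] show ?thesis by simp
  qed
  have "has_boundary_value (\<lambda>z. Re (H z) - Re (?C z + ?E z) / pi) (\<lambda>z. b z - 0)"
  proof (rule has_boundary_value_diff[OF HB _ CEB])
    show "AE r in lborel. 0 < r \<and> r < 1 \<longrightarrow> integrable (lebesgue_on {0..2*pi}) (\<lambda>t. Re (H (rcis r t)))"
      using L1_loc_circle_integrable[OF H_loc] by eventually_elim auto
    show "AE r in lborel. 0 < r \<and> r < 1 \<longrightarrow> integrable (lebesgue_on {0..2*pi}) (\<lambda>t. Re (?C (rcis r t) + ?E (rcis r t)) / pi)"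
      using L1_loc_circle_integrable[OF CE_loc]
    proof (eventually_elim, intro impI)
      fix r :: real assume "0 < r \<and> r < 1 \<longrightarrow> integrable (lebesgue_on {0..2*pi}) (\<lambda>t. (?C (rcis r t) + ?E (rcis r t)) / pi)" "0 < r \<and> r < 1"
      then have "integrable (lebesgue_on {0..2*pi}) (\<lambda>t. Re ((?C (rcis r t) + ?E (rcis r t)) / pi))"
        by (intro integrable_Re) blast
      then show "integrable (lebesgue_on {0..2*pi}) (\<lambda>t. Re (?C (rcis r t) + ?E (rcis r t)) / pi)"
        by (simp only: Re_divide_of_real)
    qed
    have bc: "continuous_on UNIV (\<lambda>s. b (cis s))"
      by (intro continuous_on_compose2[OF b] continuous_intros) auto
    show "integrable (lebesgue_on {0..2*pi}) (\<lambda>t. b (cis t))"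
      using set_integrable_circle[OF bc] borel_measurable_continuous_onI[OF bc]
      by (subst lebesgue_on_integrable_iff[where F = "\<lambda>t. b (cis t)"]) auto
  qed simp
  moreover have "AE z in lborel. z \<in> disk \<longrightarrow> Re (u z) = Re (H z) - Re (?C z + ?E z) / pi"
    using uU by eventually_elim (simp add: Re_divide_of_real)
  ultimately show "has_boundary_value (\<lambda>z. Re (u z)) b"
    using has_boundary_value_cong_AE by simp
  show u0: "Im (u 0) = c"
  proof -
    \<comment> \<open>The kernel is real at the origin, so the operator has imaginary part 0 there.
      This is true even if the integral diverges, its default value 0 being real.\<close>
    have "T_kernel G 0 = (\<lambda>w. of_real (2 * Re (G w / w)))"
    proof
      fix w
      have "T_kernel G 0 w = G w / w + cnj (G w / w)"
        by (cases "w = 0") (simp_all add: T_kernel_def)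
      then show "T_kernel G 0 w = of_real (2 * Re (G w / w))" by (simp only: complex_add_cnj)
    qed
    then have "T_op g 0 = of_real (- 1 / (2 * pi) * (LINT w|lborel. 2 * Re (G w / w)))"
      unfolding T_op_eq by (simp only: integral_complex_of_real) simp
    then have "Im (T_op g 0) = 0" by (simp only: Im_complex_of_real)
    then show ?thesis unfolding u_def by (simp add: Im_schwarz_integral_0[OF b])
  qed
  \<comment> \<open>Integrability of \<open>H\<close> up to the boundary is avoided: only small
    disks matter, so \<open>Im (H z)\<close> is cut off at radius 1/2.\<close>
  define h where "h z = indicator (cball 0 (1/2)) z *\<^sub>R Im (H z)" for z
  have cH: "continuous_on disk H" by (rule holomorphic_on_imp_continuous_on[OF Hh])
  have hint: "integrable lborel h"
    unfolding h_def by (intro borel_integrable_compact continuous_intros continuous_on_subset[OF cH]) auto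
  have hcont: "isCont h 0"
  proof -
    have "isCont (\<lambda>z. Im (H z)) 0"
      using cH by (auto simp: continuous_on_eq_continuous_at isCont_def intro: tendsto_Im)
    moreover have ev: "eventually (\<lambda>z. h z = Im (H z)) (nhds 0)"
      by (rule eventually_nhds_in_open[of "ball 0 (1/2)", THEN eventually_mono]) (auto simp: h_def)
    ultimately show ?thesis by (simp only: isCont_cong[OF ev])
  qed
  have [measurable]: "h \<in> borel_measurable borel" using hint by auto
  have h0: "h 0 - A / pi = Im (u 0)"
    unfolding u0 by (simp add: h_def H_def Im_schwarz_integral_0[OF b])
  have lim: "((\<lambda>r. (LINT z:ball 0 r|lborel. h z - (Im (?C z) + Im (?E z)) / pi) / (pi * r\<^sup>2)) \<longlongrightarrow> Im (u 0)) (at_right 0)"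
  proof -
    have "set_integrable lborel disk h"
      unfolding set_integrable_def by (rule integrable_mult_indicator[OF _ hint]) simp
    from kernel_integrals_Im_mean[OF G G0 im hcont this]
    show ?thesis unfolding A_def[symmetric] h0 .
  qed
  have "eventually (\<lambda>r. 0 < r \<and> r < 1/2) (at_right (0::real))"
    using eventually_at_right_real[of 0 "1/2"] by simp
  then have ev: "eventually (\<lambda>r. (LINT z|lebesgue_on (ball 0 r). Im (u z)) / (pi * r\<^sup>2)
     = (LINT z:ball 0 r|lborel. h z - (Im (?C z) + Im (?E z)) / pi) / (pi * r\<^sup>2)) (at_right 0)"
  proof eventually_elim
    case (elim r)
    have "AE z in lborel. z \<in> ball 0 r \<longrightarrow> Im (u z) = h z - (Im (?C z) + Im (?E z)) / pi"
      using uU by eventually_elim (use elim in \<open>auto simp: h_def Im_divide_of_real\<close>)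
    then show ?case by (subst lebesgue_on_integral_eq) auto
  qed
  show "mean_value_at_0 (\<lambda>z. Im (u z))"
    using lim unfolding mean_value_at_0_def tendsto_cong[OF ev] .
qed

section \<open>Radial test functions\<close>

text \<open>A profile in the variable \<open>s = (cmod z)^2\<close>. Support away from 1 gives
  compact support in the disk; support away from 0 makes negative powers of \<open>z\<close>
  harmless.\<close>

definition annular :: "(real \<Rightarrow> real) \<Rightarrow> bool" where
  "annular \<theta> \<longleftrightarrow> continuous_on UNIV \<theta> \<and> (\<exists>\<alpha> \<beta>. 0 < \<alpha> \<and> \<alpha> < \<beta> \<and> \<beta> < 1 \<and> (\<forall>s. s \<notin> {\<alpha>..\<beta>} \<longrightarrow> \<theta> s = 0))"

text \<open>The interval begins at -1 in order that \<open>s = 0\<close>, the value at the origin,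
  is an interior point where primitives can be differentiated. Annular profiles vanish for
  \<open>s \<le> 0\<close>, so their integral is unaffected.\<close>

definition total :: "(real \<Rightarrow> real) \<Rightarrow> real" where
  "total \<theta> = integral {-1..1} \<theta>"

text \<open>The square of the modulus is smooth at 0, and its derivative with respect to the
  conjugate variable is simply \<open>z\<close>.\<close>

definition radial :: "(real \<Rightarrow> real) \<Rightarrow> complex \<Rightarrow> complex" where
  "radial \<theta> z = of_real (\<theta> ((cmod z)\<^sup>2))"

lemma annularE:
  assumes "annular \<theta>"
  obtains \<alpha> \<beta> where "0 < \<alpha>" "\<alpha> < \<beta>" "\<beta> < 1" "\<And>s. s \<notin> {\<alpha>..\<beta>} \<Longrightarrow> \<theta> s = 0" "continuous_on UNIV \<theta>"
  using assms unfolding annular_def by blast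

lemma annular_diff_scale:
  assumes "annular \<theta>" "annular \<eta>"
  shows "annular (\<lambda>s. \<theta> s - c * \<eta> s)"
proof -
  obtain \<alpha> \<beta> where 1: "0 < \<alpha>" "\<alpha> < \<beta>" "\<beta> < 1" "\<And>s. s \<notin> {\<alpha>..\<beta>} \<Longrightarrow> \<theta> s = 0" "continuous_on UNIV \<theta>"
    using assms(1) by (rule annularE) blast
  obtain \<alpha>' \<beta>' where 2: "0 < \<alpha>'" "\<alpha>' < \<beta>'" "\<beta>' < 1" "\<And>s. s \<notin> {\<alpha>'..\<beta>'} \<Longrightarrow> \<eta> s = 0" "continuous_on UNIV \<eta>"
    using assms(2) by (rule annularE) blast
  have "continuous_on UNIV (\<lambda>s. \<theta> s - c * \<eta> s)" using 1(5) 2(5) by (intro continuous_intros)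
  moreover have "\<theta> s - c * \<eta> s = 0" if "s \<notin> {min \<alpha> \<alpha>'..max \<beta> \<beta>'}" for s
  proof -
    have "s \<notin> {\<alpha>..\<beta>}" "s \<notin> {\<alpha>'..\<beta>'}" using that by auto
    then show ?thesis using 1(4) 2(4) by simp
  qed
  ultimately show ?thesis
    unfolding annular_def using 1(1-3) 2(1-3)
    by (intro conjI exI[of _ "min \<alpha> \<alpha>'"] exI[of _ "max \<beta> \<beta>'"]) auto
qed

lemma annular_mult:
  assumes "annular \<theta>" "continuous_on UNIV p"
  shows "annular (\<lambda>s. \<theta> s * p s)"
  using assms unfolding annular_def by (auto intro!: continuous_intros)

lemma total_diff_scale:
  assumes "continuous_on UNIV \<theta>" "continuous_on UNIV \<eta>"
  shows "total (\<lambda>s. \<theta> s - c * \<eta> s) = total \<theta> - c * total \<eta>"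
proof -
  have "\<theta> integrable_on {-1..1}" "\<eta> integrable_on {-1..1}"
    using assms by (auto intro!: integrable_continuous_real intro: continuous_on_subset)
  then show ?thesis
    unfolding total_def by (subst Henstock_Kurzweil_Integration.integral_diff) (auto intro: integrable_on_mult_right)
qed

text \<open>The constant of integration is chosen to make \<open>q\<close> vanish beyond the support
  of \<open>\<theta>\<close>, so that \<open>radial q\<close> is a test function. Below the support
  \<open>q\<close> then equals \<open>- total \<theta>\<close>, the obstruction to multiplying by
  negative powers of \<open>z\<close>.\<close>

lemma annular_primitive:
  assumes "annular \<theta>"
  obtains q \<alpha> \<beta> where "0 < \<alpha>" "\<alpha> < \<beta>" "\<beta> < 1" "\<And>s. s \<notin> {\<alpha>..\<beta>} \<Longrightarrow> \<theta> s = 0"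
    "\<And>s. s > -1 \<Longrightarrow> (q has_real_derivative \<theta> s) (at s)"
    "\<And>s. s \<ge> \<beta> \<Longrightarrow> q s = 0" "\<And>s. -1 < s \<Longrightarrow> s \<le> \<alpha> \<Longrightarrow> q s = - total \<theta>"
proof -
  obtain \<alpha> \<beta> where ab: "0 < \<alpha>" "\<alpha> < \<beta>" "\<beta> < 1" "\<And>s. s \<notin> {\<alpha>..\<beta>} \<Longrightarrow> \<theta> s = 0" and c: "continuous_on UNIV \<theta>"
    using assms by (rule annularE) blast
  have cont: "continuous_on S \<theta>" for S using c by (rule continuous_on_subset) auto
  define q where "q s = integral {-1..s} \<theta> - total \<theta>" for s
  \<comment> \<open>The vanishing of \<open>\<theta>\<close> is given off the closed interval only;
    at the end point it follows by continuity.\<close>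
  have zero_ge: "\<theta> s = 0" if "s \<ge> \<beta>" for s
  proof (cases "s = \<beta>")
    case True
    have "(\<theta> \<longlongrightarrow> \<theta> \<beta>) (at_right \<beta>)"
      using c by (auto simp: continuous_on_eq_continuous_at isCont_def intro: tendsto_within_subset)
    moreover have "eventually (\<lambda>s. \<theta> s = 0) (at_right \<beta>)"
      using eventually_at_right_less[of \<beta>] by eventually_elim (auto intro: ab(4))
    ultimately show ?thesis
      using True tendsto_unique[of "at_right \<beta>" \<theta> "\<theta> \<beta>" 0] tendsto_eventually[of \<theta> 0 "at_right \<beta>"] by simp
  qed (use that ab in auto)
  have zero_le: "\<theta> s = 0" if "s \<le> \<alpha>" for s
  proof (cases "s = \<alpha>")
    case True
    have "(\<theta> \<longlongrightarrow> \<theta> \<alpha>) (at_left \<alpha>)"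
      using c by (auto simp: continuous_on_eq_continuous_at isCont_def intro: tendsto_within_subset)
    moreover have "eventually (\<lambda>s. s < \<alpha>) (at_left \<alpha>)"
      by (simp add: eventually_at_filter)
    then have "eventually (\<lambda>s. \<theta> s = 0) (at_left \<alpha>)"
      by eventually_elim (auto intro: ab(4))
    ultimately show ?thesis
      using True tendsto_unique[of "at_left \<alpha>" \<theta> "\<theta> \<alpha>" 0] tendsto_eventually[of \<theta> 0 "at_left \<alpha>"] by simp
  qed (use that ab in auto)
  show ?thesis
  proof (rule that[OF ab])
    fix s :: real assume s: "s > -1"
    have "((\<lambda>x. integral {-1..x} \<theta>) has_real_derivative \<theta> s) (at s within {-1..s+1})"
      using s by (intro integral_has_real_derivative cont) auto
    moreover have "at s within {-1..s+1} = at s"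
      using s by (intro at_within_interior) auto
    ultimately show "(q has_real_derivative \<theta> s) (at s)"
      unfolding q_def by (auto intro!: derivative_eq_intros)
  next
    fix s assume s: "s \<ge> \<beta>"
    have z: "integral {x..y} \<theta> = 0" if "\<beta> \<le> x" for x y
      using that by (subst integral_cong[where g = "\<lambda>_. 0"]) (auto simp: zero_ge)
    show "q s = 0"
    proof (cases "s \<le> 1")
      case True
      have "integral {-1..s} \<theta> + integral {s..1} \<theta> = integral {-1..1} \<theta>"
        using True s ab by (intro Henstock_Kurzweil_Integration.integral_combine integrable_continuous_real cont) auto
      then show ?thesis using z[OF s, of 1] by (simp add: q_def total_def)
    next
      case False
      have "integral {-1..1} \<theta> + integral {1..s} \<theta> = integral {-1..s} \<theta>"
        using False by (intro Henstock_Kurzweil_Integration.integral_combine integrable_continuous_real cont) auto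
      then show ?thesis using z[of 1 s] ab by (simp add: q_def total_def)
    qed
  next
    fix s assume "-1 < s" "s \<le> \<alpha>"
    then have "integral {-1..s} \<theta> = 0"
      by (subst integral_cong[where g = "\<lambda>_. 0"]) (auto simp: zero_le)
    then show "q s = - total \<theta>" by (simp add: q_def)
  qed
qed

lemma
  assumes q: "\<And>s. s > -1 \<Longrightarrow> (q has_real_derivative \<theta> s) (at s)" and \<theta>: "continuous_on UNIV \<theta>"
    and \<beta>: "0 < \<beta>" "\<beta> < 1" "\<And>s. s \<ge> \<beta> \<Longrightarrow> q s = 0"
  shows radial_C1_compact: "C1_compact_disk (radial q)"
    and radial_wirtinger: "wirtinger_zbar (radial q) z = radial \<theta> z * z"
proof -
  define D where "D z h = complex_of_real (\<theta> ((cmod z)\<^sup>2) * (2 * (Re z * Re h + Im z * Im h)))" for z h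
  have der: "(radial q has_derivative D z) (at z)" for z
  proof -
    have 1: "((\<lambda>z. (cmod z)\<^sup>2) has_derivative (\<lambda>h. 2 * (Re z * Re h + Im z * Im h))) (at z)"
      unfolding cmod_power2 by (auto intro!: derivative_eq_intros simp: fun_eq_iff algebra_simps)
    have "(cmod z)\<^sup>2 > -1" by (rule less_le_trans[of _ 0]) auto
    then have "(q has_derivative (\<lambda>x. \<theta> ((cmod z)\<^sup>2) * x)) (at ((cmod z)\<^sup>2))"
      using q unfolding has_field_derivative_def by blast
    from has_derivative_of_real[OF has_derivative_compose[OF 1 this]]
    show ?thesis unfolding radial_def[abs_def] D_def[abs_def] .
  qed
  then have fr: "frechet_derivative (radial q) (at z) = D z" for z
    using frechet_derivative_at by metis
  have cont: "continuous_on UNIV (\<lambda>z. D z h)" for h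
    unfolding D_def by (intro continuous_intros continuous_on_compose2[OF \<theta>]) auto
  have out: "radial q z = 0" if "z \<notin> cball 0 (sqrt \<beta>)" for z
  proof -
    have "sqrt \<beta> < cmod z" using that by simp
    then have "(sqrt \<beta>)\<^sup>2 < (cmod z)\<^sup>2" using \<beta> by (intro power_strict_mono) auto
    then show ?thesis using \<beta> by (simp add: radial_def)
  qed
  show "C1_compact_disk (radial q)"
    unfolding C1_compact_disk_def
  proof (intro conjI allI exI[of _ "cball 0 (sqrt \<beta>)"] impI)
    show "radial q differentiable at z" for z
      using der differentiable_def by blast
    show "cball 0 (sqrt \<beta>) \<subseteq> disk"
    proof
      fix x :: complex assume "x \<in> cball 0 (sqrt \<beta>)"
      then have "cmod x \<le> sqrt \<beta>" by simp
      also have "sqrt \<beta> < 1" using \<beta> by simp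
      finally show "x \<in> disk" by simp
    qed
  qed (use fr cont out in auto)
  show "wirtinger_zbar (radial q) z = radial \<theta> z * z"
    unfolding wirtinger_zbar_def fr D_def radial_def by (simp add: complex_eq_iff)
qed

text \<open>If \<open>d\<close> were a Laurent series with coefficients \<open>a n\<close>, this
  would be \<open>pi * a (- j) * total \<theta>\<close>: the angular integral kills every term
  except \<open>n = - j\<close>, whose powers of \<open>z\<close> cancel.\<close>

definition moment :: "(complex \<Rightarrow> complex) \<Rightarrow> (real \<Rightarrow> real) \<Rightarrow> int \<Rightarrow> complex" where
  "moment d \<theta> j = (LINT z|lborel. d z * (radial \<theta> z * z powi j))"

lemma powi_measurable [measurable]: "(\<lambda>z::complex. z powi j) \<in> borel_measurable borel"
  unfolding power_int_def by measurable

lemma radial_measurable: "annular \<theta> \<Longrightarrow> radial \<theta> \<in> borel_measurable borel"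
  unfolding radial_def[abs_def] annular_def
  by (auto intro!: borel_measurable_continuous_onI continuous_intros intro: continuous_on_compose2)

lemma annular_radial_bounded:
  assumes \<theta>: "annular \<theta>"
  obtains B \<rho> where "B \<ge> 0" "0 < \<rho>" "\<rho> < 1" "\<And>z. cmod (radial \<theta> z * z powi j) \<le> B * indicator (cball 0 \<rho>) z"
proof -
  obtain \<alpha> \<beta> where ab: "0 < \<alpha>" "\<alpha> < \<beta>" "\<beta> < 1" "\<And>s. s \<notin> {\<alpha>..\<beta>} \<Longrightarrow> \<theta> s = 0" and c: "continuous_on UNIV \<theta>"
    using \<theta> by (rule annularE) blast
  \<comment> \<open>A neighbourhood of 0 is removed, so that \<open>z powi j\<close> is continuous
    on the compact set for negative \<open>j\<close> too.\<close>
  let ?K = "{z::complex. \<alpha> \<le> (cmod z)\<^sup>2} \<inter> cball 0 (sqrt \<beta>)"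
  have out: "radial \<theta> z = 0" if "z \<notin> ?K" for z
  proof -
    have "(cmod z)\<^sup>2 \<notin> {\<alpha>..\<beta>}"
    proof
      assume *: "(cmod z)\<^sup>2 \<in> {\<alpha>..\<beta>}"
      then have "sqrt ((cmod z)\<^sup>2) \<le> sqrt \<beta>" by (intro real_sqrt_le_mono) auto
      then show False using * that by simp
    qed
    then show ?thesis using ab(4) by (simp add: radial_def)
  qed
  have "compact ?K"
    by (intro closed_Int_compact closed_Collect_le continuous_intros) auto
  moreover have "continuous_on ?K (\<lambda>z. radial \<theta> z * z powi j)"
    unfolding radial_def using ab
    by (intro continuous_intros continuous_on_compose2[OF c]) auto
  ultimately have "compact ((\<lambda>z. radial \<theta> z * z powi j) ` ?K)"
    by (rule compact_continuous_image[rotated])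
  then obtain B where B: "B > 0" "\<forall>x\<in>(\<lambda>z. radial \<theta> z * z powi j) ` ?K. cmod x \<le> B"
    using compact_imp_bounded bounded_pos by blast
  show ?thesis
  proof (rule that[of B "sqrt \<beta>"])
    show "cmod (radial \<theta> z * z powi j) \<le> B * indicator (cball 0 (sqrt \<beta>)) z" for z
    proof (cases "z \<in> ?K")
      case True
      then have "cmod (radial \<theta> z * z powi j) \<le> B" using B(2) by blast
      then show ?thesis using True by simp
    next
      case False
      have "0 \<le> B * indicator (cball 0 (sqrt \<beta>)) z" using B(1) by (intro mult_nonneg_nonneg) auto
      then show ?thesis using out[OF False] by simp
    qed
  qed (use ab B in auto)
qed

lemma locally_integrable_mult:
  fixes d m :: "complex \<Rightarrow> complex"
  assumes d: "d \<in> borel_measurable borel" "\<And>\<rho>. \<rho> < 1 \<Longrightarrow> set_integrable lborel (cball 0 \<rho>) d"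
    and m: "m \<in> borel_measurable borel" "\<And>z. cmod (m z) \<le> B * indicator (cball 0 \<rho>) z" "\<rho> < 1"
  shows "integrable lborel (\<lambda>z. d z * m z)"
proof (rule Bochner_Integration.integrable_bound)
  have [measurable]: "d \<in> borel_measurable borel" "m \<in> borel_measurable borel" by fact+
  show "integrable lborel (\<lambda>z. B *\<^sub>R (indicator (cball 0 \<rho>) z *\<^sub>R d z))"
    using d(2)[OF m(3)] unfolding set_integrable_def by (rule integrable_scaleR_right)
  show "AE z in lborel. norm (d z * m z) \<le> norm (B *\<^sub>R (indicator (cball 0 \<rho>) z *\<^sub>R d z))"
  proof (rule AE_I2)
    fix z
    have "cmod (d z) * cmod (m z) \<le> cmod (d z) * (B * indicator (cball 0 \<rho>) z)"
      by (intro mult_left_mono m) auto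
    also have "\<dots> \<le> cmod (d z) * (\<bar>B\<bar> * indicator (cball 0 \<rho>) z)"
      by (intro mult_left_mono mult_right_mono) auto
    finally show "norm (d z * m z) \<le> norm (B *\<^sub>R (indicator (cball 0 \<rho>) z *\<^sub>R d z))"
      by (simp add: norm_mult abs_mult mult_ac)
  qed
qed (use d m in measurable)

lemma moment_integrable:
  assumes d: "d \<in> borel_measurable borel" "\<And>\<rho>. \<rho> < 1 \<Longrightarrow> set_integrable lborel (cball 0 \<rho>) d" and \<theta>: "annular \<theta>"
  shows "integrable lborel (\<lambda>z. d z * (radial \<theta> z * z powi j))"
proof -
  obtain B \<rho> where B: "B \<ge> 0" "0 < \<rho>" "\<rho> < 1" "\<And>z. cmod (radial \<theta> z * z powi j) \<le> B * indicator (cball 0 \<rho>) z"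
    using annular_radial_bounded[OF \<theta>] by blast
  have [measurable]: "radial \<theta> \<in> borel_measurable borel"
    using radial_measurable[OF \<theta>] .
  have "(\<lambda>z. radial \<theta> z * z powi j) \<in> borel_measurable borel" by measurable
  from locally_integrable_mult[OF d this B(4,3)] show ?thesis by simp
qed

lemma compact_subset_cball:
  assumes "compact K" "K \<subseteq> disk"
  obtains \<rho> where "\<rho> < 1" "K \<subseteq> cball 0 \<rho>"
proof (cases "K = {}")
  case False
  obtain x where x: "x \<in> K" "\<And>y. y \<in> K \<Longrightarrow> cmod y \<le> cmod x"
    using continuous_attains_sup[of K cmod] assms False continuous_on_norm_id by blast
  show ?thesis using assms x by (intro that[of "cmod x"]) auto
qed (auto intro: that[of 0])

lemma moment_diff_scale:
  assumes d: "d \<in> borel_measurable borel" "\<And>\<rho>. \<rho> < 1 \<Longrightarrow> set_integrable lborel (cball 0 \<rho>) d"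
    and \<theta>: "annular \<theta>" "annular \<eta>"
  shows "moment d (\<lambda>s. \<theta> s - c * \<eta> s) j = moment d \<theta> j - c * moment d \<eta> j"
proof -
  have "moment d (\<lambda>s. \<theta> s - c * \<eta> s) j = (LINT z|lborel. d z * (radial \<theta> z * z powi j) - c * (d z * (radial \<eta> z * z powi j)))"
    unfolding moment_def by (intro Bochner_Integration.integral_cong refl) (simp add: radial_def algebra_simps)
  also have "\<dots> = moment d \<theta> j - c * moment d \<eta> j"
    unfolding moment_def using moment_integrable[OF d \<theta>(1)] moment_integrable[OF d \<theta>(2)]
    by (subst Bochner_Integration.integral_diff) auto
  finally show ?thesis .
qed

text \<open>The test function is \<open>z powi (j - 1) * radial q z\<close> with \<open>q\<close> a primitive of \<open>\<theta>\<close>. It is smooth at 0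
  if \<open>j \<ge> 1\<close> or if \<open>q\<close> vanishes near 0.\<close>

lemma moment_eq_0:
  assumes weak: "\<And>\<phi>. C1_compact_disk \<phi> \<Longrightarrow> (LINT z|lborel. d z * wirtinger_zbar \<phi> z) = 0"
    and \<theta>: "annular \<theta>" and j: "j \<ge> 1 \<or> total \<theta> = 0"
  shows "moment d \<theta> j = 0"
proof -
  have c: "continuous_on UNIV \<theta>" using \<theta> by (simp add: annular_def)
  obtain q \<alpha> \<beta> where q: "0 < \<alpha>" "\<alpha> < \<beta>" "\<beta> < 1" "\<And>s. s \<notin> {\<alpha>..\<beta>} \<Longrightarrow> \<theta> s = 0"
    "\<And>s. s > -1 \<Longrightarrow> (q has_real_derivative \<theta> s) (at s)"
    "\<And>s. s \<ge> \<beta> \<Longrightarrow> q s = 0" "\<And>s. -1 < s \<Longrightarrow> s \<le> \<alpha> \<Longrightarrow> q s = - total \<theta>"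
    by (rule annular_primitive[OF \<theta>]) blast
  have \<beta>: "0 < \<beta>" using q by simp
  note C = radial_C1_compact[OF q(5) c \<beta> q(3,6)] and W = radial_wirtinger[OF q(5) c \<beta> q(3,6)]
  let ?F = "\<lambda>z::complex. z powi (j - 1)"
  have fin: "moment d \<theta> j = 0"
    if K: "compact K" "K \<subseteq> disk" "\<And>z. z \<notin> K \<Longrightarrow> radial q z = 0" and V: "open V" "K \<subseteq> V" and F: "?F holomorphic_on V" for K V
  proof -
    \<comment> \<open>At 0, where the power may be singular, both sides vanish because
      \<open>\<theta> 0 = 0\<close>.\<close>
    have eq: "?F z * wirtinger_zbar (radial q) z = radial \<theta> z * z powi j" for z
    proof (cases "z = 0")
      case True
      then show ?thesis using q(1) q(4)[of 0] by (simp add: W radial_def)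
    next
      case False
      then have "z powi j = z powi (j - 1) * z" using power_int_add_1[of z "j - 1"] by simp
      then show ?thesis by (simp add: W)
    qed
    have W2: "wirtinger_zbar (\<lambda>z. ?F z * radial q z) z = ?F z * wirtinger_zbar (radial q) z" for z
      by (rule wirtinger_zbar_mult_holomorphic[OF C K V F])
    have "0 = (LINT z|lborel. d z * wirtinger_zbar (\<lambda>z. ?F z * radial q z) z)"
      by (rule weak[symmetric], rule C1_compact_disk_mult_holomorphic[OF C K V F])
    also have "\<dots> = moment d \<theta> j"
      unfolding W2 eq moment_def ..
    finally show ?thesis by simp
  qed
  have cb: "cball (0::complex) (sqrt \<beta>) \<subseteq> disk"
  proof
    fix x :: complex assume "x \<in> cball 0 (sqrt \<beta>)"
    then have "cmod x \<le> sqrt \<beta>" by simp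
    also have "sqrt \<beta> < 1" using q \<beta> by simp
    finally show "x \<in> disk" by simp
  qed
  have out: "radial q z = 0" if "z \<notin> cball 0 (sqrt \<beta>)" for z
  proof -
    have "sqrt \<beta> < cmod z" using that by simp
    then have "(sqrt \<beta>)\<^sup>2 < (cmod z)\<^sup>2" using \<beta> by (intro power_strict_mono) auto
    then show ?thesis using q(6) \<beta> by (simp add: radial_def)
  qed
  show ?thesis
  proof (cases "j \<ge> 1")
    case True
    show ?thesis
    proof (rule fin[of "cball 0 (sqrt \<beta>)" UNIV])
      have "?F = (\<lambda>z. z ^ nat (j - 1))" using True by (simp add: power_int_def fun_eq_iff)
      then show "?F holomorphic_on UNIV" by (simp only:) (intro holomorphic_intros)
    qed (use cb out in auto)
  next
    case False
    then have I: "total \<theta> = 0" using j by simp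
    let ?K = "{z::complex. \<alpha> \<le> (cmod z)\<^sup>2} \<inter> cball 0 (sqrt \<beta>)"
    show ?thesis
    proof (rule fin[of ?K "-{0}"])
      show "compact ?K" by (intro closed_Int_compact closed_Collect_le continuous_intros) auto
      show "?K \<subseteq> disk" using cb by blast
      show "radial q z = 0" if "z \<notin> ?K" for z
      proof (cases "z \<in> cball 0 (sqrt \<beta>)")
        case True
        then have "(cmod z)\<^sup>2 \<le> \<alpha>" using that by auto
        moreover have "(cmod z)\<^sup>2 > -1" by (rule less_le_trans[of _ 0]) auto
        ultimately show ?thesis using q(7) I by (simp add: radial_def)
      qed (rule out)
      show "?K \<subseteq> - {0}" using q(1) by auto
      show "(\<lambda>z. z powi (j - 1)) holomorphic_on - {0}" by (intro holomorphic_intros) auto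
    qed auto
  qed
qed

text \<open>Substitution \<open>s = r^2\<close>, carried out with the primitive
  \<open>q (r^2) / 2\<close>.\<close>

lemma radial_weight_integral:
  assumes \<theta>: "annular \<theta>"
  shows "set_integrable lborel {0<..} (\<lambda>r. r * \<theta> (r\<^sup>2))" "(LINT r:{0<..}|lborel. r * \<theta> (r\<^sup>2)) = total \<theta> / 2"
proof -
  have c: "continuous_on UNIV \<theta>" using \<theta> by (simp add: annular_def)
  obtain q \<alpha> \<beta> where q: "0 < \<alpha>" "\<alpha> < \<beta>" "\<beta> < 1" "\<And>s. s \<notin> {\<alpha>..\<beta>} \<Longrightarrow> \<theta> s = 0"
    "\<And>s. s > -1 \<Longrightarrow> (q has_real_derivative \<theta> s) (at s)"
    "\<And>s. s \<ge> \<beta> \<Longrightarrow> q s = 0" "\<And>s. -1 < s \<Longrightarrow> s \<le> \<alpha> \<Longrightarrow> q s = - total \<theta>"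
    by (rule annular_primitive[OF \<theta>]) blast
  have contf: "continuous_on UNIV (\<lambda>r. r * \<theta> (r\<^sup>2))"
    by (intro continuous_intros continuous_on_compose2[OF c]) auto
  have eq: "indicator {0<..} r *\<^sub>R (r * \<theta> (r\<^sup>2)) = indicator {0..1} r *\<^sub>R (r * \<theta> (r\<^sup>2))" for r :: real
  proof -
    have "\<theta> (r\<^sup>2) = 0" if "r > 1"
    proof -
      have "1 < r\<^sup>2" using that by (simp add: one_less_power)
      then show ?thesis using q(3,4) by auto
    qed
    then show ?thesis by (auto simp: indicator_def)
  qed
  show "set_integrable lborel {0<..} (\<lambda>r. r * \<theta> (r\<^sup>2))"
    unfolding set_integrable_def eq using set_integrable_circle[OF contf, of 0 1] by (simp add: set_integrable_def)
  have "(LBINT r. indicator {0..1} r *\<^sub>R (r * \<theta> (r\<^sup>2))) = q (1\<^sup>2) / 2 - q (0\<^sup>2) / 2"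
  proof (rule integral_FTC_atLeastAtMost)
    fix r :: real
    have "r\<^sup>2 > -1" by (rule less_le_trans[of _ 0]) auto
    from q(5)[OF this] have "((\<lambda>r. q (r\<^sup>2) / 2) has_real_derivative r * \<theta> (r\<^sup>2)) (at r within {0..1})"
      by (auto intro!: derivative_eq_intros DERIV_chain2[where g = "\<lambda>r. r\<^sup>2" and f = q])
    then show "((\<lambda>r. q (r\<^sup>2) / 2) has_vector_derivative r * \<theta> (r\<^sup>2)) (at r within {0..1})"
      by (simp add: has_real_derivative_iff_has_vector_derivative)
  qed (use contf in \<open>auto intro: continuous_on_subset\<close>)
  then show "(LINT r:{0<..}|lborel. r * \<theta> (r\<^sup>2)) = total \<theta> / 2"
    unfolding set_lebesgue_integral_def eq using q(1,3) q(6)[of 1] q(7)[of 0] by simp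
qed

text \<open>The positive part of the parabola \<open>(s - \<alpha>) * (\<beta> - s)\<close>, divided
  by its integral. Continuity is enough, since test functions are built from primitives of
  profiles.\<close>

lemma annular_bump:
  assumes "0 < \<alpha>" "\<alpha> < \<beta>" "\<beta> < 1"
  obtains \<theta> where "annular \<theta>" "\<And>s. \<theta> s \<ge> 0" "total \<theta> = 1" "\<And>s. s \<notin> {\<alpha>..\<beta>} \<Longrightarrow> \<theta> s = 0" "\<And>s. s \<in> {\<alpha><..<\<beta>} \<Longrightarrow> \<theta> s > 0"
proof -
  define \<eta> where "\<eta> s = max 0 ((s - \<alpha>) * (\<beta> - s))" for s
  have c: "continuous_on S \<eta>" for S unfolding \<eta>_def by (intro continuous_intros)
  have out: "\<eta> s = 0" if "s \<notin> {\<alpha>..\<beta>}" for s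
  proof -
    have "(s - \<alpha>) * (\<beta> - s) \<le> 0"
    proof (cases "s < \<alpha>")
      case True
      then show ?thesis using assms by (intro mult_nonpos_nonneg) auto
    next
      case False
      then show ?thesis using that by (intro mult_nonneg_nonpos) auto
    qed
    then show ?thesis by (simp add: \<eta>_def)
  qed
  have pos: "\<eta> s > 0" if "s \<in> {\<alpha><..<\<beta>}" for s
    using that by (auto simp: \<eta>_def less_max_iff_disj)
  have "total \<eta> \<noteq> 0"
  proof
    assume "total \<eta> = 0"
    then have "\<And>x. x \<in> {-1..1} \<Longrightarrow> \<eta> x = 0"
      unfolding total_def using integral_eq_0_iff[of "-1" 1 \<eta>] c by (auto simp: \<eta>_def)
    then have "\<eta> ((\<alpha> + \<beta>) / 2) = 0" using assms by auto
    then show False using pos[of "(\<alpha> + \<beta>) / 2"] assms by simp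
  qed
  moreover have "total \<eta> \<ge> 0"
    unfolding total_def by (intro Henstock_Kurzweil_Integration.integral_nonneg integrable_continuous_real c) (simp add: \<eta>_def)
  ultimately have t: "total \<eta> > 0" by simp
  show ?thesis
  proof (rule that[of "\<lambda>s. \<eta> s / total \<eta>"])
    show "annular (\<lambda>s. \<eta> s / total \<eta>)"
      unfolding annular_def using assms out t
      by (intro conjI exI[of _ \<alpha>] exI[of _ \<beta>]) (auto intro!: continuous_intros c)
    show "\<eta> s / total \<eta> \<ge> 0" for s using t by (simp add: \<eta>_def)
    show "total (\<lambda>s. \<eta> s / total \<eta>) = 1"
      using t unfolding total_def[of "\<lambda>s. \<eta> s / total \<eta>"] by (simp add: total_def)
    show "\<eta> s / total \<eta> = 0" if "s \<notin> {\<alpha>..\<beta>}" for s using out[OF that] by simp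
    show "\<eta> s / total \<eta> > 0" if "s \<in> {\<alpha><..<\<beta>}" for s using pos[OF that] t by simp
  qed
qed

section \<open>Fourier coefficients of the boundary values\<close>

text \<open>Differentiation maps the span of \<open>cos (j * t)\<close> and
  \<open>sin (j * t)\<close> into itself, so derivatives of every order have the same form.\<close>

lemma smooth_circle_trig:
  "smooth_circle (\<lambda>t. a * cos (of_int j * t) + b * sin (of_int j * t))"
proof -
  have d: "deriv (\<lambda>t. a * cos (of_int j * t) + b * sin (of_int j * t))
     = (\<lambda>t. (of_int j * b) * cos (of_int j * t) + (- of_int j * a) * sin (of_int j * t))" for a b :: real
    by (intro ext DERIV_imp_deriv) (auto intro!: derivative_eq_intros)
  have it: "\<exists>a' b'. (deriv ^^ k) (\<lambda>t. a * cos (of_int j * t) + b * sin (of_int j * t))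
     = (\<lambda>t. a' * cos (of_int j * t) + b' * sin (of_int j * t))" for k
  proof (induction k)
    case (Suc k)
    then obtain a' b' where "(deriv ^^ k) (\<lambda>t. a * cos (of_int j * t) + b * sin (of_int j * t))
     = (\<lambda>t. a' * cos (of_int j * t) + b' * sin (of_int j * t))" by blast
    then have "(deriv ^^ Suc k) (\<lambda>t. a * cos (of_int j * t) + b * sin (of_int j * t))
       = (\<lambda>t. (of_int j * b') * cos (of_int j * t) + (- of_int j * a') * sin (of_int j * t))"
      by (simp only: funpow.simps o_apply d)
    then show ?case by blast
  qed auto
  have p: "cos (of_int j * (t + 2 * pi)) = cos (of_int j * t)" "sin (of_int j * (t + 2 * pi)) = sin (of_int j * t)" for t
  proof -
    have "of_int j * (t + 2 * pi) = of_int j * t + 2 * pi * of_int j" by (simp add: algebra_simps)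
    then show "cos (of_int j * (t + 2 * pi)) = cos (of_int j * t)" "sin (of_int j * (t + 2 * pi)) = sin (of_int j * t)"
      by (simp_all add: cos_add sin_add cos_int_2pin sin_int_2pin)
  qed
  show ?thesis
    unfolding smooth_circle_def
  proof (intro conjI allI)
    fix k t
    obtain a' b' where e: "(deriv ^^ k) (\<lambda>t. a * cos (of_int j * t) + b * sin (of_int j * t))
     = (\<lambda>t. a' * cos (of_int j * t) + b' * sin (of_int j * t))" using it by blast
    show "(deriv ^^ k) (\<lambda>t. a * cos (of_int j * t) + b * sin (of_int j * t)) differentiable at t"
      unfolding e real_differentiable_def by (rule exI, (rule derivative_eq_intros refl)+)
  qed (simp add: p)
qed

lemma rcis_powi: "(rcis r t) powi j = of_real (r powi j) * cis (of_int j * t)"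
  by (simp add: rcis_def power_int_mult_distrib cis_power_int)

text \<open>Test functions for boundary values are real, so the complex coefficient is bounded
  through its cosine and sine parts, each by \<open>e / 2\<close>. The filter is unpacked into a
  radius \<open>\<delta>\<close> and a null set of radii, the form suited to an integration over
  \<open>r\<close>.\<close>

lemma boundary_fourier_small:
  assumes u: "u \<in> borel_measurable borel" "\<And>\<rho>. \<rho> < 1 \<Longrightarrow> set_integrable lborel (cball 0 \<rho>) (u :: complex \<Rightarrow> real)"
    and bv: "has_boundary_value u (\<lambda>z. 0)" and e: "e > 0"
  obtains \<delta> where "\<delta> < 1" "AE r in lborel. \<delta> < r \<and> r < 1 \<longrightarrow> cmod (LINT t:{0..2*pi}|lborel. of_real (u (rcis r t)) * cis (of_int j * t)) \<le> e"
proof -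
  have [measurable]: "u \<in> borel_measurable borel" by fact
  have loc: "L1_loc_disk (\<lambda>z. complex_of_real (u z))"
    unfolding L1_loc_disk_def
  proof (intro allI impI)
    fix K assume K: "compact K \<and> K \<subseteq> disk"
    obtain \<rho> where \<rho>: "\<rho> < 1" "K \<subseteq> cball 0 \<rho>"
      using compact_subset_cball[of K] K by blast
    have "set_integrable lborel K u"
      using K by (intro set_integrable_subset[OF u(2)[OF \<rho>(1)] _ \<rho>(2)]) (auto intro: borel_compact)
    then have "set_integrable lborel K (\<lambda>z. complex_of_real (u z))"
      unfolding set_integrable_def by (subst (asm) complex_of_real_integrable_eq[symmetric]) (simp add: scaleR_conv_of_real)
    then show "integrable (lebesgue_on K) (\<lambda>z. complex_of_real (u z))"
      using K by (subst lebesgue_on_integrable_iff[where F = "\<lambda>z. complex_of_real (u z)"]) (auto intro: borel_compact)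
  qed
  let ?c = "\<lambda>t. cos (real_of_int j * t)" and ?s = "\<lambda>t. sin (real_of_int j * t)"
  let ?F = "inf (at_left 1) (ae_filter lebesgue) :: real filter"
  have sc: "smooth_circle ?c" using smooth_circle_trig[of 1 j 0] by simp
  have ss: "smooth_circle ?s" using smooth_circle_trig[of 0 j 1] by simp
  have cc: "continuous_on UNIV (\<lambda>t. cos (real_of_int j * t))" "continuous_on UNIV (\<lambda>t. sin (real_of_int j * t))"
    by (intro continuous_intros)+
  have L: "((\<lambda>r. LINT t|lebesgue_on {0..2*pi}. u (rcis r t) * \<phi> t) \<longlongrightarrow> 0) ?F" if "smooth_circle \<phi>" for \<phi>
    using bv that unfolding has_boundary_value_def by fastforce
  have "eventually (\<lambda>r. dist (LINT t|lebesgue_on {0..2*pi}. u (rcis r t) * ?c t) 0 < e / 2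
     \<and> dist (LINT t|lebesgue_on {0..2*pi}. u (rcis r t) * ?s t) 0 < e / 2) ?F"
    by (intro eventually_conj tendstoD[OF L[OF sc]] tendstoD[OF L[OF ss]]) (use e in auto)
  then obtain P Q where P: "eventually P (at_left 1)" and Q: "AE r in lebesgue. Q r"
    and PQ: "\<And>r. P r \<Longrightarrow> Q r \<Longrightarrow> dist (LINT t|lebesgue_on {0..2*pi}. u (rcis r t) * ?c t) 0 < e / 2
     \<and> dist (LINT t|lebesgue_on {0..2*pi}. u (rcis r t) * ?s t) 0 < e / 2"
    unfolding eventually_inf by blast
  obtain \<delta>' where \<delta>': "\<delta>' < 1" "\<And>r. \<delta>' < r \<Longrightarrow> r < 1 \<Longrightarrow> P r"
    using P unfolding eventually_at_left_field by auto
  show ?thesis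
  proof (rule that[of "max 0 \<delta>'"])
    show "max 0 \<delta>' < 1" using \<delta>' by simp
    have Q': "AE r in lborel. Q r" using Q by (simp add: AE_completion_iff)
    show "AE r in lborel. max 0 \<delta>' < r \<and> r < 1 \<longrightarrow> cmod (LINT t:{0..2*pi}|lborel. of_real (u (rcis r t)) * cis (of_int j * t)) \<le> e"
      using Q' L1_loc_circle_integrable[OF loc]
    proof (eventually_elim, intro impI)
      fix r assume "Q r" "0 < r \<and> r < 1 \<longrightarrow> integrable (lebesgue_on {0..2*pi}) (\<lambda>t. complex_of_real (u (rcis r t)))"
         "max 0 \<delta>' < r \<and> r < 1"
      then have ur: "integrable (lebesgue_on {0..2*pi}) (\<lambda>t. u (rcis r t))" and Pr: "P r" and Qr: "Q r"
        using \<delta>' by (auto simp: complex_of_real_integrable_eq)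
      have ci: "set_integrable lborel {0..2*pi} (\<lambda>t. u (rcis r t) * ?c t)"
        using integrable_mult_continuous[OF ur cc(1)]
        by (subst (asm) lebesgue_on_integrable_iff[where F = "\<lambda>t. u (rcis r t) * ?c t"]) auto
      have si: "set_integrable lborel {0..2*pi} (\<lambda>t. u (rcis r t) * ?s t)"
        using integrable_mult_continuous[OF ur cc(2)]
        by (subst (asm) lebesgue_on_integrable_iff[where F = "\<lambda>t. u (rcis r t) * ?s t"]) auto
      have cv: "(LINT t|lebesgue_on {0..2*pi}. u (rcis r t) * ?c t) = (LINT t:{0..2*pi}|lborel. u (rcis r t) * ?c t)"
        by (rule lebesgue_on_integral_eq) auto
      have sv: "(LINT t|lebesgue_on {0..2*pi}. u (rcis r t) * ?s t) = (LINT t:{0..2*pi}|lborel. u (rcis r t) * ?s t)"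
        by (rule lebesgue_on_integral_eq) auto
      have ofr: "set_integrable lborel {0..2*pi} (\<lambda>t. complex_of_real (f t))" if "set_integrable lborel {0..2*pi} f" for f
      proof -
        have "integrable lborel (\<lambda>t. complex_of_real (indicat_real {0..2*pi} t *\<^sub>R f t))"
          using that unfolding set_integrable_def by (rule integrable_of_real)
        then show ?thesis by (simp add: set_integrable_def scaleR_conv_of_real)
      qed
      have eq: "of_real (u (rcis r t)) * cis (of_int j * t)
        = complex_of_real (u (rcis r t) * ?c t) + \<i> * complex_of_real (u (rcis r t) * ?s t)" for t
        by (simp add: complex_eq_iff)
      have 1: "(LINT t:{0..2*pi}|lborel. of_real (u (rcis r t)) * cis (of_int j * t))
        = (LINT t:{0..2*pi}|lborel. complex_of_real (u (rcis r t) * ?c t)) + (LINT t:{0..2*pi}|lborel. \<i> * complex_of_real (u (rcis r t) * ?s t))"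
        unfolding eq using ofr[OF ci] ofr[OF si] by (intro set_integral_add(2) set_integrable_mult_right)
      have 2: "(LINT t:{0..2*pi}|lborel. of_real (u (rcis r t)) * cis (of_int j * t))
        = of_real (LINT t:{0..2*pi}|lborel. u (rcis r t) * ?c t) + \<i> * of_real (LINT t:{0..2*pi}|lborel. u (rcis r t) * ?s t)"
        unfolding 1 by (simp only: set_integral_mult_right set_integral_complex_of_real)
      have "cmod (of_real x + \<i> * of_real y) \<le> \<bar>x\<bar> + \<bar>y\<bar>" for x y
        by (rule order_trans[OF norm_triangle_ineq]) (simp add: norm_mult)
      note 3 = this[of "LINT t:{0..2*pi}|lborel. u (rcis r t) * ?c t" "LINT t:{0..2*pi}|lborel. u (rcis r t) * ?s t"]
      show "cmod (LINT t:{0..2*pi}|lborel. of_real (u (rcis r t)) * cis (of_int j * t)) \<le> e"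
        unfolding 2 using 3 PQ[OF Pr Qr] unfolding cv sv dist_real_def diff_0_right by linarith
    qed
  qed
qed

section \<open>Vanishing of the moments\<close>

text \<open>The combination \<open>\<theta> s - total \<theta> * \<eta> s\<close> has integral 0, so
  its primitive vanishes near 0 as well and every exponent is admissible.\<close>

lemma moment_proportional:
  assumes d: "d \<in> borel_measurable borel" "\<And>\<rho>. \<rho> < 1 \<Longrightarrow> set_integrable lborel (cball 0 \<rho>) d"
    and weak: "\<And>\<phi>. C1_compact_disk \<phi> \<Longrightarrow> (LINT z|lborel. d z * wirtinger_zbar \<phi> z) = 0"
    and \<theta>: "annular \<theta>" and \<eta>: "annular \<eta>" "total \<eta> = 1"
  shows "moment d \<theta> j = total \<theta> * moment d \<eta> j"
proof -
  have "total (\<lambda>s. \<theta> s - total \<theta> * \<eta> s) = 0"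
    using \<theta> \<eta> by (subst total_diff_scale) (auto simp: annular_def)
  then have "moment d (\<lambda>s. \<theta> s - total \<theta> * \<eta> s) j = 0"
    by (intro moment_eq_0[OF weak] annular_diff_scale \<theta> \<eta>) auto
  then show ?thesis using moment_diff_scale[OF d \<theta> \<eta>(1), of "total \<theta>" j] by simp
qed

text \<open>With \<open>m z = radial \<eta> z * z powi (- int n)\<close>, twice the integral of
  \<open>Re (d z) * m z\<close> is the moment of order \<open>- n\<close> plus the conjugate of the
  integral of \<open>d z * cnj (m z)\<close>, and \<open>cnj (m z)\<close> is \<open>z ^ n\<close>
  times another radial profile. For \<open>\<eta>\<close> supported near 1 the left-hand side is a
  weighted average of small Fourier coefficients.\<close>

lemma moment_near_boundary:
  assumes d: "d \<in> borel_measurable borel" "\<And>\<rho>. \<rho> < 1 \<Longrightarrow> set_integrable lborel (cball 0 \<rho>) d"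
    and bv: "has_boundary_value (\<lambda>z. Re (d z)) (\<lambda>z. 0)" and e: "e > 0"
  obtains \<eta> \<eta>' where "annular \<eta>" "annular \<eta>'" "total \<eta> = 1" "n = 0 \<longrightarrow> \<eta>' = \<eta>"
    "cmod (moment d \<eta> (- int n) + cnj (moment d \<eta>' (int n))) \<le> e"
proof -
  have [measurable]: "d \<in> borel_measurable borel" by fact
  let ?j = "- int n"
  \<comment> \<open>On the support \<open>r \<ge> 1/2\<close>, hence
    \<open>r powi (- int n) \<le> 2 ^ n\<close>.\<close>
  define e' where "e' = e / 2 ^ n"
  have e': "e' > 0" using e by (simp add: e'_def)
  have u: "(\<lambda>z. Re (d z)) \<in> borel_measurable borel" by measurable
  have u2: "set_integrable lborel (cball 0 \<rho>) (\<lambda>z. Re (d z))" if "\<rho> < 1" for \<rho>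
    by (rule set_integral_Re(1)[OF d(2)[OF that]])
  obtain \<delta> where \<delta>: "\<delta> < 1" and small: "AE r in lborel. \<delta> < r \<and> r < 1 \<longrightarrow>
      cmod (LINT t:{0..2*pi}|lborel. of_real (Re (d (rcis r t))) * cis (of_int ?j * t)) \<le> e'"
    by (rule boundary_fourier_small[OF u u2 bv e', where j = ?j])
  \<comment> \<open>Midway between \<open>max 0 \<delta>\<close> and 1, thus beyond
    \<open>\<delta>\<close> and at least 1/2.\<close>
  define a where "a = (1 + max 0 \<delta>) / 2"
  have a: "1/2 \<le> a" "\<delta> < a" "a < 1" using \<delta> by (auto simp: a_def)
  define \<alpha> where "\<alpha> = a\<^sup>2"
  have \<alpha>: "0 < \<alpha>" "\<alpha> < 1" using a by (auto simp: \<alpha>_def power_less_one_iff)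
  obtain \<eta> where \<eta>: "annular \<eta>" "\<And>s. \<eta> s \<ge> 0" "total \<eta> = 1" "\<And>s. s \<notin> {\<alpha>..(1 + \<alpha>) / 2} \<Longrightarrow> \<eta> s = 0"
    by (rule annular_bump[of \<alpha> "(1 + \<alpha>) / 2"]) (use \<alpha> in auto)
  \<comment> \<open>For \<open>s = (cmod z)^2\<close> the conjugate of
    \<open>z powi (- int n)\<close> is \<open>z ^ n / s ^ n\<close>. The maximum with
    \<open>\<alpha>\<close> changes nothing on the support of \<open>\<eta>\<close> and keeps the
    quotient continuous.\<close>
  define \<eta>' where "\<eta>' s = \<eta> s * (1 / (max s \<alpha>) ^ n)" for s
  have "continuous_on UNIV (\<lambda>s. 1 / (max s \<alpha>) ^ n)"
    using \<alpha> by (intro continuous_intros) auto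
  then have \<eta>': "annular \<eta>'" unfolding \<eta>'_def by (rule annular_mult[OF \<eta>(1)])
  let ?m = "\<lambda>z. radial \<eta> z * z powi ?j"
  have cm: "cnj (?m z) = radial \<eta>' z * z powi (int n)" for z
  proof (cases "z = 0 \<or> \<eta> ((cmod z)\<^sup>2) = 0")
    case True
    then show ?thesis using \<eta>(4)[of 0] \<alpha> by (auto simp: radial_def \<eta>'_def)
  next
    case False
    then have "\<alpha> \<le> (cmod z)\<^sup>2" using \<eta>(4)[of "(cmod z)\<^sup>2"] by auto
    then have "max ((cmod z)\<^sup>2) \<alpha> = (cmod z)\<^sup>2" by simp
    moreover have "x / cnj z ^ n = x * z ^ n / of_real (((cmod z)\<^sup>2) ^ n)" for x
    proof -
      have "of_real (((cmod z)\<^sup>2) ^ n) = (z * cnj z) ^ n"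
        by (simp only: complex_norm_square of_real_power[of "(cmod z)\<^sup>2"])
      then show ?thesis using False by (simp add: power_mult_distrib)
    qed
    ultimately show ?thesis
      by (simp add: radial_def \<eta>'_def power_int_minus inverse_eq_divide)
  qed
  have im: "integrable lborel (\<lambda>z. d z * ?m z)" by (rule moment_integrable[OF d \<eta>(1)])
  have im': "integrable lborel (\<lambda>z. cnj (d z * cnj (?m z)))"
    unfolding cm by (intro integrable_cnj moment_integrable[OF d \<eta>'])
  have Re_eq: "of_real (Re (d z)) * ?m z = (d z * ?m z + cnj (d z * cnj (?m z))) / 2" for z
  proof -
    have "of_real (Re (d z)) = (d z + cnj (d z)) / 2" by (simp add: complex_add_cnj)
    then show ?thesis by (simp only: complex_cnj_mult complex_cnj_cnj) (simp add: algebra_simps)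
  qed
  have intR: "integrable lborel (\<lambda>z. of_real (Re (d z)) * ?m z)"
    unfolding Re_eq using im im' by (intro integrable_divide Bochner_Integration.integrable_add)
  have "(LINT z|lborel. of_real (Re (d z)) * ?m z) = ((LINT z|lborel. d z * ?m z) + (LINT z|lborel. cnj (d z * cnj (?m z)))) / 2"
    unfolding Re_eq integral_divide_zero by (subst Bochner_Integration.integral_add[OF im im']) simp
  also have "(LINT z|lborel. cnj (d z * cnj (?m z))) = cnj (moment d \<eta>' (int n))"
    unfolding cm moment_def by (rule Bochner_Integration.integral_cnj)
  finally have N: "moment d \<eta> ?j + cnj (moment d \<eta>' (int n)) = 2 * (LINT z|lborel. of_real (Re (d z)) * ?m z)"
    by (simp add: moment_def mult.commute[of _ 2])
  let ?G = "\<lambda>r. LINT t:{0..2*pi}|lborel. of_real (Re (d (rcis r t))) * cis (of_int ?j * t)"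
  have inner: "(LINT t:{0..2*pi}|lborel. of_real (Re (d (rcis r t))) * ?m (rcis r t))
      = of_real (\<eta> (r\<^sup>2) * r powi ?j) * ?G r" for r
  proof -
    have "of_real (Re (d (rcis r t))) * ?m (rcis r t) = of_real (\<eta> (r\<^sup>2) * r powi ?j) * (of_real (Re (d (rcis r t))) * cis (of_int ?j * t))" for t
      by (simp add: radial_def rcis_powi del: of_int_minus)
    then show ?thesis by (simp only: set_integral_mult_right)
  qed
  have A: "(LINT z|lborel. of_real (Re (d z)) * ?m z)
      = (LINT r|lborel. indicator {0<..} r *\<^sub>R (r *\<^sub>R (of_real (\<eta> (r\<^sup>2) * r powi ?j) * ?G r)))"
    unfolding integral_polar[OF intR] inner set_lebesgue_integral_def[of _ "{0<..}"] ..
  have B: "cmod (LINT r|lborel. indicator {0<..} r *\<^sub>R (r *\<^sub>R (of_real (\<eta> (r\<^sup>2) * r powi ?j) * ?G r)))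
      \<le> (LINT r|lborel. (indicator {0<..} r *\<^sub>R (r * \<eta> (r\<^sup>2))) * e)"
  proof (rule order_trans[OF integral_norm_bound], rule integral_mono_AE)
    show "integrable lborel (\<lambda>r. cmod (indicator {0<..} r *\<^sub>R (r *\<^sub>R (of_real (\<eta> (r\<^sup>2) * r powi ?j) * ?G r))))"
      using integrable_polar_outer[OF intR] unfolding inner set_integrable_def by (rule integrable_norm)
    show "integrable lborel (\<lambda>r. (indicator {0<..} r *\<^sub>R (r * \<eta> (r\<^sup>2))) * e)"
      using radial_weight_integral(1)[OF \<eta>(1)] unfolding set_integrable_def by (rule integrable_mult_left)
    show "AE r in lborel. cmod (indicator {0<..} r *\<^sub>R (r *\<^sub>R (of_real (\<eta> (r\<^sup>2) * r powi ?j) * ?G r)))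
        \<le> (indicator {0<..} r *\<^sub>R (r * \<eta> (r\<^sup>2))) * e"
      using small
    proof eventually_elim
      case (elim r)
      show ?case
      proof (cases "r > 0 \<and> \<eta> (r\<^sup>2) \<noteq> 0")
        case True
        then have "r\<^sup>2 \<in> {\<alpha>..(1 + \<alpha>) / 2}" using \<eta>(4)[of "r\<^sup>2"] by blast
        then have r2: "\<alpha> \<le> r\<^sup>2" "r\<^sup>2 \<le> (1 + \<alpha>) / 2" by simp_all
        have ra: "a \<le> r"
          using r2(1) True unfolding \<alpha>_def by (intro power2_le_imp_le[of a r]) simp_all
        have "r\<^sup>2 < 1" using r2(2) \<alpha> by simp
        then have r1: "r < 1" using True by (simp add: power_less_one_iff)
        have G: "cmod (?G r) \<le> e'" using elim ra r1 a by simp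
        have "r powi ?j = (1 / r) ^ n" using True by (simp add: power_int_minus power_one_over inverse_eq_divide)
        also have "\<dots> \<le> 2 ^ n"
        proof (rule power_mono)
          show "1 / r \<le> 2" using ra a True by (simp add: divide_le_eq)
        qed (use True in auto)
        finally have p: "0 \<le> r powi ?j" "r powi ?j \<le> 2 ^ n" using True by auto
        have "r powi ?j * cmod (?G r) \<le> 2 ^ n * e'" by (intro mult_mono p G) auto
        also have "\<dots> = e" by (simp add: e'_def)
        finally have "(r * \<eta> (r\<^sup>2)) * (r powi ?j * cmod (?G r)) \<le> (r * \<eta> (r\<^sup>2)) * e"
          using True \<eta>(2) by (intro mult_left_mono) auto
        moreover have "cmod (indicator {0<..} r *\<^sub>R (r *\<^sub>R (of_real (\<eta> (r\<^sup>2) * r powi ?j) * ?G r))) = (r * \<eta> (r\<^sup>2)) * (r powi ?j * cmod (?G r))"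
        proof -
          have "cmod (indicator {0<..} r *\<^sub>R (r *\<^sub>R (of_real (\<eta> (r\<^sup>2) * r powi ?j) * ?G r))) = r * (\<bar>\<eta> (r\<^sup>2) * r powi ?j\<bar> * cmod (?G r))"
            using True by (simp only: norm_scaleR norm_mult norm_of_real) simp
          also have "\<bar>\<eta> (r\<^sup>2) * r powi ?j\<bar> = \<eta> (r\<^sup>2) * r powi ?j"
            using \<eta>(2) p by (intro abs_of_nonneg mult_nonneg_nonneg) auto
          finally show ?thesis by (simp only: mult.assoc)
        qed
        ultimately show ?thesis using True by simp
      qed auto
    qed
  qed
  \<comment> \<open>The radial weight has integral \<open>total \<eta> / 2\<close>; the factor 2 in
    \<open>N\<close> restores \<open>e\<close>.\<close>
  have C: "(LINT r|lborel. (indicator {0<..} r *\<^sub>R (r * \<eta> (r\<^sup>2))) * e) = e / 2"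
  proof -
    have "(LINT r|lborel. (indicator {0<..} r *\<^sub>R (r * \<eta> (r\<^sup>2))) * e) = (LINT r:{0<..}|lborel. r * \<eta> (r\<^sup>2)) * e"
      unfolding set_lebesgue_integral_def by (rule integral_mult_left_zero)
    then show ?thesis unfolding radial_weight_integral(2)[OF \<eta>(1)] \<eta>(3) by simp
  qed
  have "cmod (LINT z|lborel. of_real (Re (d z)) * ?m z) \<le> e / 2"
    using B unfolding A C .
  then have "cmod (moment d \<eta> ?j + cnj (moment d \<eta>' (int n))) \<le> e" unfolding N by (simp add: norm_mult)
  moreover have "n = 0 \<longrightarrow> \<eta>' = \<eta>" by (simp add: \<eta>'_def fun_eq_iff)
  ultimately show ?thesis using that[of \<eta> \<eta>'] \<eta>(1,3) \<eta>' by blast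
qed

text \<open>For \<open>j = - n < 0\<close> the companion moment of order \<open>n\<close> is 0 by
  \<open>moment_eq_0\<close>, so the moment of order \<open>j\<close> is at most \<open>e\<close>
  for some profile of integral 1; by proportionality it is the same for all such profiles, hence 0.
  For \<open>j = 0\<close> the two profiles coincide and the sum is twice a real part, so an
  imaginary value survives.\<close>

lemma
  assumes d: "d \<in> borel_measurable borel" "\<And>\<rho>. \<rho> < 1 \<Longrightarrow> set_integrable lborel (cball 0 \<rho>) d"
    and weak: "\<And>\<phi>. C1_compact_disk \<phi> \<Longrightarrow> (LINT z|lborel. d z * wirtinger_zbar \<phi> z) = 0"
    and bv: "has_boundary_value (\<lambda>z. Re (d z)) (\<lambda>z. 0)" and \<theta>: "annular \<theta>"
  shows moment_nonzero_index: "j \<noteq> 0 \<Longrightarrow> moment d \<theta> j = 0"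
    and moment_Re_zero: "Re (moment d \<theta> 0) = 0"
proof -
  obtain \<eta>0 where \<eta>0: "annular \<eta>0" "total \<eta>0 = 1"
    by (rule annular_bump[of "1/4" "1/2"]) auto
  have scale: "moment d \<theta> j = total \<theta> * moment d \<eta> j" if "annular \<theta>" "annular \<eta>" "total \<eta> = 1" for \<theta> \<eta> j
    by (rule moment_proportional[OF d weak that])
  show "moment d \<theta> j = 0" if j: "j \<noteq> 0"
  proof (cases "j \<ge> 1")
    case True
    then show ?thesis by (intro moment_eq_0[OF weak \<theta>]) auto
  next
    case False
    then obtain n where n: "j = - int n" "n \<noteq> 0" using j that[of "nat (- j)"] by simp
    have "cmod (moment d \<eta>0 j) \<le> 0 + e" if e: "e > 0" for e
    proof -
      obtain \<eta> \<eta>' where E: "annular \<eta>" "annular \<eta>'" "total \<eta> = 1" "n = 0 \<longrightarrow> \<eta>' = \<eta>"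
        "cmod (moment d \<eta> (- int n) + cnj (moment d \<eta>' (int n))) \<le> e"
        by (rule moment_near_boundary[OF d bv e, where n = n]) blast
      have "moment d \<eta>' (int n) = 0" using n E by (intro moment_eq_0[OF weak]) auto
      then have "cmod (moment d \<eta> j) \<le> e" using E(5) n by simp
      then show ?thesis using scale[OF E(1) \<eta>0] E(3) by simp
    qed
    then have "moment d \<eta>0 j = 0" using field_le_epsilon[of "cmod (moment d \<eta>0 j)" 0] by simp
    then show ?thesis using scale[OF \<theta> \<eta>0] by simp
  qed
  have "\<bar>Re (moment d \<eta>0 0)\<bar> \<le> 0 + e" if e: "e > 0" for e
  proof -
    obtain \<eta> \<eta>' where E: "annular \<eta>" "annular \<eta>'" "total \<eta> = 1" "(0::nat) = 0 \<longrightarrow> \<eta>' = \<eta>"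
      "cmod (moment d \<eta> (- int 0) + cnj (moment d \<eta>' (int 0))) \<le> e"
      by (rule moment_near_boundary[OF d bv e, where n = 0]) blast
    then have "cmod (of_real (2 * Re (moment d \<eta> 0))) \<le> e" by (simp add: complex_add_cnj)
    then have "2 * \<bar>Re (moment d \<eta> 0)\<bar> \<le> e" by (simp only: norm_of_real abs_mult abs_numeral)
    then show ?thesis using scale[OF E(1) \<eta>0, of 0] E(3) by simp
  qed
  then have "Re (moment d \<eta>0 0) = 0" using field_le_epsilon[of "\<bar>Re (moment d \<eta>0 0)\<bar>" 0] by simp
  then show "Re (moment d \<theta> 0) = 0" using scale[OF \<theta> \<eta>0, of 0] by simp
qed

section \<open>Complex measures with vanishing polynomial moments\<close>

text \<open>Polynomials in \<open>z\<close> and \<open>cnj z\<close> integrate to 0 against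
  \<open>\<nu>\<close>, and by Stone--Weierstrass they approximate \<open>f\<close> uniformly on the
  closed unit disk; the error costs at most the L1 norm of \<open>\<nu>\<close> times the
  tolerance.\<close>

lemma integral_continuous_eq_0:
  fixes \<nu> :: "complex \<Rightarrow> complex"
  assumes \<nu>: "integrable lborel \<nu>" "\<And>z. z \<notin> cball 0 1 \<Longrightarrow> \<nu> z = 0"
    and mom: "\<And>a b. (LINT z|lborel. \<nu> z * (z ^ a * cnj z ^ b)) = 0"
    and f: "continuous_on UNIV (f :: complex \<Rightarrow> real)"
  shows "(LINT z|lborel. \<nu> z * f z) = 0"
proof -
  have [measurable]: "\<nu> \<in> borel_measurable borel" using \<nu> by auto
  have int: "integrable lborel (\<lambda>z. \<nu> z * h z)" if h: "continuous_on UNIV h" for h :: "complex \<Rightarrow> complex"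
  proof -
    have [measurable]: "h \<in> borel_measurable borel" using h by (rule borel_measurable_continuous_onI)
    have "compact (h ` cball 0 1)" using h by (intro compact_continuous_image) (auto intro: continuous_on_subset)
    then obtain B where B: "B > 0" "\<forall>x\<in>h ` cball 0 1. cmod x \<le> B"
      using compact_imp_bounded bounded_pos by blast
    show ?thesis
    proof (rule Bochner_Integration.integrable_bound)
      show "integrable lborel (\<lambda>z. \<nu> z * of_real B)" using \<nu> by auto
      show "AE z in lborel. norm (\<nu> z * h z) \<le> norm (\<nu> z * of_real B)"
      proof (rule AE_I2)
        fix z
        show "norm (\<nu> z * h z) \<le> norm (\<nu> z * of_real B)"
        proof (cases "z \<in> cball 0 1")
          case True
          then have "cmod (h z) \<le> B" using B(2) by blast
          then show ?thesis using B(1) by (simp add: norm_mult mult_left_mono)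
        qed (use \<nu> in auto)
      qed
    qed measurable
  qed
  \<comment> \<open>Continuous \<open>h\<close> for which \<open>\<nu> z * h z\<close> has vanishing
    moments again. Multiplying \<open>h\<close> by \<open>z\<close> or \<open>cnj z\<close> merely
    shifts an exponent.\<close>
  define W where "W = {h. continuous_on UNIV h \<and> (\<forall>a b. (LINT z|lborel. \<nu> z * (h z * (z ^ a * cnj z ^ b))) = 0)}"
  have W_cont: "continuous_on UNIV (\<lambda>z. h z * (z ^ a * cnj z ^ b))" if "h \<in> W" for h a b
    using that unfolding W_def by (auto intro!: continuous_intros)
  have W_int: "integrable lborel (\<lambda>z. \<nu> z * (h z * (z ^ a * cnj z ^ b)))" if "h \<in> W" for h a b
    by (rule int[OF W_cont[OF that]])
  have W_lin: "(\<lambda>z. \<alpha> * h z + \<beta> * k z) \<in> W" if "h \<in> W" "k \<in> W" for \<alpha> \<beta> h k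
  proof -
    have "(LINT z|lborel. \<nu> z * ((\<alpha> * h z + \<beta> * k z) * (z ^ a * cnj z ^ b))) = 0" for a b
    proof -
      have "\<nu> z * ((\<alpha> * h z + \<beta> * k z) * (z ^ a * cnj z ^ b))
        = \<alpha> * (\<nu> z * (h z * (z ^ a * cnj z ^ b))) + \<beta> * (\<nu> z * (k z * (z ^ a * cnj z ^ b)))" for z
        by (simp add: algebra_simps)
      then have "(LINT z|lborel. \<nu> z * ((\<alpha> * h z + \<beta> * k z) * (z ^ a * cnj z ^ b)))
        = (LINT z|lborel. \<alpha> * (\<nu> z * (h z * (z ^ a * cnj z ^ b)))) + (LINT z|lborel. \<beta> * (\<nu> z * (k z * (z ^ a * cnj z ^ b))))"
        using W_int[OF that(1)] W_int[OF that(2)]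
        by (simp only:) (intro Bochner_Integration.integral_add integrable_mult_right)
      then show ?thesis using that unfolding W_def by simp
    qed
    moreover have "continuous_on UNIV (\<lambda>z. \<alpha> * h z + \<beta> * k z)"
      using that unfolding W_def by (auto intro!: continuous_intros)
    ultimately show ?thesis unfolding W_def by blast
  qed
  have W_z: "(\<lambda>z. z * h z) \<in> W" if "h \<in> W" for h
  proof -
    have "\<nu> z * (z * h z * (z ^ a * cnj z ^ b)) = \<nu> z * (h z * (z ^ Suc a * cnj z ^ b))" for z a b by simp
    then have "(LINT z|lborel. \<nu> z * (z * h z * (z ^ a * cnj z ^ b))) = 0" for a b
      using that unfolding W_def by (simp only: mem_Collect_eq)
    then show ?thesis using that unfolding W_def by (auto intro!: continuous_intros)
  qed
  have W_zbar: "(\<lambda>z. cnj z * h z) \<in> W" if "h \<in> W" for h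
  proof -
    have "\<nu> z * (cnj z * h z * (z ^ a * cnj z ^ b)) = \<nu> z * (h z * (z ^ a * cnj z ^ Suc b))" for z a b by simp
    then have "(LINT z|lborel. \<nu> z * (cnj z * h z * (z ^ a * cnj z ^ b))) = 0" for a b
      using that unfolding W_def by (simp only: mem_Collect_eq)
    then show ?thesis using that unfolding W_def by (auto intro!: continuous_intros)
  qed
  \<comment> \<open>The induction claims that multiplication by \<open>p\<close> preserves
    \<open>W\<close>, rather than that \<open>p\<close> belongs to \<open>W\<close>; the product
    case is then a composition.\<close>
  have poly: "\<forall>h\<in>W. (\<lambda>z. of_real (p z) * h z) \<in> W" if "real_polynomial_function p" for p :: "complex \<Rightarrow> real"
    using that
  proof induction
    case (linear p)
    interpret bounded_linear p by fact
    \<comment> \<open>A real-linear functional on the plane is a complex combination of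
      \<open>z\<close> and \<open>cnj z\<close>.\<close>
    have p: "complex_of_real (p z) = (of_real (p 1) - \<i> * of_real (p \<i>)) / 2 * z + (of_real (p 1) + \<i> * of_real (p \<i>)) / 2 * cnj z" for z
    proof -
      have "z = Re z *\<^sub>R 1 + Im z *\<^sub>R \<i>" by (simp add: complex_eq_iff)
      then have "p z = p (Re z *\<^sub>R 1 + Im z *\<^sub>R \<i>)" by (rule arg_cong)
      also have "\<dots> = Re z * p 1 + Im z * p \<i>" by (simp only: add scaleR real_scaleR_def)
      finally show ?thesis by (simp add: complex_eq_iff field_simps)
    qed
    show ?case
    proof
      fix h assume h: "h \<in> W"
      have eq: "complex_of_real (p z) * h z = (of_real (p 1) - \<i> * of_real (p \<i>)) / 2 * (z * h z)
          + (of_real (p 1) + \<i> * of_real (p \<i>)) / 2 * (cnj z * h z)" for z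
        by (subst p) (simp only: distrib_right mult.assoc)
      show "(\<lambda>z. of_real (p z) * h z) \<in> W"
        unfolding eq by (rule W_lin[OF W_z[OF h] W_zbar[OF h]])
    qed
  next
    case (const c)
    show ?case
    proof
      fix h assume "h \<in> W"
      from W_lin[OF this this, of "of_real c" 0] show "(\<lambda>z. of_real c * h z) \<in> W" by simp
    qed
  next
    case (add p q)
    show ?case
    proof
      fix h assume "h \<in> W"
      then have "(\<lambda>z. of_real (p z) * h z) \<in> W" "(\<lambda>z. of_real (q z) * h z) \<in> W" using add by auto
      from W_lin[OF this, of 1 1] show "(\<lambda>z. of_real (p z + q z) * h z) \<in> W" by (simp add: distrib_right)
    qed
  next
    case (mult p q)
    show ?case
    proof
      fix h assume "h \<in> W"
      then have "(\<lambda>z. of_real (p z) * (of_real (q z) * h z)) \<in> W" using mult by auto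
      then show "(\<lambda>z. of_real (p z * q z) * h z) \<in> W" by (simp add: mult.assoc)
    qed
  qed
  have one: "(\<lambda>z. 1) \<in> W" using mom unfolding W_def by simp
  have p0: "continuous_on UNIV (\<lambda>z. complex_of_real (p z)) \<and> (LINT z|lborel. \<nu> z * of_real (p z)) = 0"
    if "real_polynomial_function p" for p :: "complex \<Rightarrow> real"
  proof -
    have m: "(\<lambda>z. complex_of_real (p z)) \<in> W" using poly[OF that] one by fastforce
    then have "(LINT z|lborel. \<nu> z * (of_real (p z) * (z ^ 0 * cnj z ^ 0))) = 0" unfolding W_def by blast
    then show ?thesis using m unfolding W_def by simp
  qed
  have fc: "continuous_on UNIV (\<lambda>z. complex_of_real (f z))" using f by (intro continuous_intros)
  define N where "N = (LINT z|lborel. cmod (\<nu> z))"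
  have N: "N \<ge> 0" unfolding N_def by simp
  have "cmod (LINT z|lborel. \<nu> z * f z) \<le> 0 + e" if e: "e > 0" for e
  proof -
    \<comment> \<open>\<open>N + 1\<close> avoids a division by 0 in case \<open>\<nu>\<close>
      vanishes.\<close>
    define e' where "e' = e / (N + 1)"
    have e': "e' > 0" using e N by (simp add: e'_def)
    obtain p where p: "real_polynomial_function p" "\<And>x. x \<in> cball 0 1 \<Longrightarrow> \<bar>f x - p x\<bar> < e'"
      using Stone_Weierstrass_real_polynomial_function[of "cball 0 1" f e'] f e'
      by (metis compact_cball continuous_on_subset subset_UNIV)
    note P = p0[OF p(1)]
    have pc: "continuous_on UNIV (\<lambda>z. complex_of_real (p z))" using P by blast
    have "(LINT z|lborel. \<nu> z * f z) = (LINT z|lborel. \<nu> z * f z) - (LINT z|lborel. \<nu> z * p z)"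
      using P by simp
    also have "\<dots> = (LINT z|lborel. \<nu> z * f z - \<nu> z * p z)"
      by (rule Bochner_Integration.integral_diff[OF int[OF fc] int[OF pc], symmetric])
    finally have eq: "(LINT z|lborel. \<nu> z * f z) = (LINT z|lborel. \<nu> z * f z - \<nu> z * p z)" .
    have "cmod (LINT z|lborel. \<nu> z * f z - \<nu> z * p z) \<le> (LINT z|lborel. cmod (\<nu> z) * e')"
    proof (rule order_trans[OF integral_norm_bound], rule integral_mono)
      show "integrable lborel (\<lambda>z. cmod (\<nu> z * f z - \<nu> z * p z))"
        by (intro integrable_norm Bochner_Integration.integrable_diff int fc pc)
      show "integrable lborel (\<lambda>z. cmod (\<nu> z) * e')" using \<nu> by auto
      show "cmod (\<nu> z * f z - \<nu> z * p z) \<le> cmod (\<nu> z) * e'" for z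
      proof (cases "z \<in> cball 0 1")
        case True
        have "\<nu> z * f z - \<nu> z * p z = \<nu> z * of_real (f z - p z)" by (simp add: algebra_simps)
        then have "cmod (\<nu> z * f z - \<nu> z * p z) = cmod (\<nu> z) * \<bar>f z - p z\<bar>" by (simp only: norm_mult norm_of_real)
        then show ?thesis using p(2)[OF True] by (simp add: mult_left_mono)
      qed (use \<nu> in auto)
    qed
    also have "\<dots> = N * e'" by (simp add: N_def)
    also have "\<dots> \<le> e" using N e by (simp add: e'_def divide_le_eq)
    finally show ?thesis unfolding eq by simp
  qed
  then show ?thesis using field_le_epsilon[of "cmod (LINT z|lborel. \<nu> z * f z)" 0] by simp
qed

text \<open>Indicators of closed sets are limits of continuous functions, so \<open>\<nu>\<close>
  integrates to 0 over closed sets. These form a generator stable under intersection, so the same is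
  true for all Borel sets, which forces \<open>\<nu>\<close> to vanish.\<close>

lemma AE_zero_if_polynomial_moments_zero:
  fixes \<nu> :: "complex \<Rightarrow> complex"
  assumes \<nu>: "integrable lborel \<nu>" "\<And>z. z \<notin> cball 0 1 \<Longrightarrow> \<nu> z = 0"
    and mom: "\<And>a b. (LINT z|lborel. \<nu> z * (z ^ a * cnj z ^ b)) = 0"
  shows "AE z in lborel. \<nu> z = 0"
proof -
  have [measurable]: "\<nu> \<in> borel_measurable borel" using \<nu> by auto
  have closed: "(LINT z:C|lborel. \<nu> z) = 0" if C: "closed C" for C
  proof (cases "C = {}")
    case False
    \<comment> \<open>Equal to 1 on \<open>C\<close>, and for \<open>n > 0\<close> equal to 0 at
      distance at least \<open>1 / n\<close> from it.\<close>
    let ?f = "\<lambda>n z. max 0 (1 - real n * infdist z C)"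
    have fc: "continuous_on UNIV (?f n)" for n by (intro continuous_intros)
    have [measurable]: "(\<lambda>z. ?f n z) \<in> borel_measurable borel" for n
      by (rule borel_measurable_continuous_onI[OF fc])
    have "(\<lambda>n. LINT z|lborel. \<nu> z * of_real (?f n z)) \<longlonglongrightarrow> (LINT z|lborel. \<nu> z * of_real (indicator C z))"
    proof (rule integral_dominated_convergence)
      show "(\<lambda>z. \<nu> z * of_real (indicator C z)) \<in> borel_measurable lborel"
        using C by (intro borel_measurable_times borel_measurable_of_real borel_measurable_indicator) auto
      show "integrable lborel (\<lambda>z. cmod (\<nu> z))" using \<nu> by auto
      show "AE z in lborel. (\<lambda>n. \<nu> z * of_real (?f n z)) \<longlonglongrightarrow> \<nu> z * of_real (indicator C z)"
      proof (rule AE_I2)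
        fix z
        have "(\<lambda>n. ?f n z) \<longlonglongrightarrow> indicator C z"
        proof (cases "z \<in> C")
          case False
          then have p: "infdist z C > 0" using C \<open>C \<noteq> {}\<close> by (simp add: infdist_pos_not_in_closed)
          obtain m where m: "1 / infdist z C < real m" using reals_Archimedean2 by blast
          have "?f n z = 0" if "n \<ge> m" for n
          proof -
            have "1 / infdist z C < real n" using m that by (meson less_le_trans of_nat_mono)
            then have "1 < real n * infdist z C" using p by (simp add: divide_less_eq)
            then show ?thesis by simp
          qed
          then have "eventually (\<lambda>n. ?f n z = 0) sequentially" unfolding eventually_sequentially by blast
          then show ?thesis using False by (simp add: tendsto_eventually)
        qed auto
        then show "(\<lambda>n. \<nu> z * of_real (?f n z)) \<longlonglongrightarrow> \<nu> z * of_real (indicator C z)"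
          by (intro tendsto_mult_left tendsto_of_real)
      qed
      show "AE z in lborel. norm (\<nu> z * of_real (?f n z)) \<le> cmod (\<nu> z)" for n
      proof (rule AE_I2)
        fix z
        have "\<bar>?f n z\<bar> \<le> 1" using infdist_nonneg[of z C] by auto
        then have "cmod (\<nu> z) * \<bar>?f n z\<bar> \<le> cmod (\<nu> z) * 1" by (intro mult_left_mono) auto
        then show "norm (\<nu> z * of_real (?f n z)) \<le> cmod (\<nu> z)" by (simp only: norm_mult norm_of_real mult_1_right)
      qed
    qed measurable
    moreover have "(LINT z|lborel. \<nu> z * of_real (?f n z)) = 0" for n
      by (rule integral_continuous_eq_0[OF \<nu> mom fc])
    ultimately have "(LINT z|lborel. \<nu> z * of_real (indicator C z)) = 0"
      by (simp add: LIMSEQ_const_iff)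
    then show ?thesis by (simp add: set_lebesgue_integral_def scaleR_conv_of_real mult.commute)
  qed (simp add: set_lebesgue_integral_def)
  have sub: "set_integrable lborel A \<nu>" if "A \<in> sets borel" for A
    using that \<nu>(1) unfolding set_integrable_def by (intro integrable_mult_indicator) auto
  have UNIV0: "(LINT z|lborel. \<nu> z) = 0" using closed[of UNIV] by (simp add: set_lebesgue_integral_def)
  have all: "(LINT z:A|lborel. \<nu> z) = 0" if "A \<in> sigma_sets UNIV (Collect closed)" for A
  proof (rule sigma_sets_induct_disjoint[where G = "Collect closed" and \<Omega> = UNIV and P = "\<lambda>A. (LINT z:A|lborel. \<nu> z) = 0"])
    show "Int_stable (Collect closed)" by (auto simp: Int_stable_def)
    fix A :: "complex set" assume A: "A \<in> sigma_sets UNIV (Collect closed)" and A0: "(LINT z:A|lborel. \<nu> z) = 0"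
    have Ab: "A \<in> sets borel" using A by (simp add: borel_eq_closed)
    have "(LINT z:A|lborel. \<nu> z) + (LINT z:UNIV - A|lborel. \<nu> z) = (LINT z:A \<union> (UNIV - A)|lborel. \<nu> z)"
      using Ab by (intro set_integral_Un[symmetric] sub) auto
    also have "\<dots> = 0" using UNIV0 by (simp add: set_lebesgue_integral_def)
    finally show "(LINT z:UNIV - A|lborel. \<nu> z) = 0" using A0 by simp
  next
    fix A :: "nat \<Rightarrow> complex set"
    assume A: "disjoint_family A" "range A \<subseteq> sigma_sets UNIV (Collect closed)" "\<And>i. (LINT z:A i|lborel. \<nu> z) = 0"
    have Ab: "A i \<in> sets borel" for i using A(2) by (auto simp: borel_eq_closed)
    have "(LINT z:(\<Union>i. A i)|lborel. \<nu> z) = (\<Sum>i. (LINT z:(A i)|lborel. \<nu> z))"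
      using Ab A(1) by (intro lebesgue_integral_countable_add sub) (auto simp: disjoint_family_on_def)
    then show "(LINT z:(\<Union>i. A i)|lborel. \<nu> z) = 0" using A(3) by simp
  qed (use closed that in \<open>auto simp: set_lebesgue_integral_def\<close>)
  have allb: "(LINT z:A|lborel. \<nu> z) = 0" if "A \<in> sets lborel" for A
    using that by (intro all) (simp add: borel_eq_closed)
  have "(LINT z:A|lborel. Re (\<nu> z)) = 0 \<and> (LINT z:A|lborel. Im (\<nu> z)) = 0" if "A \<in> sets lborel" for A
  proof -
    have i: "integrable lborel (\<lambda>z. indicator A z *\<^sub>R \<nu> z)" using sub[of A] that by (simp add: set_integrable_def)
    have "(LINT z|lborel. Re (indicator A z *\<^sub>R \<nu> z)) = Re (LINT z:A|lborel. \<nu> z)"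
      "(LINT z|lborel. Im (indicator A z *\<^sub>R \<nu> z)) = Im (LINT z:A|lborel. \<nu> z)"
      unfolding set_lebesgue_integral_def by (rule integral_Re[OF i], rule integral_Im[OF i])
    then show ?thesis using allb[OF that] by (simp add: set_lebesgue_integral_def)
  qed
  then have "AE z in lborel. Re (\<nu> z) = 0" "AE z in lborel. Im (\<nu> z) = 0"
    using \<nu>(1) by (auto intro!: density_unique_real simp: set_lebesgue_integral_def)
  then show ?thesis by eventually_elim (simp add: complex_eq_iff)
qed

text \<open>Off 0, \<open>z ^ a * cnj z ^ b\<close> is \<open>z powi (int a - int b)\<close> times a
  power of \<open>(cmod z)^2\<close>, which the profile absorbs. Hence
  \<open>d z * radial \<theta> z\<close> has vanishing polynomial moments; countably many profiles,
  positive on annuli that exhaust the punctured disk, finish the argument.\<close>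

lemma AE_zero_if_moments_zero:
  assumes d: "d \<in> borel_measurable borel" "\<And>\<rho>. \<rho> < 1 \<Longrightarrow> set_integrable lborel (cball 0 \<rho>) d"
    and mom: "\<And>\<theta> j. annular \<theta> \<Longrightarrow> moment d \<theta> j = 0"
  shows "AE z in lborel. z \<in> disk \<longrightarrow> d z = 0"
proof -
  have [measurable]: "d \<in> borel_measurable borel" by fact
  have ann: "AE z in lborel. d z * radial \<theta> z = 0" if \<theta>: "annular \<theta>" for \<theta>
  proof (rule AE_zero_if_polynomial_moments_zero)
    show "integrable lborel (\<lambda>z. d z * radial \<theta> z)"
      using moment_integrable[OF d \<theta>, of 0] by simp
    show "d z * radial \<theta> z = 0" if "z \<notin> cball 0 1" for z
    proof -
      have "1 < cmod z" using that by simp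
      then have "1 < (cmod z)\<^sup>2" by (simp add: one_less_power)
      then show ?thesis using \<theta> unfolding annular_def radial_def by (auto dest!: spec[where x = "(cmod z)\<^sup>2"])
    qed
    fix a b :: nat
    have \<theta>': "annular (\<lambda>s. \<theta> s * s ^ b)" by (intro annular_mult \<theta> continuous_intros)
    have [measurable]: "radial \<theta> \<in> borel_measurable borel" "radial (\<lambda>s. \<theta> s * s ^ b) \<in> borel_measurable borel"
      by (rule radial_measurable[OF \<theta>], rule radial_measurable[OF \<theta>'])
    have "(LINT z|lborel. d z * radial \<theta> z * (z ^ a * cnj z ^ b)) = moment d (\<lambda>s. \<theta> s * s ^ b) (int a - int b)"
      unfolding moment_def
    proof (rule integral_cong_AE)
      show "AE z in lborel. d z * radial \<theta> z * (z ^ a * cnj z ^ b) = d z * (radial (\<lambda>s. \<theta> s * s ^ b) z * z powi (int a - int b))"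
        using AE_lborel_singleton[of 0]
      proof eventually_elim
        case (elim z)
        have "complex_of_real (((cmod z)\<^sup>2) ^ b) = z ^ b * cnj z ^ b"
          by (simp only: of_real_power[of "(cmod z)\<^sup>2"] complex_norm_square power_mult_distrib)
        moreover have "z powi (int a - int b) = z ^ a / z ^ b" using elim by (simp add: power_int_diff)
        ultimately show ?case using elim by (simp add: radial_def)
      qed
    qed measurable
    also have "\<dots> = 0" by (rule mom[OF \<theta>'])
    finally show "(LINT z|lborel. d z * radial \<theta> z * (z ^ a * cnj z ^ b)) = 0" .
  qed
  \<comment> \<open>The shift by 3 makes \<open>1 / real (n + 3)\<close> at most 1/3, so the annulus
    is nonempty for every \<open>n\<close>.\<close>
  have "AE z in lborel. \<forall>n::nat. 1 / real (n + 3) < (cmod z)\<^sup>2 \<and> (cmod z)\<^sup>2 < 1 - 1 / real (n + 3) \<longrightarrow> d z = 0"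
  proof (subst AE_all_countable, rule allI)
    fix n :: nat
    have n: "1 / real (n + 3) \<le> 1 / 3" by (intro divide_left_mono) auto
    obtain \<theta> where \<theta>: "annular \<theta>" "\<And>s. s \<in> {1 / real (n + 3)<..<1 - 1 / real (n + 3)} \<Longrightarrow> \<theta> s > 0"
    proof (rule annular_bump[of "1 / real (n + 3)" "1 - 1 / real (n + 3)"])
      show "1 / real (n + 3) < 1 - 1 / real (n + 3)" using n by linarith
    qed auto
    show "AE z in lborel. 1 / real (n + 3) < (cmod z)\<^sup>2 \<and> (cmod z)\<^sup>2 < 1 - 1 / real (n + 3) \<longrightarrow> d z = 0"
      using ann[OF \<theta>(1)]
    proof (eventually_elim, intro impI)
      fix z assume "d z * radial \<theta> z = 0" and z: "1 / real (n + 3) < (cmod z)\<^sup>2 \<and> (cmod z)\<^sup>2 < 1 - 1 / real (n + 3)"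
      moreover have "\<theta> ((cmod z)\<^sup>2) > 0" using z by (intro \<theta>(2)) simp
      ultimately show "d z = 0" by (simp add: radial_def)
    qed
  qed
  then show ?thesis
    using AE_lborel_singleton[of 0]
  proof (eventually_elim, intro impI)
    fix z :: complex
    assume *: "\<forall>n::nat. 1 / real (n + 3) < (cmod z)\<^sup>2 \<and> (cmod z)\<^sup>2 < 1 - 1 / real (n + 3) \<longrightarrow> d z = 0" and z: "z \<noteq> 0" "z \<in> disk"
    let ?m = "min ((cmod z)\<^sup>2) (1 - (cmod z)\<^sup>2)"
    have "?m > 0" using z by (simp add: power_less_one_iff)
    then obtain n where "1 / real (Suc n) < ?m" using nat_approx_posE by blast
    moreover have "1 / real (n + 3) \<le> 1 / real (Suc n)" by (intro divide_left_mono) auto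
    ultimately have "1 / real (n + 3) < ?m" by linarith
    then show "d z = 0" using * by (auto simp: min_less_iff_conj algebra_simps)
  qed
qed

section \<open>Uniqueness for one component\<close>

text \<open>Local integrability yields measurability on compact sets only; on the disk
  \<open>u\<close> is the pointwise limit of its cut-offs to closed subdisks.\<close>

lemma L1_loc_borel_representative:
  assumes u: "L1_loc_disk u"
  obtains U where "U \<in> borel_measurable borel" "AE z in lborel. z \<in> disk \<longrightarrow> u z = U z"
    "\<And>\<rho>. \<rho> < 1 \<Longrightarrow> set_integrable lborel (cball 0 \<rho>) U"
proof -
  have sub: "cball (0::complex) \<rho> \<subseteq> disk" if "\<rho> < 1" for \<rho>
  proof
    fix x :: complex assume "x \<in> cball 0 \<rho>"
    then have "cmod x \<le> \<rho>" by (simp only: mem_cball dist_0_norm)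
    then show "x \<in> disk" using that by simp
  qed
  let ?K = "\<lambda>n. cball (0::complex) (1 - 1 / real (Suc n))"
  have "(\<lambda>z. indicator disk z *\<^sub>R u z) \<in> borel_measurable lebesgue"
  proof (rule borel_measurable_LIMSEQ_metric)
    fix n
    have "1 - 1 / real (Suc n) < 1" by simp
    then have "u \<in> borel_measurable (lebesgue_on (?K n))"
      by (intro borel_measurable_integrable L1_loc_diskD[OF u] compact_cball sub)
    then show "(\<lambda>z. indicator (?K n) z *\<^sub>R u z) \<in> borel_measurable lebesgue"
      by (subst (asm) borel_measurable_restrict_space_iff) auto
  next
    fix z :: complex
    show "(\<lambda>n. indicator (?K n) z *\<^sub>R u z) \<longlonglongrightarrow> indicator disk z *\<^sub>R u z"
    proof (cases "z \<in> disk")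
      case True
      then obtain m where m: "1 / real (Suc m) < 1 - cmod z" using nat_approx_posE[of "1 - cmod z"] by auto
      have "z \<in> ?K n" if "n \<ge> m" for n
      proof -
        have "1 / real (Suc n) \<le> 1 / real (Suc m)" using that by (intro divide_left_mono) auto
        then have "cmod z \<le> 1 - 1 / real (Suc n)" using m by linarith
        then show ?thesis by (simp only: mem_cball dist_0_norm)
      qed
      then have "eventually (\<lambda>n. indicator (?K n) z *\<^sub>R u z = indicator disk z *\<^sub>R u z) sequentially"
        using True unfolding eventually_sequentially by (intro exI[of _ m]) (simp del: of_nat_Suc mem_cball)
      then show ?thesis by (rule tendsto_eventually)
    next
      case False
      have "z \<notin> ?K n" for n using sub[of "1 - 1 / real (Suc n)"] False by auto
      then show ?thesis using False by (simp del: of_nat_Suc mem_cball)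
    qed
  qed
  then have "u \<in> borel_measurable (lebesgue_on disk)"
    by (subst borel_measurable_restrict_space_iff) auto
  then obtain U where U: "U \<in> borel_measurable borel" "AE z in lborel. z \<in> disk \<longrightarrow> u z = U z"
    by (rule lebesgue_on_borel_representative[OF _ borel_open[OF open_ball]]) blast
  show ?thesis
  proof (rule that[OF U])
    fix \<rho> :: real assume \<rho>: "\<rho> < 1"
    have eq: "AE z in lborel. z \<in> cball 0 \<rho> \<longrightarrow> u z = U z"
      using U(2) by eventually_elim (use sub[OF \<rho>] in blast)
    show "set_integrable lborel (cball 0 \<rho>) U"
      using L1_loc_diskD[OF u compact_cball sub[OF \<rho>]]
      by (subst (asm) lebesgue_on_integrable_iff[OF borel_closed[OF closed_cball] eq U(1)])
  qed
qed

text \<open>Both pairings equal the same expression in \<open>g\<close> and \<open>\<phi>\<close>,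
  so they cancel whatever its value is. The support of \<open>\<phi>\<close> lies in a closed disk
  of radius below 1, where the representatives are integrable.\<close>

lemma weak_dzbar_diff:
  assumes u: "has_weak_dzbar u g" and v: "has_weak_dzbar v g"
  obtains d where "d \<in> borel_measurable borel" "AE z in lborel. z \<in> disk \<longrightarrow> u z - v z = d z"
    "\<And>\<rho>. \<rho> < 1 \<Longrightarrow> set_integrable lborel (cball 0 \<rho>) d"
    "\<And>\<phi>. C1_compact_disk \<phi> \<Longrightarrow> (LINT z|lborel. d z * wirtinger_zbar \<phi> z) = 0"
proof -
  obtain U where U: "U \<in> borel_measurable borel" "AE z in lborel. z \<in> disk \<longrightarrow> u z = U z"
    "\<And>\<rho>. \<rho> < 1 \<Longrightarrow> set_integrable lborel (cball 0 \<rho>) U"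
    using u unfolding has_weak_dzbar_def by (elim conjE L1_loc_borel_representative) blast
  obtain V where V: "V \<in> borel_measurable borel" "AE z in lborel. z \<in> disk \<longrightarrow> v z = V z"
    "\<And>\<rho>. \<rho> < 1 \<Longrightarrow> set_integrable lborel (cball 0 \<rho>) V"
    using v unfolding has_weak_dzbar_def by (elim conjE L1_loc_borel_representative) blast
  show ?thesis
  proof (rule that[of "\<lambda>z. U z - V z"])
    show "(\<lambda>z. U z - V z) \<in> borel_measurable borel" using U V by measurable
    show "AE z in lborel. z \<in> disk \<longrightarrow> u z - v z = U z - V z"
      using U(2) V(2) by eventually_elim simp
    show "set_integrable lborel (cball 0 \<rho>) (\<lambda>z. U z - V z)" if "\<rho> < 1" for \<rho>
      using U(3)[OF that] V(3)[OF that] by (rule set_integral_diff(1))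
    fix \<phi> assume \<phi>: "C1_compact_disk \<phi>"
    obtain M where M: "M \<ge> 0" "\<And>z. cmod (wirtinger_zbar \<phi> z) \<le> M * indicator disk z"
      using \<phi> by (rule C1_compact_disk_bounded) blast
    obtain K where K: "compact K" "K \<subseteq> disk" "\<And>z. z \<notin> K \<Longrightarrow> \<phi> z = 0" "\<And>z. z \<notin> K \<Longrightarrow> wirtinger_zbar \<phi> z = 0"
      using \<phi> by (rule C1_compact_diskE) blast
    obtain \<rho> where \<rho>: "\<rho> < 1" "K \<subseteq> cball 0 \<rho>" using compact_subset_cball[OF K(1,2)] by blast
    have wm [measurable]: "wirtinger_zbar \<phi> \<in> borel_measurable borel"
      by (intro borel_measurable_continuous_onI wirtinger_zbar_continuous[OF \<phi>])
    have bd: "cmod (wirtinger_zbar \<phi> z) \<le> M * indicator (cball 0 \<rho>) z" for z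
    proof (cases "z \<in> K")
      case True
      then have "z \<in> cball 0 \<rho>" using \<rho>(2) by blast
      then show ?thesis using M(2)[of z] True K(2) by (auto simp: indicator_def split: if_splits)
    next
      case False
      then show ?thesis using K(4) M(1) by simp
    qed
    have test: "integrable lborel (\<lambda>z. F z * wirtinger_zbar \<phi> z)
        \<and> (LINT z|lborel. F z * wirtinger_zbar \<phi> z) = - (LINT z|lebesgue_on disk. g z * \<phi> z)"
      if f: "has_weak_dzbar f g" and F: "F \<in> borel_measurable borel" "AE z in lborel. z \<in> disk \<longrightarrow> f z = F z"
        "\<And>\<rho>. \<rho> < 1 \<Longrightarrow> set_integrable lborel (cball 0 \<rho>) F" for f F
    proof
      have [measurable]: "F \<in> borel_measurable borel" by fact
      show "integrable lborel (\<lambda>z. F z * wirtinger_zbar \<phi> z)"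
        by (rule locally_integrable_mult[OF F(1,3) wm bd \<rho>(1)])
      have "(LINT z|lborel. F z * wirtinger_zbar \<phi> z) = (LINT z:disk|lborel. F z * wirtinger_zbar \<phi> z)"
        unfolding set_lebesgue_integral_def
      proof (intro Bochner_Integration.integral_cong refl)
        fix z
        show "F z * wirtinger_zbar \<phi> z = indicator disk z *\<^sub>R (F z * wirtinger_zbar \<phi> z)"
        proof (cases "z \<in> disk")
          case False
          then have "wirtinger_zbar \<phi> z = 0" using K(2,4) by blast
          then show ?thesis by simp
        qed simp
      qed
      also have "\<dots> = (LINT z|lebesgue_on disk. f z * wirtinger_zbar \<phi> z)"
      proof (rule lebesgue_on_integral_eq[symmetric])
        show "AE z in lborel. z \<in> disk \<longrightarrow> f z * wirtinger_zbar \<phi> z = F z * wirtinger_zbar \<phi> z"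
          using F(2) by eventually_elim simp
      qed auto
      also have "\<dots> = - (LINT z|lebesgue_on disk. g z * \<phi> z)"
        using f \<phi> unfolding has_weak_dzbar_def by blast
      finally show "(LINT z|lborel. F z * wirtinger_zbar \<phi> z) = - (LINT z|lebesgue_on disk. g z * \<phi> z)" .
    qed
    note TU = test[OF u U] and TV = test[OF v V]
    show "(LINT z|lborel. (U z - V z) * wirtinger_zbar \<phi> z) = 0"
      using TU TV unfolding left_diff_distrib by (subst Bochner_Integration.integral_diff) auto
  qed
qed

lemma set_integrable_const_cball: "set_integrable lborel (cball (0::complex) \<rho>) (\<lambda>z. k :: complex)"
  unfolding set_integrable_def by (intro borel_integrable_compact) auto

text \<open>Provides the factor \<open>pi\<close> by which the constant \<open>\<kappa>\<close> of
  the uniqueness proof is normalised.\<close>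

lemma moment_const:
  assumes "annular \<theta>"
  shows "moment (\<lambda>z. 1) \<theta> 0 = of_real (pi * total \<theta>)"
proof -
  have one: "(\<lambda>z::complex. 1::complex) \<in> borel_measurable borel" "\<And>\<rho>. \<rho> < 1 \<Longrightarrow> set_integrable lborel (cball 0 \<rho>) (\<lambda>z::complex. 1 :: complex)"
    by (auto intro: set_integrable_const_cball)
  have int: "integrable lborel (radial \<theta>)" using moment_integrable[OF one assms, of 0] by simp
  have "moment (\<lambda>z. 1) \<theta> 0 = (LINT z|lborel. radial \<theta> z)" by (simp add: moment_def)
  also have "\<dots> = (LINT r:{0<..}|lborel. r *\<^sub>R (LINT t:{0..2*pi}|lborel. radial \<theta> (rcis r t)))"
    by (rule integral_polar[OF int])
  also have "\<dots> = (LINT r:{0<..}|lborel. of_real (2 * pi * (r * \<theta> (r\<^sup>2))))"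
    by (intro set_lebesgue_integral_cong) (auto simp: radial_def set_lebesgue_integral_def scaleR_conv_of_real)
  also have "\<dots> = of_real (2 * pi * (LINT r:{0<..}|lborel. r * \<theta> (r\<^sup>2)))"
    by (simp only: set_integral_complex_of_real set_integral_mult_right)
  finally show ?thesis by (simp add: radial_weight_integral(2)[OF assms])
qed

theorem schwarz_problem_uniqueness:
  fixes b :: "complex \<Rightarrow> real"
  assumes b: "continuous_on (sphere 0 1) b"
    and u: "has_weak_dzbar u g" "has_boundary_value (\<lambda>z. Re (u z)) b" "mean_value_at_0 (\<lambda>z. Im (u z))"
    and v: "has_weak_dzbar v g" "has_boundary_value (\<lambda>z. Re (v z)) b" "mean_value_at_0 (\<lambda>z. Im (v z))"
    and uv: "Im (u 0) = Im (v 0)"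
  shows "AE z in lborel. z \<in> disk \<longrightarrow> u z = v z"
proof -
  obtain d where dm [measurable]: "d \<in> borel_measurable borel" and d_eq: "AE z in lborel. z \<in> disk \<longrightarrow> u z - v z = d z"
    and d_int: "\<And>\<rho>. \<rho> < 1 \<Longrightarrow> set_integrable lborel (cball 0 \<rho>) d"
    and weak: "\<And>\<phi>. C1_compact_disk \<phi> \<Longrightarrow> (LINT z|lborel. d z * wirtinger_zbar \<phi> z) = 0"
    by (rule weak_dzbar_diff[OF u(1) v(1)]) blast
  have loc: "L1_loc_disk u" "L1_loc_disk v" using u v by (auto simp: has_weak_dzbar_def)
  have circ: "AE r in lborel. 0 < r \<and> r < 1 \<longrightarrow> integrable (lebesgue_on {0..2*pi}) (\<lambda>t. Re (f (rcis r t)))"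
    if "L1_loc_disk f" for f
    using L1_loc_circle_integrable[OF that] by eventually_elim auto
  have bc: "continuous_on UNIV (\<lambda>s. b (cis s))"
    by (intro continuous_on_compose2[OF b] continuous_intros) auto
  have bi: "integrable (lebesgue_on {0..2*pi}) (\<lambda>t. b (cis t))"
    using set_integrable_circle[OF bc] borel_measurable_continuous_onI[OF bc]
    by (subst lebesgue_on_integrable_iff[where F = "\<lambda>t. b (cis t)"]) auto
  have "has_boundary_value (\<lambda>z. Re (u z) - Re (v z)) (\<lambda>z. b z - b z)"
    by (rule has_boundary_value_diff[OF u(2) circ[OF loc(1)] v(2) circ[OF loc(2)] bi bi])
  moreover have "AE z in lborel. z \<in> disk \<longrightarrow> Re (u z) - Re (v z) = Re (d z)"
    using d_eq by eventually_elim (metis minus_complex.simps(1))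
  ultimately have bv: "has_boundary_value (\<lambda>z. Re (d z)) (\<lambda>z. 0)"
    using has_boundary_value_cong_AE by simp
  obtain \<eta> where \<eta>: "annular \<eta>" "total \<eta> = 1"
    by (rule annular_bump[of "1/4" "1/2"]) auto
  \<comment> \<open>The constant with the same moment of order 0 as \<open>d\<close>. Its real part
    turns out to be 0, so subtracting it disturbs neither the equation nor the boundary
    values.\<close>
  define \<kappa> where "\<kappa> = moment d \<eta> 0 / pi"
  have Re0: "Re (moment d \<eta> 0) = 0" by (rule moment_Re_zero[OF dm d_int weak bv \<eta>(1)])
  have \<kappa>: "Re \<kappa> = 0" unfolding \<kappa>_def by (simp add: Re0)
  define d' where "d' z = d z - \<kappa>" for z
  have dm' [measurable]: "d' \<in> borel_measurable borel" unfolding d'_def[abs_def] by measurable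
  have d_int': "set_integrable lborel (cball 0 \<rho>) d'" if "\<rho> < 1" for \<rho>
    unfolding d'_def by (intro set_integral_diff(1) d_int that set_integrable_const_cball)
  have weak': "(LINT z|lborel. d' z * wirtinger_zbar \<phi> z) = 0" if \<phi>: "C1_compact_disk \<phi>" for \<phi>
  proof -
    have k: "(\<lambda>z::complex. \<kappa>) holomorphic_on disk" by (intro holomorphic_intros)
    note k1 = integrable_holomorphic_wirtinger[OF \<phi> k] and k2 = integral_holomorphic_wirtinger[OF \<phi> k]
    show ?thesis
    \<comment> \<open>If the product with \<open>d\<close> is not integrable, neither is the one
      with \<open>d'\<close>, and the integral is 0 by default.\<close>
    proof (cases "integrable lborel (\<lambda>z. d z * wirtinger_zbar \<phi> z)")
      case True
      then show ?thesis
        unfolding d'_def left_diff_distrib using k1 k2 weak[OF \<phi>] by (subst Bochner_Integration.integral_diff) auto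
    next
      case False
      have "\<not> integrable lborel (\<lambda>z. d' z * wirtinger_zbar \<phi> z)"
      proof
        assume "integrable lborel (\<lambda>z. d' z * wirtinger_zbar \<phi> z)"
        from Bochner_Integration.integrable_add[OF this k1] show False
          using False by (simp add: d'_def algebra_simps)
      qed
      then show ?thesis by (rule not_integrable_integral_eq)
    qed
  qed
  have bv': "has_boundary_value (\<lambda>z. Re (d' z)) (\<lambda>z. 0)" using bv by (simp add: d'_def \<kappa>)
  have m0: "moment d' \<eta> 0 = 0"
  proof -
    have one: "(\<lambda>z::complex. 1::complex) \<in> borel_measurable borel" "\<And>\<rho>. \<rho> < 1 \<Longrightarrow> set_integrable lborel (cball 0 \<rho>) (\<lambda>z::complex. 1 :: complex)"
      by (auto intro: set_integrable_const_cball)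
    have i1: "integrable lborel (\<lambda>z. d z * (radial \<eta> z * z powi 0))" by (rule moment_integrable[OF dm d_int \<eta>(1)])
    have i2: "integrable lborel (\<lambda>z. 1 * (radial \<eta> z * z powi 0))" by (rule moment_integrable[OF one \<eta>(1)])
    have "moment d' \<eta> 0 = (LINT z|lborel. d z * (radial \<eta> z * z powi 0) - \<kappa> * (1 * (radial \<eta> z * z powi 0)))"
      unfolding moment_def d'_def by (simp add: left_diff_distrib)
    also have "\<dots> = moment d \<eta> 0 - \<kappa> * moment (\<lambda>z. 1) \<eta> 0"
      unfolding moment_def using i1 i2 by (subst Bochner_Integration.integral_diff) auto
    also have "\<dots> = 0" by (simp add: moment_const[OF \<eta>(1)] \<eta>(2) \<kappa>_def)
    finally show ?thesis .
  qed
  have all: "moment d' \<theta> j = 0" if \<theta>: "annular \<theta>" for \<theta> j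
  proof (cases "j = 0")
    case True
    have "moment d' \<theta> 0 = total \<theta> * moment d' \<eta> 0"
      by (rule moment_proportional[OF dm' d_int' weak' \<theta> \<eta>])
    then show ?thesis using m0 True by simp
  next
    case False
    show ?thesis by (rule moment_nonzero_index[OF dm' d_int' weak' bv' \<theta> False])
  qed
  have "AE z in lborel. z \<in> disk \<longrightarrow> d' z = 0"
    by (rule AE_zero_if_moments_zero[OF dm' d_int' all])
  then have dk: "AE z in lborel. z \<in> disk \<longrightarrow> u z - v z = \<kappa>"
    using d_eq by eventually_elim (simp add: d'_def)
  have "((\<lambda>r. (LINT z|lebesgue_on (ball 0 r). Im (u z)) / (pi * r\<^sup>2) - (LINT z|lebesgue_on (ball 0 r). Im (v z)) / (pi * r\<^sup>2))
      \<longlongrightarrow> Im (u 0) - Im (v 0)) (at_right 0)"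
    using u(3) v(3) unfolding mean_value_at_0_def by (rule tendsto_diff)
  moreover have "eventually (\<lambda>r. 0 < r \<and> r < 1) (at_right (0::real))"
    using eventually_at_right_real[of 0 1] by simp
  then have "eventually (\<lambda>r. (LINT z|lebesgue_on (ball 0 r). Im (u z)) / (pi * r\<^sup>2) - (LINT z|lebesgue_on (ball 0 r). Im (v z)) / (pi * r\<^sup>2) = Im \<kappa>) (at_right 0)"
  proof eventually_elim
    case (elim r)
    have "cball (0::complex) r \<subseteq> disk" using elim by (auto simp: subset_iff)
    then have int: "integrable (lebesgue_on (ball 0 r)) f" if "L1_loc_disk f" for f
    proof -
      have "set_integrable lebesgue (cball 0 r) f"
        using L1_loc_diskD[OF that compact_cball \<open>cball 0 r \<subseteq> disk\<close>]
        by (simp add: integrable_restrict_space set_integrable_def)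
      then have "set_integrable lebesgue (ball 0 r) f"
        by (rule set_integrable_subset) auto
      then show ?thesis by (simp add: integrable_restrict_space set_integrable_def)
    qed
    have "AE z in lebesgue_on (ball 0 r). u z - v z = \<kappa>"
    proof (subst AE_restrict_space_iff)
      show "AE z in lebesgue. z \<in> ball 0 r \<longrightarrow> u z - v z = \<kappa>"
        using AE_completion[OF dk] by eventually_elim (use elim in auto)
    qed auto
    then have ae: "AE z in lebesgue_on (ball 0 r). Im (u z) - Im (v z) = Im \<kappa>"
      by eventually_elim (metis minus_complex.simps(2))
    interpret complete_measure "lebesgue_on (ball (0::complex) r)"
      by (rule complete_measure_lebesgue_on) auto
    have "(LINT z|lebesgue_on (ball 0 r). Im (u z)) - (LINT z|lebesgue_on (ball 0 r). Im (v z))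
        = (LINT z|lebesgue_on (ball 0 r). Im (u z) - Im (v z))"
      using int loc by (intro Bochner_Integration.integral_diff[symmetric] integrable_Im)
    also have "\<dots> = (LINT z|lebesgue_on (ball (0::complex) r). Im \<kappa>)"
      by (rule integral_cong_AE_complete[OF ae])
    also have "\<dots> = pi * r\<^sup>2 * Im \<kappa>"
      using elim by (simp add: measure_restrict_space measure_ball_complex)
    finally show ?case using elim by (simp add: diff_divide_distrib[symmetric])
  qed
  ultimately have "((\<lambda>r::real. Im \<kappa>) \<longlongrightarrow> Im (u 0) - Im (v 0)) (at_right 0)"
    by (simp only: tendsto_cong)
  then have "Im \<kappa> = 0" using uv by (simp add: tendsto_const_iff)
  then have "\<kappa> = 0" using \<kappa> by (simp add: complex_eq_iff)
  then show ?thesis using dk by simp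
qed

section \<open>The conjugate component\<close>

text \<open>\<open>cnj\<close> is bounded and real-linear, so it commutes with the Frechet
  derivative, while the factor \<open>\<i>\<close> in the Wirtinger derivative changes sign.\<close>

lemma
  assumes \<phi>: "C1_compact_disk \<phi>"
  shows C1_compact_disk_cnj: "C1_compact_disk (\<lambda>z. cnj (\<phi> z))"
    and wirtinger_zbar_cnj: "wirtinger_zbar (\<lambda>z. cnj (\<phi> z)) z = cnj (wirtinger_z \<phi> z)"
proof -
  have der: "((\<lambda>z. cnj (\<phi> z)) has_derivative (\<lambda>h. cnj (frechet_derivative \<phi> (at z) h))) (at z)" for z
    using \<phi> unfolding C1_compact_disk_def
    by (intro bounded_linear.has_derivative[OF bounded_linear_cnj]) (auto simp: frechet_derivative_works)
  then have fr: "frechet_derivative (\<lambda>z. cnj (\<phi> z)) (at z) = (\<lambda>h. cnj (frechet_derivative \<phi> (at z) h))" for z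
    using frechet_derivative_at by metis
  show "C1_compact_disk (\<lambda>z. cnj (\<phi> z))"
  proof -
    obtain K where K: "compact K" "K \<subseteq> disk" "\<And>z. z \<notin> K \<Longrightarrow> \<phi> z = 0" "\<And>z. z \<notin> K \<Longrightarrow> wirtinger_zbar \<phi> z = 0"
      using \<phi> by (rule C1_compact_diskE) blast
    have c: "continuous_on UNIV (\<lambda>z. cnj (frechet_derivative \<phi> (at z) h))" if "h = 1 \<or> h = \<i>" for h
      using \<phi> that unfolding C1_compact_disk_def by (auto intro: continuous_on_cnj)
    have "(\<lambda>z. cnj (\<phi> z)) differentiable (at z)" for z
      unfolding differentiable_def by (rule exI) (rule der)
    then show ?thesis
      unfolding C1_compact_disk_def fr using c K(1-3) by (intro conjI allI exI[of _ K] impI) simp_all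
  qed
  show "wirtinger_zbar (\<lambda>z. cnj (\<phi> z)) z = cnj (wirtinger_z \<phi> z)"
    unfolding wirtinger_zbar_def wirtinger_z_def fr by simp
qed

text \<open>Conjugation is an involution on the test functions, so conjugating the whole identity
  and running over all conjugated test functions loses nothing.\<close>

lemma has_weak_dz_iff_cnj: "has_weak_dz u g \<longleftrightarrow> has_weak_dzbar (\<lambda>z. cnj (u z)) (\<lambda>z. cnj (g z))"
proof -
  have "integrable M f \<longleftrightarrow> integrable M (\<lambda>x. cnj (f x))" for M :: "complex measure" and f
    using integrable_cnj[of M f] integrable_cnj[of M "\<lambda>x. cnj (f x)"] by auto
  then have loc: "L1_loc_disk f \<longleftrightarrow> L1_loc_disk (\<lambda>z. cnj (f z))" for f
    unfolding L1_loc_disk_def by simp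
  have c: "(LINT z|lebesgue_on disk. cnj (f z) * cnj (h z)) = cnj (LINT z|lebesgue_on disk. f z * h z)" for f h :: "complex \<Rightarrow> complex"
    unfolding complex_cnj_mult[symmetric] by (rule Bochner_Integration.integral_cnj)
  have "(\<forall>\<phi>. C1_compact_disk \<phi> \<longrightarrow> (LINT z|lebesgue_on disk. u z * wirtinger_z \<phi> z) = - (LINT z|lebesgue_on disk. g z * \<phi> z))
    \<longleftrightarrow> (\<forall>\<phi>. C1_compact_disk \<phi> \<longrightarrow> (LINT z|lebesgue_on disk. cnj (u z) * wirtinger_zbar \<phi> z) = - (LINT z|lebesgue_on disk. cnj (g z) * \<phi> z))"
    (is "(\<forall>\<phi>. _ \<longrightarrow> ?P \<phi>) \<longleftrightarrow> (\<forall>\<phi>. _ \<longrightarrow> ?Q \<phi>)")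
  proof -
    have PQ: "?Q (\<lambda>z. cnj (\<phi> z)) \<longleftrightarrow> ?P \<phi>" if "C1_compact_disk \<phi>" for \<phi>
      unfolding wirtinger_zbar_cnj[OF that] c complex_cnj_minus[symmetric] complex_cnj_cancel_iff ..
    show ?thesis
    proof (intro iffI allI impI)
      fix \<phi> assume Q: "\<forall>\<phi>. C1_compact_disk \<phi> \<longrightarrow> ?Q \<phi>" and \<phi>: "C1_compact_disk \<phi>"
      from Q[rule_format, OF C1_compact_disk_cnj[OF \<phi>]] show "?P \<phi>" unfolding PQ[OF \<phi>] .
    next
      fix \<phi> assume P: "\<forall>\<phi>. C1_compact_disk \<phi> \<longrightarrow> ?P \<phi>" and \<phi>: "C1_compact_disk \<phi>"
      have "?Q (\<lambda>z. cnj (cnj (\<phi> z)))"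
        using PQ[OF C1_compact_disk_cnj[OF \<phi>]] P C1_compact_disk_cnj[OF \<phi>] by blast
      then show "?Q \<phi>" by simp
    qed
  qed
  then show ?thesis unfolding has_weak_dz_def has_weak_dzbar_def using loc by blast
qed

lemma T_star_op_eq: "T_star_op g z = cnj (T_op (\<lambda>w. cnj (g w)) z)"
proof -
  have k: "T_star_kernel g z w = cnj (T_kernel (\<lambda>w. cnj (g w)) z w)" for w
    by (simp add: T_star_kernel_def T_kernel_def)
  show ?thesis
    unfolding T_star_op_def T_op_def k Bochner_Integration.integral_cnj by simp
qed

lemma integrable_T_star_kernel:
  "integrable M (T_star_kernel g z) \<longleftrightarrow> integrable M (T_kernel (\<lambda>w. cnj (g w)) z)"
proof -
  have k: "T_star_kernel g z = (\<lambda>w. cnj (T_kernel (\<lambda>w. cnj (g w)) z w))"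
    by (simp add: T_star_kernel_def T_kernel_def fun_eq_iff)
  show ?thesis
    unfolding k using integrable_cnj[of M "T_kernel (\<lambda>w. cnj (g w)) z"]
      integrable_cnj[of M "\<lambda>w. cnj (T_kernel (\<lambda>w. cnj (g w)) z w)"] by auto
qed

text \<open>Conjugation does not commute with contour integrals in general. Here
  \<open>d\<zeta> / \<zeta>\<close> is \<open>\<i> * dt\<close> with real \<open>t\<close>, the
  prefactor \<open>1 / \<i>\<close> removes the \<open>\<i>\<close>, and \<open>b\<close> is
  real.\<close>

lemma conj_schwarz_integral:
  assumes b: "continuous_on (sphere 0 1) b" and z: "z \<in> disk"
  shows "1 / (2 * pi * \<i>) * contour_integral (circlepath 0 1)
      (\<lambda>\<zeta>. b \<zeta> * (cnj (\<zeta> + z) / cnj (\<zeta> - z)) * (1 / \<zeta>)) = cnj (schwarz_integral b z)"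
proof -
  let ?h = "\<lambda>\<zeta>. b \<zeta> * (cnj (\<zeta> + z) / cnj (\<zeta> - z)) * (1 / \<zeta>)"
  have "continuous_on (sphere 0 1) ?h"
    using z by (intro continuous_intros b) auto
  from circlepath_integral_eq[OF this]
  have "contour_integral (circlepath 0 1) ?h = (LINT t:{0..2*pi}|lborel. ?h (rcis 1 t) * \<i> * rcis 1 t)"
    by (intro contour_integral_unique) simp
  also have "\<dots> = (LINT t:{0..2*pi}|lborel. \<i> * cnj (b (cis t) * ((cis t + z) / (cis t - z))))"
    by (intro set_lebesgue_integral_cong) (auto simp: rcis_1 cis_cnj)
  also have "\<dots> = \<i> * cnj (LINT t:{0..2*pi}|lborel. b (cis t) * ((cis t + z) / (cis t - z)))"
    by (simp only: set_integral_mult_right set_integral_cnj)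
  finally show ?thesis by (simp add: schwarz_integral_eq[OF b z])
qed

text \<open>Conjugation negates the imaginary part. The relation is asked for on the disk only,
  because the formula for the first component is established only there.\<close>

lemma mean_value_at_0_neg:
  assumes "mean_value_at_0 u" and "\<And>z. z \<in> disk \<Longrightarrow> v z = - u z"
  shows "mean_value_at_0 v"
proof -
  have "eventually (\<lambda>r. 0 < r \<and> r < 1) (at_right (0::real))"
    using eventually_at_right_real[of 0 1] by simp
  then have ev: "eventually (\<lambda>r. - ((LINT z|lebesgue_on (ball 0 r). u z) / (pi * r\<^sup>2)) = (LINT z|lebesgue_on (ball 0 r). v z) / (pi * r\<^sup>2)) (at_right 0)"
  proof eventually_elim
    case (elim r)
    have "(LINT z|lebesgue_on (ball 0 r). v z) = (LINT z|lebesgue_on (ball 0 r). - u z)"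
      using elim assms(2) by (intro Bochner_Integration.integral_cong refl) auto
    then show ?case by simp
  qed
  have "((\<lambda>r. - ((LINT z|lebesgue_on (ball 0 r). u z) / (pi * r\<^sup>2))) \<longlongrightarrow> - u 0) (at_right 0)"
    using assms(1) unfolding mean_value_at_0_def by (rule tendsto_minus)
  then show ?thesis
    using assms(2)[of 0] unfolding mean_value_at_0_def tendsto_cong[OF ev] by simp
qed

section \<open>Bicomplex functions\<close>

lemma bc_components_sum:
  "bc_plus (p_plus * bc_of a + p_minus * bc_of b + (p_plus * bc_of a' + p_minus * bc_of b')) = a + a'"
  "bc_minus (p_plus * bc_of a + p_minus * bc_of b + (p_plus * bc_of a' + p_minus * bc_of b')) = b + b'"
proof -
  have "bc_of (x + y) = bc_of x + bc_of y" for x y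
    by (simp add: bc_of_def bicomplex_arith_defs)
  then have "p_plus * bc_of a + p_minus * bc_of b + (p_plus * bc_of a' + p_minus * bc_of b')
    = p_plus * bc_of (a + a') + p_minus * bc_of (b + b')"
    by (simp add: algebra_simps)
  then show "bc_plus (p_plus * bc_of a + p_minus * bc_of b + (p_plus * bc_of a' + p_minus * bc_of b')) = a + a'"
    "bc_minus (p_plus * bc_of a + p_minus * bc_of b + (p_plus * bc_of a' + p_minus * bc_of b')) = b + b'"
    unfolding bc_decomposition by auto
qed

lemma bicomplex_eqI: "bc_plus w = bc_plus v \<Longrightarrow> bc_minus w = bc_minus v \<Longrightarrow> w = v"
  using bc_decomposition[of w "bc_plus w" "bc_minus w"] bc_decomposition[of v "bc_plus v" "bc_minus v"] by metis

text \<open>Each component is at most \<open>sqrt 2\<close> times the norm; the cruder factor 2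
  suffices.\<close>

lemma L1_disk_bc_components:
  assumes "L1_disk_bc f"
  shows "integrable (lebesgue_on disk) (\<lambda>z. bc_plus (f z))" "integrable (lebesgue_on disk) (\<lambda>z. bc_minus (f z))"
proof -
  have bound: "cmod (bc_plus x) \<le> 2 * bc_norm x" "cmod (bc_minus x) \<le> 2 * bc_norm x" for x
  proof -
    let ?s = "((cmod (bc_plus x))\<^sup>2 + (cmod (bc_minus x))\<^sup>2) / 2"
    have "cmod (bc_plus x) \<le> sqrt (4 * ?s)" "cmod (bc_minus x) \<le> sqrt (4 * ?s)"
      by (rule real_le_rsqrt, simp)+
    then show "cmod (bc_plus x) \<le> 2 * bc_norm x" "cmod (bc_minus x) \<le> 2 * bc_norm x"
      unfolding real_sqrt_mult by (simp_all add: bc_norm_def)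
  qed
  have int: "integrable (lebesgue_on disk) (\<lambda>z. 2 * bc_norm (f z))"
    using assms unfolding L1_disk_bc_def by auto
  have meas: "(\<lambda>z. bc_plus (f z)) \<in> borel_measurable (lebesgue_on disk)"
    "(\<lambda>z. bc_minus (f z)) \<in> borel_measurable (lebesgue_on disk)"
    using assms unfolding L1_disk_bc_def by blast+
  show "integrable (lebesgue_on disk) (\<lambda>z. bc_plus (f z))"
    by (rule Bochner_Integration.integrable_bound[OF int meas(1)], rule AE_I2)
       (metis abs_ge_self bound(1) order_trans real_norm_def)
  show "integrable (lebesgue_on disk) (\<lambda>z. bc_minus (f z))"
    by (rule Bochner_Integration.integrable_bound[OF int meas(2)], rule AE_I2)
       (metis abs_ge_self bound(2) order_trans real_norm_def)
qed

text \<open>Uniqueness of the idempotent decomposition forces \<open>g\<close> and \<open>h\<close>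
  to be the components of \<open>f\<close> on the disk, and values elsewhere do not affect weak
  derivatives.\<close>

lemma has_bc_dbar_iff:
  "has_bc_dbar w f \<longleftrightarrow> has_weak_dzbar (\<lambda>z. cnj (bc_plus (w z))) (\<lambda>z. cnj (bc_plus (f z)))
     \<and> has_weak_dzbar (\<lambda>z. bc_minus (w z)) (\<lambda>z. bc_minus (f z))"
proof
  assume "has_bc_dbar w f"
  then obtain g h where gh: "has_weak_dz (\<lambda>z. bc_plus (w z)) g" "has_weak_dzbar (\<lambda>z. bc_minus (w z)) h"
    "\<forall>z\<in>disk. f z = p_plus * bc_of (g z) + p_minus * bc_of (h z)"
    unfolding has_bc_dbar_def by blast
  then have eq: "g z = bc_plus (f z)" "h z = bc_minus (f z)" if "z \<in> disk" for z
    using that unfolding bc_decomposition by auto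
  show "has_weak_dzbar (\<lambda>z. cnj (bc_plus (w z))) (\<lambda>z. cnj (bc_plus (f z)))
     \<and> has_weak_dzbar (\<lambda>z. bc_minus (w z)) (\<lambda>z. bc_minus (f z))"
  proof
    have "AE z in lborel. z \<in> disk \<longrightarrow> cnj (g z) = cnj (bc_plus (f z))" using eq(1) by simp
    from has_weak_dzbar_cong_AE[OF AE_I2[OF impI[OF refl]] this] gh(1)
    show "has_weak_dzbar (\<lambda>z. cnj (bc_plus (w z))) (\<lambda>z. cnj (bc_plus (f z)))"
      unfolding has_weak_dz_iff_cnj by (rule iffD1)
    have "AE z in lborel. z \<in> disk \<longrightarrow> h z = bc_minus (f z)" using eq(2) by simp
    from has_weak_dzbar_cong_AE[OF AE_I2[OF impI[OF refl]] this] gh(2)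
    show "has_weak_dzbar (\<lambda>z. bc_minus (w z)) (\<lambda>z. bc_minus (f z))"
      by (rule iffD1)
  qed
next
  assume "has_weak_dzbar (\<lambda>z. cnj (bc_plus (w z))) (\<lambda>z. cnj (bc_plus (f z)))
     \<and> has_weak_dzbar (\<lambda>z. bc_minus (w z)) (\<lambda>z. bc_minus (f z))"
  then show "has_bc_dbar w f"
    unfolding has_bc_dbar_def has_weak_dz_iff_cnj bc_decomposition
    by (intro exI[of _ "\<lambda>z. bc_plus (f z)"] exI[of _ "\<lambda>z. bc_minus (f z)"]) auto
qed

theorem theorem3p2:
  fixes b1 b2 :: "complex \<Rightarrow> real" and c1 c2 :: real and f :: "complex \<Rightarrow> bicomplex"
  assumes "continuous_on (sphere 0 1) b1"
    and "continuous_on (sphere 0 1) b2"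
    and "L1_disk_bc f"
  shows "(T_bc_defined f \<longrightarrow>
           schwarz_solution b1 b2 c1 c2 f
             (\<lambda>z. p_plus * bc_of (1 / (2 * pi * \<i>) *
                     contour_integral (circlepath 0 1)
                       (\<lambda>\<zeta>. b1 \<zeta> * (cnj (\<zeta> + z) / cnj (\<zeta> - z)) * (1 / \<zeta>)) + \<i> * c1)
                + p_minus * bc_of (1 / (2 * pi * \<i>) *
                     contour_integral (circlepath 0 1)
                       (\<lambda>\<zeta>. b2 \<zeta> * ((\<zeta> + z) / (\<zeta> - z)) * (1 / \<zeta>)) + \<i> * c2)
                + T_bc f z)) \<and>
         (\<forall>w v. schwarz_solution b1 b2 c1 c2 f w \<and> schwarz_solution b1 b2 c1 c2 f v
             \<longrightarrow> (AE z in lebesgue_on disk. w z = v z))"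
proof (intro conjI impI allI)
  assume T: "T_bc_defined f"
  let ?w = "\<lambda>z. p_plus * bc_of (1 / (2 * pi * \<i>) *
                     contour_integral (circlepath 0 1)
                       (\<lambda>\<zeta>. b1 \<zeta> * (cnj (\<zeta> + z) / cnj (\<zeta> - z)) * (1 / \<zeta>)) + \<i> * c1)
                + p_minus * bc_of (1 / (2 * pi * \<i>) *
                     contour_integral (circlepath 0 1)
                       (\<lambda>\<zeta>. b2 \<zeta> * ((\<zeta> + z) / (\<zeta> - z)) * (1 / \<zeta>)) + \<i> * c2)
                + T_bc f z"
  \<comment> \<open>The conjugate of the first component. Conjugation keeps the real boundary values
    \<open>b1\<close> and turns \<open>c1\<close> into \<open>- c1\<close>.\<close>
  define u where "u z = schwarz_integral b1 z + \<i> * complex_of_real (- c1) + T_op (\<lambda>w. cnj (bc_plus (f w))) z" for z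
  define v where "v z = schwarz_integral b2 z + \<i> * complex_of_real c2 + T_op (\<lambda>w. bc_minus (f w)) z" for z
  note I = L1_disk_bc_components[OF assms(3)]
  have T1: "AE z in lebesgue_on disk. integrable (lebesgue_on disk) (T_kernel (\<lambda>w. cnj (bc_plus (f w))) z)"
    using T unfolding T_bc_defined_def by eventually_elim (simp add: integrable_T_star_kernel)
  have T2: "AE z in lebesgue_on disk. integrable (lebesgue_on disk) (T_kernel (\<lambda>w. bc_minus (f w)) z)"
    using T unfolding T_bc_defined_def by eventually_elim simp
  note U = schwarz_problem_existence[OF assms(1) integrable_cnj[OF I(1)] T1, of "- c1", folded u_def]
  note V = schwarz_problem_existence[OF assms(2) I(2) T2, of c2, folded v_def]
  define w where "w = ?w"
  \<comment> \<open>Restricted to the disk, where the conjugated Schwarz integral is identified; for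
    the second component the equation is one of definitions.\<close>
  have plus: "bc_plus (w z) = cnj (u z)" if "z \<in> disk" for z
    unfolding w_def T_bc_def bc_components_sum conj_schwarz_integral[OF assms(1) that] T_star_op_eq u_def by simp
  have minus: "bc_minus (w z) = v z" for z
    unfolding w_def T_bc_def bc_components_sum v_def schwarz_integral_def ..
  have plusAE: "AE z in lborel. z \<in> disk \<longrightarrow> cnj (bc_plus (w z)) = u z"
    using plus by simp
  have plusRe: "AE z in lborel. z \<in> disk \<longrightarrow> Re (bc_plus (w z)) = Re (u z)"
    using plus by simp
  have "schwarz_solution b1 b2 c1 c2 f w"
    unfolding schwarz_solution_def has_bc_dbar_iff minus
    unfolding has_weak_dzbar_cong_AE[OF plusAE AE_I2[OF impI[OF refl]]] has_boundary_value_cong_AE[OF plusRe]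
  proof (intro conjI)
    show "mean_value_at_0 (\<lambda>z. Im (bc_plus (w z)))"
      by (rule mean_value_at_0_neg[OF U(3)]) (simp add: plus)
    show "Im (bc_plus (w 0)) = c1" using U(4) by (simp add: plus)
  qed (use U V in auto)
  then show "schwarz_solution b1 b2 c1 c2 f ?w" unfolding w_def .
next
  fix w v
  assume wv: "schwarz_solution b1 b2 c1 c2 f w \<and> schwarz_solution b1 b2 c1 c2 f v"
  \<comment> \<open>The conjugated first components satisfy the same scalar equation with the same
    real boundary values, and their imaginary parts at 0 still agree.\<close>
  have "AE z in lborel. z \<in> disk \<longrightarrow> cnj (bc_plus (w z)) = cnj (bc_plus (v z))"
    using wv mean_value_at_0_neg[of "\<lambda>z. Im (bc_plus (w z))" "\<lambda>z. Im (cnj (bc_plus (w z)))"]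
      mean_value_at_0_neg[of "\<lambda>z. Im (bc_plus (v z))" "\<lambda>z. Im (cnj (bc_plus (v z)))"]
    unfolding schwarz_solution_def has_bc_dbar_iff
    by (intro schwarz_problem_uniqueness[OF assms(1)]) auto
  moreover have "AE z in lborel. z \<in> disk \<longrightarrow> bc_minus (w z) = bc_minus (v z)"
    using wv unfolding schwarz_solution_def has_bc_dbar_iff
    by (intro schwarz_problem_uniqueness[OF assms(2)]) auto
  ultimately have "AE z in lborel. z \<in> disk \<longrightarrow> w z = v z"
    by eventually_elim (auto intro: bicomplex_eqI)
  then show "AE z in lebesgue_on disk. w z = v z"
    by (subst AE_restrict_space_iff) (auto intro: AE_completion)
qed

end
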